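(* Let $d_k$ be the limit probability (as $n\to\infty$) that a fixed vertex of a uniformly random labelled 3-connected planar graph on $n$ vertices has degree $k$, and let $e_k$ be the limit probability that the tail of the root edge of a uniformly random directed-edge-rooted labelled 3-connected planar graph on $n$ vertices has degree $k$. Then \[ \sum_k e_kw^k=\frac{T_3(r,w)}{T_3(r,1)}, \] where $r=r(1)=(7\sqrt7-17)/32$; in particular the $e_k$ form a probability distribution. As $k\to\infty$, \[ e_k\sim c\,k^{1/2}q^k, \] where $c\approx0.9313492$ is a computable constant and $q=1/(u_0+1)=\sqrt7-2$ with $u_0=(\sqrt7-1)/3$. Moreover \[ d_k=\alpha\frac{e_k}{k}\sim c\,\alpha\,k^{-1/2}q^k,\qquad \alpha=\frac{(3u_0-1)(3u_0+1)(u_0+1)}{u_0}=\frac{\sqrt7+7}{2}, \] and $\alpha$ is the asymptotic value of the expected average degree in 3-connected planar graphs.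
   Context: $T^\bullet(x,z,w)=\sum t_{n,m,k}x^nz^mw^k/n!$, where $t_{n,m,k}$ counts 3-connected planar graphs on $\{1,\dots,n\}$ with $m$ edges and a distinguished directed edge whose tail has degree $k$; explicitly $T^\bullet=\frac{x^2z^2w^2}{2}\bigl(\frac1{1+wz}+\frac1{1+xz}-1-\frac{(u+1)^2(-w_1+(u-w+1)\sqrt{w_2})}{2w(vw+u^2+2u+1)(1+u+v)^3}\bigr)$ with $u=xz(1+v)^2$, $v=z(1+u)^2$, $w_1=-uvw^2+w(1+4v+3uv^2+5v^2+u^2+2u+2v^3+3u^2v+7uv)+(u+1)^2(u+2v+1+v^2)$, $w_2=u^2v^2w^2-2wuv(2u^2v+6uv+2v^3+3uv^2+5v^2+u^2+2u+4v+1)+(u+1)^2(u+2v+1+v^2)^2$. Let $\tilde u_0(z)=-\frac13+\sqrt{\frac49+\frac1{3z}}$, $r(z)=\frac{\tilde u_0(z)}{z(1+z(1+\tilde u_0(z))^2)^2}$, and $\tau(x)$ the inverse function of $r$ (so $\tau(r(1))=1$). For $x,w$ near the positive real axis with $|w|\le1$, $T^\bullet$ has a singular expansion $T^\bullet(x,z,w)=T_0(x,w)+T_2(x,w)Z^2+T_3(x,w)Z^3+O(Z^4)$ at its dominant singularity $z=\tau(x)$, with $Z=\sqrt{1-z/\tau(x)}$; this defines $T_3(x,w)$.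
   Formalization: The last term of the explicit formula for T^• is taken with sign + instead of the printed −, since with − the series would begin with x²z²w², although there are no 3-connected graphs on two vertices; the corrected formula is assumed for small arguments. *)

theory Defs
  imports
    "HOL-Probability.Probability"
    "HOL-Library.Landau_Symbols"
    "Graph_Theory.Pair_Digraph"
    "Graph_Theory.Digraph_Component"
begin

section \<open>Labelled 3-connected planar graphs\<close>

text \<open>
  Finite simple graphs are represented by the locale \<open>pair_graph\<close>: symmetric loopfree
  digraphs without parallel arcs.  Every undirected edge gives two opposite arcs, so a
  directed edge of the graph is an element of \<open>parcs\<close>, its tail is the first component,
  and the degree of a vertex is its \<open>out_degree\<close>.
\<close>

text \<open>
  A plane drawing: vertices are distinct points, an edge is a simple arc joining its two ends
  (traversed backwards by the opposite arc), edges meet vertices only in their ends, and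
  different edges meet only in common ends.
\<close>

definition planar :: "'a pair_pre_digraph \<Rightarrow> bool" where
  "planar G \<longleftrightarrow> (\<exists>(f :: 'a \<Rightarrow> complex) (\<gamma> :: 'a \<times> 'a \<Rightarrow> real \<Rightarrow> complex).
     inj_on f (pverts G) \<and>
     (\<forall>(a, b) \<in> parcs G.
        Path_Connected.arc (\<gamma> (a, b)) \<and>
        pathstart (\<gamma> (a, b)) = f a \<and> pathfinish (\<gamma> (a, b)) = f b \<and>
        \<gamma> (b, a) = reversepath (\<gamma> (a, b)) \<and>
        path_image (\<gamma> (a, b)) \<inter> f ` pverts G = {f a, f b}) \<and>
     (\<forall>(a, b) \<in> parcs G. \<forall>(a', b') \<in> parcs G. {a, b} \<noteq> {a', b'} \<longrightarrow>
        path_image (\<gamma> (a, b)) \<inter> path_image (\<gamma> (a', b')) = f ` ({a, b} \<inter> {a', b'})))"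

definition k_connected :: "nat \<Rightarrow> 'a pair_pre_digraph \<Rightarrow> bool" where
  "k_connected k G \<longleftrightarrow> k < card (pverts G) \<and>
     (\<forall>S \<subseteq> pverts G. card S < k \<longrightarrow>
        Digraph_Component.connected (with_proj G \<restriction> (pverts G - S)))"

definition tc_graphs :: "nat \<Rightarrow> nat pair_pre_digraph set" where
  "tc_graphs n = {G. pair_graph G \<and> pverts G = {1..n} \<and> k_connected 3 G \<and> planar G}"

definition rooted_tc_graphs :: "nat \<Rightarrow> (nat pair_pre_digraph \<times> (nat \<times> nat)) set" where
  "rooted_tc_graphs n = (SIGMA G : tc_graphs n. parcs G)"

abbreviation deg :: "nat pair_pre_digraph \<Rightarrow> nat \<Rightarrow> nat" where
  "deg G v \<equiv> out_degree (with_proj G) v"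

definition num_edges :: "nat pair_pre_digraph \<Rightarrow> nat" where
  "num_edges G = card (parcs G) div 2"

definition avg_deg :: "nat pair_pre_digraph \<Rightarrow> real" where
  "avg_deg G = (\<Sum>v\<in>pverts G. real (deg G v)) / real (card (pverts G))"

text \<open>
  For \<open>n < 4\<close> the two sets above are empty and \<open>pmf_of_set\<close> is unspecified; only the
  behaviour for \<open>n \<rightarrow> \<infinity>\<close> is used.
\<close>

definition vertex_degree_prob :: "nat \<Rightarrow> nat \<Rightarrow> nat \<Rightarrow> real" where
  "vertex_degree_prob v k n =
     measure_pmf.prob (pmf_of_set (tc_graphs n)) {G. deg G v = k}"

definition root_degree_prob :: "nat \<Rightarrow> nat \<Rightarrow> real" where
  "root_degree_prob k n =
     measure_pmf.prob (pmf_of_set (rooted_tc_graphs n)) {(G, e). deg G (fst e) = k}"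

definition expected_avg_deg :: "nat \<Rightarrow> real" where
  "expected_avg_deg n = measure_pmf.expectation (pmf_of_set (tc_graphs n)) avg_deg"


section \<open>The generating function\<close>

definition t_count :: "nat \<Rightarrow> nat \<Rightarrow> nat \<Rightarrow> nat" where
  "t_count n m k =
     card {(G, e). (G, e) \<in> rooted_tc_graphs n \<and> num_edges G = m \<and> deg G (fst e) = k}"

definition T_bullet :: "complex \<Rightarrow> complex \<Rightarrow> complex \<Rightarrow> complex" where
  "T_bullet x z w =
     (\<Sum>\<^sub>\<infinity>(n, m, k)\<in>UNIV. of_nat (t_count n m k) * x ^ n * z ^ m * w ^ k / fact n)"

definition w1_poly :: "complex \<Rightarrow> complex \<Rightarrow> complex \<Rightarrow> complex" where
  "w1_poly u v w =
     - u * v * w\<^sup>2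
     + w * (1 + 4 * v + 3 * u * v\<^sup>2 + 5 * v\<^sup>2 + u\<^sup>2 + 2 * u + 2 * v^3 + 3 * u\<^sup>2 * v + 7 * u * v)
     + (u + 1)\<^sup>2 * (u + 2 * v + 1 + v\<^sup>2)"

definition w2_poly :: "complex \<Rightarrow> complex \<Rightarrow> complex \<Rightarrow> complex" where
  "w2_poly u v w =
     u\<^sup>2 * v\<^sup>2 * w\<^sup>2
     - 2 * w * u * v
       * (2 * u\<^sup>2 * v + 6 * u * v + 2 * v^3 + 3 * u * v\<^sup>2 + 5 * v\<^sup>2 + u\<^sup>2 + 2 * u + 4 * v + 1)
     + (u + 1)\<^sup>2 * (u + 2 * v + 1 + v\<^sup>2)\<^sup>2"

text \<open>
  The closed form of \<open>T_bullet\<close>, to be evaluated at the small solution \<open>(u, v)\<close> of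
  \<open>u = x z (1 + v)\<^sup>2\<close>, \<open>v = z (1 + u)\<^sup>2\<close>.  The sign of the last term is the one
  compatible with the expansion at the origin: for \<open>u = v = 0\<close> that term equals \<open>-1\<close>, so the
  bracket vanishes, and the lowest-order term of the series is \<open>x\<^sup>4 z\<^sup>6 w\<^sup>3 / 2\<close>
  (the graph \<open>K\<^sub>4\<close> with its 12 directed edges).  With the opposite sign, which is sometimes
  printed, the series starts with \<open>x\<^sup>2 z\<^sup>2 w\<^sup>2\<close> and the graphs are counted with
  weight \<open>-1\<close>.
\<close>

definition T_closed_form ::
    "complex \<Rightarrow> complex \<Rightarrow> complex \<Rightarrow> complex \<Rightarrow> complex \<Rightarrow> complex" where
  "T_closed_form x z w u v =
     x\<^sup>2 * z\<^sup>2 * w\<^sup>2 / 2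
     * (1 / (1 + w * z) + 1 / (1 + x * z) - 1
        + (u + 1)\<^sup>2 * (- w1_poly u v w + (u - w + 1) * csqrt (w2_poly u v w))
          / (2 * w * (v * w + u\<^sup>2 + 2 * u + 1) * (1 + u + v)^3))"


section \<open>The singular expansion\<close>

definition u0_fun :: "real \<Rightarrow> real" where
  "u0_fun z = - 1/3 + sqrt (4/9 + 1 / (3 * z))"

definition r_fun :: "real \<Rightarrow> real" where
  "r_fun z = u0_fun z / (z * (1 + z * (1 + u0_fun z)\<^sup>2)\<^sup>2)"

definition tau :: "real \<Rightarrow> real" where
  "tau = the_inv_into {0<..} r_fun"

text \<open>
  The expansion is taken inside the disc \<open>|z| < tau x\<close>, where the power series converges and
  \<open>1 - z / tau x\<close> has positive real part, so that the principal square root applies.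
  The coefficients are uniquely determined.
\<close>

definition singular_expansion ::
    "real \<Rightarrow> complex \<Rightarrow> complex \<Rightarrow> complex \<Rightarrow> complex \<Rightarrow> bool" where
  "singular_expansion x w t0 t2 t3 \<longleftrightarrow>
     (let Z = (\<lambda>z. csqrt (1 - z / of_real (tau x))) in
        (\<lambda>z. T_bullet (of_real x) z w - (t0 + t2 * Z z ^ 2 + t3 * Z z ^ 3))
          \<in> O[at (of_real (tau x)) within ball 0 (tau x)](\<lambda>z. Z z ^ 4))"

definition T3 :: "real \<Rightarrow> complex \<Rightarrow> complex" where
  "T3 x w = (THE t3. \<exists>t0 t2. singular_expansion x w t0 t2 t3)"

end

theory Submission
  imports Defs "HOL-Complex_Analysis.Complex_Analysis" "HOL-Real_Asymp.Real_Asymp"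
begin

text \<open>
  By Pringsheim's theorem the closed form continues \<open>T_bullet\<close> along real rays up to the critical
  curve \<open>x = r_fun z\<close>, and the series still converges there.  For fixed \<open>x = r\<close> the curve
  \<open>u (1 + u)\<^sup>2 = r v (1 + v)\<^sup>2\<close> is a nodal cubic, hence rational, and \<open>z\<close> has a fold at the critical
  parameter; this yields \<open>T3 r w = C w hq(w)\<close> with an explicit \<open>hq\<close> over \<open>\<rat>(\<surd>7)\<close>.  For fixed
  \<open>z = 1\<close> the variable \<open>u\<close> is a uniformizer, and Lagrange inversion and Laplace's method show that
  the coefficient of \<open>x\<^sup>n\<close> is asymptotic to \<open>C' n\<^bsup>-5/2\<^esup> r\<^bsup>-n\<^esup> w hq(w)\<close>, with the same \<open>hq\<close>, for \<open>w = 1\<close> and for all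
  small \<open>w > 0\<close>.  Hence the root degree converges in law to the distribution with generating function
  \<open>w hq(w)\<close>, whose singularity \<open>(1 - q w)\<^bsup>-3/2\<^esup>\<close> gives the asymptotics.  Double counting relates the
  degree of a vertex to that of the root, the factor being the expected average degree; the latter
  converges because the number of edges is concentrated.
\<close>

section \<open>Power series and Pringsheim's theorem\<close>

text \<open>The hypothesis knows the closed form only near the origin, for small \<open>w\<close>
  too, whereas both analyses take place at the critical point, for \<open>w\<close> up to 1. Scaling
  all variables by one \<open>s\<close> leads there along a ray and leaves a single variable, so
  that the nonnegative counts can carry the continuation. For \<open>z = 1\<close> the coefficients
  are integrals over the circle \<open>norm u = u0\<close> in the plane of the uniformizer, which
  runs through the critical point itself. On both routes the derivative of the singular part
  \<open>N\<close> vanishes together with that of the coordinate, \<open>x\<close> or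
  \<open>z\<close>; the quotient is regular in the local parameter. This removes the term of order
  1/2, explains the exponent -5/2, and leaves one derivative at the critical point to be computed,
  from which \<open>hq\<close> originates. A square root of the radicand on the whole disc is
  constructed only for \<open>w = 1\<close> and for small \<open>w\<close>: small \<open>w\<close>
  determine the limit law, \<open>w = 1\<close> normalizes it. The average degree is reached through
  its reciprocal, the mean over rooted graphs of a quantity bounded by 1.\<close>

lemma diffs_funpow:
  "(diffs ^^ j) c k = (fact (k + j) / fact k) * (c (k + j) :: complex)"
proof (induction j arbitrary: k)
  case (Suc j)
  have "(diffs ^^ Suc j) c k = of_nat (Suc k) * (diffs ^^ j) c (Suc k)"
    by (simp add: diffs_def)
  also have "\<dots> = of_nat (Suc k) * (fact (Suc k + j) / fact (Suc k) * c (Suc k + j))"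
    by (simp only: Suc)
  also have "\<dots> = (fact (k + Suc j) / fact k) * c (k + Suc j)"
  proof -
    have "of_nat (Suc k) \<noteq> (0::complex)" by (metis nat.simps(3) of_nat_eq_0_iff)
    thus ?thesis by (simp add: fact_Suc[of k] field_simps del: of_nat_Suc)
  qed
  finally show ?case .
qed simp

lemma higher_deriv_power_series:
  fixes c :: "nat \<Rightarrow> complex"
  assumes "ereal (norm z) < conv_radius c"
  shows "summable (\<lambda>k. (diffs ^^ j) c k * z ^ k)"
    and "(deriv ^^ j) (\<lambda>z. \<Sum>k. c k * z ^ k) z = (\<Sum>k. (diffs ^^ j) c k * z ^ k)"
proof -
  have "summable (\<lambda>k. (diffs ^^ j) c k * z ^ k) \<and>
    (deriv ^^ j) (\<lambda>z. \<Sum>k. c k * z ^ k) z = (\<Sum>k. (diffs ^^ j) c k * z ^ k)"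
  using assms
proof (induction j arbitrary: z)
  case 0
  then show ?case by (simp add: summable_in_conv_radius)
next
  case (Suc j)
  obtain K where K: "norm z < K" "ereal K < conv_radius c"
    using Suc.prems ereal_dense2 by (metis less_ereal.simps(1))
  have Kp: "K > 0" using K by (meson norm_ge_zero le_less_trans)
  have sK: "summable (\<lambda>k. (diffs ^^ j) c k * (of_real K :: complex) ^ k)"
    using Suc.IH[of "of_real K"] K Kp by simp
  have nz: "norm z < norm (of_real K :: complex)" using K Kp by simp
  have D: "DERIV (\<lambda>x. \<Sum>n. (diffs ^^ j) c n * x ^ n) z :> (\<Sum>n. diffs ((diffs ^^ j) c) n * z ^ n)"
    by (rule termdiffs_strong[OF sK nz])
  have IH: "summable (\<lambda>k. (diffs ^^ j) c k * x ^ k) \<and> (deriv ^^ j) (\<lambda>z. \<Sum>k. c k * z ^ k) x = (\<Sum>n. (diffs ^^ j) c n * x ^ n)"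
    if "norm x < K" for x
    by (rule Suc.IH) (use that K in \<open>metis less_trans less_ereal.simps(1)\<close>)
  have ev: "\<forall>\<^sub>F x in nhds z. (deriv ^^ j) (\<lambda>z. \<Sum>k. c k * z ^ k) x = (\<Sum>n. (diffs ^^ j) c n * x ^ n)"
  proof -
    have "\<forall>\<^sub>F x in nhds z. x \<in> ball 0 K"
      using K by (intro eventually_nhds_in_open) auto
    thus ?thesis
      by eventually_elim (use IH in auto)
  qed
  have "deriv ((deriv ^^ j) (\<lambda>z. \<Sum>k. c k * z ^ k)) z = deriv (\<lambda>x. \<Sum>n. (diffs ^^ j) c n * x ^ n) z"
    by (rule deriv_cong_ev[OF ev]) simp
  moreover have "summable (\<lambda>n. diffs ((diffs ^^ j) c) n * z ^ n)"
    by (rule termdiff_converges[OF \<open>norm z < K\<close>]) (use IH in auto)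
  ultimately show ?case using DERIV_imp_deriv[OF D] by simp
qed
  thus "summable (\<lambda>k. (diffs ^^ j) c k * z ^ k)"
    and "(deriv ^^ j) (\<lambda>z. \<Sum>k. c k * z ^ k) z = (\<Sum>k. (diffs ^^ j) c k * z ^ k)" by auto
qed

lemma power_series_holomorphic:
  fixes c :: "nat \<Rightarrow> complex"
  shows "(\<lambda>z. \<Sum>k. c k * z ^ k) holomorphic_on eball (0::complex) (conv_radius c)"
proof (subst holomorphic_on_open, simp, intro ballI)
  fix z assume "z \<in> eball (0::complex) (conv_radius c)"
  hence z: "ereal (norm z) < conv_radius c" by (simp add: eball_def)
  obtain K where K: "norm z < K" "ereal K < conv_radius c"
    using z ereal_dense2 by (metis less_ereal.simps(1))
  have Kp: "K > 0" using K by (meson norm_ge_zero le_less_trans)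
  have sK: "summable (\<lambda>k. c k * (of_real K :: complex) ^ k)"
    using K Kp by (intro summable_in_conv_radius) auto
  show "\<exists>f'. ((\<lambda>z. \<Sum>k. c k * z ^ k) has_field_derivative f') (at z)"
    using termdiffs_strong[OF sK, of z] K Kp by auto
qed

text \<open>Supplies the accumulation point for the identity theorem whenever two holomorphic
  functions are compared on a real interval.\<close>

lemma of_real_islimpt:
  fixes a b x :: real
  assumes "a < x" "x < b"
  shows "complex_of_real x islimpt of_real ` {a<..<b}"
  unfolding islimpt_approachable
proof (intro allI impI)
  fix e :: real assume e: "e > 0"
  define \<mu> where "\<mu> = min e (b - x)"
  define y where "y = x + \<mu> / 2"
  have "0 < \<mu>" "\<mu> \<le> e" "\<mu> \<le> b - x" using e assms by (auto simp: \<mu>_def)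
  hence "y \<in> {a<..<b}" "y \<noteq> x" "dist y x < e"
    using assms by (auto simp: y_def dist_real_def)
  thus "\<exists>x'\<in>of_real ` {a<..<b}. x' \<noteq> complex_of_real x \<and> dist x' (complex_of_real x) < e"
    by (intro bexI[of _ "of_real y"]) (auto simp: dist_of_real)
qed

text \<open>Identity theorem on the component of 0 in \<open>D \<inter> ball 0 \<rho>\<close>.
  Passing to the component makes the comparison set connected, and it still contains the whole
  segment from 0 to \<rho>.\<close>

lemma power_series_eq_continuation:
  fixes c :: "nat \<Rightarrow> complex"
  assumes D: "open D" "h holomorphic_on D" "\<And>t. 0 \<le> t \<Longrightarrow> t < \<rho> \<Longrightarrow> of_real t \<in> D"
    and R: "ereal \<rho> \<le> conv_radius c" and \<delta>: "\<delta> > 0" "\<rho> > 0"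
    and eq: "\<And>s. 0 < s \<Longrightarrow> s < \<delta> \<Longrightarrow> (\<lambda>k. c k * of_real s ^ k) sums h (of_real s)"
  obtains S where "open S" "S \<subseteq> D" "S \<subseteq> ball 0 \<rho>" "of_real ` {0..<\<rho>} \<subseteq> S"
    "\<And>z. z \<in> S \<Longrightarrow> (\<Sum>k. c k * z ^ k) = h z"
proof -
  define S where "S = connected_component_set (D \<inter> ball 0 \<rho>) (0::complex)"
  have S1: "open S" unfolding S_def using D by (intro open_connected_component) auto
  have S2: "S \<subseteq> D \<inter> ball 0 \<rho>" unfolding S_def by (rule connected_component_subset)
  have S3: "Topological_Spaces.connected S" unfolding S_def by (rule connected_connected_component)
  have S4: "of_real ` {0..<\<rho>} \<subseteq> S"
    unfolding S_def
  proof (rule connected_component_maximal)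
    show "Topological_Spaces.connected (complex_of_real ` {0..<\<rho>})"
      by (intro connected_continuous_image continuous_intros) auto
  qed (use D \<delta> in \<open>auto simp: image_iff intro!: bexI[of _ 0]\<close>)
  have H1: "(\<lambda>z. \<Sum>k. c k * z ^ k) holomorphic_on S"
  proof (rule holomorphic_on_subset[OF power_series_holomorphic], rule subsetI)
    fix z assume "z \<in> S"
    hence "ereal (norm z) < ereal \<rho>" using S2 by auto
    also note R
    finally show "z \<in> eball 0 (conv_radius c)" by (simp add: eball_def)
  qed
  have H2: "h holomorphic_on S" using D S2 by (blast intro: holomorphic_on_subset)
  define m where "m = min \<delta> \<rho>"
  have m: "m > 0" using \<delta> by (simp add: m_def)
  define A where "A = complex_of_real ` {m/4<..<m}"

  have lim: "complex_of_real (m/2) islimpt A"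
    unfolding A_def by (rule of_real_islimpt) (use m in auto)
  have "(\<Sum>k. c k * z ^ k) = h z" if "z \<in> S" for z
  proof -
    have "(\<Sum>k. c k * z ^ k) - h z = 0"
    proof (rule analytic_continuation[where f = "\<lambda>z. (\<Sum>k. c k * z ^ k) - h z", OF _ S1 S3 _ _ lim])
      show "(\<lambda>z. (\<Sum>k. c k * z ^ k) - h z) holomorphic_on S" by (intro holomorphic_intros H1 H2)
      show "A \<subseteq> S"
      proof -
        have "{m/4<..<m} \<subseteq> {0..<\<rho>}" using m by (auto simp: m_def)
        thus ?thesis using S4 unfolding A_def by (meson image_mono order_trans)
      qed
      show "of_real (m/2) \<in> S" using S4 m unfolding m_def by (intro subsetD[OF S4] imageI) (auto simp: min_def)
      show "(\<Sum>k. c k * z ^ k) - h z = 0" if zA: "z \<in> A" for z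
      proof -
        obtain s where s: "z = of_real s" "s \<in> {m/4<..<m}" using zA unfolding A_def by blast
        hence "(\<lambda>k. c k * of_real s ^ k) sums h (of_real s)"
          using m by (intro eq) (auto simp: m_def)
        thus ?thesis using s by (simp add: sums_iff)
      qed
    qed (use that in auto)
    thus ?thesis by simp
  qed
  with that S1 S2 S4 show ?thesis by blast
qed

text \<open>If the radius of convergence \<rho> were below 1, \<open>h\<close> would be holomorphic
  near \<rho>, and its Taylor series at some \<open>t < \<rho>\<close> would converge at a point
  \<open>x > \<rho>\<close>. The Taylor coefficients are sums of nonnegative terms, so the double
  series can be rearranged into the original series at \<open>x\<close>, against the choice of
  \<rho>.\<close>

theorem pringsheim_continuation:
  fixes a :: "nat \<Rightarrow> real"
  assumes nn: "\<And>k. 0 \<le> a k"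
    and D: "open D" "h holomorphic_on D" "\<And>t. 0 \<le> t \<Longrightarrow> t < 1 \<Longrightarrow> complex_of_real t \<in> D"
    and \<delta>: "\<delta> > 0"
    and eq: "\<And>s. 0 < s \<Longrightarrow> s < \<delta> \<Longrightarrow> (\<lambda>k. complex_of_real (a k * s ^ k)) sums h (of_real s)"
    and s: "0 < s" "s < 1"
  shows "(\<lambda>k. complex_of_real (a k * s ^ k)) sums h (of_real s)"
proof -
  define c where "c k = complex_of_real (a k)" for k
  have eq': "(\<lambda>k. c k * of_real s ^ k) sums h (of_real s)" if "0 < s" "s < \<delta>" for s
    using eq[OF that] by (simp add: c_def)
  have R\<delta>: "conv_radius c \<ge> \<delta>"
  proof (rule conv_radius_geI_ex')
    show "summable (\<lambda>n. c n * of_real r ^ n)" if "0 < r" "ereal r < ereal \<delta>" for r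
      using eq'[of r] that sums_summable by auto
  qed
  have R1: "conv_radius c \<ge> 1"
  proof (rule ccontr)
    assume "\<not> ?thesis"
    then obtain \<rho> where \<rho>: "conv_radius c = ereal \<rho>" "\<rho> < 1" "\<rho> \<ge> \<delta>"
      using R\<delta> by (cases "conv_radius c") auto
    obtain S where S: "open S" "S \<subseteq> D" "S \<subseteq> ball 0 \<rho>" "of_real ` {0..<\<rho>} \<subseteq> S"
      "\<And>z. z \<in> S \<Longrightarrow> (\<Sum>k. c k * z ^ k) = h z"
      by (rule power_series_eq_continuation[of D h \<rho> c \<delta>]) (use \<rho> \<delta> D eq' in auto)
    obtain \<eta>0 where \<eta>0: "\<eta>0 > 0" "ball (of_real \<rho>) \<eta>0 \<subseteq> D"
      using D \<rho> \<delta> by (metis less_eq_real_def less_le_trans openE)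
    define \<eta> where "\<eta> = min \<eta>0 \<rho>"
    have \<eta>: "\<eta> > 0" "\<eta> \<le> \<rho>" "ball (of_real \<rho>) \<eta> \<subseteq> D"
      using \<eta>0 \<rho> \<delta> by (auto simp: \<eta>_def)
    \<comment> \<open>The disc of radius \<open>\<eta>/2\<close> about \<open>t\<close> lies within
      distance \<eta> of \<rho> and contains \<open>x\<close>: the distances from \<open>t\<close>
      are \<open>\<eta>/4\<close> to \<rho> and \<open>3 * \<eta>/8\<close> to
      \<open>x\<close>.\<close>
    define t where "t = \<rho> - \<eta> / 4"
    define x where "x = \<rho> + \<eta> / 8"
    have t: "0 < t" "t < \<rho>" "t < x" using \<eta> by (auto simp: t_def x_def)
    have tS: "of_real t \<in> S" using S(4) t by auto
    have "ball (of_real t) (\<eta>/2) \<subseteq> D"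
    proof
      fix z assume "z \<in> ball (complex_of_real t) (\<eta>/2)"
      moreover have "dist (of_real \<rho>) (complex_of_real t) = \<eta>/4"
        using \<eta> by (simp add: dist_norm t_def flip: of_real_diff)
      ultimately have "dist (of_real \<rho>) z < \<eta>"
        using dist_triangle[of "of_real \<rho>" z "of_real t"] \<eta> by (auto simp: dist_commute)
      thus "z \<in> D" using \<eta> by auto
    qed
    hence hol: "h holomorphic_on ball (of_real t) (\<eta>/2)" using D holomorphic_on_subset by blast
    have "dist t x < \<eta>/2" using \<eta> by (simp add: t_def x_def dist_real_def)
    hence "of_real x \<in> ball (complex_of_real t) (\<eta>/2)" by (simp add: dist_of_real)
    from holomorphic_power_series[OF hol this]
    have T: "(\<lambda>n. (deriv ^^ n) h (of_real t) / fact n * (of_real x - of_real t) ^ n) sums h (of_real x)" .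
    \<comment> \<open>\<open>b j k\<close> is the \<open>k\<close>-th term of the
      \<open>j\<close>-th Taylor coefficient at \<open>t\<close>, obtained from \<open>j\<close>
      differentiations of the original series.\<close>
    define b where "b j k = (real (k + j choose j)) * a (k + j) * t ^ k" for j k
    have nb: "b j k \<ge> 0" for j k using nn t by (simp add: b_def)
    have bd: "(diffs ^^ j) c k * of_real t ^ k = of_real (fact j * b j k)" for j k
    proof -
      have "(fact (k + j) / fact k) = (fact j * real (k + j choose j) :: real)"
        by (simp add: binomial_fact)
      hence "complex_of_real (fact (k + j) / fact k) = complex_of_real (fact j * real (k + j choose j))"
        by (rule arg_cong)
      thus ?thesis by (simp add: diffs_funpow b_def c_def)
    qed
    have nt: "ereal (norm (complex_of_real t)) < conv_radius c" using \<rho> t by simp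
    have sb: "summable (b j)" for j
    proof -
      have "summable (\<lambda>k. complex_of_real (fact j * b j k))"
        using higher_deriv_power_series(1)[OF nt, of j] by (simp only: bd)
      hence "summable (\<lambda>k. fact j * b j k)" by (simp only: summable_complex_of_real)
      thus ?thesis by (subst (asm) summable_cmult_iff) auto
    qed
    have dh: "(deriv ^^ j) h (of_real t) / fact j = of_real (\<Sum>k. b j k)" for j
    proof -
      have "(deriv ^^ j) h (of_real t) = (deriv ^^ j) (\<lambda>z. \<Sum>k. c k * z ^ k) (of_real t)"
      proof (rule higher_deriv_transform_within_open[OF _ _ S(1) tS])
        show "h holomorphic_on S" using D S holomorphic_on_subset by blast
        then show "(\<lambda>z. \<Sum>k. c k * z ^ k) holomorphic_on S"
          by (rule holomorphic_transform) (use S in auto)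
      qed (use S in auto)
      also have "\<dots> = (\<Sum>k. complex_of_real (fact j * b j k))"
        using higher_deriv_power_series(2)[OF nt, of j] by (simp only: bd)
      also have "\<dots> = of_real (fact j * (\<Sum>k. b j k))"
        using sb by (simp add: suminf_mult suminf_of_real[symmetric] summable_mult)
      finally show ?thesis by simp
    qed
    define y where "y = x - t"
    have y: "y > 0" using t by (simp add: y_def)
    have "(\<lambda>n. complex_of_real ((\<Sum>k. b n k) * y ^ n)) sums h (of_real x)"
      using T by (simp add: dh y_def)
    hence sT: "summable (\<lambda>n. (\<Sum>k. b n k) * y ^ n)"
      using sums_summable summable_complex_of_real by blast
    have "summable (\<lambda>k. a k * x ^ k)"
    proof (rule bounded_imp_summable)
      show "0 \<le> a k * x ^ k" for k using nn t by simp
      show "(\<Sum>k\<le>K. a k * x ^ k) \<le> (\<Sum>n. (\<Sum>k. b n k) * y ^ n)" for K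
      proof -
        \<comment> \<open>Expanding \<open>x ^ k\<close> as a power of \<open>(x - t) + t\<close>
          turns a partial sum at \<open>x\<close> into a finite part of the double series, which
          nonnegativity bounds by the full Taylor sum.\<close>
        have "(\<Sum>k\<le>K. a k * x ^ k) = (\<Sum>k\<le>K. \<Sum>j\<le>k. b j (k - j) * y ^ j)"
        proof (rule sum.cong)
          fix k
          have "x ^ k = (y + t) ^ k" by (simp add: y_def)
          also have "\<dots> = (\<Sum>j\<le>k. real (k choose j) * y ^ j * t ^ (k - j))" by (rule binomial_ring)
          finally show "a k * x ^ k = (\<Sum>j\<le>k. b j (k - j) * y ^ j)"
            by (simp add: sum_distrib_left b_def mult_ac)
        qed auto
        also have "\<dots> = (\<Sum>(k,j)\<in>(SIGMA k:{..K}. {..k}). b j (k - j) * y ^ j)"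
          by (simp add: sum.Sigma)
        also have "\<dots> = (\<Sum>(j,i)\<in>(SIGMA j:{..K}. {..K-j}). b j i * y ^ j)"
          by (rule sum.reindex_bij_witness[of _ "\<lambda>(j,i). (i+j, j)" "\<lambda>(k,j). (j, k-j)"]) auto
        also have "\<dots> = (\<Sum>j\<le>K. \<Sum>i\<le>K-j. b j i * y ^ j)"
          by (simp add: sum.Sigma)
        also have "\<dots> \<le> (\<Sum>j\<le>K. (\<Sum>i. b j i) * y ^ j)"
        proof (rule sum_mono)
          fix j
          have "(\<Sum>i\<le>K-j. b j i) \<le> (\<Sum>i. b j i)" by (rule sum_le_suminf[OF sb]) (use nb in auto)
          thus "(\<Sum>i\<le>K-j. b j i * y ^ j) \<le> (\<Sum>i. b j i) * y ^ j"
            using y by (simp flip: sum_distrib_right)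
        qed
        also have "\<dots> \<le> (\<Sum>n. (\<Sum>k. b n k) * y ^ n)"
          by (rule sum_le_suminf[OF sT]) (use y in \<open>auto intro!: mult_nonneg_nonneg suminf_nonneg sb nb\<close>)
        finally show ?thesis .
      qed
    qed
    hence "summable (\<lambda>k. complex_of_real (a k * x ^ k))" by (simp only: summable_complex_of_real)
    hence "summable (\<lambda>k. c k * of_real x ^ k)" by (simp add: c_def)
    hence "conv_radius c \<ge> norm (complex_of_real x)" by (rule conv_radius_geI)
    moreover have "\<rho> < x" using \<eta> by (simp add: x_def)
    ultimately show False using \<rho> t by simp
  qed
  obtain S where S: "of_real ` {0..<1} \<subseteq> S" "S \<subseteq> ball 0 1" "\<And>z. z \<in> S \<Longrightarrow> (\<Sum>k. c k * z ^ k) = h z"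
    by (rule power_series_eq_continuation[of D h 1 c \<delta>]) (use R1 \<delta> D eq' in \<open>auto simp: one_ereal_def\<close>)
  have sS: "complex_of_real s \<in> S" using S s by auto
  have "summable (\<lambda>k. c k * of_real s ^ k)"
    by (rule summable_in_conv_radius) (use s R1 in \<open>auto intro: less_le_trans[of _ 1] simp: one_ereal_def\<close>)
  hence "(\<lambda>k. c k * of_real s ^ k) sums h (of_real s)"
    using S(3)[OF sS] by (simp add: sums_iff)
  thus ?thesis by (simp add: c_def)
qed

section \<open>Lagrange inversion\<close>

lemma holomorphic_remainder:
  assumes "G holomorphic_on ball 0 \<delta>" "\<delta> > 0"
  obtains Q where "Q holomorphic_on ball 0 \<delta>"
    "\<And>x. x \<in> ball 0 \<delta> \<Longrightarrow> G x = (\<Sum>k\<le>m. (deriv ^^ k) G 0 / fact k * x ^ k) + x ^ Suc m * Q x"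
proof -
  define g where "g k = (deriv ^^ k) G 0 / fact k" for k
  have gs: "(\<lambda>k. g k * x ^ k) sums G x" if "x \<in> ball 0 \<delta>" for x
    using holomorphic_power_series[OF assms(1) that] by (simp add: g_def)
  have gs': "summable (\<lambda>k. g (k + Suc m) * x ^ k)" if "x \<in> ball 0 \<delta>" for x
  proof (cases "x = 0")
    case False
    have "summable (\<lambda>k. g (k + Suc m) * x ^ (k + Suc m))"
      using gs[OF that] sums_summable summable_ignore_initial_segment by blast
    hence "summable (\<lambda>k. x ^ Suc m * (g (k + Suc m) * x ^ k))"
      by (simp add: power_add mult_ac)
    thus ?thesis using False by (subst (asm) summable_cmult_iff) auto
  qed (auto intro: summable_0_powser)
  have R: "conv_radius (\<lambda>k. g (k + Suc m)) \<ge> \<delta>"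
  proof (rule conv_radius_geI_ex')
    fix r :: real assume "0 < r" "ereal r < ereal \<delta>"
    thus "summable (\<lambda>n. g (n + Suc m) * of_real r ^ n)" using gs'[of "of_real r"] by simp
  qed
  show ?thesis
  proof
    show "(\<lambda>x. \<Sum>k. g (k + Suc m) * x ^ k) holomorphic_on ball 0 \<delta>"
    proof (rule holomorphic_on_subset[OF power_series_holomorphic], rule subsetI)
      fix z :: complex assume "z \<in> ball 0 \<delta>"
      hence "ereal (norm z) < ereal \<delta>" by auto
      also note R
      finally show "z \<in> eball 0 (conv_radius (\<lambda>k. g (k + Suc m)))" by (simp add: eball_def)
    qed
    fix x :: complex assume x: "x \<in> ball 0 \<delta>"
    have "G x = (\<Sum>k. g k * x ^ k)" using gs[OF x] by (simp add: sums_iff)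
    also have "\<dots> = (\<Sum>k. g (k + Suc m) * x ^ (k + Suc m)) + (\<Sum>k<Suc m. g k * x ^ k)"
      using gs[OF x] sums_summable by (blast intro: suminf_split_initial_segment)
    also have "(\<Sum>k. g (k + Suc m) * x ^ (k + Suc m)) = (\<Sum>k. x ^ Suc m * (g (k + Suc m) * x ^ k))"
      by (simp add: power_add mult_ac)
    also have "\<dots> = x ^ Suc m * (\<Sum>k. g (k + Suc m) * x ^ k)"
      by (rule suminf_mult[OF gs'[OF x]])
    finally show "G x = (\<Sum>k\<le>m. (deriv ^^ k) G 0 / fact k * x ^ k) + x ^ Suc m * (\<Sum>k. g (k + Suc m) * x ^ k)"
      by (simp add: g_def lessThan_Suc_atMost add.commute)
  qed
qed

text \<open>Substituting \<open>x = u / \<phi> u\<close> turns Cauchy's formula for the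
  \<open>m\<close>-th coefficient of \<open>G\<close> into an integral in \<open>u\<close>. The
  substitution is legitimate only near 0, where it maps into the disc of \<open>G\<close>; but the
  integrand written with \<open>H\<close> and \<phi> is holomorphic on the punctured disc of radius
  \<open>R\<close>, so its integral is the same over every circle.\<close>

theorem lagrange_coefficient:
  assumes G: "G holomorphic_on ball 0 \<delta>" "\<delta> > 0"
    and \<phi>: "\<phi> holomorphic_on ball 0 R" "\<And>u. u \<in> ball 0 R \<Longrightarrow> \<phi> u \<noteq> 0"
    and H: "H holomorphic_on ball 0 R"
    and eq: "\<And>u. norm u < \<delta>' \<Longrightarrow> H u = G (u / \<phi> u) * deriv (\<lambda>u. u / \<phi> u) u" and \<delta>': "\<delta>' > 0"
    and \<rho>: "0 < \<rho>" "\<rho> < R"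
  shows "((\<lambda>u. H u * (\<phi> u / u) ^ Suc m) has_contour_integral
    (2 * pi * \<i> * ((deriv ^^ m) G 0 / fact m))) (circlepath 0 \<rho>)"
proof -
  define X where "X u = u / \<phi> u" for u
  define F where "F u = H u * \<phi> u ^ Suc m" for u
  have F: "F holomorphic_on ball 0 R" unfolding F_def by (intro holomorphic_intros \<phi> H)
  \<comment> \<open>The integral depends only on a derivative of \<open>F\<close> at 0, hence not on
    the radius; this carries the identity from a small circle to radius \<rho>.\<close>
  have circ: "((\<lambda>u. H u * (\<phi> u / u) ^ Suc m) has_contour_integral
    ((2 * pi * \<i>) / fact m * (deriv ^^ m) F 0)) (circlepath 0 \<rho>)" if "0 < \<rho>" "\<rho> < R" for \<rho>
  proof -
    have "((\<lambda>u. F u / (u - 0) ^ Suc m) has_contour_integral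
      ((2 * pi * \<i>) / fact m * (deriv ^^ m) F 0)) (circlepath 0 \<rho>)"
    proof (rule Cauchy_has_contour_integral_higher_derivative_circlepath)
      show "continuous_on (cball 0 \<rho>) F"
        by (rule continuous_on_subset[OF holomorphic_on_imp_continuous_on[OF F]]) (use that in auto)
      show "F holomorphic_on ball 0 \<rho>" by (rule holomorphic_on_subset[OF F]) (use that in auto)
    qed (use that in auto)
    thus ?thesis by (simp add: F_def power_divide)
  qed
  have X: "X holomorphic_on ball 0 R" unfolding X_def by (intro holomorphic_intros \<phi>)
  have R: "R > 0" using \<rho> by simp
  have "isCont X 0" using X R continuous_on_eq_continuous_at[of "ball 0 R" X] holomorphic_on_imp_continuous_on by auto
  moreover have "X 0 = 0" by (simp add: X_def)
  ultimately have "\<forall>\<^sub>F u in nhds 0. dist (X u) 0 < \<delta>"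
    using G(2) by (metis isCont_def tendsto_nhds_iff tendstoD)
  then obtain \<epsilon>0 where \<epsilon>0: "\<epsilon>0 > 0" "\<And>u. dist u 0 < \<epsilon>0 \<Longrightarrow> dist (X u) 0 < \<delta>"
    unfolding eventually_nhds_metric by blast
  define \<epsilon> where "\<epsilon> = min \<epsilon>0 (min \<delta>' R)"
  have \<epsilon>: "\<epsilon> > 0" "\<epsilon> \<le> \<delta>'" "\<epsilon> \<le> R" "\<And>u. u \<in> ball 0 \<epsilon> \<Longrightarrow> X u \<in> ball 0 \<delta>"
    using \<epsilon>0 \<delta>' R by (auto simp: \<epsilon>_def)
  define B where "B = ball (0::complex) \<epsilon>"
  have BR: "B \<subseteq> ball 0 R" using \<epsilon> by (auto simp: B_def)
  define \<tau> where "\<tau> = \<epsilon> / 2"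
  have \<tau>: "0 < \<tau>" "\<tau> < \<epsilon>" "\<tau> < R" using \<epsilon> by (auto simp: \<tau>_def)
  let ?c = "circlepath 0 \<tau>"
  have im: "path_image ?c \<subseteq> B - {0}" using \<tau> by (auto simp: B_def path_image_circlepath)
  obtain Q where Q: "Q holomorphic_on ball 0 \<delta>"
    "\<And>x. x \<in> ball 0 \<delta> \<Longrightarrow> G x = (\<Sum>k\<le>m. (deriv ^^ k) G 0 / fact k * x ^ k) + x ^ Suc m * Q x"
    using holomorphic_remainder[OF G] by blast
  define g where "g k = (deriv ^^ k) G 0 / fact k" for k
  have dX: "(X has_field_derivative deriv X u) (at u)" if "u \<in> B" for u
    using holomorphic_derivI[OF X] that BR by auto
  have XB: "X holomorphic_on B" using X BR holomorphic_on_subset by blast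
  have dXB: "deriv X holomorphic_on B" by (rule holomorphic_deriv[OF XB]) (auto simp: B_def)
  have I1: "((\<lambda>u. Q (X u) * deriv X u) has_contour_integral 0) ?c"
  proof (rule Cauchy_theorem_disc_simple)
    have "(Q \<circ> X) holomorphic_on B"
      by (rule holomorphic_on_compose_gen[OF XB Q(1)]) (use \<epsilon> in \<open>auto simp: B_def\<close>)
    thus "(\<lambda>u. Q (X u) * deriv X u) holomorphic_on ball 0 \<epsilon>"
      unfolding o_def using dXB by (auto intro!: holomorphic_on_mult simp: B_def)
  qed (use im in \<open>auto simp: B_def\<close>)
  have X0: "X u \<noteq> 0" if "u \<in> B - {0}" for u using that BR \<phi> by (auto simp: X_def)
  \<comment> \<open>Powers of \<open>X\<close> below the exponent -1 have single-valued primitives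
    and contribute nothing; what remains is \<open>deriv X u / X u\<close>, through the simple zero
    of \<open>X\<close> at 0.\<close>
  have I2: "((\<lambda>u. deriv X u / X u ^ Suc (Suc j)) has_contour_integral 0) ?c" for j
  proof (rule Cauchy_theorem_primitive[where S = "B - {0}" and f = "\<lambda>u. - 1 / (of_nat (Suc j) * X u ^ Suc j)"])
    fix u assume u: "u \<in> B - {0}"
    have nz: "complex_of_nat (Suc j) \<noteq> 0" by (metis nat.simps(3) of_nat_eq_0_iff)
    have "((\<lambda>u. X u ^ Suc j) has_field_derivative (of_nat (Suc j) * (X u ^ j * deriv X u))) (at u)"
      using DERIV_power[OF dX, of u "Suc j"] u by (simp add: mult_ac del: of_nat_Suc)
    hence "((\<lambda>u. of_nat (Suc j) * X u ^ Suc j) has_field_derivative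
        of_nat (Suc j) * (of_nat (Suc j) * (X u ^ j * deriv X u))) (at u)"
      by (rule DERIV_cmult)
    from DERIV_divide[OF DERIV_const[of "-1"] this]
    have "((\<lambda>u. - 1 / (of_nat (Suc j) * X u ^ Suc j)) has_field_derivative deriv X u / X u ^ Suc (Suc j)) (at u)"
    proof (rule DERIV_cong)
      show "of_nat (Suc j) * X u ^ Suc j \<noteq> 0" using nz X0[OF u] by simp
      show "(0 * (of_nat (Suc j) * X u ^ Suc j) - - 1 * (of_nat (Suc j) * (of_nat (Suc j) * (X u ^ j * deriv X u)))) /
        (of_nat (Suc j) * X u ^ Suc j * (of_nat (Suc j) * X u ^ Suc j)) = deriv X u / X u ^ Suc (Suc j)"
        using nz X0[OF u] by (simp add: field_simps del: of_nat_Suc)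
    qed
    thus "((\<lambda>u. - 1 / (of_nat (Suc j) * X u ^ Suc j)) has_field_derivative
      deriv X u / X u ^ Suc (Suc j)) (at u within B - {0})"
      by (rule has_field_derivative_at_within)
  qed (use im in auto)
  have I3: "((\<lambda>u. deriv X u / X u) has_contour_integral (2 * pi * \<i>)) ?c"
  proof -
    have "((\<lambda>u. 1 / (u - 0)) has_contour_integral (2 * pi * \<i>)) ?c"
      using Cauchy_integral_circlepath_simple[of "\<lambda>_. 1" 0 \<tau> 0] \<tau> by simp
    moreover have "((\<lambda>u. deriv \<phi> u / \<phi> u) has_contour_integral 0) ?c"
    proof (rule Cauchy_theorem_disc_simple)
      show "(\<lambda>u. deriv \<phi> u / \<phi> u) holomorphic_on ball 0 R"
        using \<phi> by (intro holomorphic_intros) auto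
    qed (use im BR in \<open>auto simp: B_def\<close>)
    ultimately have "((\<lambda>u. 1 / (u - 0) - deriv \<phi> u / \<phi> u) has_contour_integral (2 * pi * \<i> - 0)) ?c"
      by (rule has_contour_integral_diff)
    hence "((\<lambda>u. deriv X u / X u) has_contour_integral (2 * pi * \<i> - 0)) ?c"
    proof (rule has_contour_integral_eq)
      fix u assume "u \<in> path_image ?c"
      hence u: "u \<in> B" "u \<noteq> 0" using im by auto
      have p: "\<phi> u \<noteq> 0" using u BR \<phi> by auto
      have "(\<phi> has_field_derivative deriv \<phi> u) (at u)"
        using holomorphic_derivI[OF \<phi>(1)] u BR by auto
      hence "(X has_field_derivative (\<phi> u - u * deriv \<phi> u) / (\<phi> u)\<^sup>2) (at u)"
        unfolding X_def using p by (auto intro!: derivative_eq_intros simp: power2_eq_square)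
      hence "deriv X u = (\<phi> u - u * deriv \<phi> u) / (\<phi> u)\<^sup>2" by (rule DERIV_imp_deriv)
      hence "deriv X u / X u = (\<phi> u - u * deriv \<phi> u) / (u * \<phi> u)"
        using p u by (simp add: X_def power2_eq_square)
      thus "1 / (u - 0) - deriv \<phi> u / \<phi> u = deriv X u / X u"
        using p u by (simp add: diff_divide_distrib)
    qed
    thus ?thesis by simp
  qed
  have I4: "((\<lambda>u. g k * (deriv X u * X u ^ k / X u ^ Suc m)) has_contour_integral (g k * (if k = m then 2 * pi * \<i> else 0))) ?c"
    if "k \<le> m" for k
  proof (cases "k = m")
    case True
    have "((\<lambda>u. deriv X u * X u ^ k / X u ^ Suc m) has_contour_integral (2 * pi * \<i>)) ?c"
    proof (rule has_contour_integral_eq[OF I3])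
      fix u assume "u \<in> path_image ?c"
      hence "X u \<noteq> 0" using im X0 by blast
      thus "deriv X u / X u = deriv X u * X u ^ k / X u ^ Suc m" using True by simp
    qed
    thus ?thesis using True by (auto intro: has_contour_integral_lmul)
  next
    case False
    define j where "j = m - Suc k"
    have m: "m = k + Suc j" using False that by (simp add: j_def)
    have "((\<lambda>u. deriv X u * X u ^ k / X u ^ Suc m) has_contour_integral 0) ?c"
    proof (rule has_contour_integral_eq[OF I2[of j]])
      fix u assume "u \<in> path_image ?c"
      hence "X u \<noteq> 0" using im X0 by blast
      thus "deriv X u / X u ^ Suc (Suc j) = deriv X u * X u ^ k / X u ^ Suc m"
        by (simp add: m power_add field_simps)
    qed
    from has_contour_integral_lmul[OF this, of "g k"] show ?thesis
      using False by (simp only: if_False mult_zero_right)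
  qed
  have "((\<lambda>u. \<Sum>k\<le>m. g k * (deriv X u * X u ^ k / X u ^ Suc m)) has_contour_integral
     (\<Sum>k\<le>m. g k * (if k = m then 2 * pi * \<i> else 0))) ?c"
    by (rule has_contour_integral_sum) (use I4 in auto)
  hence "((\<lambda>u. (\<Sum>k\<le>m. g k * (deriv X u * X u ^ k / X u ^ Suc m)) + Q (X u) * deriv X u) has_contour_integral
     (\<Sum>k\<le>m. g k * (if k = m then 2 * pi * \<i> else 0)) + 0) ?c"
    using I1 by (rule has_contour_integral_add)
  also have "(\<Sum>k\<le>m. g k * (if k = m then 2 * pi * \<i> else 0)) + 0 = 2 * pi * \<i> * g m"
    by (simp add: if_distrib cong: if_cong)
  finally have "((\<lambda>u. H u * (\<phi> u / u) ^ Suc m) has_contour_integral (2 * pi * \<i> * g m)) ?c"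
  proof (rule has_contour_integral_eq)
    fix u assume "u \<in> path_image ?c"
    hence "u \<in> B - {0}" using im by blast
    hence u: "u \<in> B" "u \<noteq> 0" "X u \<noteq> 0" using X0 by auto
    have "H u = G (X u) * deriv X u"
    proof -
      have "X = (\<lambda>u. u / \<phi> u)" by (simp add: fun_eq_iff X_def)
      thus ?thesis using eq[of u] u \<epsilon> by (simp add: B_def)
    qed
    also have "G (X u) = (\<Sum>k\<le>m. g k * X u ^ k) + X u ^ Suc m * Q (X u)"
      unfolding g_def by (rule Q(2)) (use u \<epsilon> in \<open>auto simp: B_def\<close>)
    finally have Hu: "H u = ((\<Sum>k\<le>m. g k * X u ^ k) + X u ^ Suc m * Q (X u)) * deriv X u" .
    have "H u / X u ^ Suc m = (\<Sum>k\<le>m. g k * (deriv X u * X u ^ k / X u ^ Suc m)) + Q (X u) * deriv X u"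
    proof -
      define y where "y = X u ^ Suc m"
      define \<Sigma> where "\<Sigma> = (\<Sum>k\<le>m. g k * X u ^ k)"
      have y: "y \<noteq> 0" using u by (simp add: y_def)
      have "(\<Sum>k\<le>m. g k * (deriv X u * X u ^ k / y)) = deriv X u * \<Sigma> / y"
        by (simp add: \<Sigma>_def sum_distrib_left sum_divide_distrib mult_ac)
      moreover have "H u / y = deriv X u * \<Sigma> / y + Q (X u) * deriv X u"
        using y Hu unfolding y_def[symmetric] \<Sigma>_def[symmetric] by (simp add: field_simps)
      ultimately show ?thesis unfolding y_def by simp
    qed
    moreover have "H u / X u ^ Suc m = H u * (\<phi> u / u) ^ Suc m"
      by (simp add: X_def power_divide)
    ultimately show "(\<Sum>k\<le>m. g k * (deriv X u * X u ^ k / X u ^ Suc m)) + Q (X u) * deriv X u = H u * (\<phi> u / u) ^ Suc m"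
      by simp
  qed
  with circ[OF \<tau>(1) \<tau>(3)] have "(2 * pi * \<i>) / fact m * (deriv ^^ m) F 0 = 2 * pi * \<i> * g m"
    by (rule has_contour_integral_unique)
  with circ[OF \<rho>] show ?thesis by (simp add: g_def)
qed

section \<open>Laplace's method\<close>

lemma integral_rescale_indicator:
  fixes f :: "real \<Rightarrow> complex"
  assumes "c > 0"
  shows "(LINT t|lborel. f t) = (LINT t|lborel. f (t / c)) / of_real c"
  using lborel_integral_real_affine[of "1/c" f 0] assms
  by (simp add: scaleR_conv_of_real field_simps)

text \<open>After the substitution \<theta> = \<open>t / sqrt m\<close> the assumption
  \<open>bound\<close> dominates all integrands by the Gaussian
  \<open>B * exp (- c * t\<^sup>2)\<close>, and \<open>taylor\<close> identifies the pointwise limit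
  as a Gaussian of rate \<sigma>; dominated convergence does the rest.\<close>

theorem laplace_complex:
  fixes h \<psi> :: "real \<Rightarrow> complex" and c \<sigma> :: real
  assumes h: "continuous_on UNIV h" and \<psi>: "continuous_on UNIV \<psi>"
    and c: "c > 0" and \<sigma>: "\<sigma> > 0"
    and bound: "\<And>\<theta>. \<bar>\<theta>\<bar> \<le> pi \<Longrightarrow> norm (\<psi> \<theta>) \<le> exp (- c * \<theta>\<^sup>2)"
    and taylor: "((\<lambda>\<theta>. (\<psi> \<theta> - of_real (exp (- \<sigma> * \<theta>\<^sup>2))) / of_real (\<theta>\<^sup>2)) \<longlongrightarrow> 0) (at 0)"
  shows "(\<lambda>m. of_real (sqrt (real m)) * (LBINT \<theta>:{-pi..pi}. h \<theta> * \<psi> \<theta> ^ m))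
            \<longlonglongrightarrow> h 0 * of_real (sqrt (pi / \<sigma>))"
proof -
  have "compact (h ` {-pi..pi})"
    by (intro compact_continuous_image continuous_on_subset[OF h]) auto
  then obtain B where B: "\<And>\<theta>. \<bar>\<theta>\<bar> \<le> pi \<Longrightarrow> norm (h \<theta>) \<le> B"
    using compact_imp_bounded bounded_iff by (smt (verit) atLeastAtMost_iff imageI abs_le_iff)
  have B0: "B \<ge> 0" using B[of 0] by (smt (verit) norm_ge_zero pi_ge_zero abs_zero)
  \<comment> \<open>The rescaled integrand; the indicator lets all integrals run over the same line
    although the range of \<open>t\<close> grows with \<open>m\<close>.\<close>
  define F where "F m t = indicator {-pi..pi} (t / sqrt (real m)) *\<^sub>R (h (t / sqrt (real m)) * \<psi> (t / sqrt (real m)) ^ m)"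
    for m :: nat and t :: real
  have ind: "indicator {-pi..pi} x = (if \<bar>x\<bar> \<le> pi then 1 else 0 :: real)" for x
    by (auto simp: indicator_def abs_le_iff)
  have m1: "F m \<in> borel_measurable lborel" for m
  proof -
    have a: "h \<in> borel_measurable borel" "\<psi> \<in> borel_measurable borel"
      using h \<psi> by (simp_all add: borel_measurable_continuous_onI)
    have "(\<lambda>t. h (t / sqrt (real m))) \<in> borel_measurable borel" "(\<lambda>t. \<psi> (t / sqrt (real m))) \<in> borel_measurable borel"
      by (rule measurable_compose[OF _ a(1)], simp, rule measurable_compose[OF _ a(2)], simp)
    thus ?thesis unfolding F_def by measurable
  qed
  have nd: "exp (- s * t\<^sup>2) = sqrt (pi / s) * normal_density 0 (sqrt (1 / (2 * s))) t" if "s > 0" for s t :: real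
  proof -
    have "2 * pi * (sqrt (1 / (2 * s)))\<^sup>2 = pi / s" using that by simp
    moreover have "(t - 0)\<^sup>2 / (2 * (sqrt (1 / (2 * s)))\<^sup>2) = s * t\<^sup>2" using that by (simp add: field_simps)
    ultimately show ?thesis using that by (simp add: normal_density_def)
  qed
  have sp: "sqrt (1 / (2 * s)) > 0" if "s > 0" for s :: real using that by simp
  have ig: "integrable lborel (\<lambda>t. exp (- s * t\<^sup>2))" and vg: "(LINT t|lborel. exp (- s * t\<^sup>2)) = sqrt (pi / s)"
    if "s > 0" for s :: real
    using that sp[OF that] by (simp_all only: nd[OF that]) (simp_all add: integral_normal_density)
  have lim1: "(\<lambda>m. F m t) \<longlonglongrightarrow> h 0 * of_real (exp (- \<sigma> * t\<^sup>2))" for t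
  proof -
    have s0: "(\<lambda>m. t / sqrt (real m)) \<longlonglongrightarrow> 0"
      by real_asymp
    have e1: "\<forall>\<^sub>F m in sequentially. \<bar>t / sqrt (real m)\<bar> \<le> pi"
    proof -
      have "\<forall>\<^sub>F m in sequentially. dist (t / sqrt (real m)) 0 < pi" using tendstoD[OF s0] pi_gt_zero by blast
      thus ?thesis by eventually_elim simp
    qed
    have hl: "(\<lambda>m. h (t / sqrt (real m))) \<longlonglongrightarrow> h 0"
    proof -
      have "isCont h 0" using h continuous_on_eq_continuous_at[of UNIV] by blast
      thus ?thesis using s0 by (rule isCont_tendsto_compose)
    qed
    have pl: "(\<lambda>m. \<psi> (t / sqrt (real m)) ^ m) \<longlonglongrightarrow> of_real (exp (- \<sigma> * t\<^sup>2))"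
    \<comment> \<open>For \<open>t = 0\<close> the rescaled argument stays at 0, which a limit over
      a punctured neighbourhood does not see; \<open>\<psi> 0 = 1\<close> follows by
      continuity.\<close>
    proof (cases "t = 0")
      case True
      have "isCont \<psi> 0" using \<psi> continuous_on_eq_continuous_at[of UNIV] by blast
      have "((\<lambda>\<theta>. \<psi> \<theta> - of_real (exp (- \<sigma> * \<theta>\<^sup>2))) \<longlongrightarrow> 0) (at 0)"
      proof -
        have "((\<lambda>\<theta>::real. (\<psi> \<theta> - of_real (exp (- \<sigma> * \<theta>\<^sup>2))) / of_real (\<theta>\<^sup>2) * of_real (\<theta>\<^sup>2)) \<longlongrightarrow> 0 * of_real (0\<^sup>2)) (at 0)"
          by (intro tendsto_intros taylor)
        hence "((\<lambda>\<theta>::real. (\<psi> \<theta> - of_real (exp (- \<sigma> * \<theta>\<^sup>2))) / of_real (\<theta>\<^sup>2) * of_real (\<theta>\<^sup>2)) \<longlongrightarrow> 0) (at 0)"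
          by (simp only: mult_zero_left)
        thus ?thesis
          by (rule Lim_transform_eventually) (auto simp: eventually_at_filter)
      qed
      moreover have "((\<lambda>\<theta>. \<psi> \<theta> - of_real (exp (- \<sigma> * \<theta>\<^sup>2))) \<longlongrightarrow> \<psi> 0 - of_real (exp (- \<sigma> * 0\<^sup>2))) (at 0)"
        using \<open>isCont \<psi> 0\<close> by (intro tendsto_intros) (auto simp: isCont_def)
      ultimately have "\<psi> 0 - of_real (exp (- \<sigma> * 0\<^sup>2)) = 0"
        by (rule LIM_unique[rotated])
      thus ?thesis using True by simp
    next
      case False
      define s where "s m = t / sqrt (real m)" for m
      define d where "d \<theta> = (\<psi> \<theta> - of_real (exp (- \<sigma> * \<theta>\<^sup>2))) / of_real (\<theta>\<^sup>2)" for \<theta>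
      have "filterlim s (at 0) sequentially"
        unfolding filterlim_at using s0 False by (auto simp: s_def[abs_def] intro!: eventually_sequentiallyI[of 1])
      hence dl: "(\<lambda>m. d (s m)) \<longlonglongrightarrow> 0"
        unfolding d_def by (rule filterlim_compose[OF taylor])
      have le: "\<forall>\<^sub>F m in sequentially. norm (\<psi> (s m) ^ m - of_real (exp (- \<sigma> * t\<^sup>2))) \<le> t\<^sup>2 * norm (d (s m))"
        using e1 eventually_gt_at_top[of 0]
      proof eventually_elim
        case (elim m)
        have sm: "(s m)\<^sup>2 = t\<^sup>2 / real m" using elim by (simp add: s_def power_divide)
        have sm0: "s m \<noteq> 0" using False elim by (simp add: s_def)
        have n1: "norm (\<psi> (s m)) \<le> 1"
          using bound[of "s m"] elim c by (simp add: s_def) (smt (verit) exp_le_one_iff mult_nonneg_nonneg zero_le_power2 divide_nonneg_nonneg of_nat_0_le_iff)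
        have n2: "norm (complex_of_real (exp (- \<sigma> * (s m)\<^sup>2))) \<le> 1"
          using \<sigma> by simp
        have "complex_of_real (exp (- \<sigma> * (s m)\<^sup>2)) ^ m = of_real (exp (real m * (- \<sigma> * (s m)\<^sup>2)))"
          by (simp only: exp_of_nat_mult of_real_power)
        also have "real m * (- \<sigma> * (s m)\<^sup>2) = - \<sigma> * t\<^sup>2" using elim sm by simp
        finally have "norm (\<psi> (s m) ^ m - of_real (exp (- \<sigma> * t\<^sup>2)))
          = norm (\<psi> (s m) ^ m - complex_of_real (exp (- \<sigma> * (s m)\<^sup>2)) ^ m)" by simp
        \<comment> \<open>In the closed unit disc \<open>m\<close>-th powers differ by at most
          \<open>m\<close> times the difference of the bases; the factor \<open>m\<close> is
          absorbed by \<open>(s m)\<^sup>2 = t\<^sup>2 / real m\<close>.\<close>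
        also have "\<dots> \<le> real m * norm (\<psi> (s m) - complex_of_real (exp (- \<sigma> * (s m)\<^sup>2)))"
          by (rule norm_power_diff[OF n1 n2])
        also have "\<dots> = real m * (norm (d (s m)) * (s m)\<^sup>2)"
          using sm0 by (simp add: d_def norm_divide norm_power)
        also have "\<dots> = t\<^sup>2 * norm (d (s m))" using elim sm by simp
        finally show ?case .
      qed
      have "(\<lambda>m. t\<^sup>2 * norm (d (s m))) \<longlonglongrightarrow> t\<^sup>2 * norm (0::complex)"
        by (intro tendsto_intros dl)
      hence "(\<lambda>m. \<psi> (s m) ^ m - of_real (exp (- \<sigma> * t\<^sup>2))) \<longlonglongrightarrow> 0"
        using le by (intro Lim_null_comparison[OF le]) simp
      thus ?thesis unfolding s_def by (simp add: LIM_zero_iff)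
    qed
    have "(\<lambda>m. h (t / sqrt (real m)) * \<psi> (t / sqrt (real m)) ^ m) \<longlonglongrightarrow> h 0 * of_real (exp (- \<sigma> * t\<^sup>2))"
      by (intro tendsto_mult hl pl)
    moreover have "\<forall>\<^sub>F m in sequentially. h (t / sqrt (real m)) * \<psi> (t / sqrt (real m)) ^ m = F m t"
      using e1 by eventually_elim (simp add: F_def ind)
    ultimately show ?thesis by (rule Lim_transform_eventually)
  qed
  have bnd: "norm (F m t) \<le> B * exp (- c * t\<^sup>2)" if "m > 0" for m t
  proof (cases "\<bar>t / sqrt (real m)\<bar> \<le> pi")
    case True
    have "norm (\<psi> (t / sqrt (real m)) ^ m) \<le> exp (- c * (t / sqrt (real m))\<^sup>2) ^ m"
      unfolding norm_power by (intro power_mono bound True) auto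
    also have "\<dots> = exp (real m * (- c * (t / sqrt (real m))\<^sup>2))" by (simp only: exp_of_nat_mult)
    also have "real m * (- c * (t / sqrt (real m))\<^sup>2) = - c * t\<^sup>2" using that by (simp add: power_divide)
    finally have "norm (h (t / sqrt (real m)) * \<psi> (t / sqrt (real m)) ^ m) \<le> B * exp (- c * t\<^sup>2)"
      unfolding norm_mult using B[OF True] B0 by (intro mult_mono) auto
    thus ?thesis using B0 True by (simp add: F_def ind)
  next
    case False
    thus ?thesis using B0 by (simp add: F_def ind)
  qed
  have "(\<lambda>m. LINT t|lborel. F (Suc m) t) \<longlonglongrightarrow> (LINT t|lborel. h 0 * of_real (exp (- \<sigma> * t\<^sup>2)))"
  proof (rule integral_dominated_convergence)
    show "integrable lborel (\<lambda>t. B * exp (- c * t\<^sup>2))" by (intro integrable_mult_right ig c)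
    show "AE t in lborel. (\<lambda>m. F (Suc m) t) \<longlonglongrightarrow> h 0 * of_real (exp (- \<sigma> * t\<^sup>2))"
      using LIMSEQ_Suc[OF lim1] by simp
    show "AE t in lborel. norm (F (Suc m) t) \<le> B * exp (- c * t\<^sup>2)" for m
      using bnd[of "Suc m"] by simp
    show "F (Suc m) \<in> borel_measurable lborel" for m by (rule m1)
  qed (intro borel_measurable_times borel_measurable_const, simp)
  hence L: "(\<lambda>m. LINT t|lborel. F m t) \<longlonglongrightarrow> (LINT t|lborel. h 0 * of_real (exp (- \<sigma> * t\<^sup>2)))"
    by (rule LIMSEQ_imp_Suc)
  have v: "(LINT t|lborel. h 0 * of_real (exp (- \<sigma> * t\<^sup>2))) = h 0 * of_real (sqrt (pi / \<sigma>))"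
    using vg[OF \<sigma>] by (simp only: integral_mult_right_zero integral_complex_of_real)
  have "(LINT t|lborel. F m t) = of_real (sqrt (real m)) * (LBINT \<theta>:{-pi..pi}. h \<theta> * \<psi> \<theta> ^ m)" if "m > 0" for m
    using integral_rescale_indicator[of "sqrt (real m)" "\<lambda>\<theta>. indicator {-pi..pi} \<theta> *\<^sub>R (h \<theta> * \<psi> \<theta> ^ m)"] that
    by (simp add: F_def set_lebesgue_integral_def field_simps)
  hence "\<forall>\<^sub>F m in sequentially. (LINT t|lborel. F m t) = of_real (sqrt (real m)) * (LBINT \<theta>:{-pi..pi}. h \<theta> * \<psi> \<theta> ^ m)"
    by (auto intro: eventually_sequentiallyI[of 1])
  with L show ?thesis unfolding v by (rule Lim_transform_eventually)
qed

section \<open>Coefficients at the saddle point\<close>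

text \<open>The critical value of \<open>u\<close> for \<open>z = 1\<close>: the positive zero of
  \<open>3 * u\<^sup>2 + 2 * u - 2\<close>, which up to sign is the numerator of the derivative of
  \<open>u / (chi u)\<^sup>2\<close>.\<close>

definition ucrit :: real where "ucrit = (sqrt 7 - 1) / 3"

lemma ucrit_quadratic: "3 * ucrit\<^sup>2 = 2 - 2 * ucrit"
  by (simp add: ucrit_def power2_eq_square field_simps)

lemma ucrit_bounds: "0.5485 < ucrit" "ucrit < 0.5486"
proof -
  have "2.6455 < sqrt 7" by (rule real_less_rsqrt) (simp add: power2_eq_square)
  thus "0.5485 < ucrit" by (simp add: ucrit_def)
  have "sqrt 7 < 2.6458" by (rule real_less_lsqrt) (simp_all add: power2_eq_square)
  thus "ucrit < 0.5486" by (simp add: ucrit_def)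
qed

text \<open>For \<open>z = 1\<close> this is \<open>1 + v\<close> with
  \<open>v = (1 + u)\<^sup>2\<close>, so that the system becomes
  \<open>x = u / (chi u)\<^sup>2\<close>.\<close>

definition chi :: "complex \<Rightarrow> complex" where "chi u = 2 + 2 * u + u\<^sup>2"

text \<open>The radius 11/20 lies just above \<open>ucrit\<close>: the saddle circle fits into the
  disc, and crude triangle inequalities still exclude zeros.\<close>

lemma chi_nonzero:
  assumes "norm u < 11/20" shows "chi u \<noteq> 0"
proof
  assume "chi u = 0"
  hence "2 * u + u\<^sup>2 = - 2" by (simp add: chi_def eq_neg_iff_add_eq_0 algebra_simps)
  hence "2 = norm (2 * u + u\<^sup>2)" by simp
  also have "\<dots> \<le> 2 * norm u + (norm u)\<^sup>2"
    by (rule order_trans[OF norm_triangle_ineq]) (simp add: norm_mult norm_power)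
  also have "\<dots> \<le> 2 * (11/20) + (11/20)\<^sup>2" using assms by (intro add_mono mult_mono power_mono) auto
  finally show False by (simp add: power2_eq_square)
qed

definition chi0 :: real where "chi0 = 2 + 2 * ucrit + ucrit\<^sup>2"

lemma chi0_pos: "chi0 > 0" using ucrit_bounds by (simp add: chi0_def add_pos_nonneg)

text \<open>Lagrange's kernel \<open>(chi u)\<^sup>2 / u\<close> on the circle through the critical
  point, normalized to be 1 at that point.\<close>

definition kernel :: "real \<Rightarrow> complex" where
  "kernel \<theta> = (chi (of_real ucrit * cis \<theta>))\<^sup>2 * cis (- \<theta>) / of_real (chi0\<^sup>2)"

text \<open>Fourth-order Taylor bound together with \<open>\<theta>\<^sup>2 \<le> 10\<close>: the
  constant is \<open>1/12 = 1/2 - 10/24\<close>.\<close>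

lemma one_minus_cos_ge:
  assumes "\<bar>\<theta>\<bar> \<le> pi" shows "\<theta>\<^sup>2 / 12 \<le> 1 - cos (\<theta>::real)"
proof -
  obtain t where t: "cos \<theta> = (\<Sum>m<4. cos_coeff m * \<theta> ^ m) + cos (t + 1/2 * real 4 * pi) / fact 4 * \<theta> ^ 4"
    using Maclaurin_cos_expansion[of \<theta> 4] by auto
  have "cos (t + 1/2 * real 4 * pi) / fact 4 * \<theta> ^ 4 \<le> 1 / fact 4 * \<theta> ^ 4"
    by (intro mult_right_mono divide_right_mono) auto
  moreover have "(\<Sum>m<4. cos_coeff m * \<theta> ^ m) = 1 - \<theta>\<^sup>2 / 2"
  proof -
    have "(\<Sum>m<4. f m) = f 0 + f 1 + f 2 + f 3" for f :: "nat \<Rightarrow> real" by (simp add: eval_nat_numeral)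
    thus ?thesis by (simp add: cos_coeff_def)
  qed
  ultimately have c: "cos \<theta> \<le> 1 - \<theta>\<^sup>2 / 2 + \<theta> ^ 4 / 24" using t by (simp add: fact_numeral)
  have "pi\<^sup>2 \<le> 3.15\<^sup>2" using pi_approx by (intro power_mono) auto
  moreover have "\<theta>\<^sup>2 \<le> pi\<^sup>2" using assms by (metis abs_ge_zero power2_abs power_mono)
  ultimately have "\<theta>\<^sup>2 \<le> 10" by (simp add: power2_eq_square)
  hence "\<theta>\<^sup>2 * \<theta>\<^sup>2 \<le> \<theta>\<^sup>2 * 10" by (intro mult_left_mono) auto
  hence "\<theta> ^ 4 \<le> 10 * \<theta>\<^sup>2" by (simp add: power4_eq_xxxx power2_eq_square mult_ac)
  thus ?thesis using c by simp
qed

text \<open>On the circle the squared modulus of \<open>chi\<close> is \<open>chi0\<^sup>2\<close>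
  minus \<open>1 - cos \<theta>\<close> times a sum of nonnegative terms. The term
  \<open>8 * ucrit\<close> alone already gives quadratic decay, with the rate
  \<open>8 * ucrit / 12\<close> relative to \<open>chi0\<^sup>2\<close>.\<close>

lemma kernel_bound:
  assumes "\<bar>\<theta>\<bar> \<le> pi"
  shows "norm (kernel \<theta>) \<le> exp (- (2 * ucrit / (3 * chi0\<^sup>2)) * \<theta>\<^sup>2)"
proof -
  define u where "u = ucrit"
  define C where "C = cos \<theta>"
  define S where "S = sin \<theta>"
  have u: "u > 0" using ucrit_bounds by (simp add: u_def)
  have CS: "S\<^sup>2 = 1 - C\<^sup>2" "C \<le> 1" "C \<ge> -1" by (simp_all add: C_def S_def sin_squared_eq)
  have "chi (of_real u * cis \<theta>) = Complex (2 + 2 * u * C + u\<^sup>2 * (C\<^sup>2 - S\<^sup>2)) (2 * u * S + 2 * u\<^sup>2 * S * C)"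
    by (simp add: chi_def complex_eq_iff C_def S_def power2_eq_square algebra_simps)
  hence "(norm (chi (of_real u * cis \<theta>)))\<^sup>2 = (2 + 2 * u * C + u\<^sup>2 * (C\<^sup>2 - S\<^sup>2))\<^sup>2 + (2 * u * S + 2 * u\<^sup>2 * S * C)\<^sup>2"
    by (simp add: cmod_power2)
  also have "\<dots> = (2 + 2 * u * C + u\<^sup>2 * (C\<^sup>2 - S\<^sup>2))\<^sup>2 + (2 * u + 2 * u\<^sup>2 * C)\<^sup>2 * S\<^sup>2"
    by (simp add: algebra_simps power2_eq_square)
  also have "\<dots> = chi0\<^sup>2 - (1 - C) * (8 * u + (8 * u\<^sup>2 * (1 + C) + 4 * u ^ 3))"
    unfolding CS chi0_def u_def[symmetric] by (simp add: algebra_simps power2_eq_square power3_eq_cube)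
  also have "\<dots> \<le> chi0\<^sup>2 - (1 - C) * (8 * u + 0)"
    using CS u by (intro diff_left_mono mult_left_mono add_left_mono) (auto intro!: add_nonneg_nonneg mult_nonneg_nonneg)
  also have "\<dots> \<le> chi0\<^sup>2 - (\<theta>\<^sup>2 / 12) * (8 * u)"
    using mult_right_mono[OF one_minus_cos_ge[OF assms], of "8 * u"] u by (simp add: C_def)
  finally have "(norm (chi (of_real u * cis \<theta>)))\<^sup>2 / chi0\<^sup>2 \<le> (chi0\<^sup>2 - (\<theta>\<^sup>2 / 12) * (8 * u)) / chi0\<^sup>2"
    using chi0_pos by (intro divide_right_mono) auto
  also have "\<dots> = 1 + (- (2 * u / (3 * chi0\<^sup>2)) * \<theta>\<^sup>2)"
    using chi0_pos by (simp add: field_simps)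
  also have "\<dots> \<le> exp (- (2 * u / (3 * chi0\<^sup>2)) * \<theta>\<^sup>2)" by (rule exp_ge_add_one_self)
  finally show ?thesis using chi0_pos by (simp add: kernel_def u_def norm_divide norm_mult norm_power)
qed

lemma exp_taylor2_limit:
  fixes c :: complex shows
  "((\<lambda>\<theta>::real. (exp (c * of_real \<theta>) - 1 - c * of_real \<theta> - c\<^sup>2 * of_real (\<theta>\<^sup>2) / 2) / of_real (\<theta>\<^sup>2)) \<longlongrightarrow> 0) (at 0)"
proof (rule Lim_null_comparison)
  show "\<forall>\<^sub>F \<theta> in at 0. norm ((exp (c * of_real \<theta>) - 1 - c * of_real \<theta> - c\<^sup>2 * of_real (\<theta>\<^sup>2) / 2) / of_real (\<theta>\<^sup>2))
     \<le> exp \<bar>Re c * \<theta>\<bar> * norm c ^ 3 * \<bar>\<theta>\<bar> / 2"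
  proof (rule eventually_mono[of "\<lambda>\<theta>. \<theta> \<noteq> 0"])
    show "\<forall>\<^sub>F \<theta>::real in at 0. \<theta> \<noteq> 0" by (simp add: eventually_at_filter)
    fix \<theta> :: real assume nz: "\<theta> \<noteq> 0"
    have "norm (exp (c * of_real \<theta>) - (\<Sum>k\<le>2. (c * of_real \<theta>) ^ k / fact k)) \<le> exp \<bar>Re (c * of_real \<theta>)\<bar> * norm (c * of_real \<theta>) ^ Suc 2 / fact 2"
      by (rule Taylor_exp)
    also have "(\<Sum>k\<le>2. (c * complex_of_real \<theta>) ^ k / fact k) = 1 + c * of_real \<theta> + c\<^sup>2 * of_real (\<theta>\<^sup>2) / 2"
      by (simp add: eval_nat_numeral)
    finally have "norm (exp (c * of_real \<theta>) - 1 - c * of_real \<theta> - c\<^sup>2 * of_real (\<theta>\<^sup>2) / 2)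
      \<le> exp \<bar>Re c * \<theta>\<bar> * norm c ^ 3 * \<bar>\<theta>\<bar> / 2 * \<theta>\<^sup>2"
      by (simp add: norm_mult power_mult_distrib power2_eq_square power3_eq_cube algebra_simps)
    thus "norm ((exp (c * of_real \<theta>) - 1 - c * of_real \<theta> - c\<^sup>2 * of_real (\<theta>\<^sup>2) / 2) / of_real (\<theta>\<^sup>2))
     \<le> exp \<bar>Re c * \<theta>\<bar> * norm c ^ 3 * \<bar>\<theta>\<bar> / 2"
      using nz by (simp add: norm_divide pos_divide_le_eq norm_power)
  qed
  have "((\<lambda>\<theta>. exp \<bar>Re c * \<theta>\<bar> * norm c ^ 3 * \<bar>\<theta>\<bar> / 2) \<longlongrightarrow> exp \<bar>Re c * 0\<bar> * norm c ^ 3 * \<bar>0\<bar> / 2) (at 0)"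
    by (intro tendsto_intros) auto
  thus "((\<lambda>\<theta>. exp \<bar>Re c * \<theta>\<bar> * norm c ^ 3 * \<bar>\<theta>\<bar> / 2) \<longlongrightarrow> 0) (at 0)" by simp
qed

text \<open>Rate of the Gaussian to which \<open>kernel\<close> is tangent of second order at
  0.\<close>

definition ksigma :: real where "ksigma = 1/4 + 2 * ucrit\<^sup>2 / chi0"

text \<open>The kernel is a trigonometric polynomial with frequencies from -1 to 3, and
  \<open>id1\<close>, \<open>id2\<close>, \<open>id3\<close> compute its moments of order 0, 1, 2.
  The first is the normalization, the second vanishes because the circle passes through the saddle
  point, the third yields \<open>ksigma\<close>; the last two hold modulo the quadratic equation of
  \<open>ucrit\<close>.\<close>

lemma kernel_taylor:
  "((\<lambda>\<theta>. (kernel \<theta> - of_real (exp (- ksigma * \<theta>\<^sup>2))) / of_real (\<theta>\<^sup>2)) \<longlongrightarrow> 0) (at 0)"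
proof -
  define u where "u = ucrit"
  define T where "T c \<theta> = (exp (c * of_real \<theta>) - 1 - c * of_real \<theta> - c\<^sup>2 * of_real (\<theta>\<^sup>2) / 2) / of_real (\<theta>\<^sup>2)"
    for c :: complex and \<theta> :: real
  have T: "(T c \<longlongrightarrow> 0) (at 0)" for c unfolding T_def by (rule exp_taylor2_limit)
  define E where "E \<theta> = (exp (- ksigma * \<theta>\<^sup>2) - 1 + ksigma * \<theta>\<^sup>2) / \<theta>\<^sup>2" for \<theta> :: real
  have E: "(E \<longlongrightarrow> 0) (at 0)" unfolding E_def by real_asymp
  have exT: "exp (c * of_real \<theta>) = 1 + c * of_real \<theta> + c\<^sup>2 * of_real (\<theta>\<^sup>2) / 2 + of_real (\<theta>\<^sup>2) * T c \<theta>"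
    if "\<theta> \<noteq> 0" for c and \<theta> :: real using that by (simp add: T_def)
  have q1: "u\<^sup>2 = (2 - 2 * u) / 3" using ucrit_quadratic by (simp add: u_def)
  have c0nz: "chi0 \<noteq> 0" using chi0_pos by simp
  have s2: "ksigma * chi0\<^sup>2 = chi0\<^sup>2 / 4 + 2 * u\<^sup>2 * chi0" using c0nz by (simp add: ksigma_def u_def[symmetric] field_simps power2_eq_square)
  have u3: "u ^ 3 = u * u\<^sup>2" "u ^ 4 = u\<^sup>2 * u\<^sup>2" by (simp_all add: power3_eq_cube power4_eq_xxxx power2_eq_square)
  have id1: "4 + 8 * u + 8 * u\<^sup>2 + 4 * u ^ 3 + u ^ 4 = chi0\<^sup>2"
    by (simp add: chi0_def u_def[symmetric] power2_eq_square algebra_simps power3_eq_cube power4_eq_xxxx)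
  have id2: "- 4 + 8 * u\<^sup>2 + 8 * u ^ 3 + 3 * u ^ 4 = 0"
  proof -
    have "- 4 + 8 * u\<^sup>2 + 8 * u ^ 3 + 3 * u ^ 4 = (3 * u\<^sup>2 - (2 - 2 * u)) * (u\<^sup>2 + 2 * u + 2)"
      by (simp add: algebra_simps power2_eq_square power3_eq_cube power4_eq_xxxx)
    thus ?thesis using ucrit_quadratic by (simp add: u_def)
  qed
  have id3: "4 + 8 * u\<^sup>2 + 16 * u ^ 3 + 9 * u ^ 4 = 2 * (ksigma * chi0\<^sup>2)"
  proof -
    \<comment> \<open>The cofactor comes from division by the quadratic polynomial of
      \<open>ucrit\<close>; the remainder is identically 0.\<close>
    have "4 + 8 * u\<^sup>2 + 16 * u ^ 3 + 9 * u ^ 4 - 2 * (chi0\<^sup>2 / 4 + 2 * u\<^sup>2 * chi0) = (3 * u\<^sup>2 - (2 - 2 * u)) * (3/2 * u\<^sup>2 + u - 1)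
      + (4 + 8 * u\<^sup>2 + 16 * u ^ 3 + 9 * u ^ 4 - 2 * (chi0\<^sup>2 / 4 + 2 * u\<^sup>2 * chi0) - (3 * u\<^sup>2 - (2 - 2 * u)) * (3/2 * u\<^sup>2 + u - 1))" by simp
    also have "(4 + 8 * u\<^sup>2 + 16 * u ^ 3 + 9 * u ^ 4 - 2 * (chi0\<^sup>2 / 4 + 2 * u\<^sup>2 * chi0) - (3 * u\<^sup>2 - (2 - 2 * u)) * (3/2 * u\<^sup>2 + u - 1)) = 0"
      by (simp add: chi0_def u_def[symmetric] algebra_simps power2_eq_square power3_eq_cube power4_eq_xxxx)
    finally show ?thesis using ucrit_quadratic s2 by (simp add: u_def)
  qed
  define L where "L \<theta> = (4 * T (- \<i>) \<theta> + 8 * (of_real u)\<^sup>2 * T \<i> \<theta> + 4 * of_real u ^ 3 * T (2 * \<i>) \<theta> + of_real u ^ 4 * T (3 * \<i>) \<theta>) / of_real (chi0\<^sup>2)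
     - of_real (E \<theta>)" for \<theta>
  have "(L \<longlongrightarrow> (4 * 0 + 8 * (of_real u)\<^sup>2 * 0 + 4 * of_real u ^ 3 * 0 + of_real u ^ 4 * 0) / of_real (chi0\<^sup>2) - of_real 0) (at 0)"
    unfolding L_def by (intro tendsto_intros T E) (use c0nz in auto)
  hence L0: "(L \<longlongrightarrow> 0) (at 0)" by simp
  have "L \<theta> = (kernel \<theta> - of_real (exp (- ksigma * \<theta>\<^sup>2))) / of_real (\<theta>\<^sup>2)" if nz: "\<theta> \<noteq> 0" for \<theta>
  proof -
    define t where "t = complex_of_real \<theta>"
    have t: "t \<noteq> 0" "of_real (\<theta>\<^sup>2) = t\<^sup>2" using nz by (simp_all add: t_def)
    define U where "U = complex_of_real u"
    define K where "K = complex_of_real (chi0\<^sup>2)"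
    have K: "K \<noteq> 0" using c0nz by (simp add: K_def)
    define s where "s = complex_of_real ksigma"
    have cid: "4 + 8 * U + 8 * U\<^sup>2 + 4 * U ^ 3 + U ^ 4 = K" "- 4 + 8 * U\<^sup>2 + 8 * U ^ 3 + 3 * U ^ 4 = 0"
       "4 + 8 * U\<^sup>2 + 16 * U ^ 3 + 9 * U ^ 4 = 2 * (s * K)"
      using arg_cong[OF id1, of complex_of_real] arg_cong[OF id2, of complex_of_real] arg_cong[OF id3, of complex_of_real]
      by (simp_all add: U_def K_def s_def)
    define e where "e = cis \<theta>"
    have ee: "e * cis (-\<theta>) = 1" by (simp add: e_def cis_mult)
    have ce: "exp (- \<i> * t) = cis (-\<theta>)" "exp (\<i> * t) = e" "exp (2 * \<i> * t) = e\<^sup>2" "exp (3 * \<i> * t) = e ^ 3"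
      by (simp_all add: t_def e_def cis_conv_exp exp_of_nat_mult[symmetric] mult_ac)
    have "(2 + 2 * (U * e) + (U * e)\<^sup>2)\<^sup>2 * cis (-\<theta>) = 4 * cis (-\<theta>) + 8 * U * (e * cis (-\<theta>)) + 8 * U\<^sup>2 * e * (e * cis (-\<theta>)) + 4 * U ^ 3 * e\<^sup>2 * (e * cis (-\<theta>)) + U ^ 4 * e ^ 3 * (e * cis (-\<theta>))"
      by (simp add: algebra_simps power2_eq_square power3_eq_cube power4_eq_xxxx)
    hence "kernel \<theta> * K = 4 * cis (-\<theta>) + 8 * U + 8 * U\<^sup>2 * e + 4 * U ^ 3 * e\<^sup>2 + U ^ 4 * e ^ 3"
      using c0nz unfolding ee by (simp add: kernel_def chi_def u_def U_def e_def K_def)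
    also have "\<dots> = 4 * exp (- \<i> * t) + 8 * U + 8 * U\<^sup>2 * exp (\<i> * t) + 4 * U ^ 3 * exp (2 * \<i> * t) + U ^ 4 * exp (3 * \<i> * t)"
      by (simp only: ce)
    also have "\<dots> = (4 + 8 * U + 8 * U\<^sup>2 + 4 * U ^ 3 + U ^ 4) + \<i> * t * (- 4 + 8 * U\<^sup>2 + 8 * U ^ 3 + 3 * U ^ 4)
       - t\<^sup>2 / 2 * (4 + 8 * U\<^sup>2 + 16 * U ^ 3 + 9 * U ^ 4)
       + t\<^sup>2 * (4 * T (- \<i>) \<theta> + 8 * U\<^sup>2 * T \<i> \<theta> + 4 * U ^ 3 * T (2 * \<i>) \<theta> + U ^ 4 * T (3 * \<i>) \<theta>)"
      unfolding t_def exT[OF nz] unfolding t(2) t_def[symmetric]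
      by (simp add: algebra_simps)
    also have "\<dots> = K - t\<^sup>2 * (s * K) + t\<^sup>2 * (4 * T (- \<i>) \<theta> + 8 * U\<^sup>2 * T \<i> \<theta> + 4 * U ^ 3 * T (2 * \<i>) \<theta> + U ^ 4 * T (3 * \<i>) \<theta>)"
      unfolding cid by simp
    finally have k1: "kernel \<theta> * K = K - t\<^sup>2 * (s * K) + t\<^sup>2 * (4 * T (- \<i>) \<theta> + 8 * U\<^sup>2 * T \<i> \<theta> + 4 * U ^ 3 * T (2 * \<i>) \<theta> + U ^ 4 * T (3 * \<i>) \<theta>)" .
    define M where "M = 4 * T (- \<i>) \<theta> + 8 * U\<^sup>2 * T \<i> \<theta> + 4 * U ^ 3 * T (2 * \<i>) \<theta> + U ^ 4 * T (3 * \<i>) \<theta>"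
    define P where "P = (4 * T (- \<i>) \<theta> + 8 * U\<^sup>2 * T \<i> \<theta> + 4 * U ^ 3 * T (2 * \<i>) \<theta> + U ^ 4 * T (3 * \<i>) \<theta>) / K"
    have "kernel \<theta> * K = (1 - t\<^sup>2 * s + t\<^sup>2 * P) * K"
      unfolding k1 P_def M_def[symmetric] using K by (simp add: left_diff_distrib distrib_right)
    hence "kernel \<theta> = 1 - t\<^sup>2 * s + t\<^sup>2 * P" using K by simp
    moreover have "exp (- ksigma * \<theta>\<^sup>2) = 1 - ksigma * \<theta>\<^sup>2 + \<theta>\<^sup>2 * E \<theta>" using nz by (simp add: E_def)
    hence "complex_of_real (exp (- ksigma * \<theta>\<^sup>2)) = 1 - s * t\<^sup>2 + t\<^sup>2 * of_real (E \<theta>)"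
      by (simp only: s_def t_def of_real_diff of_real_add of_real_mult of_real_power of_real_1)
    ultimately have "kernel \<theta> - of_real (exp (- ksigma * \<theta>\<^sup>2)) = t\<^sup>2 * (P - of_real (E \<theta>))"
      by (simp only:) (simp add: algebra_simps)
    thus ?thesis using t(1) unfolding t(2) L_def U_def[symmetric] K_def[symmetric] P_def[symmetric]
      by simp
  qed
  hence "\<forall>\<^sub>F \<theta> in at 0. L \<theta> = (kernel \<theta> - of_real (exp (- ksigma * \<theta>\<^sup>2))) / of_real (\<theta>\<^sup>2)"
    by (auto simp: eventually_at_filter)
  with L0 show ?thesis by (rule Lim_transform_eventually)
qed

text \<open>\<open>circlepath\<close> runs over the angles from 0 to \<open>2 * pi\<close>, whereas
  Laplace's method needs the saddle at 0 in the interior of the interval.\<close>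

lemma has_integral_circle_shift:
  fixes f :: "real \<Rightarrow> complex"
  assumes I: "(f has_integral I) {0..2 * pi}" and per: "\<And>t. f (t + 2 * pi) = f t"
  shows "(f has_integral I) {-pi..pi}"
proof -
  have "f integrable_on {0..pi}" "f integrable_on {pi..2 * pi}"
    using I by (auto intro: integrable_subinterval_real[of f 0 "2 * pi"] simp: has_integral_integrable)
  then obtain A B where A: "(f has_integral A) {0..pi}" and B: "(f has_integral B) {pi..2 * pi}"
    by (auto simp: integrable_on_def)
  have "(f has_integral A + B) {0..2 * pi}"
    by (rule has_integral_combine[OF _ _ A B]) auto
  hence AB: "I = B + A" using I has_integral_unique by (metis add.commute)
  have "((\<lambda>x. f (x + 2 * pi)) has_integral B) {pi - 2 * pi..2 * pi - 2 * pi}"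
    by (rule has_integral_shift_real_ivl[OF B])
  hence "(f has_integral B) {-pi..0}" by (simp add: per)
  from has_integral_combine[OF _ _ this A] show ?thesis by (simp add: AB)
qed

text \<open>The circle of radius \<open>ucrit\<close> passes through the saddle of the kernel, so
  the limit sees only the value of the amplitude \<open>H\<close> there. \<open>G\<close> is given
  on a small disc in \<open>x\<close>; all information about the singularity at \<open>x = r\<close>
  is carried by the regular function \<open>H\<close> of \<open>u\<close>.\<close>

theorem saddle_coefficients:
  assumes G: "G holomorphic_on ball 0 \<delta>" "\<delta> > 0"
    and H: "H holomorphic_on ball 0 (11/20)"
    and eq: "\<And>u. norm u < \<delta>' \<Longrightarrow> H u = G (u / (chi u)\<^sup>2) * deriv (\<lambda>u. u / (chi u)\<^sup>2) u" and \<delta>': "\<delta>' > 0"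
  shows "(\<lambda>m. of_real (sqrt (real (Suc m)) * (ucrit / chi0\<^sup>2) ^ Suc m) * ((deriv ^^ m) G 0 / fact m))
      \<longlonglongrightarrow> of_real (ucrit / (2 * pi) * sqrt (pi / ksigma)) * H (of_real ucrit)"
proof -
  define U where "U = complex_of_real ucrit"
  have u: "ucrit > 0" "ucrit < 11/20" using ucrit_bounds by auto
  define r where "r = ucrit / chi0\<^sup>2"
  have r: "r > 0" using u chi0_pos by (simp add: r_def)
  define h where "h \<theta> = H (U * cis \<theta>) * cis \<theta>" for \<theta>
  have cis_cont: "continuous_on UNIV cis" by (intro continuous_intros)
  have ball: "U * cis \<theta> \<in> ball 0 (11/20)" for \<theta> using u by (simp add: U_def norm_mult)
  have hc: "continuous_on UNIV h"
    unfolding h_def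
    by (intro continuous_intros continuous_on_compose2[OF holomorphic_on_imp_continuous_on[OF H]]) (use ball in auto)
  have kc: "continuous_on UNIV kernel"
    unfolding kernel_def chi_def using chi0_pos by (intro continuous_intros) auto
  have kp: "ksigma > 0" using u chi0_pos by (simp add: ksigma_def add_pos_nonneg)
  have cp: "2 * ucrit / (3 * chi0\<^sup>2) > 0" using u chi0_pos by simp
  have L: "(\<lambda>m. of_real (sqrt (real m)) * (LBINT \<theta>:{-pi..pi}. h \<theta> * kernel \<theta> ^ m)) \<longlonglongrightarrow> h 0 * of_real (sqrt (pi / ksigma))"
    by (rule laplace_complex[OF hc kc cp kp kernel_bound kernel_taylor])
  have main: "of_real (r ^ Suc m) * ((deriv ^^ m) G 0 / fact m) = of_real (ucrit / (2 * pi)) * (LBINT \<theta>:{-pi..pi}. h \<theta> * kernel \<theta> ^ Suc m)" for m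
  proof -
    define g where "g = (deriv ^^ m) G 0 / fact m"
    have "((\<lambda>u. H u * ((chi u)\<^sup>2 / u) ^ Suc m) has_contour_integral (2 * pi * \<i> * g)) (circlepath 0 ucrit)"
      unfolding g_def
    proof (rule lagrange_coefficient[OF G _ _ H eq \<delta>' u])
      show "(\<lambda>u. (chi u)\<^sup>2) holomorphic_on ball 0 (11/20)" unfolding chi_def by (intro holomorphic_intros)
    qed (use chi_nonzero in auto)
    hence "((\<lambda>t. H (U * cis t) * ((chi (U * cis t))\<^sup>2 / (U * cis t)) ^ Suc m * U * \<i> * cis t) has_integral (2 * pi * \<i> * g)) {0..2 * pi}"
      by (simp add: circlepath_def has_contour_integral_part_circlepath_iff U_def)
    hence "((\<lambda>t. H (U * cis t) * ((chi (U * cis t))\<^sup>2 / (U * cis t)) ^ Suc m * U * \<i> * cis t) has_integral (2 * pi * \<i> * g)) {-pi..pi}"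
      by (rule has_integral_circle_shift) (simp add: cis_mult[symmetric])
    moreover have "H (U * cis t) * ((chi (U * cis t))\<^sup>2 / (U * cis t)) ^ Suc m * U * \<i> * cis t
      = (U * \<i> / of_real (r ^ Suc m)) * (h t * kernel t ^ Suc m)" for t
    proof -
      have "(chi (U * cis t))\<^sup>2 / (U * cis t) = kernel t / of_real r"
        using u chi0_pos by (simp add: kernel_def U_def r_def cis_inverse[symmetric] field_simps)
      thus ?thesis
        by (simp only: h_def power_divide of_real_power) (simp only: times_divide_eq_left times_divide_eq_right mult_ac)
    qed
    ultimately have hi: "((\<lambda>t. (U * \<i> / of_real (r ^ Suc m)) * (h t * kernel t ^ Suc m)) has_integral (2 * pi * \<i> * g)) {-pi..pi}"
      by simp
    have ci: "continuous_on {-pi..pi} (\<lambda>t. h t * kernel t ^ Suc m)"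
      by (intro continuous_intros continuous_on_subset[OF hc] continuous_on_subset[OF kc]) auto
    have "((\<lambda>t. h t * kernel t ^ Suc m) has_integral (LBINT \<theta>:{-pi..pi}. h \<theta> * kernel \<theta> ^ Suc m)) {-pi..pi}"
      using set_borel_integral_eq_integral[OF borel_integrable_atLeastAtMost'[OF ci]] by (simp add: has_integral_iff)
    hence "((\<lambda>t. (U * \<i> / of_real (r ^ Suc m)) * (h t * kernel t ^ Suc m)) has_integral
       (U * \<i> / of_real (r ^ Suc m)) * (LBINT \<theta>:{-pi..pi}. h \<theta> * kernel \<theta> ^ Suc m)) {-pi..pi}"
      by (rule has_integral_mult_right)
    from has_integral_unique[OF this hi]
    have "(U * \<i> / of_real (r ^ Suc m)) * (LBINT \<theta>:{-pi..pi}. h \<theta> * kernel \<theta> ^ Suc m) = 2 * pi * \<i> * g" .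
    thus ?thesis unfolding g_def[symmetric] using r by (simp add: U_def field_simps)
  qed
  have "(\<lambda>m. of_real (ucrit / (2 * pi)) * (of_real (sqrt (real (Suc m))) * (LBINT \<theta>:{-pi..pi}. h \<theta> * kernel \<theta> ^ Suc m)))
     \<longlonglongrightarrow> of_real (ucrit / (2 * pi)) * (h 0 * of_real (sqrt (pi / ksigma)))"
    by (intro tendsto_mult tendsto_const LIMSEQ_Suc[OF L])
  moreover have "of_real (ucrit / (2 * pi)) * (of_real (sqrt (real (Suc m))) * (LBINT \<theta>:{-pi..pi}. h \<theta> * kernel \<theta> ^ Suc m))
     = of_real (sqrt (real (Suc m)) * r ^ Suc m) * ((deriv ^^ m) G 0 / fact m)" for m
  proof -
    have "of_real (ucrit / (2 * pi)) * (of_real (sqrt (real (Suc m))) * (LBINT \<theta>:{-pi..pi}. h \<theta> * kernel \<theta> ^ Suc m))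
      = of_real (sqrt (real (Suc m))) * (of_real (ucrit / (2 * pi)) * (LBINT \<theta>:{-pi..pi}. h \<theta> * kernel \<theta> ^ Suc m))"
      by (simp only: mult_ac)
    thus ?thesis unfolding main[symmetric] by (simp only: of_real_mult mult_ac)
  qed
  ultimately show ?thesis unfolding r_def[symmetric] by (simp add: h_def U_def mult_ac)
qed

section \<open>Differentiation at the critical point\<close>

definition s7 :: complex where "s7 = of_real (sqrt 7)"

lemma s7_sq: "s7\<^sup>2 = 7"
  by (simp add: s7_def flip: of_real_power)

text \<open>The two association patterns under which the simplifier reduces every polynomial in
  \<open>s7\<close> to the form \<open>a + b * s7\<close>.\<close>

lemma s7_rules: "s7 * s7 = 7" "s7 * (s7 * x) = 7 * x"
  using s7_sq by (simp_all add: power2_eq_square flip: mult.assoc)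

text \<open>\<open>(2 + s7) / 3\<close> is \<open>1 + ucrit\<close>, the critical value of
  \<open>y = 1 + u\<close>.\<close>

lemma ycrit_powers:
  shows "((2 + s7) / 3) ^ 2 = (11 + 4 * s7) / 9"
    and "((2 + s7) / 3) ^ 3 = (50 + 19 * s7) / 27"
    and "((2 + s7) / 3) ^ 4 = (233 + 88 * s7) / 81"
    and "((2 + s7) / 3) ^ 5 = (1082 + 409 * s7) / 243"
proof -
  show p2: "((2 + s7) / 3) ^ 2 = (11 + 4 * s7) / 9"
    by (simp add: power2_eq_square field_simps s7_rules)
  show p3: "((2 + s7) / 3) ^ 3 = (50 + 19 * s7) / 27"
    unfolding power_Suc[of _ 2, simplified] p2 by (simp add: field_simps s7_rules)
  show p4: "((2 + s7) / 3) ^ 4 = (233 + 88 * s7) / 81"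
    unfolding power_Suc[of _ 3, simplified] p3 by (simp add: field_simps s7_rules)
  show p5: "((2 + s7) / 3) ^ 5 = (1082 + 409 * s7) / 243"
    unfolding power_Suc[of _ 4, simplified] p4 by (simp add: field_simps s7_rules)
qed

text \<open>The part of the derivative of \<open>Gdiag\<close> at the critical point that carries
  the square root, with all denominators cleared, so that coefficients of powers of \<open>w\<close>
  are compared without fractions. \<open>diag_scale\<close> restores the denominators.\<close>

lemma diag_integral:
  fixes w :: complex
  shows "3776 * (((113 + 37 * s7)) ^ 2 * ((23440 - 8864 * s7)) * ((- 2279 - 859 * s7) + (4350 + 1572 * s7) * w + (81 - 81 * s7) * w ^ 2) * ((3481 + 0 * s7) + (8716 - 4154 * s7) * w + (8219 - 3100 * s7) * w ^ 2)) + 33984 * (((113 + 37 * s7)) ^ 2 * ((2656 - 992 * s7)) * ((- 1867 - 710 * s7) + (2496 + 942 * s7) * w + (- 81 + 0 * s7) * w ^ 2) * ((3481 + 0 * s7) + (8716 - 4154 * s7) * w + (8219 - 3100 * s7) * w ^ 2))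
    - 177447456 * (((2656 - 992 * s7)) * ((- 2279 - 859 * s7) + (4350 + 1572 * s7) * w + (81 - 81 * s7) * w ^ 2) * ((5914 + 2162 * s7) + (- 5860 - 2216 * s7) * w + (- 54 + 54 * s7) * w ^ 2)) = 9 * (((113 + 37 * s7)) ^ 3 * ((42496 - 15872 * s7)) * (((- 3080685 - 1437653 * s7) + (2951888 + 1552526 * s7) * w + (26008932 - 9369906 * s7) * w ^ 2 + (63557744 - 24031594 * s7) * w ^ 3 + (37371401 - 14125021 * s7) * w ^ 4)))"
  by (simp add: algebra_simps s7_rules power2_eq_square power3_eq_cube power4_eq_xxxx)

text \<open>The analogue of \<open>diag_integral\<close> for \<open>Kuv\<close>. The last polynomial
  on the right, the numerator of \<open>kn\<close>, is the same up to the factor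
  \<open>1 + w\<close>: here the expansion in \<open>z\<close> and the asymptotics in
  \<open>x\<close> meet.\<close>

lemma fold_integral:
  fixes w :: complex
  shows "1888 * (((2279 + 859 * s7)) ^ 2 * ((4025161 - 1521371 * s7)) * ((- 1198766714 - 453091276 * s7) + (1196353362 + 452180328 * s7) * w + (486481986 + 183875904 * s7) * w ^ 2 + (- 6826842 - 2578716 * s7) * w ^ 3) * ((3481 + 0 * s7) + (8716 - 4154 * s7) * w + (8219 - 3100 * s7) * w ^ 2)) + 8496 * (((2279 + 859 * s7)) ^ 2 * ((198983 - 75208 * s7)) * ((- 2795611610 - 1056641476 * s7) + (2712927726 + 1025382060 * s7) * w + (1134494874 + 428778936 * s7) * w ^ 2 + (- 16040430 - 6073056 * s7) * w ^ 3) * ((3481 + 0 * s7) + (8716 - 4154 * s7) * w + (8219 - 3100 * s7) * w ^ 2))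
    - 14787288 * (((198983 - 75208 * s7)) * ((- 1198766714 - 453091276 * s7) + (1196353362 + 452180328 * s7) * w + (486481986 + 183875904 * s7) * w ^ 2 + (- 6826842 - 2578716 * s7) * w ^ 3) * ((17048246 + 6443686 * s7) + (- 14019660 - 5298408 * s7) * w + (105462 + 40338 * s7) * w ^ 2)) = 6561 * (((2279 + 859 * s7)) ^ 3 * ((- 51016 + 19304 * s7)) * (((- 3080685 - 1437653 * s7) + (2951888 + 1552526 * s7) * w + (26008932 - 9369906 * s7) * w ^ 2 + (63557744 - 24031594 * s7) * w ^ 3 + (37371401 - 14125021 * s7) * w ^ 4) * (1 + w)))"
  by (simp add: algebra_simps s7_rules power2_eq_square power3_eq_cube power4_eq_xxxx)

lemma diag_scale:
  fixes G RD RR BB BD QQ DD HH KK W :: complex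
  assumes "3776 * (G ^ 2 * RD * BB * QQ) + 33984 * (G ^ 2 * RR * BD * QQ) - 177447456 * (RR * BB * DD) = 9 * (G ^ 3 * HH * KK)"
  shows "2 * (G / 27) ^ 2 * ((RD / 243) * (BB / 243) + (RR / 81) * (BD / 81)) * (QQ / 3481) - (RR / 81) * (BB / 243) * (DD / 81) = 2 * (G / 27) ^ 3 * ((HH / 243) * (KK / 13144256))"
proof -
  \<comment> \<open>The multiplier \<open>1888 * 3481 * 3 ^ 16\<close> is a common denominator of
    all terms.\<close>
  have "(2 * (G / 27) ^ 2 * ((RD / 243) * (BB / 243) + (RR / 81) * (BD / 81)) * (QQ / 3481) - (RR / 81) * (BB / 243) * (DD / 81) - 2 * (G / 27) ^ 3 * ((HH / 243) * (KK / 13144256))) * 282908560392288 = 3776 * (G ^ 2 * RD * BB * QQ) + 33984 * (G ^ 2 * RR * BD * QQ) - 177447456 * (RR * BB * DD) - 9 * (G ^ 3 * HH * KK)"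
    by (simp add: field_simps power2_eq_square power3_eq_cube)
  also have "\<dots> = 0" using assms by simp
  finally show ?thesis by (simp only: mult_eq_0_iff) simp
qed

lemma fold_scale:
  fixes G RD RR BB BD QQ DD HH KK W :: complex
  assumes "1888 * (G ^ 2 * RD * BB * QQ) + 8496 * (G ^ 2 * RR * BD * QQ) - 14787288 * (RR * BB * DD) = 6561 * (G ^ 3 * HH * (KK * W))"
  shows "2 * (G / 243) ^ 2 * ((RD / 486) * (BB / 1594323) + (RR / 324) * (BD / 531441)) * (QQ / 3481) - (RR / 324) * (BB / 1594323) * (DD / 19683) = 2 * (G / 243) ^ 3 * ((HH / 243) * (W * (KK / 13144256)))"
proof -
  have "(2 * (G / 243) ^ 2 * ((RD / 486) * (BB / 1594323) + (RR / 324) * (BD / 531441)) * (QQ / 3481) - (RR / 324) * (BB / 1594323) * (DD / 19683) - 2 * (G / 243) ^ 3 * ((HH / 243) * (W * (KK / 13144256)))) * 150349208243437927008 = 1888 * (G ^ 2 * RD * BB * QQ) + 8496 * (G ^ 2 * RR * BD * QQ) - 14787288 * (RR * BB * DD) - 6561 * (G ^ 3 * HH * (KK * W))"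
    by (simp add: field_simps power2_eq_square power3_eq_cube)
  also have "\<dots> = 0" using assms by simp
  finally show ?thesis by (simp only: mult_eq_0_iff) simp
qed

text \<open>For \<open>z = 1\<close> one has \<open>u = y - 1\<close> and \<open>v = y\<^sup>2\<close>.\<close>

definition q2 :: "complex \<Rightarrow> complex \<Rightarrow> complex" where
  "q2 y w = (y ^ 3 + 2 * y + 1)\<^sup>2 - 2 * w * (y - 1) * (2 * y ^ 4 + 3 * y ^ 3 + 4 * y\<^sup>2 + 2 * y + 1) + w\<^sup>2 * (y - 1)\<^sup>2"

definition q2' :: "complex \<Rightarrow> complex \<Rightarrow> complex" where
  "q2' y w = 2 * (y ^ 3 + 2 * y + 1) * (3 * y\<^sup>2 + 2) - 2 * w * (2 * y ^ 4 + 3 * y ^ 3 + 4 * y\<^sup>2 + 2 * y + 1)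
     - 2 * w * (y - 1) * (8 * y ^ 3 + 9 * y\<^sup>2 + 8 * y + 2) + 2 * w\<^sup>2 * (y - 1)"

text \<open>The coefficient of the reciprocal square root that is left of the derivative of
  \<open>Ndiag\<close> once the factors \<open>1 + 4 * y - 3 * y\<^sup>2\<close> and
  \<open>w + 1\<close> are split off.\<close>

definition bp :: "complex \<Rightarrow> complex \<Rightarrow> complex" where
  "bp y w = - (y ^ 5) + 2 * w * y ^ 4 + 2 * (w - 1) * y ^ 3 + (5 * w - 1) * y\<^sup>2 + (2 * w - w\<^sup>2) * y + w\<^sup>2 + w"

definition bp' :: "complex \<Rightarrow> complex \<Rightarrow> complex" where
  "bp' y w = - 5 * y ^ 4 + 8 * w * y ^ 3 + 6 * (w - 1) * y\<^sup>2 + 2 * (5 * w - 1) * y + (2 * w - w\<^sup>2)"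

definition w1r :: "complex \<Rightarrow> complex \<Rightarrow> complex" where
  "w1r y w = 2 * w * y ^ 4 + y ^ 4 + 3 * w * y ^ 3 + 5 * w * y\<^sup>2 + 2 * y\<^sup>2 - w\<^sup>2 * y + w * y + y + w\<^sup>2 + w"

text \<open>\<open>q2\<close> at the critical point, divided by its value at \<open>w = 0\<close>.
  The zero nearest to the origin is the reciprocal of \<open>s7 - 2\<close>, the singularity of the
  limit law.\<close>

definition qn :: "complex \<Rightarrow> complex" where
  "qn w = (1 - (s7 - 2) * w) * (1 - (673 * s7 - 1754) / 3481 * w)"

text \<open>The coefficients come from the derivative of \<open>Gdiag\<close> at the critical point,
  reduced by \<open>s7\<^sup>2 = 7\<close> and normalized so that \<open>hq 1 = 1\<close>.\<close>

definition kn :: "complex \<Rightarrow> complex" where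
  "kn w = (- 15 - 7 * s7) / 64 + (424 + 223 * s7) / 1888 * w + (13004466 - 4684953 * s7) / 6572128 * w\<^sup>2
     + (31778872 - 12015797 * s7) / 6572128 * w ^ 3 + (37371401 - 14125021 * s7) / 13144256 * w ^ 4"

definition hq :: "complex \<Rightarrow> complex" where
  "hq w = (15 + 7 * s7) / 64 + (17 - 7 * s7) / 64 * w + kn w / (csqrt (qn w)) ^ 3"

lemma w1_poly_diag: "w1_poly (y - 1) (y\<^sup>2) w = y\<^sup>2 * w1r y w"
  unfolding w1_poly_def w1r_def by algebra

lemma w2_poly_diag: "w2_poly (y - 1) (y\<^sup>2) w = y ^ 4 * q2 y w"
  unfolding w2_poly_def q2_def by algebra

text \<open>Writing \<open>s7 = 3 * y - 2\<close> makes the claim a polynomial identity modulo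
  \<open>3 * y\<^sup>2 - 4 * y - 1\<close>, the quadratic polynomial of the critical
  \<open>y\<close>.\<close>

lemma q2_crit: "q2 ((2 + s7) / 3) w = ((113 + 37 * s7) / 27)\<^sup>2 * qn w"
proof -
  define y where "y = (2 + s7) / 3"
  have s: "s7 = 3 * y - 2" by (simp add: y_def field_simps)
  have "3 * (3 * y\<^sup>2 - 4 * y - 1) = (3 * y - 2)\<^sup>2 - 7" by (simp add: power2_eq_square algebra_simps)
  hence "3 * (3 * y\<^sup>2 - 4 * y - 1) = 0" using s7_sq unfolding s by simp
  hence e: "3 * y\<^sup>2 - 4 * y - 1 = 0" by (simp only: mult_eq_0_iff) simp
  have "q2 y w * (27\<^sup>2 * 3481) - (113 + 37 * (3 * y - 2))\<^sup>2 * ((1 - (3 * y - 2 - 2) * w) * (3481 - (673 * (3 * y - 2) - 1754) * w)) = 0"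
    using e unfolding q2_def by algebra
  hence "q2 y w = ((113 + 37 * s7) / 27)\<^sup>2 * qn w"
    unfolding qn_def s by (simp add: field_simps)
  thus ?thesis unfolding y_def .
qed

text \<open>Implicit differentiation. \<sigma> is an arbitrary holomorphic square root because the
  branches for \<open>w = 1\<close> and for small \<open>w\<close> are given by different
  formulas.\<close>

lemma N_diag_deriv:
  assumes \<sigma>: "\<sigma> holomorphic_on S" "open S" "u \<in> S" "\<And>u. u \<in> S \<Longrightarrow> (\<sigma> u)\<^sup>2 = q2 (1 + u) w"
    and nz: "\<sigma> u \<noteq> 0"
  shows "(\<sigma> has_field_derivative (q2' (1 + u) w / (2 * \<sigma> u))) (at u)"
proof -
  have d: "(\<sigma> has_field_derivative deriv \<sigma> u) (at u)" using holomorphic_derivI[OF \<sigma>(1-3)] .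
  have "((\<lambda>u. (\<sigma> u)\<^sup>2) has_field_derivative 2 * \<sigma> u * deriv \<sigma> u) (at u)"
    by (auto intro!: derivative_eq_intros d)
  moreover have "((\<lambda>u. q2 (1 + u) w) has_field_derivative q2' (1 + u) w) (at u)"
    unfolding q2_def q2'_def by (auto intro!: derivative_eq_intros) algebra
  hence "((\<lambda>u. (\<sigma> u)\<^sup>2) has_field_derivative q2' (1 + u) w) (at u)"
    by (rule has_field_derivative_transform_within_open[OF _ \<sigma>(2,3)]) (use \<sigma> in auto)
  ultimately have "2 * \<sigma> u * deriv \<sigma> u = q2' (1 + u) w" by (rule DERIV_unique)
  hence "deriv \<sigma> u = q2' (1 + u) w / (2 * \<sigma> u)" using nz by (simp add: field_simps)
  thus ?thesis using d by simp
qed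

lemma X_deriv:
  assumes "chi u \<noteq> 0"
  shows "((\<lambda>u. u / (chi u)\<^sup>2) has_field_derivative ((1 + 4 * (1 + u) - 3 * (1 + u)\<^sup>2) / (1 + (1 + u)\<^sup>2) ^ 3)) (at u)"
proof -
  have c: "chi u = 1 + (1 + u)\<^sup>2" by (simp add: chi_def power2_eq_square algebra_simps)
  have "((\<lambda>u. u / (chi u)\<^sup>2) has_field_derivative ((chi u)\<^sup>2 - u * (2 * chi u * (2 + 2 * u))) / ((chi u)\<^sup>2 * (chi u)\<^sup>2)) (at u)"
    unfolding chi_def using assms by (auto intro!: derivative_eq_intros simp: chi_def)
  also have "((chi u)\<^sup>2 - u * (2 * chi u * (2 + 2 * u))) / ((chi u)\<^sup>2 * (chi u)\<^sup>2) = (chi u - u * (2 * (2 + 2 * u))) / (chi u) ^ 3"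
    using assms by (simp add: divide_simps) algebra
  also have "chi u - u * (2 * (2 + 2 * u)) = 1 + 4 * (1 + u) - 3 * (1 + u)\<^sup>2" by (simp add: chi_def power2_eq_square algebra_simps)
  finally show ?thesis unfolding c .
qed

definition rhoq :: "complex \<Rightarrow> complex" where "rhoq y = (1 + y\<^sup>2) ^ 3 / (y\<^sup>2 * (1 + y) ^ 4)"

text \<open>\<open>Nuv\<close> for \<open>u = y - 1\<close> and \<open>v = y\<^sup>2\<close>, with
  \<open>y\<^sup>2\<close> cancelled; \<sigma> stands for the square root of
  \<open>q2 y w\<close>.\<close>

definition Ndiag :: "complex \<Rightarrow> complex \<Rightarrow> complex \<Rightarrow> complex" where
  "Ndiag \<sigma> y w = (- w1r y w + (y - w) * \<sigma>) / (y * (1 + y) ^ 3)"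

text \<open>The derivative of \<open>Ndiag\<close> with respect to
  \<open>x = u / (chi u)\<^sup>2\<close>.\<close>

definition Gdiag :: "complex \<Rightarrow> complex \<Rightarrow> complex \<Rightarrow> complex" where
  "Gdiag \<sigma> y w = (w + 1) * (rhoq y * (y\<^sup>2 + w + bp y w / \<sigma>))"

text \<open>\<open>Ndiag\<close> and \<open>x\<close> both have a \<open>u\<close>-derivative with
  the factor \<open>1 + 4 * y - 3 * y\<^sup>2\<close>, which vanishes at the critical point. Their
  quotient \<open>Gdiag\<close> is therefore regular there as a function of \<open>u\<close>, and
  \<open>Ndiag\<close> has no singular term of order 1/2 in \<open>x\<close>.\<close>

lemma Ndiag_has_derivative:
  assumes d\<sigma>: "(\<sigma> has_field_derivative (q2' (1 + u) w / (2 * \<sigma> u))) (at u)"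
    and sq: "(\<sigma> u)\<^sup>2 = q2 (1 + u) w"
    and nz: "\<sigma> u \<noteq> 0" "1 + u \<noteq> 0" "2 + u \<noteq> 0" "chi u \<noteq> 0"
  shows "((\<lambda>u. Ndiag (\<sigma> u) (1 + u) w) has_field_derivative
     ((1 + 4 * (1 + u) - 3 * (1 + u)\<^sup>2) / (1 + (1 + u)\<^sup>2) ^ 3 * Gdiag (\<sigma> u) (1 + u) w)) (at u)"
proof -
  define y where "y = 1 + u"
  define s where "s = \<sigma> u"
  define w1r' where "w1r' = 8 * w * y ^ 3 + 4 * y ^ 3 + 9 * w * y\<^sup>2 + 10 * w * y + 4 * y - w\<^sup>2 + w + 1"
  have y: "y \<noteq> 0" "1 + y \<noteq> 0" "s \<noteq> 0" "1 + y\<^sup>2 \<noteq> 0"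
    using nz by (auto simp: y_def s_def chi_def power2_eq_square algebra_simps)
  have a: "((\<lambda>u. - w1r (1 + u) w + ((1 + u) - w) * \<sigma> u) has_field_derivative
      (- w1r' + s + (y - w) * (q2' y w / (2 * s)))) (at u)"
    unfolding w1r_def w1r'_def y_def s_def by (rule derivative_eq_intros d\<sigma> refl | simp)+ algebra
  have b: "((\<lambda>u. (1 + u) * (1 + (1 + u)) ^ 3) has_field_derivative ((1 + y) ^ 3 + 3 * y * (1 + y)\<^sup>2)) (at u)"
    unfolding y_def by (rule derivative_eq_intros refl | simp)+
  have "((\<lambda>u. Ndiag (\<sigma> u) (1 + u) w) has_field_derivative
     ((- w1r' + s + (y - w) * (q2' y w / (2 * s))) * (y * (1 + y) ^ 3) - (- w1r y w + (y - w) * s) * ((1 + y) ^ 3 + 3 * y * (1 + y)\<^sup>2))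
      / ((y * (1 + y) ^ 3) * (y * (1 + y) ^ 3))) (at u)"
    unfolding Ndiag_def using DERIV_divide[OF a b] y by (simp add: y_def s_def)
  also have "((- w1r' + s + (y - w) * (q2' y w / (2 * s))) * (y * (1 + y) ^ 3) - (- w1r y w + (y - w) * s) * ((1 + y) ^ 3 + 3 * y * (1 + y)\<^sup>2))
      / ((y * (1 + y) ^ 3) * (y * (1 + y) ^ 3))
    = (1 + 4 * y - 3 * y\<^sup>2) / (1 + y\<^sup>2) ^ 3 * Gdiag s y w"
  proof -
    have s2: "s\<^sup>2 = q2 y w" using sq by (simp add: s_def y_def)
    \<comment> \<open>Cleared of denominators the claim is polynomial, with
      \<open>s\<^sup>2 = q2 y w\<close> as the only relation.\<close>
    have "((- w1r' + s) * (2 * s) + (y - w) * q2' y w) * (y * (1 + y)) - (- w1r y w + (y - w) * s) * (2 * s) * (1 + 4 * y)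
       = (1 + 4 * y - 3 * y\<^sup>2) * ((w + 1) * ((y\<^sup>2 + w) * (2 * s) + 2 * bp y w))"
      using s2 unfolding w1r'_def q2'_def q2_def w1r_def bp_def by algebra
    hence "(((- w1r' + s) * (2 * s) + (y - w) * q2' y w) * (y * (1 + y)) - (- w1r y w + (y - w) * s) * (2 * s) * (1 + 4 * y)) / (y\<^sup>2 * (1 + y) ^ 4 * (2 * s))
      = (1 + 4 * y - 3 * y\<^sup>2) * ((w + 1) * ((y\<^sup>2 + w) * (2 * s) + 2 * bp y w)) / (y\<^sup>2 * (1 + y) ^ 4 * (2 * s))" by simp
    moreover have "(((- w1r' + s) * (2 * s) + (y - w) * q2' y w) * (y * (1 + y)) - (- w1r y w + (y - w) * s) * (2 * s) * (1 + 4 * y)) / (y\<^sup>2 * (1 + y) ^ 4 * (2 * s))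
      = ((- w1r' + s + (y - w) * (q2' y w / (2 * s))) * (y * (1 + y) ^ 3) - (- w1r y w + (y - w) * s) * ((1 + y) ^ 3 + 3 * y * (1 + y)\<^sup>2))
      / ((y * (1 + y) ^ 3) * (y * (1 + y) ^ 3))"
      using y by (simp add: divide_simps) algebra
    moreover have "(1 + 4 * y - 3 * y\<^sup>2) * ((w + 1) * ((y\<^sup>2 + w) * (2 * s) + 2 * bp y w)) / (y\<^sup>2 * (1 + y) ^ 4 * (2 * s))
      = (1 + 4 * y - 3 * y\<^sup>2) / (1 + y\<^sup>2) ^ 3 * Gdiag s y w"
      using y unfolding Gdiag_def rhoq_def by (simp add: divide_simps)
    ultimately show ?thesis by simp
  qed
  finally show ?thesis by (simp add: y_def s_def)
qed

text \<open>This derivative is the amplitude at the saddle point and the source of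
  \<open>hq\<close>. \<open>S\<close> may be either square root of \<open>qn w\<close>; it is
  identified with the principal one afterwards, by the sign of its real part.\<close>

lemma Gdiag_deriv_crit:
  assumes d\<sigma>: "(\<sigma> has_field_derivative (q2' (1 + u) w / (2 * \<sigma> u))) (at u)"
    and u: "1 + u = (2 + s7) / 3"
    and sq: "\<sigma> u = (113 + 37 * s7) / 27 * S" "S\<^sup>2 = qn w" "S \<noteq> 0"
  shows "((\<lambda>u. Gdiag (\<sigma> u) (1 + u) w) has_field_derivative
     (42496 - 15872 * s7) / 243 * ((1 + w) * ((15 + 7 * s7) / 64 + (17 - 7 * s7) / 64 * w + kn w / S ^ 3))) (at u)"
proof -
  define y where "y = 1 + u"
  define s where "s = \<sigma> u"
  define g where "g = (113 + 37 * s7) / 27"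
  have ys: "y = (2 + s7) / 3" using u by (simp add: y_def)
  have nz: "y \<noteq> 0" "1 + y \<noteq> 0" "g \<noteq> 0"
  proof -
    have "y * (s7 - 2) = 1" "(1 + y) * (5 - s7) = 6" "g * (113 - 37 * s7) = 3186 / 27"
      using s7_sq unfolding ys g_def by (simp_all add: field_simps power2_eq_square)
    thus "y \<noteq> 0" "1 + y \<noteq> 0" "g \<noteq> 0" by auto
  qed
  have sg: "s = g * S" using sq by (simp add: s_def g_def)
  have s0: "s \<noteq> 0" using sg nz sq by simp
  define R where "R = (2656 - 992 * s7) / 81"
  define R' where "R' = (23440 - 8864 * s7) / 243"
  have R: "rhoq y = R"
  proof -
    have "(1 + y\<^sup>2) ^ 3 * 81 = (2656 - 992 * s7) * (y\<^sup>2 * (1 + y) ^ 4)"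
    proof -
      have s: "s7 = 3 * y - 2" by (simp add: ys field_simps)
      have "3 * (3 * y\<^sup>2 - 4 * y - 1) = (3 * y - 2)\<^sup>2 - 7" by (simp add: power2_eq_square algebra_simps)
  hence "3 * (3 * y\<^sup>2 - 4 * y - 1) = 0" using s7_sq unfolding s by simp
  hence e: "3 * y\<^sup>2 - 4 * y - 1 = 0" by (simp only: mult_eq_0_iff) simp
      show ?thesis unfolding s using e by algebra
    qed
    thus ?thesis using nz by (simp add: rhoq_def R_def divide_simps)
  qed
  have "((\<lambda>u. rhoq (1 + u)) has_field_derivative
     (6 * y * (1 + y\<^sup>2)\<^sup>2 * (y\<^sup>2 * (1 + y) ^ 4) - (1 + y\<^sup>2) ^ 3 * (2 * y * (1 + y) ^ 4 + 4 * y\<^sup>2 * (1 + y) ^ 3)) / ((y\<^sup>2 * (1 + y) ^ 4) * (y\<^sup>2 * (1 + y) ^ 4))) (at u)"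
  proof -
    have 1: "((\<lambda>u. (1 + (1 + u)\<^sup>2) ^ 3) has_field_derivative 6 * y * (1 + y\<^sup>2)\<^sup>2) (at u)"
      unfolding y_def by (rule derivative_eq_intros refl | simp)+
    have 2: "((\<lambda>u. (1 + u)\<^sup>2 * (1 + (1 + u)) ^ 4) has_field_derivative 2 * y * (1 + y) ^ 4 + 4 * y\<^sup>2 * (1 + y) ^ 3) (at u)"
      unfolding y_def by (rule derivative_eq_intros refl | simp)+
    show ?thesis unfolding rhoq_def using DERIV_divide[OF 1 2] nz by (simp add: y_def)
  qed
  also have "(6 * y * (1 + y\<^sup>2)\<^sup>2 * (y\<^sup>2 * (1 + y) ^ 4) - (1 + y\<^sup>2) ^ 3 * (2 * y * (1 + y) ^ 4 + 4 * y\<^sup>2 * (1 + y) ^ 3)) / ((y\<^sup>2 * (1 + y) ^ 4) * (y\<^sup>2 * (1 + y) ^ 4)) = R'"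
  proof -
    have s: "s7 = 3 * y - 2" by (simp add: ys field_simps)
    have "3 * (3 * y\<^sup>2 - 4 * y - 1) = (3 * y - 2)\<^sup>2 - 7" by (simp add: power2_eq_square algebra_simps)
  hence "3 * (3 * y\<^sup>2 - 4 * y - 1) = 0" using s7_sq unfolding s by simp
  hence e: "3 * y\<^sup>2 - 4 * y - 1 = 0" by (simp only: mult_eq_0_iff) simp
    have "(6 * y * (1 + y\<^sup>2)\<^sup>2 * (y\<^sup>2 * (1 + y) ^ 4) - (1 + y\<^sup>2) ^ 3 * (2 * y * (1 + y) ^ 4 + 4 * y\<^sup>2 * (1 + y) ^ 3)) * 243
      = (23440 - 8864 * s7) * ((y\<^sup>2 * (1 + y) ^ 4) * (y\<^sup>2 * (1 + y) ^ 4))"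
      unfolding s using e by algebra
    thus ?thesis using nz by (simp add: R'_def divide_simps)
  qed
  finally have r: "((\<lambda>u. rhoq (1 + u)) has_field_derivative R') (at u)" .
  have b: "((\<lambda>u. bp (1 + u) w) has_field_derivative bp' y w) (at u)"
    unfolding bp_def bp'_def y_def by (rule derivative_eq_intros refl | simp)+ algebra
  have bs: "((\<lambda>u. bp (1 + u) w / \<sigma> u) has_field_derivative (bp' y w * s - bp y w * (q2' y w / (2 * s))) / (s * s)) (at u)"
    using DERIV_divide[OF b d\<sigma>] s0 by (simp add: y_def s_def)
  have ysq: "((\<lambda>u. (1 + u)\<^sup>2 + w) has_field_derivative 2 * y) (at u)"
    unfolding y_def by (rule derivative_eq_intros refl | simp)+
  have "((\<lambda>u. Gdiag (\<sigma> u) (1 + u) w) has_field_derivative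
     (w + 1) * (R' * (y\<^sup>2 + w + bp y w / s) + (2 * y + (bp' y w * s - bp y w * (q2' y w / (2 * s))) / (s * s)) * R)) (at u)"
    unfolding Gdiag_def
    using DERIV_cmult[OF DERIV_mult[OF r DERIV_add[OF ysq bs]], of "w + 1"] R by (simp add: y_def s_def)
  also have "(w + 1) * (R' * (y\<^sup>2 + w + bp y w / s) + (2 * y + (bp' y w * s - bp y w * (q2' y w / (2 * s))) / (s * s)) * R)
     = (42496 - 15872 * s7) / 243 * ((1 + w) * ((15 + 7 * s7) / 64 + (17 - 7 * s7) / 64 * w + kn w / S ^ 3))"
  proof -
    have 1: "R' * (y\<^sup>2 + w) + 2 * y * R = (42496 - 15872 * s7) / 243 * ((15 + 7 * s7) / 64 + (17 - 7 * s7) / 64 * w)"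
      unfolding ys R_def R'_def ycrit_powers by (simp add: field_simps s7_rules)
    have h: "bp y w = ((- 2279 - 859 * s7) + (4350 + 1572 * s7) * w + (81 - 81 * s7) * w ^ 2) / 243" "bp' y w = ((- 1867 - 710 * s7) + (2496 + 942 * s7) * w + (- 81 + 0 * s7) * w ^ 2) / 81" "q2' y w = ((5914 + 2162 * s7) + (- 5860 - 2216 * s7) * w + (- 54 + 54 * s7) * w ^ 2) / 81"
      "qn w = ((3481 + 0 * s7) + (8716 - 4154 * s7) * w + (8219 - 3100 * s7) * w ^ 2) / 3481" "kn w = ((- 3080685 - 1437653 * s7) + (2951888 + 1552526 * s7) * w + (26008932 - 9369906 * s7) * w ^ 2 + (63557744 - 24031594 * s7) * w ^ 3 + (37371401 - 14125021 * s7) * w ^ 4) / 13144256"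
      unfolding ys bp_def bp'_def q2'_def qn_def kn_def ycrit_powers
      by (simp_all add: field_simps s7_rules power2_eq_square)
    have 2: "2 * g ^ 2 * (R' * bp y w + R * bp' y w) * qn w - R * bp y w * q2' y w = 2 * g ^ 3 * ((42496 - 15872 * s7) / 243 * kn w)"
      unfolding h g_def R_def R'_def by (rule diag_scale[OF diag_integral])
    have "R' * (bp y w / s) + ((bp' y w * s - bp y w * (q2' y w / (2 * s))) / (s * s)) * R
        = (2 * g\<^sup>2 * (R' * bp y w + R * bp' y w) * S\<^sup>2 - R * bp y w * q2' y w) / (2 * g ^ 3 * S ^ 3)"
      using nz sq(3) unfolding sg by (simp add: divide_simps) algebra
    also have "\<dots> = (42496 - 15872 * s7) / 243 * (kn w / S ^ 3)"
      unfolding sq(2) 2 using nz by simp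
    finally have 3: "R' * (bp y w / s) + ((bp' y w * s - bp y w * (q2' y w / (2 * s))) / (s * s)) * R = (42496 - 15872 * s7) / 243 * (kn w / S ^ 3)" .
    have "(w + 1) * (R' * (y\<^sup>2 + w + bp y w / s) + (2 * y + (bp' y w * s - bp y w * (q2' y w / (2 * s))) / (s * s)) * R)
      = (w + 1) * ((R' * (y\<^sup>2 + w) + 2 * y * R) + (R' * (bp y w / s) + ((bp' y w * s - bp y w * (q2' y w / (2 * s))) / (s * s)) * R))"
      by (simp only: distrib_left distrib_right mult_ac add_ac)
    also have "\<dots> = (42496 - 15872 * s7) / 243 * ((1 + w) * ((15 + 7 * s7) / 64 + (17 - 7 * s7) / 64 * w + kn w / S ^ 3))"
      unfolding 1 3 by (simp only: distrib_left mult_ac add_ac)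
    finally show ?thesis .
  qed
  finally show ?thesis .
qed

text \<open>Along the curve \<open>u (1 + u)\<^sup>2 = r v (1 + v)\<^sup>2\<close> the derivative of \<open>Nuv\<close> is
  \<open>Jac (za + zb / S) / (1 + u + v)\<^sup>4\<close> up to the speed; the derivative of \<open>ln z\<close> has the same factor \<open>Jac\<close>.\<close>

definition za :: "complex \<Rightarrow> complex \<Rightarrow> complex \<Rightarrow> complex" where
  "za u v w = (u ^ 3 * v\<^sup>2 + 2 * u ^ 3 * v + u\<^sup>2 * v ^ 3 + 4 * u\<^sup>2 * v\<^sup>2 + 5 *
     u\<^sup>2 * v + 2 * u * v ^ 3 + 5 * u * v\<^sup>2 + 4 * u * v + v ^ 3 + 2 * v\<^sup>2 + v)
     + (u ^ 3 - u\<^sup>2 * v + 2 * u\<^sup>2 - u * v\<^sup>2 - 2 * u * v + u - v ^ 3 - 2 *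
     v\<^sup>2 - v) * w + (u\<^sup>2 * v + u * v\<^sup>2 + 2 * u * v) * w\<^sup>2"

definition zb :: "complex \<Rightarrow> complex \<Rightarrow> complex \<Rightarrow> complex" where
  "zb u v w = (0 - u ^ 5 * v\<^sup>2 - 2 * u ^ 5 * v - u ^ 4 * v ^ 4 - 5 * u ^ 4 * v ^ 3 - 10 * u ^ 4 *
     v\<^sup>2 - 9 * u ^ 4 * v - u ^ 3 * v ^ 5 - 7 * u ^ 3 * v ^ 4 - 21 * u ^ 3 * v ^ 3 - 28 * u
     ^ 3 * v\<^sup>2 - 16 * u ^ 3 * v - 3 * u\<^sup>2 * v ^ 5 - 15 * u\<^sup>2 * v ^ 4 - 33 *
     u\<^sup>2 * v ^ 3 - 34 * u\<^sup>2 * v\<^sup>2 - 14 * u\<^sup>2 * v - 3 * u * v ^ 5 - 13 *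
     u * v ^ 4 - 23 * u * v ^ 3 - 19 * u * v\<^sup>2 - 6 * u * v - v ^ 5 - 4 * v ^ 4 - 6 * v ^ 3
     - 4 * v\<^sup>2 - v) + (2 * u ^ 5 * v\<^sup>2 + 4 * u ^ 5 * v + u ^ 5 + 5 * u ^ 4 * v ^ 3 +
     15 * u ^ 4 * v\<^sup>2 + 19 * u ^ 4 * v + 4 * u ^ 4 + 5 * u ^ 3 * v ^ 4 + 23 * u ^ 3 * v ^
     3 + 39 * u ^ 3 * v\<^sup>2 + 34 * u ^ 3 * v + 6 * u ^ 3 + 2 * u\<^sup>2 * v ^ 5 + 13 *
     u\<^sup>2 * v ^ 4 + 35 * u\<^sup>2 * v ^ 3 + 45 * u\<^sup>2 * v\<^sup>2 + 28 * u\<^sup>2 *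
     v + 4 * u\<^sup>2 + 3 * u * v ^ 5 + 12 * u * v ^ 4 + 23 * u * v ^ 3 + 23 * u * v\<^sup>2 +
     10 * u * v + u + v ^ 5 + 4 * v ^ 4 + 6 * v ^ 3 + 4 * v\<^sup>2 + v) * w + (2 * u ^ 4 *
     v\<^sup>2 + 5 * u ^ 3 * v ^ 3 + 12 * u ^ 3 * v\<^sup>2 + 2 * u ^ 3 * v + 5 * u\<^sup>2 * v
     ^ 4 + 18 * u\<^sup>2 * v ^ 3 + 20 * u\<^sup>2 * v\<^sup>2 + 4 * u\<^sup>2 * v + 2 * u * v ^
     5 + 10 * u * v ^ 4 + 16 * u * v ^ 3 + 10 * u * v\<^sup>2 + 2 * u * v) * w\<^sup>2 + (0 - u ^
     3 * v\<^sup>2 - u\<^sup>2 * v ^ 3 - 2 * u\<^sup>2 * v\<^sup>2) * w ^ 3"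

text \<open>Partial derivatives with respect to the variable named by the last letter, collected by
  powers of \<open>w\<close> so that they can be evaluated at the critical point from a table of
  monomials in \<open>u\<close> and \<open>v\<close>.\<close>

definition w1u :: "complex \<Rightarrow> complex \<Rightarrow> complex \<Rightarrow> complex" where
  "w1u u v w = (3 * u\<^sup>2 + 2 * u * v\<^sup>2 + 4 * u * v + 6 * u + 2 * v\<^sup>2 + 4 * v + 3) + (6 * u * v
     + 2 * u + 3 * v\<^sup>2 + 7 * v + 2) * w + (0 - v) * w\<^sup>2"

definition w1v :: "complex \<Rightarrow> complex \<Rightarrow> complex \<Rightarrow> complex" where
  "w1v u v w = (2 * u\<^sup>2 * v + 2 * u\<^sup>2 + 4 * u * v + 4 * u + 2 * v + 2) + (3 * u\<^sup>2 + 6 * u * v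
     + 7 * u + 6 * v\<^sup>2 + 10 * v + 4) * w + (0 - u) * w\<^sup>2"

definition w2u :: "complex \<Rightarrow> complex \<Rightarrow> complex \<Rightarrow> complex" where
  "w2u u v w = (4 * u ^ 3 + 6 * u\<^sup>2 * v\<^sup>2 + 12 * u\<^sup>2 * v + 12 * u\<^sup>2 + 2 * u * v ^ 4 + 8
     * u * v ^ 3 + 20 * u * v\<^sup>2 + 24 * u * v + 12 * u + 2 * v ^ 4 + 8 * v ^ 3 + 14 *
     v\<^sup>2 + 12 * v + 4) + (- 12 * u\<^sup>2 * v\<^sup>2 - 6 * u\<^sup>2 * v - 12 * u * v ^
     3 - 24 * u * v\<^sup>2 - 8 * u * v - 4 * v ^ 4 - 10 * v ^ 3 - 8 * v\<^sup>2 - 2 * v) * w +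
     (2 * u * v\<^sup>2) * w\<^sup>2"

definition w2v :: "complex \<Rightarrow> complex \<Rightarrow> complex \<Rightarrow> complex" where
  "w2v u v w = (4 * u ^ 3 * v + 4 * u ^ 3 + 4 * u\<^sup>2 * v ^ 3 + 12 * u\<^sup>2 * v\<^sup>2 + 20 * u\<^sup>2
     * v + 12 * u\<^sup>2 + 8 * u * v ^ 3 + 24 * u * v\<^sup>2 + 28 * u * v + 12 * u + 4 * v ^ 3
     + 12 * v\<^sup>2 + 12 * v + 4) + (- 8 * u ^ 3 * v - 2 * u ^ 3 - 18 * u\<^sup>2 * v\<^sup>2
     - 24 * u\<^sup>2 * v - 4 * u\<^sup>2 - 16 * u * v ^ 3 - 30 * u * v\<^sup>2 - 16 * u * v - 2
     * u) * w + (2 * u\<^sup>2 * v) * w\<^sup>2"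

definition zau :: "complex \<Rightarrow> complex \<Rightarrow> complex \<Rightarrow> complex" where
  "zau u v w = (3 * u\<^sup>2 * v\<^sup>2 + 6 * u\<^sup>2 * v + 2 * u * v ^ 3 + 8 * u * v\<^sup>2 + 10 * u * v
     + 2 * v ^ 3 + 5 * v\<^sup>2 + 4 * v) + (3 * u\<^sup>2 - 2 * u * v + 4 * u - v\<^sup>2 - 2 *
     v + 1) * w + (2 * u * v + v\<^sup>2 + 2 * v) * w\<^sup>2"

definition zav :: "complex \<Rightarrow> complex \<Rightarrow> complex \<Rightarrow> complex" where
  "zav u v w = (2 * u ^ 3 * v + 2 * u ^ 3 + 3 * u\<^sup>2 * v\<^sup>2 + 8 * u\<^sup>2 * v + 5 * u\<^sup>2 + 6 *
     u * v\<^sup>2 + 10 * u * v + 4 * u + 3 * v\<^sup>2 + 4 * v + 1) + (0 - u\<^sup>2 - 2 * u * v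
     - 2 * u - 3 * v\<^sup>2 - 4 * v - 1) * w + (u\<^sup>2 + 2 * u * v + 2 * u) * w\<^sup>2"

definition zbu :: "complex \<Rightarrow> complex \<Rightarrow> complex \<Rightarrow> complex" where
  "zbu u v w = (- 5 * u ^ 4 * v\<^sup>2 - 10 * u ^ 4 * v - 4 * u ^ 3 * v ^ 4 - 20 * u ^ 3 * v ^ 3 - 40 * u ^ 3
     * v\<^sup>2 - 36 * u ^ 3 * v - 3 * u\<^sup>2 * v ^ 5 - 21 * u\<^sup>2 * v ^ 4 - 63 *
     u\<^sup>2 * v ^ 3 - 84 * u\<^sup>2 * v\<^sup>2 - 48 * u\<^sup>2 * v - 6 * u * v ^ 5 - 30 *
     u * v ^ 4 - 66 * u * v ^ 3 - 68 * u * v\<^sup>2 - 28 * u * v - 3 * v ^ 5 - 13 * v ^ 4 - 23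
     * v ^ 3 - 19 * v\<^sup>2 - 6 * v) + (10 * u ^ 4 * v\<^sup>2 + 20 * u ^ 4 * v + 5 * u ^ 4 +
     20 * u ^ 3 * v ^ 3 + 60 * u ^ 3 * v\<^sup>2 + 76 * u ^ 3 * v + 16 * u ^ 3 + 15 * u\<^sup>2
     * v ^ 4 + 69 * u\<^sup>2 * v ^ 3 + 117 * u\<^sup>2 * v\<^sup>2 + 102 * u\<^sup>2 * v + 18 *
     u\<^sup>2 + 4 * u * v ^ 5 + 26 * u * v ^ 4 + 70 * u * v ^ 3 + 90 * u * v\<^sup>2 + 56 * u *
     v + 8 * u + 3 * v ^ 5 + 12 * v ^ 4 + 23 * v ^ 3 + 23 * v\<^sup>2 + 10 * v + 1) * w + (8 * u
     ^ 3 * v\<^sup>2 + 15 * u\<^sup>2 * v ^ 3 + 36 * u\<^sup>2 * v\<^sup>2 + 6 * u\<^sup>2 * v +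
     10 * u * v ^ 4 + 36 * u * v ^ 3 + 40 * u * v\<^sup>2 + 8 * u * v + 2 * v ^ 5 + 10 * v ^ 4 +
     16 * v ^ 3 + 10 * v\<^sup>2 + 2 * v) * w\<^sup>2 + (- 3 * u\<^sup>2 * v\<^sup>2 - 2 * u * v
     ^ 3 - 4 * u * v\<^sup>2) * w ^ 3"

definition zbv :: "complex \<Rightarrow> complex \<Rightarrow> complex \<Rightarrow> complex" where
  "zbv u v w = (- 2 * u ^ 5 * v - 2 * u ^ 5 - 4 * u ^ 4 * v ^ 3 - 15 * u ^ 4 * v\<^sup>2 - 20 * u ^ 4 * v - 9 *
     u ^ 4 - 5 * u ^ 3 * v ^ 4 - 28 * u ^ 3 * v ^ 3 - 63 * u ^ 3 * v\<^sup>2 - 56 * u ^ 3 * v -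
     16 * u ^ 3 - 15 * u\<^sup>2 * v ^ 4 - 60 * u\<^sup>2 * v ^ 3 - 99 * u\<^sup>2 * v\<^sup>2 -
     68 * u\<^sup>2 * v - 14 * u\<^sup>2 - 15 * u * v ^ 4 - 52 * u * v ^ 3 - 69 * u * v\<^sup>2
     - 38 * u * v - 6 * u - 5 * v ^ 4 - 16 * v ^ 3 - 18 * v\<^sup>2 - 8 * v - 1) + (4 * u ^ 5 *
     v + 4 * u ^ 5 + 15 * u ^ 4 * v\<^sup>2 + 30 * u ^ 4 * v + 19 * u ^ 4 + 20 * u ^ 3 * v ^ 3 +
     69 * u ^ 3 * v\<^sup>2 + 78 * u ^ 3 * v + 34 * u ^ 3 + 10 * u\<^sup>2 * v ^ 4 + 52 *
     u\<^sup>2 * v ^ 3 + 105 * u\<^sup>2 * v\<^sup>2 + 90 * u\<^sup>2 * v + 28 * u\<^sup>2 + 15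
     * u * v ^ 4 + 48 * u * v ^ 3 + 69 * u * v\<^sup>2 + 46 * u * v + 10 * u + 5 * v ^ 4 + 16 *
     v ^ 3 + 18 * v\<^sup>2 + 8 * v + 1) * w + (4 * u ^ 4 * v + 15 * u ^ 3 * v\<^sup>2 + 24 * u
     ^ 3 * v + 2 * u ^ 3 + 20 * u\<^sup>2 * v ^ 3 + 54 * u\<^sup>2 * v\<^sup>2 + 40 * u\<^sup>2
     * v + 4 * u\<^sup>2 + 10 * u * v ^ 4 + 40 * u * v ^ 3 + 48 * u * v\<^sup>2 + 20 * u * v + 2
     * u) * w\<^sup>2 + (- 2 * u ^ 3 * v - 3 * u\<^sup>2 * v\<^sup>2 - 4 * u\<^sup>2 * v) * w ^
     3"

text \<open>The part of the closed form that is singular at the critical point; the factors around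
  it are rational in \<open>x\<close>, \<open>z\<close> and \<open>w\<close>.\<close>

definition Nuv :: "complex \<Rightarrow> complex \<Rightarrow> complex \<Rightarrow> complex \<Rightarrow> complex" where
  "Nuv S u v w = (- w1_poly u v w + (u - w + 1) * S) / (1 + u + v) ^ 3"

lemma w1_deriv:
  assumes "(u has_field_derivative du) (at t)" "(v has_field_derivative dv) (at t)"
  shows "((\<lambda>t. w1_poly (u t) (v t) w) has_field_derivative (w1u (u t) (v t) w * du + w1v (u t) (v t) w * dv)) (at t)"
  unfolding w1_poly_def w1u_def w1v_def by (rule derivative_eq_intros refl assms | simp)+ algebra

lemma w2_deriv:
  assumes "(u has_field_derivative du) (at t)" "(v has_field_derivative dv) (at t)"
  shows "((\<lambda>t. w2_poly (u t) (v t) w) has_field_derivative (w2u (u t) (v t) w * du + w2v (u t) (v t) w * dv)) (at t)"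
  unfolding w2_poly_def w2u_def w2v_def by (rule derivative_eq_intros refl assms | simp)+ algebra

lemma za_deriv:
  assumes "(u has_field_derivative du) (at t)" "(v has_field_derivative dv) (at t)"
  shows "((\<lambda>t. za (u t) (v t) w) has_field_derivative (zau (u t) (v t) w * du + zav (u t) (v t) w * dv)) (at t)"
  unfolding za_def zau_def zav_def by (rule derivative_eq_intros refl assms | simp)+ algebra

lemma zb_deriv:
  assumes "(u has_field_derivative du) (at t)" "(v has_field_derivative dv) (at t)"
  shows "((\<lambda>t. zb (u t) (v t) w) has_field_derivative (zbu (u t) (v t) w * du + zbv (u t) (v t) w * dv)) (at t)"
  unfolding zb_def zbu_def zbv_def by (rule derivative_eq_intros refl assms | simp)+ algebra

text \<open>Tangent direction of the curve
  \<open>u * (1 + u)\<^sup>2 = r * v * (1 + v)\<^sup>2\<close>, from its logarithmic derivative, in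
  which \<open>r\<close> drops out. In this direction the logarithmic derivative of
  \<open>z = v / (1 + u)\<^sup>2\<close> is \<open>Jac\<close>.\<close>

definition dirU :: "complex \<Rightarrow> complex \<Rightarrow> complex" where "dirU u v = (1 + 3 * v) * u * (1 + u)"
definition dirV :: "complex \<Rightarrow> complex \<Rightarrow> complex" where "dirV u v = (1 + 3 * u) * v * (1 + v)"
definition Jac :: "complex \<Rightarrow> complex \<Rightarrow> complex" where "Jac u v = 1 + u + v - 3 * u * v"

text \<open>Divisibility by \<open>Jac\<close> of the part free of the square root;
  \<open>zb_identity\<close> is its counterpart for the part with the square root. These two
  identities are what removes the singular term of order 1/2.\<close>

lemma za_identity:
  "- (w1u u v w * dirU u v + w1v u v w * dirV u v) * (1 + u + v) + 3 * (dirU u v + dirV u v) * w1_poly u v w = Jac u v * za u v w"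
  unfolding w1u_def w1v_def dirU_def dirV_def w1_poly_def Jac_def za_def by algebra

lemma zb_identity:
  "(2 * dirU u v * w2_poly u v w + (u - w + 1) * (w2u u v w * dirU u v + w2v u v w * dirV u v)) * (1 + u + v)
    - 6 * (dirU u v + dirV u v) * (u - w + 1) * w2_poly u v w = 2 * (Jac u v * zb u v w)"
  unfolding w2u_def w2v_def dirU_def dirV_def w2_poly_def Jac_def zb_def by algebra

text \<open>Logarithmic form of the chain rule along the curve; \<open>l\<close> is the speed of the
  parametrization relative to the tangent direction.\<close>

lemma Nuv_has_derivative:
  assumes u: "(u has_field_derivative l * dirU (u t) (v t)) (at t)" and v: "(v has_field_derivative l * dirV (u t) (v t)) (at t)"
    and S: "(S has_field_derivative (l * (w2u (u t) (v t) w * dirU (u t) (v t) + w2v (u t) (v t) w * dirV (u t) (v t)) / (2 * S t))) (at t)"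
    and S2: "(S t)\<^sup>2 = w2_poly (u t) (v t) w" and nz: "S t \<noteq> 0" "1 + u t + v t \<noteq> 0"
  shows "((\<lambda>t. Nuv (S t) (u t) (v t) w) has_field_derivative
    l * Jac (u t) (v t) * ((za (u t) (v t) w + zb (u t) (v t) w / S t) / (1 + u t + v t) ^ 4)) (at t)"
proof -
  define U where "U = u t"
  define V where "V = v t"
  define s where "s = S t"
  define D where "D = 1 + U + V"
  define dU where "dU = dirU U V"
  define dV where "dV = dirV U V"
  define W1 where "W1 = w1_poly U V w"
  define W2 where "W2 = w2_poly U V w"
  define dW1 where "dW1 = w1u U V w * dU + w1v U V w * dV"
  define dW2 where "dW2 = w2u U V w * dU + w2v U V w * dV"
  have n: "s \<noteq> 0" "D \<noteq> 0" using nz by (simp_all add: s_def D_def U_def V_def)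
  have s2: "s\<^sup>2 = W2" using S2 by (simp add: s_def W2_def U_def V_def)
  have i1: "- dW1 * D + 3 * (dU + dV) * W1 = Jac U V * za U V w"
    unfolding dW1_def dU_def dV_def W1_def D_def by (rule za_identity)
  have i2: "(2 * dU * W2 + (U - w + 1) * dW2) * D - 6 * (dU + dV) * (U - w + 1) * W2 = 2 * (Jac U V * zb U V w)"
    unfolding dW2_def dU_def dV_def W2_def D_def by (rule zb_identity)
  have dS: "(S has_field_derivative (l * dW2 / (2 * s))) (at t)"
    using S by (simp add: dW2_def dU_def dV_def s_def U_def V_def)
  have du: "(u has_field_derivative l * dU) (at t)" and dv: "(v has_field_derivative l * dV) (at t)"
    using u v by (simp_all add: dU_def dV_def U_def V_def)
  have w1d: "((\<lambda>t. w1_poly (u t) (v t) w) has_field_derivative l * dW1) (at t)"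
    by (rule DERIV_cong[OF w1_deriv[OF du dv]]) (simp add: dW1_def U_def V_def algebra_simps)
  have num: "((\<lambda>t. - w1_poly (u t) (v t) w + (u t - w + 1) * S t) has_field_derivative
      l * (- dW1 + dU * s + (U - w + 1) * (dW2 / (2 * s)))) (at t)"
    by (rule derivative_eq_intros refl w1d du dS)+ (simp add: U_def s_def algebra_simps)
  have den: "((\<lambda>t. (1 + u t + v t) ^ 3) has_field_derivative l * (3 * D\<^sup>2 * (dU + dV))) (at t)"
    by (rule derivative_eq_intros refl du dv)+ (simp add: D_def U_def V_def algebra_simps)
  have "((\<lambda>t. Nuv (S t) (u t) (v t) w) has_field_derivative
    (l * (- dW1 + dU * s + (U - w + 1) * (dW2 / (2 * s))) * D ^ 3 - (- W1 + (U - w + 1) * s) * (l * (3 * D\<^sup>2 * (dU + dV)))) / (D ^ 3 * D ^ 3)) (at t)"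
    unfolding Nuv_def using DERIV_divide[OF num den] nz
    by (simp add: D_def U_def V_def s_def W1_def)
  also have "(l * (- dW1 + dU * s + (U - w + 1) * (dW2 / (2 * s))) * D ^ 3 - (- W1 + (U - w + 1) * s) * (l * (3 * D\<^sup>2 * (dU + dV)))) / (D ^ 3 * D ^ 3)
    = l * ((- dW1 * D + 3 * (dU + dV) * W1) * (2 * s) + ((2 * dU * s\<^sup>2 + (U - w + 1) * dW2) * D - 6 * (dU + dV) * (U - w + 1) * s\<^sup>2)) / (2 * s * D ^ 4)"
    using n by (simp add: divide_simps) algebra
  also have "\<dots> = l * Jac U V * ((za U V w + zb U V w / s) / D ^ 4)"
    unfolding i1 s2 i2 using n by (simp add: field_simps)
  finally show ?thesis by (simp add: U_def V_def D_def s_def)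
qed

text \<open>The derivative of \<open>Nuv\<close> with respect to
  \<open>z = v / (1 + u)\<^sup>2\<close> along the curve; the vanishing factor \<open>Jac\<close>
  has cancelled.\<close>

definition Kuv :: "complex \<Rightarrow> complex \<Rightarrow> complex \<Rightarrow> complex \<Rightarrow> complex" where
  "Kuv S u v w = (1 + u)\<^sup>2 / (v * (1 + u + v) ^ 4) * (za u v w + zb u v w / S)"

section \<open>Values of the polynomials at the critical point\<close>

definition Uc :: complex where "Uc = (s7 - 1) / 3"
definition Vc :: complex where "Vc = (11 + 4 * s7) / 9"

lemma Uc_lin: "Uc = - (1 / 3) + (1 / 3) * s7" and Vc_lin: "Vc = 11 / 9 + (4 / 9) * s7"
  by (simp_all add: Uc_def Vc_def field_simps)

lemma Uc_pow:
  shows "Uc ^ 2 = ((8 / 9) - (2 / 9) * s7)"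
    and "Uc ^ 3 = (- (22 / 27) + (10 / 27) * s7)"
    and "Uc ^ 4 = ((92 / 81) - (32 / 81) * s7)"
    and "Uc ^ 5 = (- (316 / 243) + (124 / 243) * s7)"
proof -
  show p2: "Uc ^ 2 = ((8 / 9) - (2 / 9) * s7)" by (simp add: Uc_def power2_eq_square field_simps s7_rules)
  have "Uc ^ 3 = Uc ^ 2 * Uc" by (simp flip: power_Suc2)
  thus p3: "Uc ^ 3 = (- (22 / 27) + (10 / 27) * s7)" unfolding p2 by (simp add: Uc_def field_simps s7_rules)
  have "Uc ^ 4 = Uc ^ 3 * Uc" by (simp flip: power_Suc2)
  thus p4: "Uc ^ 4 = ((92 / 81) - (32 / 81) * s7)" unfolding p3 by (simp add: Uc_def field_simps s7_rules)
  have "Uc ^ 5 = Uc ^ 4 * Uc" by (simp flip: power_Suc2)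
  thus p5: "Uc ^ 5 = (- (316 / 243) + (124 / 243) * s7)" unfolding p4 by (simp add: Uc_def field_simps s7_rules)
qed

lemma Vc_pow:
  shows "Vc ^ 2 = ((233 / 81) + (88 / 81) * s7)"
    and "Vc ^ 3 = ((5027 / 729) + (1900 / 729) * s7)"
    and "Vc ^ 4 = ((108497 / 6561) + (41008 / 6561) * s7)"
    and "Vc ^ 5 = ((2341691 / 59049) + (885076 / 59049) * s7)"
proof -
  show p2: "Vc ^ 2 = ((233 / 81) + (88 / 81) * s7)" by (simp add: Vc_def power2_eq_square field_simps s7_rules)
  have "Vc ^ 3 = Vc ^ 2 * Vc" by (simp flip: power_Suc2)
  thus p3: "Vc ^ 3 = ((5027 / 729) + (1900 / 729) * s7)" unfolding p2 by (simp add: Vc_def field_simps s7_rules)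
  have "Vc ^ 4 = Vc ^ 3 * Vc" by (simp flip: power_Suc2)
  thus p4: "Vc ^ 4 = ((108497 / 6561) + (41008 / 6561) * s7)" unfolding p3 by (simp add: Vc_def field_simps s7_rules)
  have "Vc ^ 5 = Vc ^ 4 * Vc" by (simp flip: power_Suc2)
  thus p5: "Vc ^ 5 = ((2341691 / 59049) + (885076 / 59049) * s7)" unfolding p4 by (simp add: Vc_def field_simps s7_rules)
qed

text \<open>The mixed monomials of the polynomials above, linear in \<open>s7\<close>. Unfolding
  with \<open>mult.assoc\<close> brackets each product so that its monomial matches an
  entry.\<close>

lemma UVc_table:
  shows "Uc * Vc = ((17 / 27) + (7 / 27) * s7)"
    and "Uc * Vc\<^sup>2 = ((383 / 243) + (145 / 243) * s7)"
    and "Uc * Vc ^ 3 = ((8273 / 2187) + (3127 / 2187) * s7)"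
    and "Uc * Vc ^ 4 = ((178559 / 19683) + (67489 / 19683) * s7)"
    and "Uc * Vc ^ 5 = ((3853841 / 177147) + (1456615 / 177147) * s7)"
    and "Uc\<^sup>2 * Vc = ((32 / 81) + (10 / 81) * s7)"
    and "Uc\<^sup>2 * Vc\<^sup>2 = ((632 / 729) + (238 / 729) * s7)"
    and "Uc\<^sup>2 * Vc ^ 3 = ((13616 / 6561) + (5146 / 6561) * s7)"
    and "Uc\<^sup>2 * Vc ^ 4 = ((293864 / 59049) + (111070 / 59049) * s7)"
    and "Uc\<^sup>2 * Vc ^ 5 = ((6342464 / 531441) + (2397226 / 531441) * s7)"
    and "Uc ^ 3 * Vc = ((38 / 243) + (22 / 243) * s7)"
    and "Uc ^ 3 * Vc\<^sup>2 = ((1034 / 2187) + (394 / 2187) * s7)"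
    and "Uc ^ 3 * Vc ^ 3 = ((22406 / 19683) + (8470 / 19683) * s7)"
    and "Uc ^ 3 * Vc ^ 4 = ((483626 / 177147) + (182794 / 177147) * s7)"
    and "Uc ^ 3 * Vc ^ 5 = ((10438118 / 1594323) + (3945238 / 1594323) * s7)"
    and "Uc ^ 4 * Vc = ((116 / 729) + (16 / 729) * s7)"
    and "Uc ^ 4 * Vc\<^sup>2 = ((1724 / 6561) + (640 / 6561) * s7)"
    and "Uc ^ 4 * Vc ^ 3 = ((36884 / 59049) + (13936 / 59049) * s7)"
    and "Uc ^ 4 * Vc ^ 4 = ((795932 / 531441) + (300832 / 531441) * s7)"
    and "Uc ^ 5 * Vc = (- (4 / 2187) + (100 / 2187) * s7)"
    and "Uc ^ 5 * Vc\<^sup>2 = ((2756 / 19683) + (1084 / 19683) * s7)"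
  by (simp_all only: Uc_pow Vc_pow) (simp_all add: Uc_def Vc_def field_simps s7_rules)

lemma za_crit: "za Uc Vc w = (((263357 / 6561) + (99547 / 6561) * s7)) + ((- (12008 / 729) - (4522 / 729) * s7)) * w + (((785 / 243) + (301 / 243) * s7)) * w\<^sup>2"
  unfolding za_def mult.assoc UVc_table unfolding Uc_pow Vc_pow
  by (simp add: Uc_lin Vc_lin algebra_simps)

lemma zb_crit: "zb Uc Vc w = ((- (1198766714 / 1594323) - (453091276 / 1594323) * s7)) + (((398784454 / 531441) + (150726776 / 531441) * s7)) * w + (((54053554 / 177147) + (20430656 / 177147) * s7)) * w\<^sup>2 + ((- (28094 / 6561) - (10612 / 6561) * s7)) * w ^ 3"
  unfolding zb_def mult.assoc UVc_table unfolding Uc_pow Vc_pow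
  by (simp add: Uc_lin Vc_lin algebra_simps)

lemma zau_crit: "zau Uc Vc w = (((141073 / 2187) + (53294 / 2187) * s7)) + ((- (344 / 81) - (148 / 81) * s7)) * w + (((533 / 81) + (202 / 81) * s7)) * w\<^sup>2"
  unfolding zau_def mult.assoc UVc_table unfolding Uc_pow Vc_pow
  by (simp add: Uc_lin Vc_lin algebra_simps)

lemma zav_crit: "zav Uc Vc w = (((3064 / 81) + (1160 / 81) * s7)) + ((- (16) - (6) * s7)) * w + (((40 / 27) + (26 / 27) * s7)) * w\<^sup>2"
  unfolding zav_def mult.assoc UVc_table unfolding Uc_pow Vc_pow
  by (simp add: Uc_lin Vc_lin algebra_simps)

lemma zbu_crit: "zbu Uc Vc w = ((- (311011006 / 177147) - (117550988 / 177147) * s7)) + (((310816010 / 177147) + (117474520 / 177147) * s7)) * w + (((44268718 / 59049) + (16730828 / 59049) * s7)) * w\<^sup>2 + ((- (36022 / 2187) - (13616 / 2187) * s7)) * w ^ 3"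
  unfolding zbu_def mult.assoc UVc_table unfolding Uc_pow Vc_pow
  by (simp add: Uc_lin Vc_lin algebra_simps)

lemma zbv_crit: "zbv Uc Vc w = ((- (200460400 / 177147) - (75766928 / 177147) * s7)) + (((63875006 / 59049) + (24142372 / 59049) * s7)) * w + (((8801066 / 19683) + (3327286 / 19683) * s7)) * w\<^sup>2 + ((- (364 / 81) - (134 / 81) * s7)) * w ^ 3"
  unfolding zbv_def mult.assoc UVc_table unfolding Uc_pow Vc_pow
  by (simp add: Uc_lin Vc_lin algebra_simps)

lemma w2u_crit: "w2u Uc Vc w = (((5030326 / 19683) + (1901414 / 19683) * s7)) + ((- (1716308 / 6561) - (648592 / 6561) * s7)) * w + (((766 / 243) + (290 / 243) * s7)) * w\<^sup>2"
  unfolding w2u_def mult.assoc UVc_table unfolding Uc_pow Vc_pow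
  by (simp add: Uc_lin Vc_lin algebra_simps)

lemma w2v_crit: "w2v Uc Vc w = (((1293344 / 6561) + (488896 / 6561) * s7)) + ((- (318164 / 2187) - (120304 / 2187) * s7)) * w + (((64 / 81) + (20 / 81) * s7)) * w\<^sup>2"
  unfolding w2v_def mult.assoc UVc_table unfolding Uc_pow Vc_pow
  by (simp add: Uc_lin Vc_lin algebra_simps)

lemma Dcrit_powers:
  shows "((17 + 7 * s7) / 9) ^ 2 = (632 + 238 * s7) / 81"
    and "((17 + 7 * s7) / 9) ^ 3 = (22406 + 8470 * s7) / 729"
    and "((17 + 7 * s7) / 9) ^ 4 = (795932 + 300832 * s7) / 6561"
proof -
  show p2: "((17 + 7 * s7) / 9) ^ 2 = (632 + 238 * s7) / 81"
    by (simp add: power2_eq_square field_simps s7_rules)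
  show p3: "((17 + 7 * s7) / 9) ^ 3 = (22406 + 8470 * s7) / 729"
    unfolding power_Suc[of _ 2, simplified] p2 by (simp add: field_simps s7_rules)
  show p4: "((17 + 7 * s7) / 9) ^ 4 = (795932 + 300832 * s7) / 6561"
    unfolding power_Suc[of _ 3, simplified] p3 by (simp add: field_simps s7_rules)
qed

text \<open>At the fold \<open>z\<close> is stationary, so \<open>v = z * (1 + u)\<^sup>2\<close>
  forces the derivative of \<open>v\<close> to be \<open>2 * (1 + u)\<close> times that of
  \<open>u\<close>. The result contains the same function of \<open>w\<close> as
  \<open>Gdiag_deriv_crit\<close>, which is why ratios of values of \<open>T3\<close> coincide with
  limits of coefficient ratios.\<close>

lemma Kuv_deriv_crit:
  assumes u: "(u has_field_derivative a) (at t)" and v: "(v has_field_derivative 2 * ((2 + s7) / 3) * a) (at t)"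
    and uv: "u t = (s7 - 1) / 3" "v t = (11 + 4 * s7) / 9"
    and S: "(S has_field_derivative ((w2u (u t) (v t) w * a + w2v (u t) (v t) w * (2 * ((2 + s7) / 3) * a)) / (2 * S t))) (at t)"
    and sq: "S t = ((2 + s7) / 3)\<^sup>2 * ((113 + 37 * s7) / 27) * R" "R\<^sup>2 = qn w" "R \<noteq> 0"
  shows "((\<lambda>t. Kuv (S t) (u t) (v t) w) has_field_derivative
     a * ((19304 * s7 - 51016) / 243) * ((1 + w) * ((15 + 7 * s7) / 64 + (17 - 7 * s7) / 64 * w + kn w / R ^ 3))) (at t)"
proof -
  define y where "y = (2 + s7) / 3"
  define U where "U = (s7 - 1) / 3"
  define V where "V = (11 + 4 * s7) / 9"
  define s where "s = S t"
  define g where "g = ((2 + s7) / 3)\<^sup>2 * ((113 + 37 * s7) / 27)"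
  define D where "D = 1 + U + V"
  define za0 where "za0 = (263357 + 99547 * s7) / 6561 + (- 12008 - 4522 * s7) / 729 * w + (785 + 301 * s7) / 243 * w\<^sup>2"
  define za1 where "za1 = (397537 + 150206 * s7) / 2187 + (- 4340 - 1660 * s7) / 81 * w + (1057 + 386 * s7) / 81 * w\<^sup>2"
  define zb0 where "zb0 = (- 1198766714 - 453091276 * s7) / 1594323 + (398784454 + 150726776 * s7) / 531441 * w + (54053554 + 20430656 * s7) / 177147 * w\<^sup>2 + (- 28094 - 10612 * s7) / 6561 * w ^ 3"
  define zb1 where "zb1 = (- 2795611610 - 1056641476 * s7) / 531441 + (301436414 + 113931340 * s7) / 59049 * w + (126054986 + 47642104 * s7) / 59049 * w\<^sup>2 + (- 66010 - 24992 * s7) / 2187 * w ^ 3"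
  define w21 where "w21 = (17048246 + 6443686 * s7) / 19683 + (- 1557740 - 588712 * s7) / 2187 * w + (434 + 166 * s7) / 81 * w\<^sup>2"
  have g: "g = (2279 + 859 * s7) / 243"
    unfolding g_def ycrit_powers by (simp add: field_simps s7_rules)
  have nz: "1 + U \<noteq> 0" "V \<noteq> 0" "D \<noteq> 0" "g \<noteq> 0"
  proof -
    have "(1 + U) * (s7 - 2) = 1" "V * (11 - 4 * s7) = 1" "D * (17 - 7 * s7) = - 6" "g * (2279 - 859 * s7) = 28674 / 243"
      using s7_sq unfolding U_def V_def D_def g by (simp_all add: field_simps power2_eq_square)
    thus "1 + U \<noteq> 0" "V \<noteq> 0" "D \<noteq> 0" "g \<noteq> 0" by auto
  qed
  have sg: "s = g * R" using sq by (simp add: s_def g_def)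
  have s0: "s \<noteq> 0" using sg nz sq by simp
  have a0: "za U V w = za0" and a1: "zau U V w + zav U V w * (2 * y) = za1"
    and b0: "zb U V w = zb0" and b1: "zbu U V w + zbv U V w * (2 * y) = zb1"
    and c1: "w2u U V w + w2v U V w * (2 * y) = w21"
  proof -
    have UV: "U = Uc" "V = Vc" by (simp_all add: U_def V_def Uc_def Vc_def)
    show "za U V w = za0" and "zau U V w + zav U V w * (2 * y) = za1"
      and "zb U V w = zb0" and "zbu U V w + zbv U V w * (2 * y) = zb1"
      and "w2u U V w + w2v U V w * (2 * y) = w21"
      unfolding UV za_crit zau_crit zav_crit zb_crit zbu_crit zbv_crit w2u_crit w2v_crit y_def
        za0_def za1_def zb0_def zb1_def w21_def
      by (simp_all add: field_simps s7_rules)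
  qed
  have dza: "((\<lambda>t. za (u t) (v t) w) has_field_derivative a * za1) (at t)"
    by (rule DERIV_cong[OF za_deriv[OF u v]]) (unfold a1[symmetric] uv U_def V_def y_def, simp add: algebra_simps)
  have dzb: "((\<lambda>t. zb (u t) (v t) w) has_field_derivative a * zb1) (at t)"
    by (rule DERIV_cong[OF zb_deriv[OF u v]]) (unfold b1[symmetric] uv U_def V_def y_def, simp add: algebra_simps)
  have dS: "(S has_field_derivative a * w21 / (2 * s)) (at t)"
    by (rule DERIV_cong[OF S]) (unfold c1[symmetric] uv U_def V_def y_def s_def, simp add: algebra_simps)
  note [simp] = uv[folded U_def V_def]
  have pre: "((\<lambda>t. (1 + u t)\<^sup>2 / (v t * (1 + u t + v t) ^ 4)) has_field_derivative
     a * (2 * (1 + U) * (V * D ^ 4) - (1 + U)\<^sup>2 * (2 * y * D ^ 4 + V * (4 * D ^ 3 * (1 + 2 * y)))) / (V * D ^ 4 * (V * D ^ 4))) (at t)"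
  proof -
    have 1: "((\<lambda>t. (1 + u t)\<^sup>2) has_field_derivative a * (2 * (1 + U))) (at t)"
      by (rule derivative_eq_intros refl u)+ simp
    have 2: "((\<lambda>t. v t * (1 + u t + v t) ^ 4) has_field_derivative a * (2 * y * D ^ 4 + V * (4 * D ^ 3 * (1 + 2 * y)))) (at t)"
      by (rule derivative_eq_intros refl u v)+ (simp add: D_def y_def algebra_simps)
    show ?thesis
      by (rule DERIV_cong[OF DERIV_divide[OF 1 2]]) (use nz in \<open>simp_all add: D_def algebra_simps\<close>)
  qed
  have f0: "(1 + U)\<^sup>2 / (V * D ^ 4) = (198983 - 75208 * s7) / 324"
    and f1: "(2 * (1 + U) * (V * D ^ 4) - (1 + U)\<^sup>2 * (2 * y * D ^ 4 + V * (4 * D ^ 3 * (1 + 2 * y)))) / (V * D ^ 4 * (V * D ^ 4))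
       = (198983 - 75208 * s7) / 324 * ((14 - 10 * s7) / 3)"
  proof -
    have U1: "1 + U = (2 + s7) / 3" and D: "D = (17 + 7 * s7) / 9" by (simp_all add: U_def V_def D_def field_simps)
    have "(1 + U)\<^sup>2 * 324 = (198983 - 75208 * s7) * (V * D ^ 4)"
      unfolding U1 D V_def Dcrit_powers ycrit_powers by (simp add: field_simps s7_rules)
    thus f0: "(1 + U)\<^sup>2 / (V * D ^ 4) = (198983 - 75208 * s7) / 324" using nz by (simp add: divide_simps)
    have l: "(2 * (1 + U) * (V * D) - (1 + U)\<^sup>2 * (2 * y * D + V * (4 * (1 + 2 * y)))) * 3 = (14 - 10 * s7) * ((1 + U)\<^sup>2 * (V * D))"
      unfolding U1 D V_def y_def ycrit_powers by (simp add: field_simps s7_rules)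
    have "2 * (1 + U) * (V * D ^ 4) - (1 + U)\<^sup>2 * (2 * y * D ^ 4 + V * (4 * D ^ 3 * (1 + 2 * y)))
      = (2 * (1 + U) * (V * D) - (1 + U)\<^sup>2 * (2 * y * D + V * (4 * (1 + 2 * y)))) * D ^ 3" by algebra
    also have "\<dots> = (14 - 10 * s7) / 3 * ((1 + U)\<^sup>2 * (V * D)) * D ^ 3"
    proof -
      have l3: "2 * (1 + U) * (V * D) - (1 + U)\<^sup>2 * (2 * y * D + V * (4 * (1 + 2 * y))) = ((14 - 10 * s7) * ((1 + U)\<^sup>2 * (V * D))) / 3"
        by (rule eq_divide_imp[OF _ l]) simp
      show ?thesis unfolding l3 by simp
    qed
    finally have "(2 * (1 + U) * (V * D ^ 4) - (1 + U)\<^sup>2 * (2 * y * D ^ 4 + V * (4 * D ^ 3 * (1 + 2 * y)))) / (V * D ^ 4 * (V * D ^ 4))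
       = (14 - 10 * s7) / 3 * ((1 + U)\<^sup>2 * (V * D)) * D ^ 3 / (V * D ^ 4 * (V * D ^ 4))" by (simp only:)
    also have "\<dots> = (14 - 10 * s7) / 3 * ((1 + U)\<^sup>2 / (V * D ^ 4))"
    proof -
      define Q where "Q = V * D ^ 4"
      have Q: "Q \<noteq> 0" using nz by (simp add: Q_def)
      have X: "(14 - 10 * s7) / 3 * ((1 + U)\<^sup>2 * (V * D)) * D ^ 3 = (14 - 10 * s7) / 3 * ((1 + U)\<^sup>2 * Q)"
        unfolding Q_def by algebra
      show ?thesis unfolding Q_def[symmetric] X using Q by simp
    qed
    finally show "(2 * (1 + U) * (V * D ^ 4) - (1 + U)\<^sup>2 * (2 * y * D ^ 4 + V * (4 * D ^ 3 * (1 + 2 * y)))) / (V * D ^ 4 * (V * D ^ 4))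
       = (198983 - 75208 * s7) / 324 * ((14 - 10 * s7) / 3)" unfolding f0 by simp
  qed
  define f where "f = (198983 - 75208 * s7) / 324"
  define f' where "f' = (198983 - 75208 * s7) / 324 * ((14 - 10 * s7) / 3)"
  have pre': "((\<lambda>t. (1 + u t)\<^sup>2 / (v t * (1 + u t + v t) ^ 4)) has_field_derivative a * f') (at t)"
    by (rule DERIV_cong[OF pre]) (unfold f'_def f1[symmetric], simp)
  have vals: "za (u t) (v t) w = za0" "zb (u t) (v t) w = zb0"
    unfolding uv[folded U_def V_def] a0 b0 by (rule refl)+
  have q: "((\<lambda>t. zb (u t) (v t) w / S t) has_field_derivative a * ((zb1 * s - zb0 * (w21 / (2 * s))) / (s * s))) (at t)"
  proof (rule DERIV_cong[OF DERIV_divide[OF dzb dS]])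
    show "S t \<noteq> 0" using s0 by (simp add: s_def)
    show "(a * zb1 * S t - zb (u t) (v t) w * (a * w21 / (2 * s))) / (S t * S t) = a * ((zb1 * s - zb0 * (w21 / (2 * s))) / (s * s))"
      unfolding vals s_def[symmetric] by (simp add: right_diff_distrib mult_ac)
  qed
  have f0': "(1 + u t)\<^sup>2 / (v t * (1 + u t + v t) ^ 4) = f"
    unfolding uv[folded U_def V_def] D_def[symmetric] f_def by (rule f0)
  have "((\<lambda>t. Kuv (S t) (u t) (v t) w) has_field_derivative
     a * (f' * (za0 + zb0 / s) + (za1 + (zb1 * s - zb0 * (w21 / (2 * s))) / (s * s)) * f)) (at t)"
    unfolding Kuv_def
    by (rule DERIV_cong[OF DERIV_mult[OF pre' DERIV_add[OF dza q]]])
       (unfold f0' vals s_def[symmetric], simp only: distrib_left distrib_right mult_ac add_ac)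
  also have "f' * (za0 + zb0 / s) + (za1 + (zb1 * s - zb0 * (w21 / (2 * s))) / (s * s)) * f
     = ((19304 * s7 - 51016) / 243) * ((1 + w) * ((15 + 7 * s7) / 64 + (17 - 7 * s7) / 64 * w + kn w / R ^ 3))"
  proof -
    have 1: "f' * za0 + za1 * f = ((19304 * s7 - 51016) / 243) * ((1 + w) * ((15 + 7 * s7) / 64 + (17 - 7 * s7) / 64 * w))"
      unfolding f_def f'_def za0_def za1_def by (simp add: field_simps s7_rules power2_eq_square)
    have fh: "f' = (4025161 - 1521371 * s7) / 486"
      unfolding f'_def by (simp add: field_simps s7_rules)
    have h: "zb0 = ((- 1198766714 - 453091276 * s7) + (1196353362 + 452180328 * s7) * w + (486481986 + 183875904 * s7) * w ^ 2 + (- 6826842 - 2578716 * s7) * w ^ 3) / 1594323" "zb1 = ((- 2795611610 - 1056641476 * s7) + (2712927726 + 1025382060 * s7) * w + (1134494874 + 428778936 * s7) * w ^ 2 + (- 16040430 - 6073056 * s7) * w ^ 3) / 531441" "w21 = ((17048246 + 6443686 * s7) + (- 14019660 - 5298408 * s7) * w + (105462 + 40338 * s7) * w ^ 2) / 19683"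
      "qn w = ((3481 + 0 * s7) + (8716 - 4154 * s7) * w + (8219 - 3100 * s7) * w ^ 2) / 3481" "kn w = ((- 3080685 - 1437653 * s7) + (2951888 + 1552526 * s7) * w + (26008932 - 9369906 * s7) * w ^ 2 + (63557744 - 24031594 * s7) * w ^ 3 + (37371401 - 14125021 * s7) * w ^ 4) / 13144256"
      unfolding zb0_def zb1_def w21_def qn_def kn_def
      by (simp_all add: field_simps s7_rules power2_eq_square)
    have 2: "2 * g ^ 2 * (f' * zb0 + f * zb1) * qn w - f * zb0 * w21 = 2 * g ^ 3 * ((- 51016 + 19304 * s7) / 243 * ((1 + w) * kn w))"
      unfolding h g f_def fh by (rule fold_scale[OF fold_integral])
    have "f' * (zb0 / s) + ((zb1 * s - zb0 * (w21 / (2 * s))) / (s * s)) * f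
        = (2 * g\<^sup>2 * (f' * zb0 + f * zb1) * R\<^sup>2 - f * zb0 * w21) / (2 * g ^ 3 * R ^ 3)"
      using nz sq(3) unfolding sg by (simp add: divide_simps) algebra
    also have "\<dots> = ((19304 * s7 - 51016) / 243) * ((1 + w) * (kn w / R ^ 3))"
      unfolding sq(2) 2 using nz by simp
    finally have 3: "f' * (zb0 / s) + ((zb1 * s - zb0 * (w21 / (2 * s))) / (s * s)) * f = ((19304 * s7 - 51016) / 243) * ((1 + w) * (kn w / R ^ 3))" .
    have "f' * (za0 + zb0 / s) + (za1 + (zb1 * s - zb0 * (w21 / (2 * s))) / (s * s)) * f
      = (f' * za0 + za1 * f) + (f' * (zb0 / s) + ((zb1 * s - zb0 * (w21 / (2 * s))) / (s * s)) * f)"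
      by (simp only: distrib_left distrib_right mult_ac add_ac)
    also have "\<dots> = ((19304 * s7 - 51016) / 243) * ((1 + w) * ((15 + 7 * s7) / 64 + (17 - 7 * s7) / 64 * w + kn w / R ^ 3))"
      unfolding 1 3 by (simp only: distrib_left mult_ac add_ac)
    finally show ?thesis .
  qed
  finally show ?thesis by (simp only: mult.assoc)
qed

section \<open>The small solution of the system\<close>

text \<open>The system with \<open>v\<close> eliminated: its solutions \<open>u\<close> are the
  fixed points of \<open>Phi x z\<close>.\<close>

definition Phi :: "complex \<Rightarrow> complex \<Rightarrow> complex \<Rightarrow> complex" where
  "Phi x z u = x * z * (1 + z * (1 + u)\<^sup>2)\<^sup>2"

text \<open>The last equation says that \<open>u0_fun z\<close> is a fixed point for
  \<open>x = r_fun z\<close>; together with the quadratic equation in the second place it makes this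
  fixed point a double one.\<close>

lemma u0_fun_props:
  assumes "z > 0"
  shows "u0_fun z > 1/3" and "z * (1 + u0_fun z) * (3 * u0_fun z - 1) = 1" and "r_fun z > 0"
    and "r_fun z * z * (1 + z * (1 + u0_fun z)\<^sup>2)\<^sup>2 = u0_fun z"
proof -
  define q where "q = sqrt (4/9 + 1 / (3 * z))"
  have q2: "q\<^sup>2 = 4/9 + 1 / (3 * z)" unfolding q_def by (rule real_sqrt_pow2) (use assms in simp)
  have "sqrt ((2/3)\<^sup>2) < q" unfolding q_def by (rule real_sqrt_less_mono) (use assms in \<open>simp add: power2_eq_square\<close>)
  hence "2/3 < q" by simp
  thus a: "u0_fun z > 1/3" by (simp add: u0_fun_def q_def)
  have "(1 + u0_fun z) * (3 * u0_fun z - 1) = 3 * q\<^sup>2 - 4/3"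
  proof -
    have "u0_fun z = - 1/3 + q" by (simp only: u0_fun_def q_def)
    hence "u0_fun z = q - 1/3" by simp
    thus ?thesis by (simp only:) (simp add: power2_eq_square algebra_simps)
  qed
  also have "\<dots> = 1 / z" by (simp add: q2)
  finally show "z * (1 + u0_fun z) * (3 * u0_fun z - 1) = 1" using assms by (simp add: field_simps)
  have p: "1 + z * (1 + u0_fun z)\<^sup>2 > 0" using assms by (simp add: add_pos_nonneg)
  thus "r_fun z > 0" using a assms by (simp add: r_fun_def)
  show "r_fun z * z * (1 + z * (1 + u0_fun z)\<^sup>2)\<^sup>2 = u0_fun z"
    using p assms by (simp add: r_fun_def)
qed

text \<open>The critical point \<open>(r_fun Z, Z)\<close> is where the derivative of the fixed-point map equals 1.\<close>

lemma Phi_slope: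
  assumes "z > 0"
  defines "a \<equiv> u0_fun z"
  shows "r_fun z * z * (2 * (1 + z * (1 + a)\<^sup>2) * (z * (2 * (1 + a)))) = 1"
proof -
  define p where "p = 1 + z * (1 + a)\<^sup>2"
  have p: "p > 0" using assms by (simp add: p_def add_pos_nonneg)
  have e: "z * (1 + a) * (3 * a - 1) = 1" "r_fun z * z * p\<^sup>2 = a"
    using u0_fun_props[OF assms(1)] by (simp_all add: a_def p_def)
  have "r_fun z * z * (2 * p * (z * (2 * (1 + a)))) * p = 4 * z * (1 + a) * (r_fun z * z * p\<^sup>2)"
    by (simp add: power2_eq_square mult_ac)
  also have "\<dots> = 4 * z * (1 + a) * a" by (simp only: e)
  also have "\<dots> = p" using e(1) by (simp add: p_def power2_eq_square algebra_simps)
  finally show ?thesis using p by (simp add: p_def)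
qed

text \<open>The factor \<open>2 + norm (u + u')\<close> is kept and not replaced by its maximum: at
  the critical point it is the source of strictness.\<close>

lemma norm_diff_le_chord:
  fixes u u' z :: complex
  assumes z: "norm z \<le> Z" and u: "norm u \<le> a" "norm u' \<le> a"
  shows "norm ((1 + z * (1 + u)\<^sup>2)\<^sup>2 - (1 + z * (1 + u')\<^sup>2)\<^sup>2)
     \<le> (2 * (1 + Z * (1 + a)\<^sup>2)) * (Z * ((2 + norm (u + u')) * norm (u - u')))"
proof -
  have Z: "Z \<ge> 0" "a \<ge> 0" using z u norm_ge_zero order_trans by blast+
  have q: "norm ((1 + x)\<^sup>2) \<le> (1 + a)\<^sup>2" if "norm x \<le> a" for x :: complex
  proof -
    have "norm (1 + x) \<le> 1 + a" using norm_triangle_ineq[of 1 x] that by simp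
    thus ?thesis unfolding norm_power by (rule power_mono) simp
  qed
  have q1: "norm (1 + z * (1 + x)\<^sup>2) \<le> 1 + Z * (1 + a)\<^sup>2" if "norm x \<le> a" for x :: complex
  proof -
    have "norm (1 + z * (1 + x)\<^sup>2) \<le> 1 + norm z * norm ((1 + x)\<^sup>2)"
      using norm_triangle_ineq[of 1 "z * (1 + x)\<^sup>2"] by (simp add: norm_mult)
    also have "\<dots> \<le> 1 + Z * (1 + a)\<^sup>2" by (intro add_left_mono mult_mono z q that Z) auto
    finally show ?thesis .
  qed
  have "(1 + z * (1 + u)\<^sup>2)\<^sup>2 - (1 + z * (1 + u')\<^sup>2)\<^sup>2
     = ((1 + z * (1 + u)\<^sup>2) + (1 + z * (1 + u')\<^sup>2)) * (z * ((2 + (u + u')) * (u - u')))"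
    by (simp add: power2_eq_square algebra_simps)
  hence "norm ((1 + z * (1 + u)\<^sup>2)\<^sup>2 - (1 + z * (1 + u')\<^sup>2)\<^sup>2)
    = norm ((1 + z * (1 + u)\<^sup>2) + (1 + z * (1 + u')\<^sup>2)) * (norm z * (norm (2 + (u + u')) * norm (u - u')))"
    by (simp add: norm_mult)
  also have "\<dots> \<le> (2 * (1 + Z * (1 + a)\<^sup>2)) * (Z * ((2 + norm (u + u')) * norm (u - u')))"
  proof (intro mult_mono)
    show "norm ((1 + z * (1 + u)\<^sup>2) + (1 + z * (1 + u')\<^sup>2)) \<le> 2 * (1 + Z * (1 + a)\<^sup>2)"
      by (rule order_trans[OF norm_triangle_ineq]) (use add_mono[OF q1[OF u(1)] q1[OF u(2)]] in simp)
    show "norm (2 + (u + u')) \<le> 2 + norm (u + u')" using norm_triangle_ineq[of 2 "u + u'"] by simp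
  qed (use z Z in \<open>auto intro!: mult_nonneg_nonneg add_nonneg_nonneg\<close>)
  finally show ?thesis .
qed

text \<open>Majorization: \<open>Phi\<close> has nonnegative coefficients, so on the disc its slope
  is at most \<sigma> times the slope 1 at the critical point.\<close>

lemma Phi_lipschitz:
  assumes Z: "Z > 0" and x: "norm (x * z) \<le> \<sigma> * (r_fun Z * Z)" and z: "norm z \<le> Z" and \<sigma>: "\<sigma> \<ge> 0"
    and u: "norm u \<le> u0_fun Z" "norm u' \<le> u0_fun Z"
  shows "norm (Phi x z u - Phi x z u') \<le> \<sigma> * norm (u - u')"
    and "norm (Phi x z u - Phi x z u') \<le> \<sigma> * ((2 + norm (u + u')) / (2 + 2 * u0_fun Z) * norm (u - u'))"
proof -
  define a where "a = u0_fun Z"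
  have a: "a > 0" using u0_fun_props[OF Z] by (simp add: a_def)
  have r: "r_fun Z > 0" using u0_fun_props[OF Z] by simp
  have "norm (Phi x z u - Phi x z u') = norm (x * z) * norm ((1 + z * (1 + u)\<^sup>2)\<^sup>2 - (1 + z * (1 + u')\<^sup>2)\<^sup>2)"
    by (simp add: Phi_def norm_mult flip: right_diff_distrib)
  also have "\<dots> \<le> (\<sigma> * (r_fun Z * Z)) * ((2 * (1 + Z * (1 + a)\<^sup>2)) * (Z * ((2 + norm (u + u')) * norm (u - u'))))"
    by (intro mult_mono x norm_diff_le_chord z) (use u Z r \<sigma> in \<open>auto simp: a_def\<close>)
  also have "\<dots> = \<sigma> * ((2 + norm (u + u')) / (2 + 2 * a) * norm (u - u')) * (r_fun Z * Z * (2 * (1 + Z * (1 + a)\<^sup>2) * (Z * (2 * (1 + a)))))"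
    using a by (simp add: field_simps)
  also have "\<dots> = \<sigma> * ((2 + norm (u + u')) / (2 + 2 * a) * norm (u - u'))"
    using Phi_slope[OF Z] by (simp add: a_def)
  finally show 1: "norm (Phi x z u - Phi x z u') \<le> \<sigma> * ((2 + norm (u + u')) / (2 + 2 * u0_fun Z) * norm (u - u'))"
    by (simp add: a_def)
  have "norm (u + u') \<le> 2 * a" using norm_triangle_ineq[of u u'] u by (simp add: a_def)
  hence "(2 + norm (u + u')) / (2 + 2 * a) \<le> 1" using a by simp
  hence "(2 + norm (u + u')) / (2 + 2 * a) * norm (u - u') \<le> 1 * norm (u - u')"
    by (rule mult_right_mono) simp
  from mult_left_mono[OF this \<sigma>] have "\<sigma> * ((2 + norm (u + u')) / (2 + 2 * a) * norm (u - u')) \<le> \<sigma> * norm (u - u')"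
    by (simp only: mult_1)
  with 1 show "norm (Phi x z u - Phi x z u') \<le> \<sigma> * norm (u - u')" by (simp add: a_def)
qed

lemma Phi_bound:
  assumes Z: "Z > 0" and x: "norm (x * z) \<le> \<sigma> * (r_fun Z * Z)" and z: "norm z \<le> Z" and \<sigma>: "\<sigma> \<ge> 0"
    and u: "norm u \<le> u0_fun Z"
  shows "norm (Phi x z u) \<le> \<sigma> * u0_fun Z"
proof -
  define a where "a = u0_fun Z"
  have a: "a > 0" using u0_fun_props[OF Z] by (simp add: a_def)
  have "norm (1 + u) \<le> 1 + a" using norm_triangle_ineq[of 1 u] u by (simp add: a_def)
  hence "norm (z * (1 + u)\<^sup>2) \<le> Z * (1 + a)\<^sup>2"
    unfolding norm_mult norm_power using z Z by (intro mult_mono power_mono) auto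
  hence "norm (1 + z * (1 + u)\<^sup>2) \<le> 1 + Z * (1 + a)\<^sup>2"
    using norm_triangle_ineq[of 1 "z * (1 + u)\<^sup>2"] by simp
  hence "norm (Phi x z u) \<le> (\<sigma> * (r_fun Z * Z)) * (1 + Z * (1 + a)\<^sup>2)\<^sup>2"
    unfolding Phi_def norm_mult[of "x * z"] norm_power
    using x order_trans[OF norm_ge_zero x] by (intro mult_mono power_mono) auto
  also have "\<dots> = \<sigma> * a" using u0_fun_props(4)[OF Z] by (simp add: a_def mult.assoc)
  finally show ?thesis by (simp add: a_def)
qed

text \<open>At the critical point the map is not a contraction, but \<open>\<bar>u + u'\<bar> < 2 a\<close> for distinct
  points of the disc of radius \<open>a\<close>.\<close>

lemma Phi_fixpoint_unique:
  assumes Z: "Z > 0" and x: "norm (x * z) \<le> r_fun Z * Z" and z: "norm z \<le> Z"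
    and u: "norm u \<le> u0_fun Z" "norm u' \<le> u0_fun Z" and fp: "Phi x z u = u" "Phi x z u' = u'"
  shows "u = u'"
proof (rule ccontr)
  assume ne: "u \<noteq> u'"
  define a where "a = u0_fun Z"
  have a: "a > 0" using u0_fun_props[OF Z] by (simp add: a_def)
  \<comment> \<open>Parallelogram law: two distinct points of the closed disc have their midpoint
    strictly inside.\<close>
  have "(norm (u + u'))\<^sup>2 + (norm (u - u'))\<^sup>2 = 2 * (norm u)\<^sup>2 + 2 * (norm u')\<^sup>2"
    by (simp only: cmod_power2 plus_complex.sel minus_complex.sel) (simp add: power2_eq_square algebra_simps)
  also have "\<dots> \<le> 2 * a\<^sup>2 + 2 * a\<^sup>2" using u by (intro add_mono mult_left_mono power_mono) (auto simp: a_def)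
  finally have "(norm (u + u'))\<^sup>2 + (norm (u - u'))\<^sup>2 \<le> (2 * a)\<^sup>2" by (simp add: power_mult_distrib)
  moreover have "(norm (u - u'))\<^sup>2 > 0" using ne by simp
  ultimately have "(norm (u + u'))\<^sup>2 < (2 * a)\<^sup>2" by linarith
  hence "norm (u + u') < 2 * a" by (rule power_less_imp_less_base) (use a in simp)
  hence "(2 + norm (u + u')) / (2 + 2 * a) < 1" using a by simp
  hence "(2 + norm (u + u')) / (2 + 2 * a) * norm (u - u') < 1 * norm (u - u')"
    using ne by (intro mult_strict_right_mono) auto
  moreover have "norm (u - u') \<le> 1 * ((2 + norm (u + u')) / (2 + 2 * a) * norm (u - u'))"
    using Phi_lipschitz(2)[OF Z _ z _ u, of x 1] x fp by (simp add: a_def)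
  ultimately show False by simp
qed

text \<open>Starting the iteration at 0 keeps nonnegative data nonnegative and reduces holomorphy of
  the solution to uniform convergence.\<close>

primrec uiter :: "nat \<Rightarrow> complex \<Rightarrow> complex \<Rightarrow> complex" where
  "uiter 0 x z = 0"
| "uiter (Suc n) x z = Phi x z (uiter n x z)"

definition usol :: "complex \<Rightarrow> complex \<Rightarrow> complex" where
  "usol x z = lim (\<lambda>n. uiter n x z)"

definition vsol :: "complex \<Rightarrow> complex \<Rightarrow> complex" where
  "vsol x z = z * (1 + usol x z)\<^sup>2"

lemma uiter_bounds:
  assumes Z: "Z > 0" and x: "norm (x * z) \<le> \<sigma> * (r_fun Z * Z)" and z: "norm z \<le> Z" and \<sigma>: "0 \<le> \<sigma>" "\<sigma> < 1"
  shows "norm (uiter n x z) \<le> u0_fun Z" and "norm (uiter (Suc n) x z - uiter n x z) \<le> \<sigma> ^ n * u0_fun Z"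
proof -
  have a: "u0_fun Z > 0" using u0_fun_props[OF Z] by simp
  show b: "norm (uiter n x z) \<le> u0_fun Z" for n
  proof (induction n)
    case (Suc n)
    have "norm (uiter (Suc n) x z) \<le> \<sigma> * u0_fun Z" using Phi_bound[OF Z x z \<sigma>(1) Suc] by simp
    also have "\<dots> \<le> 1 * u0_fun Z" using \<sigma> a by (intro mult_right_mono) auto
    finally show ?case by simp
  qed (use a in simp)
  show "norm (uiter (Suc n) x z - uiter n x z) \<le> \<sigma> ^ n * u0_fun Z"
  proof (induction n)
    case 0
    then show ?case using b[of 1] by simp
  next
    case (Suc n)
    have "norm (uiter (Suc (Suc n)) x z - uiter (Suc n) x z) \<le> \<sigma> * norm (uiter (Suc n) x z - uiter n x z)"
      using Phi_lipschitz(1)[OF Z x z \<sigma>(1) b[of "Suc n"] b[of n]] by simp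
    also have "\<dots> \<le> \<sigma> * (\<sigma> ^ n * u0_fun Z)" using Suc \<sigma> by (intro mult_left_mono) auto
    finally show ?case by simp
  qed
qed

lemma uiter_uniform:
  assumes Z: "Z > 0" and \<sigma>: "0 \<le> \<sigma>" "\<sigma> < 1"
    and P: "\<And>s. s \<in> A \<Longrightarrow> norm (x s * z s) \<le> \<sigma> * (r_fun Z * Z) \<and> norm (z s) \<le> Z"
  shows "uniform_limit A (\<lambda>n s. uiter n (x s) (z s)) (\<lambda>s. usol (x s) (z s)) sequentially"
proof -
  have a: "u0_fun Z > 0" using u0_fun_props[OF Z] by simp
  have "uniform_limit A (\<lambda>n s. \<Sum>i<n. uiter (Suc i) (x s) (z s) - uiter i (x s) (z s))
     (\<lambda>s. \<Sum>i. uiter (Suc i) (x s) (z s) - uiter i (x s) (z s)) sequentially"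
  proof (rule Weierstrass_m_test)
    show "norm (uiter (Suc n) (x s) (z s) - uiter n (x s) (z s)) \<le> \<sigma> ^ n * u0_fun Z" if "s \<in> A" for n s
      using uiter_bounds(2)[OF Z _ _ \<sigma>] P[OF that] by blast
    show "summable (\<lambda>n. \<sigma> ^ n * u0_fun Z)" using \<sigma> by (intro summable_mult2 summable_geometric) auto
  qed
  moreover have "(\<Sum>i<n. uiter (Suc i) x z - uiter i x z) = uiter n x z" for n x z
    by (subst sum_lessThan_telescope) simp
  ultimately have u: "uniform_limit A (\<lambda>n s. uiter n (x s) (z s))
     (\<lambda>s. \<Sum>i. uiter (Suc i) (x s) (z s) - uiter i (x s) (z s)) sequentially" by simp
  moreover have "(\<Sum>i. uiter (Suc i) (x s) (z s) - uiter i (x s) (z s)) = usol (x s) (z s)" if "s \<in> A" for s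
    unfolding usol_def using tendsto_uniform_limitI[OF u that] by (rule limI[symmetric])
  ultimately show ?thesis
    using uniform_limit_cong'[of A "\<lambda>n s. uiter n (x s) (z s)" "\<lambda>n s. uiter n (x s) (z s)"
      "\<lambda>s. \<Sum>i. uiter (Suc i) (x s) (z s) - uiter i (x s) (z s)" "\<lambda>s. usol (x s) (z s)" sequentially] by blast
qed

lemma usol_props:
  assumes Z: "Z > 0" and x: "norm (x * z) \<le> \<sigma> * (r_fun Z * Z)" and z: "norm z \<le> Z" and \<sigma>: "0 \<le> \<sigma>" "\<sigma> < 1"
  shows "Phi x z (usol x z) = usol x z" and "norm (usol x z) \<le> \<sigma> * u0_fun Z"
    and "(\<lambda>n. uiter n x z) \<longlonglongrightarrow> usol x z"
proof -
  have "uniform_limit {()} (\<lambda>n s. uiter n x z) (\<lambda>s. usol x z) sequentially"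
    by (rule uiter_uniform[OF Z \<sigma>]) (use x z in auto)
  thus l: "(\<lambda>n. uiter n x z) \<longlonglongrightarrow> usol x z" by (auto dest: tendsto_uniform_limitI)
  have "(\<lambda>n. Phi x z (uiter n x z)) \<longlonglongrightarrow> Phi x z (usol x z)"
    unfolding Phi_def by (intro tendsto_intros l)
  moreover have "(\<lambda>n. Phi x z (uiter n x z)) \<longlonglongrightarrow> usol x z"
    using LIMSEQ_Suc[OF l] by simp
  ultimately show fp: "Phi x z (usol x z) = usol x z" by (rule LIMSEQ_unique)
  have "norm (usol x z) \<le> u0_fun Z"
    by (rule Lim_bounded[OF tendsto_norm[OF l]]) (use uiter_bounds(1)[OF Z x z \<sigma>] in auto)
  from Phi_bound[OF Z x z \<sigma>(1) this] show "norm (usol x z) \<le> \<sigma> * u0_fun Z" by (simp add: fp)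
qed

text \<open>Strict inequality for \<open>x * z\<close> provides, locally, one contraction factor
  \<sigma> below 1 and hence uniform convergence of the iterates.\<close>

lemma usol_holomorphic:
  assumes Z: "Z > 0" and S: "open S" and h: "x holomorphic_on S" "z holomorphic_on S"
    and P: "\<And>s. s \<in> S \<Longrightarrow> norm (x s * z s) < r_fun Z * Z \<and> norm (z s) \<le> Z"
  shows "(\<lambda>s. usol (x s) (z s)) holomorphic_on S"
proof (rule holomorphic_uniform_sequence[OF S])
  show "(\<lambda>s. uiter n (x s) (z s)) holomorphic_on S" for n
    by (induction n) (auto simp: Phi_def intro!: holomorphic_intros h)
  fix s assume s: "s \<in> S"
  have rZ: "r_fun Z * Z > 0" using u0_fun_props[OF Z] Z by simp
  have c: "continuous_on S (\<lambda>s. norm (x s * z s))"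
    by (intro continuous_intros holomorphic_on_imp_continuous_on h)
  obtain \<sigma>0 where \<sigma>0: "norm (x s * z s) < \<sigma>0" "\<sigma>0 < r_fun Z * Z" using P[OF s] dense by blast
  have "open {t \<in> S. norm (x t * z t) < \<sigma>0}"
    using continuous_open_preimage[OF c S open_lessThan[of \<sigma>0]] by (simp add: vimage_def Int_def)
  moreover have "s \<in> {t \<in> S. norm (x t * z t) < \<sigma>0}" using s \<sigma>0 by simp
  ultimately obtain d where d: "d > 0" "cball s d \<subseteq> {t \<in> S. norm (x t * z t) < \<sigma>0}"
    using open_contains_cball by meson
  define \<sigma> where "\<sigma> = \<sigma>0 / (r_fun Z * Z)"
  have \<sigma>: "0 \<le> \<sigma>" "\<sigma> < 1" "\<sigma>0 = \<sigma> * (r_fun Z * Z)"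
    using \<sigma>0 rZ Z u0_fun_props(3)[OF Z] order_le_less_trans[OF norm_ge_zero \<sigma>0(1)] by (simp_all add: \<sigma>_def)
  have "uniform_limit (cball s d) (\<lambda>n s. uiter n (x s) (z s)) (\<lambda>s. usol (x s) (z s)) sequentially"
  proof (rule uiter_uniform[OF Z \<sigma>(1,2)])
    fix t assume "t \<in> cball s d"
    hence "t \<in> S" "norm (x t * z t) < \<sigma>0" using d by auto
    thus "norm (x t * z t) \<le> \<sigma> * (r_fun Z * Z) \<and> norm (z t) \<le> Z" using P \<sigma>(3) by auto
  qed
  thus "\<exists>d>0. cball s d \<subseteq> S \<and> uniform_limit (cball s d) (\<lambda>n s. uiter n (x s) (z s)) (\<lambda>s. usol (x s) (z s)) sequentially"
    using d by blast
qed

section \<open>Vertex degrees and root degrees\<close>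

lemma pair_graph_iff:
  "pair_graph G \<longleftrightarrow> finite (pverts G) \<and> parcs G \<subseteq> pverts G \<times> pverts G \<and>
     (\<forall>a b. (a, b) \<in> parcs G \<longrightarrow> (b, a) \<in> parcs G \<and> a \<noteq> b)"
proof
  assume "pair_graph G"
  then interpret pair_graph G .
  show "finite (pverts G) \<and> parcs G \<subseteq> pverts G \<times> pverts G \<and>
     (\<forall>a b. (a, b) \<in> parcs G \<longrightarrow> (b, a) \<in> parcs G \<and> a \<noteq> b)"
    using in_arcsD1 in_arcsD2 arcs_symmetric no_loops' by auto
next
  assume A: "finite (pverts G) \<and> parcs G \<subseteq> pverts G \<times> pverts G \<and>
     (\<forall>a b. (a, b) \<in> parcs G \<longrightarrow> (b, a) \<in> parcs G \<and> a \<noteq> b)"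
  hence "finite (parcs G)" by (meson finite_SigmaI finite_subset)
  with A show "pair_graph G"
    by unfold_locales (auto simp: symmetric_def sym_def)
qed

section \<open>Invariance under relabelling of the vertices\<close>

definition map_pg :: "(nat \<Rightarrow> nat) \<Rightarrow> nat pair_pre_digraph \<Rightarrow> nat pair_pre_digraph" where
  "map_pg \<pi> G = \<lparr>pverts = \<pi> ` pverts G, parcs = map_prod \<pi> \<pi> ` parcs G\<rparr>"

lemma pverts_map_pg [simp]: "pverts (map_pg \<pi> G) = \<pi> ` pverts G"
  and parcs_map_pg [simp]: "parcs (map_pg \<pi> G) = map_prod \<pi> \<pi> ` parcs G"
  by (simp_all add: map_pg_def)

lemma pair_graph_map_pg:
  assumes "inj \<pi>" "pair_graph G" shows "pair_graph (map_pg \<pi> G)"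
  using assms unfolding pair_graph_iff by (fastforce simp: inj_def)

text \<open>Reachability along arcs of \<open>E\<close> inside \<open>V\<close>, in either
  direction. It frees \<open>connected\<close> from the induced and symmetrized graph records, so
  that it can be transported along a map.\<close>

definition psym :: "nat set \<Rightarrow> (nat \<times> nat) set \<Rightarrow> nat \<Rightarrow> nat \<Rightarrow> bool" where
  "psym V E u v \<longleftrightarrow> (u, v) \<in> rtrancl_on V {(a, b). a \<in> V \<and> b \<in> V \<and> ((a, b) \<in> E \<or> (b, a) \<in> E)}"

lemma connected_induced_iff:
  "Digraph_Component.connected (with_proj G \<restriction> V) \<longleftrightarrow>
     V \<noteq> {} \<and> (\<forall>u\<in>V. \<forall>v\<in>V. psym V (parcs G) u v)"
proof -
  have e: "arcs_ends (with_proj (mk_symmetric (with_proj G \<restriction> V)))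
     = {(a, b). a \<in> V \<and> b \<in> V \<and> ((a, b) \<in> parcs G \<or> (b, a) \<in> parcs G)}"
    by (force simp: arcs_ends_def arc_to_ends_def mk_symmetric_def induce_subgraph_def)
  show ?thesis
    unfolding connected_def strongly_connected_def reachable_def e psym_def
    by (simp add: mk_symmetric_def induce_subgraph_def)
qed

lemma psym_map:
  assumes "inj \<pi>" "psym V E u v"
  shows "psym (\<pi> ` V) (map_prod \<pi> \<pi> ` E) (\<pi> u) (\<pi> v)"
  using assms(2) unfolding psym_def
proof (induction rule: rtrancl_on.induct)
  case (rtrancl_on_refl a)
  then show ?case by (intro rtrancl_on.rtrancl_on_refl) auto
next
  case (rtrancl_on_into_rtrancl_on a b c)
  show ?case
    by (rule rtrancl_on.rtrancl_on_into_rtrancl_on[OF rtrancl_on_into_rtrancl_on.IH])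
       (use rtrancl_on_into_rtrancl_on.hyps in force)+
qed

lemma k_connected_map_pg:
  assumes "inj \<pi>" "k_connected k G" shows "k_connected k (map_pg \<pi> G)"
  unfolding k_connected_def
proof (intro conjI allI impI)
  show "k < card (pverts (map_pg \<pi> G))"
    using assms by (simp add: k_connected_def card_image inj_on_subset)
next
  fix S assume S: "S \<subseteq> pverts (map_pg \<pi> G)" "card S < k"
  define S' where "S' = \<pi> -` S"
  have S': "S = \<pi> ` S'" using S by (auto simp: S'_def)
  have "card S' = card S" unfolding S' using assms(1) by (simp add: card_image inj_on_subset)
  moreover have "S' \<subseteq> pverts G" using S assms(1) by (auto simp: S'_def inj_def)
  ultimately have "Digraph_Component.connected (with_proj G \<restriction> (pverts G - S'))"
    using assms(2) S by (auto simp: k_connected_def)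
  hence c: "pverts G - S' \<noteq> {}" "\<And>u v. u \<in> pverts G - S' \<Longrightarrow> v \<in> pverts G - S' \<Longrightarrow> psym (pverts G - S') (parcs G) u v"
    unfolding connected_induced_iff by blast+
  have V: "pverts (map_pg \<pi> G) - S = \<pi> ` (pverts G - S')"
    unfolding S' using assms(1) by (simp add: image_set_diff)
  show "Digraph_Component.connected (with_proj (map_pg \<pi> G) \<restriction> (pverts (map_pg \<pi> G) - S))"
    unfolding connected_induced_iff V using c psym_map[OF assms(1)] by auto
qed

text \<open>The drawing is precomposed with the inverse of \<pi>; the points and arcs in the plane
  stay the same.\<close>

lemma planar_map_pg:
  assumes bij: "bij \<pi>" and "planar G" shows "planar (map_pg \<pi> G)"
proof -
  define \<rho> where "\<rho> = inv \<pi>"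
  have \<rho>: "\<rho> (\<pi> x) = x" for x using bij by (simp add: \<rho>_def bij_is_inj)
  have \<rho>i: "\<rho> ` \<pi> ` A = A" for A by (force simp: \<rho>)
  obtain f :: "nat \<Rightarrow> complex" and \<gamma> :: "nat \<times> nat \<Rightarrow> real \<Rightarrow> complex"
    where f: "inj_on f (pverts G)"
    and g0: "\<forall>(a, b) \<in> parcs G. Path_Connected.arc (\<gamma> (a, b)) \<and>
        pathstart (\<gamma> (a, b)) = f a \<and> pathfinish (\<gamma> (a, b)) = f b \<and>
        \<gamma> (b, a) = reversepath (\<gamma> (a, b)) \<and> path_image (\<gamma> (a, b)) \<inter> f ` pverts G = {f a, f b}"
    and h0: "\<forall>(a, b) \<in> parcs G. \<forall>(a', b') \<in> parcs G. {a, b} \<noteq> {a', b'} \<longrightarrow>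
        path_image (\<gamma> (a, b)) \<inter> path_image (\<gamma> (a', b')) = f ` ({a, b} \<inter> {a', b'})"
    using assms(2) unfolding planar_def
    by (elim exE conjE) (rule that; assumption)
  have g: "Path_Connected.arc (\<gamma> (a, b)) \<and>
        pathstart (\<gamma> (a, b)) = f a \<and> pathfinish (\<gamma> (a, b)) = f b \<and>
        \<gamma> (b, a) = reversepath (\<gamma> (a, b)) \<and> path_image (\<gamma> (a, b)) \<inter> f ` pverts G = {f a, f b}"
    if "(a, b) \<in> parcs G" for a b using bspec[OF g0 that, unfolded prod.case] .
  have h: "path_image (\<gamma> (a, b)) \<inter> path_image (\<gamma> (a', b')) = f ` ({a, b} \<inter> {a', b'})"
    if "(a, b) \<in> parcs G" "(a', b') \<in> parcs G" "{a, b} \<noteq> {a', b'}" for a b a' b'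
    using bspec[OF bspec[OF h0 that(1), unfolded prod.case] that(2), unfolded prod.case] that(3) by (rule mp)
  define f' where "f' = f \<circ> \<rho>"
  define \<gamma>' where "\<gamma>' = \<gamma> \<circ> map_prod \<rho> \<rho>"
  have im: "f' ` \<pi> ` A = f ` A" for A unfolding f'_def image_comp[symmetric] by (simp add: \<rho>i)
  have f'\<pi>: "f' (\<pi> x) = f x" for x by (simp add: f'_def \<rho>)
  have \<gamma>'\<pi>: "\<gamma>' (\<pi> x, \<pi> y) = \<gamma> (x, y)" for x y by (simp add: \<gamma>'_def \<rho>)
  have inj: "inj \<pi>" using bij by (rule bij_is_inj)
  have "inj_on f' (pverts (map_pg \<pi> G))" using f by (auto simp: inj_on_def f'\<pi>)
  moreover have "\<forall>(a, b)\<in>parcs (map_pg \<pi> G). Path_Connected.arc (\<gamma>' (a, b)) \<and>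
        pathstart (\<gamma>' (a, b)) = f' a \<and> pathfinish (\<gamma>' (a, b)) = f' b \<and>
        \<gamma>' (b, a) = reversepath (\<gamma>' (a, b)) \<and> path_image (\<gamma>' (a, b)) \<inter> f' ` pverts (map_pg \<pi> G) = {f' a, f' b}"
  proof (rule ballI, clarify)
    fix x y assume "(x, y) \<in> parcs (map_pg \<pi> G)"
    then obtain a b where ab: "(a, b) \<in> parcs G" "x = \<pi> a" "y = \<pi> b" by auto
    show "Path_Connected.arc (\<gamma>' (x, y)) \<and>
        pathstart (\<gamma>' (x, y)) = f' x \<and> pathfinish (\<gamma>' (x, y)) = f' y \<and>
        \<gamma>' (y, x) = reversepath (\<gamma>' (x, y)) \<and> path_image (\<gamma>' (x, y)) \<inter> f' ` pverts (map_pg \<pi> G) = {f' x, f' y}"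
      using g[OF ab(1)] by (simp only: ab f'\<pi> \<gamma>'\<pi> im pverts_map_pg)
  qed
  moreover have "\<forall>(a, b)\<in>parcs (map_pg \<pi> G). \<forall>(a', b')\<in>parcs (map_pg \<pi> G). {a, b} \<noteq> {a', b'} \<longrightarrow>
        path_image (\<gamma>' (a, b)) \<inter> path_image (\<gamma>' (a', b')) = f' ` ({a, b} \<inter> {a', b'})"
  proof clarify
    fix x y a b x' y' a' b'
    assume 1: "(x, y) \<in> parcs (map_pg \<pi> G)" "(x', y') \<in> parcs (map_pg \<pi> G)" and ne: "{x, y} \<noteq> {x', y'}"
    then obtain a b a' b' where ab: "(a, b) \<in> parcs G" "(a', b') \<in> parcs G" "x = \<pi> a" "y = \<pi> b" "x' = \<pi> a'" "y' = \<pi> b'"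
      by auto
    have ne': "{a, b} \<noteq> {a', b'}" using ne ab by auto
    have "{x, y} \<inter> {x', y'} = \<pi> ` ({a, b} \<inter> {a', b'})"
      unfolding image_Int[OF inj] using ab by simp
    thus "path_image (\<gamma>' (x, y)) \<inter> path_image (\<gamma>' (x', y')) = f' ` ({x, y} \<inter> {x', y'})"
      using h[OF ab(1,2) ne'] by (simp only: im ab \<gamma>'\<pi>)
  qed
  ultimately show ?thesis unfolding planar_def by blast
qed

lemma map_pg_tc:
  assumes "bij \<pi>" "\<pi> ` {1..n} = {1..n}" "G \<in> tc_graphs n"
  shows "map_pg \<pi> G \<in> tc_graphs n"
proof -
  have G: "pair_graph G" "pverts G = {1..n}" "k_connected 3 G" "planar G"
    using assms(3) by (simp_all add: tc_graphs_def)
  have "inj \<pi>" using assms(1) by (rule bij_is_inj)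
  thus ?thesis
    unfolding tc_graphs_def
    using pair_graph_map_pg[OF _ G(1)] k_connected_map_pg[OF _ G(3)] planar_map_pg[OF assms(1) G(4)] assms(2) G(2)
    by (simp del: atLeastAtMost_iff)
qed

lemma deg_map_pg:
  assumes "inj \<pi>" shows "deg (map_pg \<pi> G) (\<pi> v) = deg G v"
proof -
  have "out_arcs (with_proj (map_pg \<pi> G)) (\<pi> v) = map_prod \<pi> \<pi> ` out_arcs (with_proj G) v"
    using assms by (auto simp: out_arcs_def inj_eq)
  moreover have "inj (map_prod \<pi> \<pi>)" using assms by (simp add: prod.inj_map)
  ultimately show ?thesis unfolding out_degree_def by (simp add: card_image inj_on_subset)
qed

lemma finite_tc_graphs: "finite (tc_graphs n)"
proof -
  have "tc_graphs n \<subseteq> (\<lambda>A. \<lparr>pverts = {1..n}, parcs = A\<rparr>) ` Pow ({1..n} \<times> {1..n})"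
  proof
    fix G assume G: "G \<in> tc_graphs n"
    hence "parcs G \<subseteq> {1..n} \<times> {1..n}" "pverts G = {1..n}" unfolding tc_graphs_def pair_graph_iff by auto
    moreover have "G = \<lparr>pverts = pverts G, parcs = parcs G\<rparr>" by (cases G) simp
    ultimately have "G = \<lparr>pverts = {1..n}, parcs = parcs G\<rparr>" "parcs G \<in> Pow ({1..n} \<times> {1..n})" by simp_all
    thus "G \<in> (\<lambda>A. \<lparr>pverts = {1..n}, parcs = A\<rparr>) ` Pow ({1..n} \<times> {1..n})" by (rule image_eqI)
  qed
  thus ?thesis by (rule finite_subset) auto
qed

section \<open>Double counting of vertices and root edges\<close>

lemma tc_graphs_facts:
  assumes "G \<in> tc_graphs n"
  shows "pverts G = {1..n}" "parcs G \<subseteq> {1..n} \<times> {1..n}" "finite (parcs G)"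
    "\<And>a b. (a, b) \<in> parcs G \<Longrightarrow> (b, a) \<in> parcs G \<and> a \<noteq> b"
  using assms finite_subset[of "parcs G" "{1..n} \<times> {1..n}"] unfolding tc_graphs_def pair_graph_iff by auto

lemma finite_rooted: "finite (rooted_tc_graphs n)"
  unfolding rooted_tc_graphs_def using finite_tc_graphs tc_graphs_facts(3) by (intro finite_SigmaI)

lemma deg_eq_card: "deg G v = card {e \<in> parcs G. fst e = v}"
  by (simp add: out_degree_def out_arcs_def)

text \<open>Exchanging the labels 1 and \<open>v\<close> is an involution of the graphs on
  \<open>{1..n}\<close> that swaps the two degrees.\<close>

lemma card_vertex_degree:
  assumes "v \<in> {1..n}"
  shows "card {G \<in> tc_graphs n. deg G v = k} = card {G \<in> tc_graphs n. deg G 1 = k}"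
proof -
  define \<pi> where "\<pi> = Transposition.transpose 1 v"
  have bij: "bij \<pi>" by (simp add: \<pi>_def)
  have im: "\<pi> ` {1..n} = {1..n}" using assms unfolding \<pi>_def by (intro transpose_image_eq) auto
  have inv: "\<pi> (\<pi> x) = x" for x by (simp add: \<pi>_def)
  have mm: "map_pg \<pi> (map_pg \<pi> G) = G" for G
  proof -
    have "map_prod \<pi> \<pi> (map_prod \<pi> \<pi> x) = x" for x by (cases x) (simp add: inv)
    thus ?thesis by (cases G) (simp add: map_pg_def image_image inv)
  qed
  have inj: "inj \<pi>" using bij by (rule bij_is_inj)
  have "bij_betw (map_pg \<pi>) {G \<in> tc_graphs n. deg G v = k} {G \<in> tc_graphs n. deg G 1 = k}"
  proof (rule bij_betw_byWitness[where f' = "map_pg \<pi>"])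
    have "deg (map_pg \<pi> G) 1 = deg G v" "deg (map_pg \<pi> G) v = deg G 1" for G
      using deg_map_pg[OF inj, of G v] deg_map_pg[OF inj, of G 1] by (simp_all add: \<pi>_def)
    thus "map_pg \<pi> ` {G \<in> tc_graphs n. deg G v = k} \<subseteq> {G \<in> tc_graphs n. deg G 1 = k}"
      "map_pg \<pi> ` {G \<in> tc_graphs n. deg G 1 = k} \<subseteq> {G \<in> tc_graphs n. deg G v = k}"
      using map_pg_tc[OF bij im] by auto
  qed (use mm in auto)
  thus ?thesis by (rule bij_betw_same_card)
qed

text \<open>A vertex of degree \<open>k\<close> is the tail of exactly \<open>k\<close> arcs, and by
  symmetry all \<open>n\<close> labels contribute equally.\<close>

lemma card_rooted_degree:
  "card {(G, e) \<in> rooted_tc_graphs n. deg G (fst e) = k} = k * n * card {G \<in> tc_graphs n. deg G 1 = k}"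
proof -
  have fin: "finite {G \<in> tc_graphs n. P G}" for P using finite_tc_graphs by simp
  have "{(G, e) \<in> rooted_tc_graphs n. deg G (fst e) = k}
     = (SIGMA G:tc_graphs n. {e \<in> parcs G. deg G (fst e) = k})"
    by (auto simp: rooted_tc_graphs_def)
  hence "card {(G, e) \<in> rooted_tc_graphs n. deg G (fst e) = k} = (\<Sum>G\<in>tc_graphs n. card {e \<in> parcs G. deg G (fst e) = k})"
    using finite_tc_graphs tc_graphs_facts(3) by (simp add: card_SigmaI)
  also have "\<dots> = (\<Sum>G\<in>tc_graphs n. \<Sum>v\<in>{1..n}. if deg G v = k then k else 0)"
  proof (rule sum.cong[OF refl])
    fix G assume G: "G \<in> tc_graphs n"
    have sub: "fst e \<in> {1..n}" if "e \<in> parcs G" for e using tc_graphs_facts(2)[OF G] that by auto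
    have "{e \<in> parcs G. deg G (fst e) = k} = (\<Union>v\<in>{1..n}. if deg G v = k then {e \<in> parcs G. fst e = v} else {})"
    proof (rule set_eqI)
      fix e
      show "e \<in> {e \<in> parcs G. deg G (fst e) = k} \<longleftrightarrow> e \<in> (\<Union>v\<in>{1..n}. if deg G v = k then {e \<in> parcs G. fst e = v} else {})"
        using sub[of e] by (auto split: if_splits)
    qed
    also have "card \<dots> = (\<Sum>v\<in>{1..n}. card (if deg G v = k then {e \<in> parcs G. fst e = v} else {}))"
      by (rule card_UN_disjoint) (use tc_graphs_facts(3)[OF G] in auto)
    also have "\<dots> = (\<Sum>v\<in>{1..n}. if deg G v = k then k else 0)"
      by (rule sum.cong) (auto simp: deg_eq_card)
    finally show "card {e \<in> parcs G. deg G (fst e) = k} = (\<Sum>v\<in>{1..n}. if deg G v = k then k else 0)" .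
  qed
  also have "\<dots> = (\<Sum>v\<in>{1..n}. \<Sum>G\<in>tc_graphs n. if deg G v = k then k else 0)" by (rule sum.swap)
  also have "\<dots> = (\<Sum>v\<in>{1..n}. k * card {G \<in> tc_graphs n. deg G v = k})"
    using finite_tc_graphs by (simp add: sum.If_cases Int_def mult.commute)
  also have "\<dots> = (\<Sum>v\<in>{1..n}. k * card {G \<in> tc_graphs n. deg G 1 = k})"
    by (rule sum.cong) (simp_all only: card_vertex_degree)
  finally show ?thesis by simp
qed

text \<open>Connectedness after removal of the empty set excludes isolated vertices.\<close>

lemma deg_pos:
  assumes G: "G \<in> tc_graphs n" and v: "v \<in> {1..n}" shows "deg G v > 0"
proof -
  have k: "k_connected 3 G" "pverts G = {1..n}" using G by (simp_all add: tc_graphs_def)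
  have n: "n > 3" using k by (simp add: k_connected_def)
  have "Digraph_Component.connected (with_proj G \<restriction> (pverts G - {}))"
    using k unfolding k_connected_def by force
  hence c: "psym {1..n} (parcs G) v w" if "w \<in> {1..n}" for w
    unfolding connected_induced_iff using v that k by simp
  obtain w where w: "w \<in> {1..n}" "w \<noteq> v" using n v by (cases "v = 1") (auto intro: that[of 1] that[of 2])
  have "\<exists>x. (v, x) \<in> parcs G \<or> (x, v) \<in> parcs G"
    using c[OF w(1)] w(2) unfolding psym_def
    by (induction rule: rtrancl_on.induct) auto
  then obtain x where "(v, x) \<in> parcs G" using tc_graphs_facts(4)[OF G] by blast
  hence "(v, x) \<in> {e \<in> parcs G. fst e = v}" by simp
  moreover have "finite {e \<in> parcs G. fst e = v}" using tc_graphs_facts(3)[OF G] by simp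
  ultimately show ?thesis unfolding deg_eq_card by (metis card_gt_0_iff empty_iff)
qed

text \<open>The tail of the root is a size-biased vertex: each degree is weighted by itself, and the
  normalizing constant is the expected average degree.\<close>

lemma vertex_degree_prob_eq:
  assumes ne: "tc_graphs n \<noteq> {}" and v: "v \<in> {1..n}"
  shows "vertex_degree_prob v k n = expected_avg_deg n * root_degree_prob k n / real k"
    and "root_degree_prob k n = card {(G, e) \<in> rooted_tc_graphs n. deg G (fst e) = k} / card (rooted_tc_graphs n)"
    and "expected_avg_deg n = card (rooted_tc_graphs n) / (real n * card (tc_graphs n))"
    and "rooted_tc_graphs n \<noteq> {}"
proof -
  obtain G0 where G0: "G0 \<in> tc_graphs n" using ne by blast
  have "deg G0 v > 0" using deg_pos[OF G0 v] .
  then obtain e0 where "e0 \<in> parcs G0" unfolding deg_eq_card by (metis (no_types, lifting) card.empty empty_Collect_eq less_irrefl)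
  thus ne2: "rooted_tc_graphs n \<noteq> {}" using G0 by (auto simp: rooted_tc_graphs_def)
  have cr: "card (rooted_tc_graphs n) = (\<Sum>G\<in>tc_graphs n. card (parcs G))"
    unfolding rooted_tc_graphs_def using finite_tc_graphs tc_graphs_facts(3) by (simp add: card_SigmaI)
  have "expected_avg_deg n = (\<Sum>G\<in>tc_graphs n. avg_deg G) / card (tc_graphs n)"
    unfolding expected_avg_deg_def using integral_pmf_of_set[OF ne finite_tc_graphs] by simp
  also have "(\<Sum>G\<in>tc_graphs n. avg_deg G) = (\<Sum>G\<in>tc_graphs n. real (card (parcs G)) / real n)"
  proof (rule sum.cong[OF refl])
    fix G assume G: "G \<in> tc_graphs n"
    have "parcs G = (\<Union>v\<in>{1..n}. {e \<in> parcs G. fst e = v})" using tc_graphs_facts(2)[OF G] by auto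
    hence "card (parcs G) = card (\<Union>v\<in>{1..n}. {e \<in> parcs G. fst e = v})" by simp
    also have "\<dots> = (\<Sum>v\<in>{1..n}. card {e \<in> parcs G. fst e = v})"
      by (rule card_UN_disjoint) (use tc_graphs_facts(3)[OF G] in auto)
    finally have "real (card (parcs G)) = (\<Sum>v\<in>{1..n}. real (deg G v))" by (simp add: deg_eq_card)
    thus "avg_deg G = real (card (parcs G)) / real n"
      using tc_graphs_facts(1)[OF G] by (simp add: avg_deg_def)
  qed
  also have "\<dots> = card (rooted_tc_graphs n) / real n" by (simp add: cr sum_divide_distrib)
  finally show ead: "expected_avg_deg n = card (rooted_tc_graphs n) / (real n * card (tc_graphs n))" by simp
  have "root_degree_prob k n = card (rooted_tc_graphs n \<inter> {(G, e). deg G (fst e) = k}) / card (rooted_tc_graphs n)"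
    unfolding root_degree_prob_def by (rule measure_pmf_of_set[OF ne2 finite_rooted])
  also have "rooted_tc_graphs n \<inter> {(G, e). deg G (fst e) = k} = {(G, e) \<in> rooted_tc_graphs n. deg G (fst e) = k}" by auto
  finally show rd: "root_degree_prob k n = card {(G, e) \<in> rooted_tc_graphs n. deg G (fst e) = k} / card (rooted_tc_graphs n)" .
  have "vertex_degree_prob v k n = card (tc_graphs n \<inter> {G. deg G v = k}) / card (tc_graphs n)"
    unfolding vertex_degree_prob_def by (rule measure_pmf_of_set[OF ne finite_tc_graphs])
  also have "tc_graphs n \<inter> {G. deg G v = k} = {G \<in> tc_graphs n. deg G v = k}" by auto
  finally have vd: "vertex_degree_prob v k n = card {G \<in> tc_graphs n. deg G v = k} / card (tc_graphs n)" .
  have n: "real n > 0" using v by simp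
  have c: "real (card (rooted_tc_graphs n)) > 0" "real (card (tc_graphs n)) > 0"
    using ne ne2 finite_rooted finite_tc_graphs by (simp_all add: card_gt_0_iff)
  show "vertex_degree_prob v k n = expected_avg_deg n * root_degree_prob k n / real k"
  \<comment> \<open>For \<open>k = 0\<close> the right-hand side is 0 by the convention for
    division, which agrees with the absence of isolated vertices.\<close>
  proof (cases "k = 0")
    case True
    have e: "{G \<in> tc_graphs n. deg G v = 0} = {}" using deg_pos[OF _ v] by force
    show ?thesis using vd unfolding True e by simp
  next
    case False
    have "real (card {(G, e) \<in> rooted_tc_graphs n. deg G (fst e) = k}) = real k * real n * real (card {G \<in> tc_graphs n. deg G v = k})"
      unfolding card_rooted_degree card_vertex_degree[OF v] by simp
    thus ?thesis unfolding vd ead rd using n c False by (simp add: field_simps)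
  qed
qed

section \<open>Coefficients of products of singular powers\<close>

text \<open>The limiting generating function will be known only for small positive \<open>w\<close>;
  such an interval already determines the coefficients.\<close>

lemma power_series_eqI:
  fixes a b :: "nat \<Rightarrow> complex"
  assumes a: "\<And>w. 0 < w \<Longrightarrow> w < \<delta> \<Longrightarrow> (\<lambda>k. a k * of_real w ^ k) sums f w"
    and b: "\<And>w. 0 < w \<Longrightarrow> w < \<delta> \<Longrightarrow> (\<lambda>k. b k * of_real w ^ k) sums f w" and \<delta>: "\<delta> > 0"
  shows "a = b"
proof
  fix n
  define c where "c k = a k - b k" for k
  have c: "(\<lambda>k. c k * of_real w ^ k) sums 0" if "0 < w" "w < \<delta>" for w
    using sums_diff[OF a[OF that] b[OF that]] by (simp add: c_def left_diff_distrib)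
  have R: "conv_radius c \<ge> \<delta>"
  proof (rule conv_radius_geI_ex')
    show "summable (\<lambda>n. c n * of_real r ^ n)" if "0 < r" "ereal r < ereal \<delta>" for r
      using c[of r] that sums_summable by auto
  qed
  obtain S where S: "open S" "of_real ` {0..<\<delta>} \<subseteq> S" "\<And>z. z \<in> S \<Longrightarrow> (\<Sum>k. c k * z ^ k) = (0::complex)"
    by (rule power_series_eq_continuation[of UNIV "\<lambda>_. 0" \<delta> c \<delta>]) (use R \<delta> c in auto)
  have 0: "0 \<in> S" using S(2) \<delta> by (auto simp: image_iff subset_iff)
  have r0: "ereal (norm (0::complex)) < conv_radius c" using R \<delta> by (auto intro: less_le_trans[of _ "ereal \<delta>"])
  have "(deriv ^^ n) (\<lambda>z. \<Sum>k. c k * z ^ k) 0 = (deriv ^^ n) (\<lambda>z. 0::complex) 0"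
  proof (rule higher_deriv_transform_within_open[OF _ _ S(1) 0])
    show "(\<lambda>z. \<Sum>k. c k * z ^ k) holomorphic_on S"
      by (rule holomorphic_transform[of "\<lambda>_. 0"]) (use S in auto)
  qed (use S in auto)
  moreover have "(deriv ^^ n) (\<lambda>z. \<Sum>k. c k * z ^ k) 0 = (\<Sum>k. (diffs ^^ n) c k * 0 ^ k)"
    by (rule higher_deriv_power_series(2)[OF r0])
  moreover have "(\<Sum>k. (diffs ^^ n) c k * 0 ^ k) = fact n * c n"
    by (simp only: powser_zero diffs_funpow) simp
  ultimately have "fact n * c n = 0" by simp
  thus "a n = b n" by (simp add: c_def)
qed

text \<open>Coefficients of \<open>(1 - z) powr (- 3/2)\<close>; the sign makes them
  positive.\<close>

definition beta_c :: "nat \<Rightarrow> real" where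
  "beta_c k = ((- 3/2) gchoose k) * (- 1) ^ k"

lemma beta_c_0 [simp]: "beta_c 0 = 1" by (simp add: beta_c_def)

lemma beta_c_Suc: "beta_c (Suc k) = beta_c k * ((real k + 3/2) / (real k + 1))"
proof -
  have "((- 3/2 :: real) gchoose Suc k) * real (Suc k) = (- 3/2 - real k) * ((- 3/2) gchoose k)"
    using gbinomial_absorb_comp[of "- 3/2 :: real" k] gbinomial_absorption[of k "- 3/2 :: real"]
    by (simp only: mult.commute[of _ "real (Suc k)"])
  hence "((- 3/2 :: real) gchoose Suc k) = (- 3/2 - real k) * ((- 3/2) gchoose k) / real (Suc k)"
    by (intro eq_divide_imp) simp_all
  thus ?thesis by (simp add: beta_c_def) (simp add: field_simps)
qed

lemma beta_c_pos: "beta_c k > 0"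
  by (induction k) (auto simp: beta_c_Suc intro!: mult_pos_pos divide_pos_pos)

lemma beta_c_mono: "j \<le> k \<Longrightarrow> beta_c j \<le> beta_c k"
proof (rule lift_Suc_mono_le[of beta_c])
  fix n
  have "beta_c n * 1 \<le> beta_c n * ((real n + 3/2) / (real n + 1))"
    using beta_c_pos[of n] by (intro mult_left_mono) auto
  thus "beta_c n \<le> beta_c (Suc n)" by (simp add: beta_c_Suc)
qed

lemma beta_c_ratio: "(\<lambda>k. beta_c (k - j) / beta_c k) \<longlonglongrightarrow> 1"
proof (induction j)
  case 0
  have "(\<lambda>k. beta_c (k - 0) / beta_c k) = (\<lambda>_. 1)" using beta_c_pos by (auto simp: fun_eq_iff less_imp_neq[symmetric])
  thus ?case by simp
next
  case (Suc j)
  have "(\<lambda>k. (real (k - j) - 1 + 1) / (real (k - j) - 1 + 3/2)) \<longlonglongrightarrow> 1" by real_asymp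
  from tendsto_mult[OF this Suc]
  have "(\<lambda>k. (real (k - j) - 1 + 1) / (real (k - j) - 1 + 3/2) * (beta_c (k - j) / beta_c k)) \<longlonglongrightarrow> 1" by simp
  moreover have "\<forall>\<^sub>F k in sequentially. (real (k - j) - 1 + 1) / (real (k - j) - 1 + 3/2) * (beta_c (k - j) / beta_c k) = beta_c (k - Suc j) / beta_c k"
    using eventually_gt_at_top[of j]
  proof eventually_elim
    case (elim k)
    define i where "i = k - Suc j"
    have i: "k - j = Suc i" using elim by (simp add: i_def)
    show ?case unfolding i i_def[symmetric] using beta_c_pos[of i] by (simp add: beta_c_Suc)
  qed
  ultimately show ?case by (rule Lim_transform_eventually)
qed

text \<open>The constant is the reciprocal of \<open>Gamma (3/2)\<close>.\<close>

lemma beta_c_asymp: "(\<lambda>k. beta_c k / sqrt (real k)) \<longlonglongrightarrow> 2 / sqrt pi"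
proof -
  have G: "Gamma (3/2 :: real) = sqrt pi / 2"
    using Gamma_plus1[of "1/2 :: real"] Gamma_one_half_real nonpos_Ints_nonpos[of "1/2 :: real"] by auto
  have "(\<lambda>n. ((- 3/2 :: real) gchoose n) / ((-1)^n / exp ((- 3/2 + 1) * of_real (ln (real n))))) \<longlonglongrightarrow> inverse (Gamma (- (- 3/2)))"
    by (rule gbinomial_asymptotic)
  hence "(\<lambda>n. ((- 3/2 :: real) gchoose n) / ((-1)^n / exp ((- 3/2 + 1) * of_real (ln (real n))))) \<longlonglongrightarrow> 2 / sqrt pi"
    by (simp add: G)
  moreover have "\<forall>\<^sub>F n in sequentially. ((- 3/2 :: real) gchoose n) / ((-1)^n / exp ((- 3/2 + 1) * of_real (ln (real n)))) = beta_c n / sqrt (real n)"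
    using eventually_gt_at_top[of 0]
  proof eventually_elim
    case (elim n)
    have "exp ((- 3/2 + 1) * of_real (ln (real n))) = inverse (sqrt (real n))"
    proof -
      have "sqrt (real n) = real n powr (1/2)" using elim by (simp add: powr_half_sqrt)
      also have "\<dots> = exp (1/2 * ln (real n))" using elim by (simp add: powr_def)
      finally show ?thesis by (simp add: exp_minus[symmetric])
    qed
    thus ?case by (cases "even n") (simp_all add: beta_c_def field_simps)
  qed
  ultimately show ?thesis by (rule Lim_transform_eventually)
qed

lemma beta_c_sums:
  assumes "\<bar>z\<bar> < 1" shows "(\<lambda>k. beta_c k * z ^ k) sums ((1 - z) powr (- 3/2))"
proof -
  have "(\<lambda>n. ((- 3/2) gchoose n) * (- z) ^ n) sums (1 + (- z)) powr (- 3/2)"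
    by (rule gen_binomial_real) (use assms in simp)
  moreover have "((- 3/2) gchoose n) * (- z) ^ n = beta_c n * z ^ n" for n
    by (simp add: beta_c_def power_minus[of z])
  ultimately show ?thesis by simp
qed

lemma norm_mult_le_left: "0 \<le> c \<Longrightarrow> 0 \<le> r \<Longrightarrow> r \<le> 1 \<Longrightarrow> norm (c * r) \<le> (c::real)"
  by (simp add: mult_left_le)

text \<open>Coefficients of the product of \<open>(1 - b * w) powr (- 3/2)\<close> and
  \<open>(1 - a * w) powr (- 3/2)\<close>.\<close>

definition conv_c :: "real \<Rightarrow> real \<Rightarrow> nat \<Rightarrow> real" where
  "conv_c a b k = (\<Sum>j\<le>k. (beta_c j * b ^ j) * (beta_c (k - j) * a ^ (k - j)))"

lemma conv_c_sums:
  assumes "0 < b" "b < a" "0 \<le> w" "a * w < 1"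
  shows "(\<lambda>k. conv_c a b k * w ^ k) sums (((1 - b * w) powr (- 3/2)) * ((1 - a * w) powr (- 3/2)))"
proof -
  have bw: "\<bar>b * w\<bar> < 1" and aw: "\<bar>a * w\<bar> < 1"
    using assms mult_right_mono[of b a w] by (auto simp: abs_mult)
  have s: "(\<lambda>k. beta_c k * z ^ k) sums ((1 - z) powr (- 3/2))" "summable (\<lambda>k. norm (beta_c k * z ^ k))" if "\<bar>z\<bar> < 1" for z
    using beta_c_sums[OF that] beta_c_sums[of "\<bar>z\<bar>"] that beta_c_pos
    by (auto simp: abs_mult power_abs less_imp_le sums_iff)
  have "(\<lambda>k. \<Sum>i\<le>k. (beta_c i * (b * w) ^ i) * (beta_c (k - i) * (a * w) ^ (k - i)))
     sums ((\<Sum>k. beta_c k * (b * w) ^ k) * (\<Sum>k. beta_c k * (a * w) ^ k))"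
    by (rule Cauchy_product_sums[OF s(2)[OF bw] s(2)[OF aw]])
  moreover have "(\<Sum>i\<le>k. (beta_c i * (b * w) ^ i) * (beta_c (k - i) * (a * w) ^ (k - i))) = conv_c a b k * w ^ k" for k
  proof -
    have "w ^ i * w ^ (k - i) = w ^ k" if "i \<le> k" for i using that by (simp flip: power_add)
    hence "(\<Sum>i\<le>k. (beta_c i * (b * w) ^ i) * (beta_c (k - i) * (a * w) ^ (k - i)))
       = (\<Sum>i\<le>k. (beta_c i * b ^ i) * (beta_c (k - i) * a ^ (k - i)) * w ^ k)"
      by (intro sum.cong) (auto simp: power_mult_distrib mult_ac)
    thus ?thesis by (simp add: conv_c_def sum_distrib_right)
  qed
  ultimately show ?thesis using s(1)[OF bw] s(1)[OF aw] by (simp add: sums_iff)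
qed

text \<open>As \<open>b < a\<close>, the factor with \<open>b\<close> is regular at the dominant
  singularity \<open>1 / a\<close> and contributes its value there. Tannery's theorem applies
  because \<open>beta_c\<close> increases, so that the ratios
  \<open>beta_c (k - j) / beta_c k\<close> are at most 1.\<close>

lemma conv_c_asymp:
  assumes "0 < b" "b < a"
  shows "(\<lambda>k. conv_c a b k / (a ^ k * sqrt (real k))) \<longlonglongrightarrow> 2 / sqrt pi * (1 - b / a) powr (- 3/2)"
proof -
  define z where "z = b / a"
  have z: "0 < z" "z < 1" and a: "a > 0" using assms by (simp_all add: z_def)
  have zs: "(\<lambda>k. beta_c k * z ^ k) sums ((1 - z) powr (- 3/2))" using beta_c_sums[of z] z by simp
  have "(\<lambda>k. \<Sum>j. (if j \<le> k then beta_c j * z ^ j * (beta_c (k - j) / beta_c k) else 0)) \<longlonglongrightarrow> (\<Sum>j. beta_c j * z ^ j)"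
  proof (rule tannerys_theorem[where M = "\<lambda>j. beta_c j * z ^ j", THEN conjunct2, THEN conjunct2])
    fix j
    have "(\<lambda>k. beta_c j * z ^ j * (beta_c (k - j) / beta_c k)) \<longlonglongrightarrow> beta_c j * z ^ j * 1"
      by (intro tendsto_mult tendsto_const beta_c_ratio)
    hence "(\<lambda>k. beta_c j * z ^ j * (beta_c (k - j) / beta_c k)) \<longlonglongrightarrow> beta_c j * z ^ j" by simp
    thus "((\<lambda>k. if j \<le> k then beta_c j * z ^ j * (beta_c (k - j) / beta_c k) else 0) \<longlongrightarrow> beta_c j * z ^ j) sequentially"
      by (rule Lim_transform_eventually) (auto intro: eventually_sequentiallyI[of j])
  next
    show "\<forall>\<^sub>F (j, k) in at_top \<times>\<^sub>F sequentially. norm (if j \<le> k then beta_c j * z ^ j * (beta_c (k - j) / beta_c k) else 0) \<le> beta_c j * z ^ j"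
    proof (rule always_eventually, clarify)
      fix j k
      have "beta_c (k - j) / beta_c k \<le> 1" "0 \<le> beta_c (k - j) / beta_c k"
        using beta_c_mono[of "k - j" k] beta_c_pos[of k] beta_c_pos[of "k - j"] by (simp_all add: less_imp_le)
      moreover have "0 \<le> beta_c j * z ^ j" using beta_c_pos[of j] z by simp
      ultimately have "norm (beta_c j * z ^ j * (beta_c (k - j) / beta_c k)) \<le> beta_c j * z ^ j"
        by (intro norm_mult_le_left)
      thus "norm (if j \<le> k then beta_c j * z ^ j * (beta_c (k - j) / beta_c k) else 0) \<le> beta_c j * z ^ j"
        using \<open>0 \<le> beta_c j * z ^ j\<close> by simp
    qed
    show "summable (\<lambda>j. beta_c j * z ^ j)" using zs by (rule sums_summable)
  qed auto
  also have "(\<Sum>j. beta_c j * z ^ j) = (1 - z) powr (- 3/2)" using zs by (simp add: sums_iff)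
  finally have t: "(\<lambda>k. (\<Sum>j. (if j \<le> k then beta_c j * z ^ j * (beta_c (k - j) / beta_c k) else 0)) * (beta_c k / sqrt (real k)))
     \<longlonglongrightarrow> (1 - z) powr (- 3/2) * (2 / sqrt pi)"
    by (intro tendsto_mult beta_c_asymp)
  have "(\<Sum>j. (if j \<le> k then beta_c j * z ^ j * (beta_c (k - j) / beta_c k) else 0)) * (beta_c k / sqrt (real k)) = conv_c a b k / (a ^ k * sqrt (real k))" for k
  proof -
    have "(\<Sum>j. (if j \<le> k then beta_c j * z ^ j * (beta_c (k - j) / beta_c k) else 0)) = (\<Sum>j\<le>k. beta_c j * z ^ j * (beta_c (k - j) / beta_c k))"
      by (subst suminf_finite[of "{..k}"]) auto
    moreover have "beta_c j * z ^ j * (beta_c (k - j) / beta_c k) = (beta_c j * b ^ j) * (beta_c (k - j) * a ^ (k - j)) / (a ^ k * beta_c k)" if "j \<le> k" for j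
    proof -
      have "a ^ k = a ^ j * a ^ (k - j)" using that by (simp flip: power_add)
      thus ?thesis using a beta_c_pos[of k] by (simp add: z_def power_divide)
    qed
    ultimately have "(\<Sum>j. (if j \<le> k then beta_c j * z ^ j * (beta_c (k - j) / beta_c k) else 0)) = conv_c a b k / (a ^ k * beta_c k)"
      by (simp add: conv_c_def sum_divide_distrib)
    thus ?thesis using beta_c_pos[of k] by simp
  qed
  with t show ?thesis by (simp add: z_def mult.commute)
qed

section \<open>Coefficient asymptotics for z = 1\<close>

lemma Re_csqrt_pos: "Re z > 0 \<Longrightarrow> Re (csqrt z) > 0"
  by (metis csqrt_0 Re_csqrt le_less less_irrefl zero_complex.sel(1) power2_csqrt Re_power2 diff_0 neg_less_0_iff_less not_less zero_le_power2 zero_power2)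

text \<open>For \<open>z = 1\<close> the variable \<open>u\<close> is a uniformizer, and \<open>q2\<close> has a holomorphic square root on the disc
  of radius \<open>11/20 > ucrit\<close> when \<open>w = 1\<close> or \<open>w\<close> is small.\<close>

lemma cubic_lower:
  fixes u :: complex assumes "norm u < 11/20" shows "norm ((1 + u) ^ 3 + 2 * (1 + u) + 1) \<ge> 1/10" "norm ((1 + u) ^ 3 + 2 * (1 + u) + 1) \<le> 8"
    "norm (2 + (1 + u) + 2 * (1 + u)\<^sup>2 - (1 + u) ^ 3) \<ge> 1"
proof -
  have b: "norm (a * u + b * u\<^sup>2 + c * u ^ 3) \<le> norm a * (11/20) + norm b * (11/20)\<^sup>2 + norm c * (11/20) ^ 3" for a b c :: complex
  proof -
    have "norm (a * u + b * u\<^sup>2 + c * u ^ 3) \<le> norm (a * u) + norm (b * u\<^sup>2) + norm (c * u ^ 3)"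
      by (meson add_right_mono norm_triangle_ineq order_trans)
    also have "\<dots> \<le> norm a * (11/20) + norm b * (11/20)\<^sup>2 + norm c * (11/20) ^ 3"
      unfolding norm_mult norm_power using assms by (intro add_mono mult_left_mono power_mono) auto
    finally show ?thesis .
  qed
  \<comment> \<open>This cubic is the square root of \<open>q2\<close> for \<open>w = 0\<close>. At
    radius 11/20 its nonconstant part is still smaller than the constant term 4.\<close>
  have e1: "(1 + u) ^ 3 + 2 * (1 + u) + 1 = 4 + (5 * u + 3 * u\<^sup>2 + 1 * u ^ 3)"
    by (simp add: power2_eq_square power3_eq_cube algebra_simps)
  have b1: "norm (5 * u + 3 * u\<^sup>2 + 1 * u ^ 3) \<le> 39/10" using b[of 5 3 1] by (simp add: power2_eq_square power3_eq_cube)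
  show "norm ((1 + u) ^ 3 + 2 * (1 + u) + 1) \<ge> 1/10"
    unfolding e1 using norm_diff_ineq[of 4 "5 * u + 3 * u\<^sup>2 + 1 * u ^ 3"] b1 by simp
  show "norm ((1 + u) ^ 3 + 2 * (1 + u) + 1) \<le> 8"
    unfolding e1 using norm_triangle_ineq[of 4 "5 * u + 3 * u\<^sup>2 + 1 * u ^ 3"] b1 by simp
  \<comment> \<open>This cubic is the square root of \<open>q2\<close> for \<open>w = 1\<close>, see
    \<open>q2_one\<close>.\<close>
  have e2: "2 + (1 + u) + 2 * (1 + u)\<^sup>2 - (1 + u) ^ 3 = 4 + (2 * u + (- 1) * u\<^sup>2 + (- 1) * u ^ 3)"
    by (simp add: power2_eq_square power3_eq_cube algebra_simps)
  have b2: "norm (2 * u + (- 1) * u\<^sup>2 + (- 1) * u ^ 3) \<le> 3" using b[of 2 "-1" "-1"] by (simp add: power2_eq_square power3_eq_cube)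
  show "norm (2 + (1 + u) + 2 * (1 + u)\<^sup>2 - (1 + u) ^ 3) \<ge> 1"
    unfolding e2 using norm_diff_ineq[of 4 "2 * u + (- 1) * u\<^sup>2 + (- 1) * u ^ 3"] b2 by simp
qed

text \<open>Positivity of the real part on the real segment selects the branch that agrees with
  \<open>csqrt\<close> in the closed form.\<close>

definition sqbranch :: "complex \<Rightarrow> (complex \<Rightarrow> complex) \<Rightarrow> bool" where
  "sqbranch w \<sigma> \<longleftrightarrow> \<sigma> holomorphic_on ball 0 (11/20) \<and> (\<forall>u\<in>ball 0 (11/20). (\<sigma> u)\<^sup>2 = q2 (1 + u) w \<and> \<sigma> u \<noteq> 0) \<and>
     (\<forall>t. 0 \<le> t \<and> t < 11/20 \<longrightarrow> Re (\<sigma> (of_real t)) > 0 )"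

lemma q2_one: "q2 y 1 = (2 + y + 2 * y\<^sup>2 - y ^ 3)\<^sup>2"
  by (simp add: q2_def power2_eq_square power3_eq_cube power4_eq_xxxx algebra_simps)

lemma sqbranch_one: "\<exists>\<sigma>. sqbranch 1 \<sigma>"
proof
  define \<sigma> where "\<sigma> u = 2 + (1 + u) + 2 * (1 + u)\<^sup>2 - (1 + u) ^ 3" for u :: complex
  have "Re (\<sigma> (of_real t)) > 0" if "0 \<le> t" "t < 11/20" for t :: real
  proof -
    have "t * t \<le> 1 * t" using that by (intro mult_right_mono) auto
    moreover from calculation have "t * t * t \<le> 1 * t" using that by (intro mult_right_mono) auto
    moreover have "Re (\<sigma> (of_real t)) = 4 + 2 * t - t * t - t * t * t"
      by (simp add: \<sigma>_def power2_eq_square power3_eq_cube algebra_simps)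
    ultimately show ?thesis using that by linarith
  qed
  moreover have "\<sigma> u \<noteq> 0" if "u \<in> ball 0 (11/20)" for u
    using cubic_lower(3)[of u] that by (auto simp: \<sigma>_def)
  ultimately show "sqbranch 1 \<sigma>"
    unfolding sqbranch_def by (auto simp: \<sigma>_def[abs_def] q2_one intro!: holomorphic_intros)
qed

text \<open>\<open>q2\<close> is the square of a zero-free cubic minus \<open>w * h\<close>. With
  the bounds 1/10 for the cubic and 200 for \<open>h\<close>, the relative perturbation
  \<open>p\<close> is at most \<open>20000 * w\<close> in modulus, so \<open>1 - p\<close> stays in
  the right half-plane.\<close>

lemma sqbranch_small:
  fixes w :: real
  assumes w: "0 < w" "w < 1 / 200000" shows "\<exists>\<sigma>. sqbranch (of_real w) \<sigma>"
proof -
  define g where "g u = (1 + u) ^ 3 + 2 * (1 + u) + 1" for u :: complex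
  define h where "h u = 2 * u * (2 * (1 + u) ^ 4 + 3 * (1 + u) ^ 3 + 4 * (1 + u)\<^sup>2 + 2 * (1 + u) + 1) - of_real w * u\<^sup>2" for u :: complex
  define p where "p u = of_real w * h u / (g u)\<^sup>2" for u
  have q: "q2 (1 + u) (of_real w) = (g u)\<^sup>2 - of_real w * h u" for u
    unfolding q2_def g_def h_def by algebra
  have g0: "norm (g u) \<ge> 1/10" if "norm u < 11/20" for u using cubic_lower(1)[OF that] by (simp add: g_def)
  have h1: "norm (h u) \<le> 200" if "norm u < 11/20" for u
  proof -
    have n: "norm (1 + u) \<le> 2" using norm_triangle_ineq[of 1 u] that by simp
    have "norm (2 * (1 + u) ^ 4 + 3 * (1 + u) ^ 3 + 4 * (1 + u)\<^sup>2 + 2 * (1 + u) + 1)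
      \<le> norm (2 * (1 + u) ^ 4) + norm (3 * (1 + u) ^ 3) + norm (4 * (1 + u)\<^sup>2) + norm (2 * (1 + u)) + norm (1::complex)"
      by (meson add_right_mono norm_triangle_ineq order_trans)
    also have "\<dots> \<le> 2 * 2 ^ 4 + 3 * 2 ^ 3 + 4 * 2\<^sup>2 + 2 * 2 + 1"
      unfolding norm_mult norm_power using n by (intro add_mono mult_mono power_mono) auto
    finally have 1: "norm (2 * (1 + u) ^ 4 + 3 * (1 + u) ^ 3 + 4 * (1 + u)\<^sup>2 + 2 * (1 + u) + 1) \<le> 77" by simp
    have "norm (h u) \<le> norm (2 * u * (2 * (1 + u) ^ 4 + 3 * (1 + u) ^ 3 + 4 * (1 + u)\<^sup>2 + 2 * (1 + u) + 1)) + norm (of_real w * u\<^sup>2)"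
      unfolding h_def by (rule norm_triangle_ineq4)
    also have "\<dots> \<le> (2 * (11/20)) * 77 + 1 * 1"
      unfolding norm_mult norm_power using 1 that w
      by (intro add_mono mult_mono) (auto simp: power_le_one)
    finally show ?thesis by simp
  qed
  have p1: "norm (p u) < 1" if "norm u < 11/20" for u
  proof -
    have "w * 200 / (1/10)\<^sup>2 < 1" using w by (simp add: power2_eq_square)
    moreover have "norm (p u) \<le> (w * 200) / (1/10)\<^sup>2"
      unfolding p_def norm_divide norm_mult norm_power using g0[OF that] h1[OF that] w
      by (intro frac_le mult_mono power_mono) auto
    ultimately show ?thesis by linarith
  qed
  have Re: "Re (1 - p u) > 0" if "norm u < 11/20" for u using p1[OF that] complex_Re_le_cmod[of "p u"] by simp
  have nn: "1 - p u \<notin> \<real>\<^sub>\<le>\<^sub>0" if "norm u < 11/20" for u using Re[OF that] complex_nonpos_Reals_iff[of "1 - p u"] by linarith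
  define \<sigma> where "\<sigma> u = g u * csqrt (1 - p u)" for u
  have gnz: "g u \<noteq> 0" if "norm u < 11/20" for u using g0[OF that] by auto
  have hp: "(\<lambda>u. 1 - p u) holomorphic_on ball 0 (11/20)"
    unfolding p_def g_def h_def using gnz by (intro holomorphic_intros) (auto simp: g_def)
  have hg: "g holomorphic_on ball 0 (11/20)" unfolding g_def by (intro holomorphic_intros)
  have "(\<lambda>u. csqrt (1 - p u)) holomorphic_on ball 0 (11/20)"
    by (rule holomorphic_on_compose_gen[OF hp holomorphic_on_csqrt, unfolded o_def]) (use nn in auto)
  from holomorphic_on_mult[OF hg this] have hol: "\<sigma> holomorphic_on ball 0 (11/20)" by (simp add: \<sigma>_def[abs_def])
  have sq: "(\<sigma> u)\<^sup>2 = q2 (1 + u) (of_real w) \<and> \<sigma> u \<noteq> 0" if "u \<in> ball 0 (11/20)" for u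
  proof -
    have u: "norm u < 11/20" using that by simp
    have "(\<sigma> u)\<^sup>2 = (g u)\<^sup>2 * (1 - p u)" by (simp add: \<sigma>_def power_mult_distrib)
    also have "\<dots> = (g u)\<^sup>2 - of_real w * h u" using gnz[OF u] by (simp add: p_def algebra_simps)
    finally show ?thesis using q gnz[OF u] nn[OF u] by (auto simp: \<sigma>_def)
  qed
  have "Re (\<sigma> (of_real t)) > 0" if t: "0 \<le> t" "t < 11/20" for t :: real
  proof -
    have u: "norm (of_real t :: complex) < 11/20" using t by simp
    define r where "r = (1 + t) ^ 3 + 2 * (1 + t) + 1"
    have "g (of_real t) = of_real r" by (simp add: g_def r_def)
    moreover have "r > 0" using t by (simp add: r_def add_pos_nonneg add_nonneg_pos)
    moreover have "Re (csqrt (1 - p (of_real t))) > 0"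
      using Re_csqrt_pos[OF Re[OF u]] .
    ultimately show ?thesis by (simp add: \<sigma>_def)
  qed
  with hol sq show ?thesis unfolding sqbranch_def by blast
qed

text \<open>Lagrange's formula is applied to the second derivative of the series. For the series
  itself and for its first derivative the amplitude contains the derivative of
  \<open>u / (chi u)\<^sup>2\<close> and vanishes at the saddle; for the second derivative it is the
  \<open>u\<close>-derivative of \<open>Gdiag\<close>. The two differentiations produce the factors
  \<open>m + 2\<close> and \<open>m + 1\<close>.\<close>

theorem diag_asymptotics:
  fixes \<nu> :: "nat \<Rightarrow> complex" and w :: real
  assumes br: "sqbranch (of_real w) \<sigma>" and w: "0 < w" "w \<le> 1"
    and \<delta>: "\<delta> > 0"
    and eq: "\<And>t. 0 < t \<Longrightarrow> t < \<delta> \<Longrightarrow> (\<lambda>n. \<nu> n * of_real (t / (2 + 2 * t + t\<^sup>2)\<^sup>2) ^ n) sums Ndiag (\<sigma> (of_real t)) (1 + of_real t) (of_real w)"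
  shows "(\<lambda>m. of_real (sqrt (real (Suc m)) * (ucrit / chi0\<^sup>2) ^ Suc m) * (of_nat (Suc (Suc m)) * of_nat (Suc m) * \<nu> (Suc (Suc m))))
    \<longlonglongrightarrow> of_real (ucrit / (2 * pi) * sqrt (pi / ksigma)) * ((42496 - 15872 * s7) / 243 * ((1 + of_real w) * hq (of_real w)))"
proof -
  define W where "W = complex_of_real w"
  define X where "X u = u / (chi u)\<^sup>2" for u
  define Xr where "Xr t = t / (2 + 2 * t + t\<^sup>2)\<^sup>2" for t :: real
  have XXr: "X (of_real t) = of_real (Xr t)" for t by (simp add: X_def Xr_def chi_def)
  have Xrp: "0 < Xr t" if "0 < t" for t
    using that unfolding Xr_def by (intro divide_pos_pos zero_less_power) (auto intro!: add_pos_nonneg)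
  have Xrt: "Xr t \<le> t" if "0 < t" for t
  proof -
    have "1 \<le> (2 + 2 * t + t\<^sup>2)\<^sup>2" using that by (intro one_le_power) (simp add: add_nonneg_nonneg)
    hence "t * 1 \<le> t * (2 + 2 * t + t\<^sup>2)\<^sup>2" using that by (intro mult_left_mono) auto
    moreover have "(2 + 2 * t + t\<^sup>2)\<^sup>2 > 0" using \<open>1 \<le> (2 + 2 * t + t\<^sup>2)\<^sup>2\<close> by linarith
    ultimately show ?thesis by (simp add: Xr_def pos_divide_le_eq)
  qed
  define \<rho> where "\<rho> = Xr (\<delta> / 2)"
  have \<rho>: "\<rho> > 0" using \<delta> Xrp by (simp add: \<rho>_def)
  have R: "conv_radius \<nu> \<ge> \<rho>"
  proof -
    have "summable (\<lambda>n. \<nu> n * of_real \<rho> ^ n)"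
      using eq[of "\<delta> / 2"] \<delta> sums_summable by (simp add: \<rho>_def Xr_def)
    from conv_radius_geI[OF this] \<rho> show ?thesis by simp
  qed
  define f where "f x = (\<Sum>n. \<nu> n * x ^ n)" for x
  have fh: "f holomorphic_on ball 0 \<rho>"
    unfolding f_def
  proof (rule holomorphic_on_subset[OF power_series_holomorphic], rule subsetI)
    fix z :: complex assume "z \<in> ball 0 \<rho>"
    hence "ereal (norm z) < ereal \<rho>" by auto
    also note R
    finally show "z \<in> eball 0 (conv_radius \<nu>)" by (simp add: eball_def)
  qed
  define N where "N u = Ndiag (\<sigma> u) (1 + u) W" for u
  define Gd where "Gd u = Gdiag (\<sigma> u) (1 + u) W" for u
  define B where "B = ball (0::complex) (11/20)"
  have \<sigma>: "\<sigma> holomorphic_on B" "\<And>u. u \<in> B \<Longrightarrow> (\<sigma> u)\<^sup>2 = q2 (1 + u) W" "\<And>u. u \<in> B \<Longrightarrow> \<sigma> u \<noteq> 0"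
    "\<And>t. 0 \<le> t \<Longrightarrow> t < 11/20 \<Longrightarrow> Re (\<sigma> (of_real t)) > 0"
    using br by (auto simp: sqbranch_def B_def W_def)
  have oB: "open B" by (simp add: B_def)
  have nz: "1 + u \<noteq> 0" "2 + u \<noteq> 0" "chi u \<noteq> 0" if "u \<in> B" for u
  proof -
    have u: "norm u < 11/20" using that by (simp add: B_def)
    show "1 + u \<noteq> 0" using u by (auto simp: add_eq_0_iff)
    show "2 + u \<noteq> 0" using u by (auto simp: add_eq_0_iff)
    show "chi u \<noteq> 0" by (rule chi_nonzero[OF u])
  qed
  have d\<sigma>: "(\<sigma> has_field_derivative (q2' (1 + u) W / (2 * \<sigma> u))) (at u)" if "u \<in> B" for u
    by (rule N_diag_deriv[OF \<sigma>(1) oB that \<sigma>(2)]) (use that \<sigma>(3) in auto)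
  have dN: "(N has_field_derivative (1 + 4 * (1 + u) - 3 * (1 + u)\<^sup>2) / (1 + (1 + u)\<^sup>2) ^ 3 * Gd u) (at u)" if "u \<in> B" for u
    unfolding N_def Gd_def by (rule Ndiag_has_derivative[where \<sigma> = \<sigma>, OF d\<sigma>]) (use that \<sigma> nz in auto)
  have dX: "(X has_field_derivative (1 + 4 * (1 + u) - 3 * (1 + u)\<^sup>2) / (1 + (1 + u)\<^sup>2) ^ 3) (at u)" if "u \<in> B" for u
    unfolding X_def by (rule X_deriv[OF nz(3)[OF that]])
  have Gh: "Gd holomorphic_on B"
    unfolding Gd_def Gdiag_def rhoq_def bp_def
    by (intro holomorphic_intros \<sigma>(1)) (use \<sigma>(3) nz in \<open>auto simp: add.assoc[symmetric]\<close>)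
  have Xh: "X holomorphic_on B" unfolding X_def chi_def by (intro holomorphic_intros) (use nz(3) in \<open>auto simp: chi_def\<close>)
  have Nh: "N holomorphic_on B" using dN by (intro holomorphic_onI) (auto simp: field_differentiable_def intro: has_field_derivative_at_within)
  have X0: "X 0 = 0" by (simp add: X_def)
  have B0: "0 \<in> B" by (simp add: B_def)
  have "isCont X 0" using dX[OF B0] DERIV_isCont by blast
  hence "\<forall>\<^sub>F u in nhds 0. dist (X u) (X 0) < \<rho>" using \<rho> by (metis isCont_def tendsto_nhds_iff tendstoD)
  then obtain \<epsilon>0 where \<epsilon>0: "\<epsilon>0 > 0" "\<And>u. dist u 0 < \<epsilon>0 \<Longrightarrow> dist (X u) (X 0) < \<rho>"
    unfolding eventually_nhds_metric by blast
  define \<epsilon> where "\<epsilon> = min \<epsilon>0 (min \<delta> (1/10))"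
  have \<epsilon>: "\<epsilon> > 0" "\<epsilon> \<le> \<epsilon>0" "\<epsilon> \<le> \<delta>" "\<epsilon> \<le> 1/10" using \<epsilon>0 \<delta> by (auto simp: \<epsilon>_def)
  define C where "C = ball (0::complex) \<epsilon>"
  have CB: "C \<subseteq> B" using \<epsilon> by (auto simp: C_def B_def)
  have XC: "X u \<in> ball 0 \<rho>" if "u \<in> C" for u using \<epsilon>0(2)[of u] \<epsilon> that X0 by (simp add: C_def dist_commute)
  have cubenz: "1 + 4 * (1 + u) - 3 * (1 + u)\<^sup>2 \<noteq> 0" "1 + (1 + u)\<^sup>2 \<noteq> 0" if "u \<in> C" for u
  proof -
    have u: "norm u < 1/10" using that \<epsilon> by (simp add: C_def)
    have "norm (2 * u + 3 * u\<^sup>2) \<le> 2 * norm u + 3 * (norm u)\<^sup>2"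
      by (rule order_trans[OF norm_triangle_ineq]) (simp add: norm_mult norm_power)
    also have "\<dots> \<le> 2 * (1/10) + 3 * (1/10)\<^sup>2" using u by (intro add_mono mult_left_mono power_mono) auto
    finally have "norm (2 * u + 3 * u\<^sup>2) < norm (2::complex)" by (simp add: power2_eq_square)
    hence "2 * u + 3 * u\<^sup>2 \<noteq> 2" by auto
    thus "1 + 4 * (1 + u) - 3 * (1 + u)\<^sup>2 \<noteq> 0" by (auto simp: power2_eq_square algebra_simps)
    have "1 + (1 + u)\<^sup>2 = chi u" by (simp add: chi_def power2_eq_square algebra_simps)
    thus "1 + (1 + u)\<^sup>2 \<noteq> 0" using nz(3) that CB by auto
  qed
  have fX: "f (X u) = N u" if "u \<in> C" for u
  proof -
    have lim: "complex_of_real (\<epsilon>/2) islimpt of_real ` {\<epsilon>/4<..<\<epsilon>}" by (rule of_real_islimpt) (use \<epsilon> in auto)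
    have "f (X u) - N u = 0"
    proof (rule analytic_continuation[where f = "\<lambda>u. f (X u) - N u" and S = C, OF _ _ _ _ _ lim])
      show "(\<lambda>u. f (X u) - N u) holomorphic_on C"
        by (intro holomorphic_on_diff holomorphic_on_subset[OF Nh CB]
            holomorphic_on_compose_gen[OF holomorphic_on_subset[OF Xh CB] fh, unfolded o_def]) (use XC in auto)
      show "of_real ` {\<epsilon>/4<..<\<epsilon>} \<subseteq> C" "of_real (\<epsilon>/2) \<in> C" using \<epsilon> by (auto simp: C_def)
      fix z assume "z \<in> complex_of_real ` {\<epsilon>/4<..<\<epsilon>}"
      then obtain t where t: "z = of_real t" "\<epsilon>/4 < t" "t < \<epsilon>" by auto
      have "(\<lambda>n. \<nu> n * of_real (Xr t) ^ n) sums N (of_real t)"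
        using eq[of t] t \<epsilon> by (simp add: Xr_def N_def W_def)
      thus "f (X z) - N z = 0" by (simp add: f_def XXr t sums_iff)
    qed (use that in \<open>auto simp: C_def\<close>)
    thus ?thesis by simp
  qed
  have f1: "deriv f (X u) = Gd u" if u: "u \<in> C" for u
  proof -
    have oC: "open C" by (simp add: C_def)
    have dfX: "((\<lambda>u. f (X u)) has_field_derivative deriv f (X u) * ((1 + 4 * (1 + u) - 3 * (1 + u)\<^sup>2) / (1 + (1 + u)\<^sup>2) ^ 3)) (at u)"
      by (rule DERIV_chain2[OF holomorphic_derivI[OF fh open_ball XC[OF u]] dX]) (use u CB in auto)
    have "((\<lambda>u. f (X u)) has_field_derivative ((1 + 4 * (1 + u) - 3 * (1 + u)\<^sup>2) / (1 + (1 + u)\<^sup>2) ^ 3 * Gd u)) (at u)"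
      by (rule has_field_derivative_transform_within_open[OF dN oC u]) (use u CB fX in auto)
    from DERIV_unique[OF dfX this] show ?thesis using cubenz[OF u] by simp
  qed
  define H where "H = deriv Gd"
  have Hh: "H holomorphic_on B" unfolding H_def by (intro holomorphic_deriv Gh oB)
  define f2 where "f2 = deriv (deriv f)"
  have f1h: "deriv f holomorphic_on ball 0 \<rho>" by (intro holomorphic_deriv fh open_ball)
  have f2h: "f2 holomorphic_on ball 0 \<rho>" unfolding f2_def by (intro holomorphic_deriv f1h open_ball)
  have HX: "H u = f2 (X u) * deriv X u" if u: "u \<in> C" for u
  proof -
    have oC: "open C" by (simp add: C_def)
    have uB: "u \<in> B" using u CB by auto
    have "((\<lambda>u. deriv f (X u)) has_field_derivative f2 (X u) * deriv X u) (at u)"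
      unfolding f2_def
      by (rule DERIV_chain2[OF holomorphic_derivI[OF f1h open_ball XC[OF u]] holomorphic_derivI[OF Xh oB uB]])
    hence "(Gd has_field_derivative f2 (X u) * deriv X u) (at u)"
      by (rule has_field_derivative_transform_within_open[OF _ oC u]) (use f1 in auto)
    thus ?thesis unfolding H_def by (rule DERIV_imp_deriv)
  qed
  have S: "(\<lambda>m. of_real (sqrt (real (Suc m)) * (ucrit / chi0\<^sup>2) ^ Suc m) * ((deriv ^^ m) f2 0 / fact m))
      \<longlonglongrightarrow> of_real (ucrit / (2 * pi) * sqrt (pi / ksigma)) * H (of_real ucrit)"
  proof (rule saddle_coefficients[OF f2h \<rho> _ _ \<epsilon>(1)])
    show "H holomorphic_on ball 0 (11/20)" using Hh by (simp add: B_def)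
    fix u :: complex assume "norm u < \<epsilon>"
    hence "u \<in> C" by (simp add: C_def)
    thus "H u = f2 (u / (chi u)\<^sup>2) * deriv (\<lambda>u. u / (chi u)\<^sup>2) u"
      using HX[of u] by (simp add: X_def[abs_def])
  qed
  have co: "(deriv ^^ m) f2 0 / fact m = of_nat (Suc (Suc m)) * of_nat (Suc m) * \<nu> (Suc (Suc m))" for m
  proof -
    have r0: "ereal (norm (0::complex)) < conv_radius \<nu>" using R \<rho> by (auto intro: less_le_trans[of _ "ereal \<rho>"])
    have "(deriv ^^ m) f2 0 = (deriv ^^ (Suc (Suc m))) f 0"
      unfolding f2_def by (simp only: funpow_Suc_right o_apply)
    also have "\<dots> = (\<Sum>k. (diffs ^^ Suc (Suc m)) \<nu> k * 0 ^ k)"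
      unfolding f_def by (rule higher_deriv_power_series(2)[OF r0])
    also have "\<dots> = fact (Suc (Suc m)) * \<nu> (Suc (Suc m))"
      by (simp only: powser_zero diffs_funpow) simp
    finally show ?thesis by (simp add: mult_ac)
  qed
  have Hc: "H (of_real ucrit) = (42496 - 15872 * s7) / 243 * ((1 + W) * hq W)"
  proof -
    have uB: "of_real ucrit \<in> B" using ucrit_bounds by (simp add: B_def)
    have y: "1 + complex_of_real ucrit = (2 + s7) / 3" by (simp add: ucrit_def s7_def field_simps)
    define gc :: real where "gc = (113 + 37 * sqrt 7) / 27"
    have gc: "gc > 0" "(113 + 37 * s7) / 27 = of_real gc" by (simp_all add: gc_def s7_def add_pos_nonneg)
    define S where "S = \<sigma> (of_real ucrit) / of_real gc"
    have s1: "\<sigma> (of_real ucrit) = (113 + 37 * s7) / 27 * S" using gc by (simp add: S_def gc(2))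
    have "(\<sigma> (of_real ucrit))\<^sup>2 = ((113 + 37 * s7) / 27)\<^sup>2 * qn W"
      using \<sigma>(2)[OF uB] unfolding y q2_crit .
    hence s2: "S\<^sup>2 = qn W" using gc by (simp add: S_def power_divide gc(2))
    have s3: "S \<noteq> 0" using \<sigma>(3)[OF uB] gc by (simp add: S_def)
    have "Re S = Re (\<sigma> (of_real ucrit)) / gc" by (simp add: S_def)
    moreover have "Re (\<sigma> (of_real ucrit)) > 0" using \<sigma>(4)[of ucrit] ucrit_bounds by simp
    ultimately have "Re S > 0" using gc by simp
    \<comment> \<open>Positivity of the real part of \<sigma> at the critical point makes
      \<open>S\<close> the principal square root.\<close>
    hence cs: "csqrt (qn W) = S" by (intro csqrt_unique s2) simp
    have "(Gd has_field_derivative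
     (42496 - 15872 * s7) / 243 * ((1 + W) * ((15 + 7 * s7) / 64 + (17 - 7 * s7) / 64 * W + kn W / S ^ 3))) (at (of_real ucrit))"
      unfolding Gd_def by (rule Gdiag_deriv_crit[where \<sigma> = \<sigma>, OF d\<sigma>[OF uB] y s1 s2 s3])
    thus ?thesis unfolding H_def hq_def cs by (rule DERIV_imp_deriv)
  qed
  show ?thesis using S unfolding co Hc W_def .
qed

section \<open>Continuation of the closed form\<close>

text \<open>At the critical point the contraction factor is 1 and the estimates of the iteration
  give nothing. Instead, off a neighbourhood of \<open>u0\<close> the function
  \<open>norm (u - Phi x0 z0 u)\<close> has a positive minimum, by compactness and uniqueness of the
  fixed point, whereas \<open>usol\<close> is almost fixed by the limiting map.\<close>

lemma usol_tendsto:
  assumes Z: "Z > 0"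
    and ev: "\<forall>\<^sub>F s in F. norm (x s * z s) < r_fun Z * Z \<and> norm (z s) \<le> Z"
    and lim: "(x \<longlongrightarrow> x0) F" "(z \<longlongrightarrow> z0) F"
    and x0: "norm (x0 * z0) \<le> r_fun Z * Z" "norm z0 \<le> Z" and u0: "norm u0 \<le> u0_fun Z" "Phi x0 z0 u0 = u0"
  shows "((\<lambda>s. usol (x s) (z s)) \<longlongrightarrow> u0) F"
proof (rule topological_tendstoI)
  fix S assume S: "open S" "u0 \<in> S"
  define a where "a = u0_fun Z"
  have a: "a > 0" using u0_fun_props[OF Z] by (simp add: a_def)
  define U where "U s = usol (x s) (z s)" for s
  have rZ: "r_fun Z * Z > 0" using u0_fun_props[OF Z] Z by simp
  have Up: "norm (U s) \<le> a \<and> Phi (x s) (z s) (U s) = U s" if "norm (x s * z s) < r_fun Z * Z \<and> norm (z s) \<le> Z" for s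
  proof -
    define \<sigma> where "\<sigma> = norm (x s * z s) / (r_fun Z * Z)"
    have \<sigma>: "0 \<le> \<sigma>" "\<sigma> < 1" "norm (x s * z s) \<le> \<sigma> * (r_fun Z * Z)"
      using that rZ Z u0_fun_props(3)[OF Z] by (simp_all add: \<sigma>_def del: norm_mult)
    have "norm (U s) \<le> \<sigma> * a" "Phi (x s) (z s) (U s) = U s"
      using usol_props[OF Z \<sigma>(3) _ \<sigma>(1,2)] that by (simp_all add: U_def a_def)
    moreover have "\<sigma> * a \<le> 1 * a" using \<sigma> a by (intro mult_right_mono) auto
    ultimately show ?thesis by simp
  qed
  define g where "g u = norm (u - Phi x0 z0 u)" for u
  have K: "compact (cball 0 a - S)" using S by (intro compact_diff) auto
  have "\<forall>\<^sub>F s in F. U s \<in> S"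
  proof (cases "cball 0 a - S = {}")
    case True
    show ?thesis using ev
    proof eventually_elim
      case (elim s)
      have "U s \<in> cball 0 a" using Up[OF elim] by simp
      thus ?case using True by blast
    qed
  next
    case False
    have "continuous_on (cball 0 a - S) g" unfolding g_def Phi_def by (intro continuous_intros)
    then obtain m where m: "m \<in> cball 0 a - S" "\<And>u. u \<in> cball 0 a - S \<Longrightarrow> g m \<le> g u"
      using continuous_attains_inf[OF K False] by blast
    have gm: "g m > 0"
    proof (rule ccontr)
      assume "\<not> ?thesis"
      hence "Phi x0 z0 m = m" by (simp add: g_def)
      hence "m = u0" using Phi_fixpoint_unique[OF Z x0 _ u0(1) _ u0(2), of m] m by (simp add: a_def)
      thus False using m S by simp
    qed
    \<comment> \<open>Differences of the coefficients of the two maps, written as polynomials in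
      \<open>(1 + u)\<^sup>2\<close>.\<close>
    define p where "p j s = x s * z s * z s ^ j - x0 * z0 * z0 ^ j" for j s
    have p: "((\<lambda>s. p j s) \<longlongrightarrow> 0) F" for j
    proof -
      have "((\<lambda>s. p j s) \<longlongrightarrow> x0 * z0 * z0 ^ j - x0 * z0 * z0 ^ j) F"
        unfolding p_def by (intro tendsto_intros lim)
      thus ?thesis by simp
    qed
    define E where "E s = norm (p 0 s) + 2 * norm (p 1 s) * (1 + a)\<^sup>2 + norm (p 2 s) * (1 + a) ^ 4" for s
    have "(E \<longlongrightarrow> norm (0::complex) + 2 * norm (0::complex) * (1 + a)\<^sup>2 + norm (0::complex) * (1 + a) ^ 4) F"
      unfolding E_def by (intro tendsto_intros p)
    hence "\<forall>\<^sub>F s in F. E s < g m" using gm by (simp add: order_tendstoD(2))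
    thus ?thesis using ev
    proof eventually_elim
      case (elim s)
      have u: "norm (U s) \<le> a" "Phi (x s) (z s) (U s) = U s" using Up elim by blast+
      have n1: "norm (1 + U s) \<le> 1 + a" using norm_triangle_ineq[of 1 "U s"] u by simp
      have "Phi (x s) (z s) (U s) - Phi x0 z0 (U s) = p 0 s + 2 * p 1 s * (1 + U s)\<^sup>2 + p 2 s * (1 + U s) ^ 4"
        unfolding Phi_def p_def by (simp add: algebra_simps power2_eq_square power4_eq_xxxx)
      hence "g (U s) = norm (p 0 s + 2 * p 1 s * (1 + U s)\<^sup>2 + p 2 s * (1 + U s) ^ 4)"
        by (simp only: g_def u(2))
      also have "\<dots> \<le> norm (p 0 s) + norm (2 * p 1 s * (1 + U s)\<^sup>2) + norm (p 2 s * (1 + U s) ^ 4)"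
        by (meson add_right_mono norm_triangle_ineq order_trans)
      also have "\<dots> \<le> E s"
        unfolding E_def norm_mult norm_power using n1
        by (intro add_mono mult_mono power_mono order_refl) auto
      also have "E s < g m" using elim by simp
      finally have "U s \<notin> cball 0 a - S" using m(2)[of "U s"] by force
      thus ?case using u by simp
    qed
  qed
  thus "\<forall>\<^sub>F s in F. usol (x s) (z s) \<in> S" by (simp add: U_def)
qed

lemma usol_nonneg:
  assumes Z: "Z > 0" and x: "norm (x * z) < r_fun Z * Z" and z: "norm z \<le> Z" and nn: "x \<in> \<real>\<^sub>\<ge>\<^sub>0" "z \<in> \<real>\<^sub>\<ge>\<^sub>0"
  shows "usol x z \<in> \<real>\<^sub>\<ge>\<^sub>0" and "norm (usol x z) \<le> u0_fun Z" and "Phi x z (usol x z) = usol x z"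
    and "norm (usol x z) \<le> norm (x * z) / (r_fun Z * Z) * u0_fun Z"
proof -
  have rZ: "r_fun Z * Z > 0" using u0_fun_props[OF Z] Z by simp
  define \<sigma> where "\<sigma> = norm (x * z) / (r_fun Z * Z)"
  have \<sigma>: "0 \<le> \<sigma>" "\<sigma> < 1" "norm (x * z) \<le> \<sigma> * (r_fun Z * Z)"
    using x rZ Z u0_fun_props(3)[OF Z] by (simp_all add: \<sigma>_def del: norm_mult)
  note P = usol_props[OF Z \<sigma>(3) z \<sigma>(1,2)]
  have "uiter n x z \<in> \<real>\<^sub>\<ge>\<^sub>0" for n
    by (induction n) (auto simp: Phi_def intro!: nonneg_Reals_mult_I nonneg_Reals_add_I nonneg_Reals_pow_I nn)
  thus "usol x z \<in> \<real>\<^sub>\<ge>\<^sub>0" by (intro closed_sequentially[OF closed_nonneg_Reals_complex _ P(3)]) auto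
  show "Phi x z (usol x z) = usol x z" by (rule P)
  show "norm (usol x z) \<le> norm (x * z) / (r_fun Z * Z) * u0_fun Z" using P(2) by (simp add: \<sigma>_def)
  have "\<sigma> * u0_fun Z \<le> 1 * u0_fun Z" using \<sigma> u0_fun_props[OF Z] by (intro mult_right_mono) auto
  with P(2) show "norm (usol x z) \<le> u0_fun Z" by simp
qed

text \<open>\<open>u0_fun\<close> takes the value 1 at 1/4. The bound by 1 is what the positivity of
  the radicand in \<open>w2_poly_pos\<close> requires.\<close>

lemma u0_fun_lt_1: "z > 1/4 \<Longrightarrow> u0_fun z < 1"
proof -
  assume z: "z > 1/4"
  have "1 / (3 * z) < 4/3" using z by (simp add: field_simps)
  hence "sqrt (4/9 + 1 / (3 * z)) < sqrt ((4/3)\<^sup>2)" by (intro real_sqrt_less_mono) (simp add: power2_eq_square)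
  thus ?thesis by (simp add: u0_fun_def)
qed

text \<open>\<open>T_closed_form\<close> with the factor \<open>w\<close> of the denominator cancelled, so that it is regular at \<open>w = 0\<close>.\<close>

definition Tc :: "complex \<Rightarrow> complex \<Rightarrow> complex \<Rightarrow> complex \<Rightarrow> complex \<Rightarrow> complex" where
  "Tc x z w u v = x\<^sup>2 * z\<^sup>2 * w / 2
     * (w * (1 / (1 + w * z) + 1 / (1 + x * z) - 1)
        + (u + 1)\<^sup>2 * (- w1_poly u v w + (u - w + 1) * csqrt (w2_poly u v w))
          / (2 * (v * w + u\<^sup>2 + 2 * u + 1) * (1 + u + v)^3))"

lemma Tc_eq: "w \<noteq> 0 \<Longrightarrow> T_closed_form x z w u v = Tc x z w u v"
proof -
  assume w: "w \<noteq> 0"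
  define A where "A = 1 / (1 + w * z) + 1 / (1 + x * z) - 1"
  define P where "P = v * w + u\<^sup>2 + 2 * u + 1"
  define N where "N = (u + 1)\<^sup>2 * (- w1_poly u v w + (u - w + 1) * csqrt (w2_poly u v w))"
  define M where "M = N / (2 * P * (1 + u + v) ^ 3)"
  have "N / (2 * w * P * (1 + u + v) ^ 3) = M / w" by (simp add: M_def mult_ac)
  hence "T_closed_form x z w u v = x\<^sup>2 * z\<^sup>2 * w\<^sup>2 / 2 * (A + M / w)"
    by (simp only: T_closed_form_def A_def P_def N_def)
  also have "\<dots> = x\<^sup>2 * z\<^sup>2 * w / 2 * (w * A + M)" using w by (simp add: field_simps power2_eq_square)
  finally show ?thesis by (simp only: Tc_def A_def P_def N_def M_def)
qed

text \<open>Where \<open>Tc\<close> is regular: no denominator vanishes and the radicand avoids the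
  branch cut of \<open>csqrt\<close>.\<close>

definition Tdom :: "complex \<Rightarrow> complex \<Rightarrow> complex \<Rightarrow> complex \<Rightarrow> complex \<Rightarrow> bool" where
  "Tdom x z w u v \<longleftrightarrow> (1 + w * z) * (1 + x * z) * (v * w + u\<^sup>2 + 2 * u + 1) * (1 + u + v) \<noteq> 0 \<and> w2_poly u v w \<notin> \<real>\<^sub>\<le>\<^sub>0"

text \<open>For \<open>w = 1\<close> the radicand is the square of \<open>R\<close>, and for smaller
  \<open>w\<close> a nonnegative multiple of \<open>1 - w\<close> is added. The bound on
  \<open>u\<close> enters through the term \<open>v\<^sup>2 * (1 - u)\<close> of
  \<open>R\<close>.\<close>

lemma w2_poly_pos:
  fixes u v w :: real
  assumes "0 \<le> u" "u \<le> 1" "0 \<le> v" "0 \<le> w" "w \<le> 1"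
  obtains p where "p > 0" "w2_poly (of_real u) (of_real v) (of_real w) = of_real p"
proof
  define Q where "Q = 2 * u\<^sup>2 * v + 6 * u * v + 2 * v^3 + 3 * u * v\<^sup>2 + 5 * v\<^sup>2 + u\<^sup>2 + 2 * u + 4 * v + 1"
  define p where "p = u\<^sup>2 * v\<^sup>2 * w\<^sup>2 - 2 * w * u * v * Q + (u + 1)\<^sup>2 * (u + 2 * v + 1 + v\<^sup>2)\<^sup>2"
  show "w2_poly (of_real u) (of_real v) (of_real w) = of_real p"
    by (simp add: w2_poly_def p_def Q_def)
  define R where "R = (1 + u)\<^sup>2 + v * (2 + u) + v\<^sup>2 * (1 - u)"
  have "R \<ge> (1 + u)\<^sup>2" using assms by (simp add: R_def)
  moreover have "(1 + u)\<^sup>2 > 0" using assms by simp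
  ultimately have "R > 0" by linarith
  hence R: "R\<^sup>2 > 0" by simp
  have "Q \<ge> 6 * (u * v)" using assms by (simp add: Q_def add_nonneg_nonneg)
  moreover have "u * v * (1 + w) \<le> u * v * 2" using assms by (intro mult_left_mono) auto
  moreover have "u * v \<ge> 0" using assms by simp
  ultimately have "2 * Q - u * v * (1 + w) \<ge> 0" by linarith
  hence "(1 - w) * (u * v * (2 * Q - u * v * (1 + w))) \<ge> 0" using assms by simp
  moreover have "p = R\<^sup>2 + (1 - w) * (u * v * (2 * Q - u * v * (1 + w)))"
    unfolding p_def R_def Q_def by algebra
  ultimately show "p > 0" using R by linarith
qed

lemma Tdom_real:
  assumes "x \<in> \<real>\<^sub>\<ge>\<^sub>0" "z \<in> \<real>\<^sub>\<ge>\<^sub>0" "w \<in> \<real>\<^sub>\<ge>\<^sub>0" "u \<in> \<real>\<^sub>\<ge>\<^sub>0" "v \<in> \<real>\<^sub>\<ge>\<^sub>0" "norm w \<le> 1" "norm u \<le> 1"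
  shows "Tdom x z w u v"
proof -
  obtain x' z' w' u' v' where r: "x = of_real x'" "z = of_real z'" "w = of_real w'" "u = of_real u'" "v = of_real v'"
    "x' \<ge> 0" "z' \<ge> 0" "w' \<ge> 0" "u' \<ge> 0" "v' \<ge> 0" "w' \<le> 1" "u' \<le> 1"
    using assms by (auto elim!: nonneg_Reals_cases)
  obtain p where p: "p > 0" "w2_poly u v w = of_real p" using w2_poly_pos[of u' v' w'] r by auto
  have "1 + w' * z' > 0" "1 + x' * z' > 0" "v' * w' + u'\<^sup>2 + 2 * u' + 1 > 0" "1 + u' + v' > 0"
    using r by (simp_all add: add_nonneg_pos add_pos_nonneg add_nonneg_nonneg)
  hence "complex_of_real ((1 + w' * z') * (1 + x' * z') * (v' * w' + u'\<^sup>2 + 2 * u' + 1) * (1 + u' + v')) \<noteq> 0"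
    by (simp only: of_real_eq_0_iff mult_eq_0_iff) auto
  thus ?thesis using p by (simp add: Tdom_def r(1-5))
qed

lemma Tc_tendsto:
  assumes "(x \<longlongrightarrow> x0) F" "(z \<longlongrightarrow> z0) F" "(w \<longlongrightarrow> w0) F" "(u \<longlongrightarrow> u0) F" "(v \<longlongrightarrow> v0) F" "Tdom x0 z0 w0 u0 v0"
  shows "((\<lambda>s. Tc (x s) (z s) (w s) (u s) (v s)) \<longlongrightarrow> Tc x0 z0 w0 u0 v0) F"
proof -
  have w2: "((\<lambda>s. w2_poly (u s) (v s) (w s)) \<longlongrightarrow> w2_poly u0 v0 w0) F"
    unfolding w2_poly_def by (intro tendsto_intros assms)
  have "isCont csqrt (w2_poly u0 v0 w0)" using assms(6) by (intro continuous_at_csqrt) (auto simp: Tdom_def)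
  hence s: "((\<lambda>s. csqrt (w2_poly (u s) (v s) (w s))) \<longlongrightarrow> csqrt (w2_poly u0 v0 w0)) F"
    using w2 by (rule isCont_tendsto_compose)
  have w1: "((\<lambda>s. w1_poly (u s) (v s) (w s)) \<longlongrightarrow> w1_poly u0 v0 w0) F"
    unfolding w1_poly_def by (intro tendsto_intros assms)
  show ?thesis unfolding Tc_def
    by (intro tendsto_intros assms(1-5) s w1) (use assms(6) in \<open>auto simp: Tdom_def simp del: distrib_left_numeral\<close>)
qed

lemma Tc_holomorphic:
  assumes S: "open S" and h: "x holomorphic_on S" "z holomorphic_on S" "w holomorphic_on S" "u holomorphic_on S" "v holomorphic_on S"
  defines "D \<equiv> {s \<in> S. Tdom (x s) (z s) (w s) (u s) (v s)}"
  shows "open D" and "(\<lambda>s. Tc (x s) (z s) (w s) (u s) (v s)) holomorphic_on D"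
proof -
  define f where "f s = (1 + w s * z s) * (1 + x s * z s) * (v s * w s + (u s)\<^sup>2 + 2 * u s + 1) * (1 + u s + v s)" for s
  define g where "g s = w2_poly (u s) (v s) (w s)" for s
  have f: "f holomorphic_on S" unfolding f_def by (intro holomorphic_intros h)
  have g: "g holomorphic_on S" unfolding g_def w2_poly_def by (intro holomorphic_intros h)
  have "open (S \<inter> f -` (- {0}))"
    by (rule continuous_open_preimage[OF holomorphic_on_imp_continuous_on[OF f] S]) auto
  moreover have "open (S \<inter> g -` (- \<real>\<^sub>\<le>\<^sub>0))"
    by (rule continuous_open_preimage[OF holomorphic_on_imp_continuous_on[OF g] S]) (simp add: open_Compl closed_nonpos_Reals_complex)
  moreover have "D = (S \<inter> f -` (- {0})) \<inter> (S \<inter> g -` (- \<real>\<^sub>\<le>\<^sub>0))"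
    by (auto simp: D_def Tdom_def f_def g_def)
  ultimately show "open D" by auto
  have sub: "D \<subseteq> S" by (auto simp: D_def)
  note hD = h[THEN holomorphic_on_subset[OF _ sub]]
  have "(\<lambda>s. csqrt (g s)) holomorphic_on D"
    by (rule holomorphic_on_compose_gen[OF holomorphic_on_subset[OF g sub] holomorphic_on_csqrt, unfolded o_def])
       (auto simp: D_def Tdom_def g_def)
  hence s: "(\<lambda>s. csqrt (w2_poly (u s) (v s) (w s))) holomorphic_on D" by (simp add: g_def)
  have w1: "(\<lambda>s. w1_poly (u s) (v s) (w s)) holomorphic_on D" unfolding w1_poly_def by (intro holomorphic_intros hD)
  show "(\<lambda>s. Tc (x s) (z s) (w s) (u s) (v s)) holomorphic_on D"
    unfolding Tc_def by (intro holomorphic_intros hD s w1) (auto simp: D_def Tdom_def simp del: distrib_left_numeral)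
qed

text \<open>Along a ray the triple series, graded by total degree, is a power series in
  \<open>s\<close> with nonnegative coefficients, and for small \<open>s\<close> every argument is
  in the range of the hypothesis.\<close>

definition ray_fun :: "real \<Rightarrow> real \<Rightarrow> real \<Rightarrow> complex \<Rightarrow> complex" where
  "ray_fun x z w s = Tc (s * of_real x) (s * of_real z) (s * of_real w) (usol (s * of_real x) (s * of_real z)) (vsol (s * of_real x) (s * of_real z))"

text \<open>Off the real segment the radicand may meet the cut, so \<open>D\<close> is only claimed
  to contain the segment; this is what \<open>pringsheim_continuation\<close> asks for.\<close>

lemma ray_holomorphic:
  assumes z: "z > 1/4" and x: "0 < x" "x \<le> r_fun z" and w: "0 < w" "w \<le> 1"
  obtains D where "open D" "ray_fun x z w holomorphic_on D" "\<And>t. 0 \<le> t \<Longrightarrow> t < 1 \<Longrightarrow> of_real t \<in> D"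
proof -
  have z0: "z > 0" using z by simp
  define X where "X s = s * complex_of_real x" for s
  define Z where "Z s = s * complex_of_real z" for s
  define W where "W s = s * complex_of_real w" for s
  have b: "norm (X s * Z s) < r_fun z * z \<and> norm (Z s) \<le> z" if "s \<in> ball 0 1" for s
  proof -
    have s: "norm s < 1" using that by simp
    have "norm (X s * Z s) = (norm s * norm s) * (x * z)" using x z0 by (simp add: X_def Z_def norm_mult)
    also have "\<dots> < 1 * (x * z)" using s x z0 mult_strict_mono[of "norm s" 1 "norm s" 1] by (intro mult_strict_right_mono) auto
    also have "\<dots> \<le> r_fun z * z" using x z0 by simp
    finally show ?thesis using s z0 by (simp add: Z_def norm_mult mult_left_le_one_le)
  qed
  have hol: "X holomorphic_on ball 0 1" "Z holomorphic_on ball 0 1" "W holomorphic_on ball 0 1"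
    unfolding X_def Z_def W_def by (intro holomorphic_intros)+
  have U: "(\<lambda>s. usol (X s) (Z s)) holomorphic_on ball 0 1" by (rule usol_holomorphic[OF z0 open_ball hol(1,2) b])
  have V: "(\<lambda>s. vsol (X s) (Z s)) holomorphic_on ball 0 1" unfolding vsol_def by (intro holomorphic_intros U hol)
  define D where "D = {s \<in> ball 0 1. Tdom (X s) (Z s) (W s) (usol (X s) (Z s)) (vsol (X s) (Z s))}"
  have D: "open D" "(\<lambda>s. Tc (X s) (Z s) (W s) (usol (X s) (Z s)) (vsol (X s) (Z s))) holomorphic_on D"
    unfolding D_def by (rule Tc_holomorphic[OF open_ball hol U V])+
  show ?thesis
  proof
    show "open D" by (rule D)
    show "ray_fun x z w holomorphic_on D" using D(2) by (simp add: ray_fun_def[abs_def] X_def Z_def W_def)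
    fix t :: real assume t: "0 \<le> t" "t < 1"
    have tb: "of_real t \<in> ball (0::complex) 1" using t by simp
    have r: "X (of_real t) = of_real (t * x)" "Z (of_real t) = of_real (t * z)" "W (of_real t) = of_real (t * w)"
      by (simp_all add: X_def Z_def W_def)
    have nn: "X (of_real t) \<in> \<real>\<^sub>\<ge>\<^sub>0" "Z (of_real t) \<in> \<real>\<^sub>\<ge>\<^sub>0" "W (of_real t) \<in> \<real>\<^sub>\<ge>\<^sub>0"
      unfolding r using t x z0 w by (simp_all only: nonneg_Reals_of_real_iff mult_nonneg_nonneg less_imp_le)
    have u: "usol (X (of_real t)) (Z (of_real t)) \<in> \<real>\<^sub>\<ge>\<^sub>0" "norm (usol (X (of_real t)) (Z (of_real t))) \<le> u0_fun z"
      using usol_nonneg[OF z0 _ _ nn(1,2)] b[OF tb] by blast+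
    have v: "vsol (X (of_real t)) (Z (of_real t)) \<in> \<real>\<^sub>\<ge>\<^sub>0"
      unfolding vsol_def by (intro nonneg_Reals_mult_I nonneg_Reals_add_I nonneg_Reals_pow_I nn u) auto
    have "norm (W (of_real t)) \<le> 1" unfolding r norm_of_real using t w by (simp add: mult_le_one abs_mult)
    moreover have "norm (usol (X (of_real t)) (Z (of_real t))) \<le> 1" using u(2) u0_fun_lt_1[OF z] by simp
    ultimately show "of_real t \<in> D" unfolding D_def using tb Tdom_real[OF nn u(1) v] by simp
  qed
qed

text \<open>The end point may lie on the critical curve, hence the appeal to
  \<open>usol_tendsto\<close>.\<close>

lemma ray_limit:
  assumes z: "z > 1/4" and x: "0 < x" "x \<le> r_fun z" and w: "0 < w" "w \<le> 1"
    and u: "0 \<le> u" "u \<le> u0_fun z" "x * z * (1 + z * (1 + u)\<^sup>2)\<^sup>2 = u"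
  shows "((\<lambda>t. ray_fun x z w (of_real t)) \<longlongrightarrow> Tc (of_real x) (of_real z) (of_real w) (of_real u) (of_real (z * (1 + u)\<^sup>2))) (at_left 1)"
proof -
  have z0: "z > 0" using z by simp
  have e1: "((\<lambda>t. complex_of_real t * of_real c) \<longlongrightarrow> of_real c) (at_left (1::real))" for c
  proof -
    have "((\<lambda>t. complex_of_real t * of_real c) \<longlongrightarrow> of_real 1 * of_real c) (at_left (1::real))" by (intro tendsto_intros)
    thus ?thesis by simp
  qed
  have U: "((\<lambda>t. usol (of_real t * of_real x) (of_real t * of_real z)) \<longlongrightarrow> of_real u) (at_left (1::real))"
  proof (rule usol_tendsto[OF z0 _ e1 e1])
    have "\<forall>\<^sub>F t in at_left (1::real). t \<in> {0<..<1}"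
      by (rule eventually_at_leftI[of 0]) auto
    thus "\<forall>\<^sub>F t in at_left 1. norm (of_real t * of_real x * (of_real t * of_real z) :: complex) < r_fun z * z \<and> norm (of_real t * of_real z :: complex) \<le> z"
    proof eventually_elim
      case (elim t)
      have "norm (of_real t * of_real x * (of_real t * of_real z) :: complex) = (t * t) * (x * z)"
        using elim x z0 by (simp add: norm_mult)
      also have "\<dots> < 1 * (x * z)" using elim x z0 mult_strict_mono[of t 1 t 1] by (intro mult_strict_right_mono) auto
      also have "\<dots> \<le> r_fun z * z" using x z0 by simp
      finally show ?case using elim z0 by (simp add: norm_mult mult_left_le_one_le)
    qed
    show "norm (complex_of_real x * complex_of_real z) \<le> r_fun z * z" using x z0 by (simp add: norm_mult)
    show "Phi (of_real x) (of_real z) (of_real u) = of_real u"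
      using arg_cong[OF u(3), of complex_of_real] by (simp add: Phi_def)
  qed (use u z0 in auto)
  have V: "((\<lambda>t. vsol (of_real t * of_real x) (of_real t * of_real z)) \<longlongrightarrow> of_real (z * (1 + u)\<^sup>2)) (at_left (1::real))"
    unfolding vsol_def of_real_mult of_real_power of_real_add of_real_1 by (intro tendsto_intros U e1)
  show ?thesis unfolding ray_fun_def
    by (rule Tc_tendsto[OF e1 e1 e1 U V], rule Tdom_real)
       (use x z0 w u u0_fun_lt_1[OF z] in \<open>simp_all only: nonneg_Reals_of_real_iff norm_of_real, auto\<close>)
qed

section \<open>The triple series, summed by total degree\<close>

definition acoef :: "nat \<times> nat \<times> nat \<Rightarrow> real" where
  "acoef = (\<lambda>(n, m, k). real (t_count n m k) / fact n)"

definition mono3 :: "real \<Rightarrow> real \<Rightarrow> real \<Rightarrow> nat \<times> nat \<times> nat \<Rightarrow> real" where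
  "mono3 x z w = (\<lambda>(n, m, k). x ^ n * z ^ m * w ^ k)"

definition tot3 :: "nat \<times> nat \<times> nat \<Rightarrow> nat" where "tot3 = (\<lambda>(n, m, k). n + m + k)"

definition lev3 :: "nat \<Rightarrow> (nat \<times> nat \<times> nat) set" where "lev3 d = {i. tot3 i = d}"

lemma finite_lev3: "finite (lev3 d)"
proof (rule finite_subset)
  show "lev3 d \<subseteq> {..d} \<times> {..d} \<times> {..d}" by (auto simp: lev3_def tot3_def)
qed auto

lemma acoef_nonneg: "acoef i \<ge> 0" by (cases i) (simp add: acoef_def)

lemma mono3_nonneg: "0 \<le> x \<Longrightarrow> 0 \<le> z \<Longrightarrow> 0 \<le> w \<Longrightarrow> mono3 x z w i \<ge> 0"
  by (cases i) (simp add: mono3_def)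

lemma mono3_scale: "mono3 (s * x) (s * z) (s * w) i = s ^ tot3 i * mono3 x z w i"
  by (cases i) (simp add: mono3_def tot3_def power_add power_mult_distrib)

lemma mono3_mono:
  assumes "0 \<le> x" "x \<le> x'" "0 \<le> z" "z \<le> z'" "0 \<le> w" "w \<le> w'"
  shows "mono3 x z w i \<le> mono3 x' z' w' i"
  using assms by (cases i) (auto simp: mono3_def intro!: mult_mono power_mono mult_nonneg_nonneg)

lemma T_bullet_eq: "T_bullet (of_real x) (of_real z) (of_real w) = (\<Sum>\<^sub>\<infinity>i. of_real (acoef i * mono3 x z w i))"
  unfolding T_bullet_def by (rule infsum_cong) (auto simp: acoef_def mono3_def)

abbreviation Tsummable :: "real \<Rightarrow> real \<Rightarrow> real \<Rightarrow> bool" where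
  "Tsummable x z w \<equiv> (\<lambda>i. acoef i * mono3 x z w i) summable_on UNIV"

text \<open>Coefficient of \<open>s ^ d\<close> on the ray through \<open>(x, z, w)\<close>.\<close>

definition lcoef :: "real \<Rightarrow> real \<Rightarrow> real \<Rightarrow> nat \<Rightarrow> real" where
  "lcoef x z w d = (\<Sum>i\<in>lev3 d. acoef i * mono3 x z w i)"

lemma UNIV_lev3: "bij_betw snd (SIGMA d:UNIV. lev3 d) UNIV"
  unfolding bij_betw_def by (auto simp: lev3_def inj_on_def image_iff)

lemma lcoef_scale: "lcoef (s * x) (s * z) (s * w) d = lcoef x z w d * s ^ d"
  unfolding lcoef_def sum_distrib_right by (rule sum.cong) (auto simp: mono3_scale lev3_def mult_ac)

lemma lcoef_nonneg: "0 \<le> x \<Longrightarrow> 0 \<le> z \<Longrightarrow> 0 \<le> w \<Longrightarrow> lcoef x z w d \<ge> 0"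
  unfolding lcoef_def by (intro sum_nonneg mult_nonneg_nonneg acoef_nonneg mono3_nonneg)

lemma Tsummable_imp_sums:
  assumes "0 \<le> x" "0 \<le> z" "0 \<le> w" and s: "Tsummable x z w"
  shows "(\<lambda>d. lcoef x z w d) sums (\<Sum>\<^sub>\<infinity>i. acoef i * mono3 x z w i)"
proof -
  define S where "S = (\<Sum>\<^sub>\<infinity>i. acoef i * mono3 x z w i)"
  have "((\<lambda>i. acoef i * mono3 x z w i) has_sum S) UNIV"
    unfolding S_def using s by (rule has_sum_infsum)
  hence "((\<lambda>p. acoef (snd p) * mono3 x z w (snd p)) has_sum S) (SIGMA d:UNIV. lev3 d)"
    using has_sum_reindex_bij_betw[OF UNIV_lev3, of "\<lambda>i. acoef i * mono3 x z w i" S] by simp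
  hence "((\<lambda>d. lcoef x z w d) has_sum S) UNIV"
  proof (rule has_sum_SigmaD)
    show "((\<lambda>i. acoef (snd (d, i)) * mono3 x z w (snd (d, i))) has_sum lcoef x z w d) (lev3 d)" for d
      unfolding lcoef_def using has_sum_finite[OF finite_lev3] by simp
  qed
  thus ?thesis unfolding S_def by (rule has_sum_imp_sums)
qed

lemma summable_imp_Tsummable:
  assumes nn: "0 \<le> x" "0 \<le> z" "0 \<le> w" and s: "summable (lcoef x z w)"
  shows "Tsummable x z w"
proof (rule nonneg_bdd_above_summable_on)
  show "bdd_above (sum (\<lambda>i. acoef i * mono3 x z w i) ` {F. F \<subseteq> UNIV \<and> finite F})"
  proof (rule bdd_aboveI2)
    fix F :: "(nat \<times> nat \<times> nat) set" assume "F \<in> {F. F \<subseteq> UNIV \<and> finite F}"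
    hence F: "finite F" by simp
    define K where "K = Max (insert 0 (tot3 ` F))"
    have "F \<subseteq> (\<Union>d\<in>{..K}. lev3 d)"
    proof
      fix i assume "i \<in> F"
      hence "tot3 i \<le> K" unfolding K_def using F by (intro Max_ge) auto
      thus "i \<in> (\<Union>d\<in>{..K}. lev3 d)" by (auto simp: lev3_def)
    qed
    hence "(\<Sum>i\<in>F. acoef i * mono3 x z w i) \<le> (\<Sum>i\<in>(\<Union>d\<in>{..K}. lev3 d). acoef i * mono3 x z w i)"
      by (intro sum_mono2) (auto intro!: finite_lev3 mult_nonneg_nonneg acoef_nonneg mono3_nonneg nn)
    also have "\<dots> = (\<Sum>d\<le>K. lcoef x z w d)"
      unfolding lcoef_def by (rule sum.UNION_disjoint) (use finite_lev3 in \<open>auto simp: lev3_def\<close>)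
    also have "\<dots> \<le> suminf (lcoef x z w)" by (rule sum_le_suminf[OF s]) (auto intro: lcoef_nonneg nn)
    finally show "(\<Sum>i\<in>F. acoef i * mono3 x z w i) \<le> suminf (lcoef x z w)" .
  qed
qed (auto intro!: mult_nonneg_nonneg acoef_nonneg mono3_nonneg nn)

lemma Tsummable_mono:
  assumes "0 \<le> x" "x \<le> x'" "0 \<le> z" "z \<le> z'" "0 \<le> w" "w \<le> w'" "Tsummable x' z' w'"
  shows "Tsummable x z w"
  by (rule summable_on_comparison_test[OF assms(7)])
     (use assms mono3_mono[OF assms(1-6)] in \<open>auto intro!: mult_left_mono acoef_nonneg mult_nonneg_nonneg mono3_nonneg\<close>)

text \<open>The infinite sum of a family that is not summable is 0 by convention, so a nonzero value
  certifies convergence.\<close>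

lemma Tsummable_nonzero:
  assumes "T_bullet (of_real x) (of_real z) (of_real w) \<noteq> 0" shows "Tsummable x z w"
proof (rule ccontr)
  assume "\<not> ?thesis"
  hence "\<not> (\<lambda>i. complex_of_real (acoef i * mono3 x z w i)) summable_on UNIV"
    using has_sum_of_real_iff summable_on_def summable_on_Re[of "\<lambda>i. complex_of_real (acoef i * mono3 x z w i)"] by auto
  thus False using assms unfolding T_bullet_eq by (simp add: infsum_not_exists)
qed

lemma T_bullet_real:
  "T_bullet (of_real x) (of_real z) (of_real w) = of_real (\<Sum>\<^sub>\<infinity>i. acoef i * mono3 x z w i)"
proof (cases "Tsummable x z w")
  case True
  hence "((\<lambda>i. complex_of_real (acoef i * mono3 x z w i)) has_sum of_real (\<Sum>\<^sub>\<infinity>i. acoef i * mono3 x z w i)) UNIV"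
    by (intro has_sum_of_real has_sum_infsum)
  thus ?thesis unfolding T_bullet_eq by (rule infsumI)
next
  \<comment> \<open>Here both sides are 0 by the convention for \<open>infsum\<close>.\<close>
  case False
  hence "T_bullet (of_real x) (of_real z) (of_real w) = 0" using Tsummable_nonzero by blast
  thus ?thesis using False by (simp add: infsum_not_exists)
qed

text \<open>The hypothesis of the theorem with its radius \<epsilon> fixed for all statements that
  depend on it.\<close>

locale closed_form =
  fixes \<epsilon> :: real
  assumes eps: "\<epsilon> > 0"
    and explicit: "\<And>x z w u v :: complex.
       norm x < \<epsilon> \<Longrightarrow> norm z < \<epsilon> \<Longrightarrow> norm w < \<epsilon> \<Longrightarrow> norm u < \<epsilon> \<Longrightarrow> norm v < \<epsilon> \<Longrightarrow> w \<noteq> 0 \<Longrightarrow>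
       u = x * z * (1 + v)\<^sup>2 \<Longrightarrow> v = z * (1 + u)\<^sup>2 \<Longrightarrow>
       T_bullet x z w = T_closed_form x z w u v"
begin

lemma ray_small:
  assumes z: "z > 1/4" and x: "0 < x" "x \<le> r_fun z" and w: "0 < w" "w \<le> 1"
  obtains \<delta> where "\<delta> > 0" "\<And>t. 0 < t \<Longrightarrow> t < \<delta> \<Longrightarrow> T_bullet (of_real (t * x)) (of_real (t * z)) (of_real (t * w)) = ray_fun x z w (of_real t)"
proof -
  have z0: "z > 0" using z by simp
  \<comment> \<open>The bound with \<open>4 * z\<close> serves \<open>v\<close>, since
    \<open>norm (1 + U) \<le> 2\<close>; the others serve \<open>x\<close>, \<open>w\<close> and
    \<open>u\<close>.\<close>
  define \<delta> where "\<delta> = min (1/2) (min (\<epsilon> / (4 * z + 1)) (min (\<epsilon> / (x + 1)) \<epsilon>))"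
  have \<delta>: "\<delta> > 0" using eps z0 x by (simp add: \<delta>_def)
  show ?thesis
  proof
    show "\<delta> > 0" by (rule \<delta>)
    fix t :: real assume t: "0 < t" "t < \<delta>"
    have t1: "t < 1/2" "t * (4 * z + 1) < \<epsilon>" "t * (x + 1) < \<epsilon>" "t < \<epsilon>"
      using t z0 x by (simp_all add: \<delta>_def pos_less_divide_eq)
    define X where "X = complex_of_real t * of_real x"
    define Z where "Z = complex_of_real t * of_real z"
    define W where "W = complex_of_real t * of_real w"
    have nX: "norm X = t * x" "norm Z = t * z" "norm W = t * w"
      using t x z0 w by (simp_all add: X_def Z_def W_def norm_mult)
    have XZ: "norm (X * Z) \<le> t\<^sup>2 * (r_fun z * z)"
      using t x z0 by (simp add: norm_mult nX power2_eq_square)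
    have t2: "0 \<le> t\<^sup>2" "t\<^sup>2 < 1" using t t1 by (simp_all add: power_less_one_iff)
    have Zz: "norm Z \<le> z" using t t1 z0 by (simp add: nX)
    note P = usol_props[OF z0 XZ Zz t2]
    define U where "U = usol X Z"
    define V where "V = vsol X Z"
    have u1: "u0_fun z < 1" "u0_fun z > 0" using u0_fun_lt_1[OF z] u0_fun_props[OF z0] by simp_all
    have "t\<^sup>2 * u0_fun z \<le> t\<^sup>2 * 1" using u1 by (intro mult_left_mono) auto
    hence "norm U \<le> t\<^sup>2" using P(2) by (simp add: U_def)
    also have "t\<^sup>2 < t" using t t1 by (simp add: power2_eq_square)
    finally have nU: "norm U < t" .
    have "norm (1 + U) \<le> 2" using norm_triangle_ineq[of 1 U] nU t1 by simp
    hence "norm V \<le> t * z * 2\<^sup>2" unfolding V_def vsol_def U_def[symmetric] norm_mult norm_power nX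
      using t z0 by (intro mult_left_mono power_mono) auto
    hence nV: "norm V < \<epsilon>" using t1 t by (simp add: algebra_simps)
    have "T_bullet X Z W = T_closed_form X Z W U V"
    proof (rule explicit)
      have "t * w \<le> t" using t w by (simp add: mult_left_le)
      moreover have "t * x + t < \<epsilon>" "4 * (t * z) + t < \<epsilon>" using t1 by (simp_all add: algebra_simps)
      moreover have "t * x > 0" "t * z > 0" using t x z0 by simp_all
      ultimately have "t * x < \<epsilon>" "t * z < \<epsilon>" "t * w < \<epsilon>" using t t1(4) by linarith+
      thus "norm X < \<epsilon>" "norm Z < \<epsilon>" "norm W < \<epsilon>" by (simp_all add: nX)
      show "norm U < \<epsilon>" using nU t1 by simp
      show "W \<noteq> 0" using nX t w by (metis mult_pos_pos norm_zero less_irrefl)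
      show "U = X * Z * (1 + V)\<^sup>2" using P(1) by (simp add: Phi_def U_def V_def vsol_def)
      show "V = Z * (1 + U)\<^sup>2" by (simp add: V_def vsol_def U_def)
    qed (rule nV)
    also have "\<dots> = Tc X Z W U V"
      by (rule Tc_eq) (metis nX(3) t w mult_pos_pos norm_zero less_irrefl)
    finally show "T_bullet (of_real (t * x)) (of_real (t * z)) (of_real (t * w)) = ray_fun x z w (of_real t)"
      by (simp add: ray_fun_def X_def Z_def W_def U_def V_def)
  qed
qed

text \<open>An infinite sum with a non-zero value converges.  The value on the ray through
  \<open>x = 8/169\<close>, \<open>z = w = 1\<close>, where \<open>u = 1/2\<close> and \<open>v = 9/4\<close>, is not identically zero.\<close>

lemma Tsummable_small: obtains \<xi> where "\<xi> > 0" "Tsummable \<xi> \<xi> \<xi>"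
proof -
  define x0 :: real where "x0 = 8 / 169"
  have "sqrt 7 > 2.6457" by (rule real_less_rsqrt) (simp add: power2_eq_square)
  have q: "u0_fun 1 = (sqrt 7 - 1) / 3"
  proof -
    have "sqrt (4/9 + 1/3) = sqrt (7 / 9)" by simp
    also have "\<dots> = sqrt 7 / 3" by (simp add: real_sqrt_divide)
    finally show ?thesis by (simp add: u0_fun_def)
  qed
  have s7: "2.6457 < sqrt 7" "sqrt 7 < 2.6458"
    by (rule real_less_rsqrt, simp add: power2_eq_square) (rule real_less_lsqrt, simp_all add: power2_eq_square)
  have r: "x0 \<le> r_fun 1"
  proof -
    define u where "u = u0_fun 1"
    have u: "1/2 < u" "3 * u\<^sup>2 = 2 - 2 * u" "u < 0.55"
      using s7 by (simp_all add: u_def q) (simp add: power2_eq_square field_simps)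
    have p: "1 + (1 + u)\<^sup>2 = (8 + 4 * u) / 3" using u(2) by (simp add: power2_eq_square algebra_simps)
    have "(1 + (1 + u)\<^sup>2)\<^sup>2 = (64 + 64 * u + 16 * u\<^sup>2) / 9" unfolding p by (simp add: power2_eq_square field_simps)
    also have "16 * u\<^sup>2 = 16 * (2 - 2 * u) / 3" using u(2) by simp
    finally have e: "(1 + (1 + u)\<^sup>2)\<^sup>2 = (224 + 160 * u) / 27" by (simp add: field_simps)
    have "8 * ((224 + 160 * u) / 27) \<le> 169 * u" using s7 unfolding u_def q by (simp add: field_simps)
    hence "8 / 169 \<le> u / ((224 + 160 * u) / 27)" using u by (simp add: field_simps)
    thus ?thesis by (simp add: x0_def r_fun_def u_def[symmetric] e)
  qed
  have x: "0 < x0" "(1::real) > 1/4" by (simp_all add: x0_def)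
  obtain D where D: "open D" "ray_fun x0 1 1 holomorphic_on D" "\<And>t. 0 \<le> t \<Longrightarrow> t < 1 \<Longrightarrow> of_real t \<in> D"
    using ray_holomorphic[OF x(2) x(1) r, of 1] by auto
  obtain \<delta> where \<delta>: "\<delta> > 0" "\<And>t. 0 < t \<Longrightarrow> t < \<delta> \<Longrightarrow> T_bullet (of_real (t * x0)) (of_real (t * 1)) (of_real (t * 1)) = ray_fun x0 1 1 (of_real t)"
    using ray_small[OF x(2) x(1) r, of 1] by auto
  \<comment> \<open>If the closed form vanished on an initial piece of the ray, it would vanish up
    to the end point by the identity theorem, contrary to its limit there.\<close>
  have "\<exists>t. 0 < t \<and> t < min \<delta> 1 \<and> ray_fun x0 1 1 (of_real t) \<noteq> 0"
  proof (rule ccontr)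
    assume "\<not> ?thesis"
    hence z: "\<And>t. 0 < t \<Longrightarrow> t < min \<delta> 1 \<Longrightarrow> (\<lambda>k. 0 * of_real t ^ k) sums ray_fun x0 1 1 (of_real t)" by simp
    obtain S where S: "of_real ` {0..<1} \<subseteq> S" "\<And>s. s \<in> S \<Longrightarrow> (\<Sum>k. 0 * s ^ k) = ray_fun x0 1 1 s"
      by (rule power_series_eq_continuation[of D "ray_fun x0 1 1" 1 "\<lambda>_. 0" "min \<delta> 1"]) (use D \<delta> z in auto)
    have "ray_fun x0 1 1 (of_real t) = 0" if "0 \<le> t" "t < 1" for t :: real
    proof -
      have "complex_of_real t \<in> of_real ` {0..<1}" using that by (intro imageI) simp
      hence "complex_of_real t \<in> S" using S(1) by (rule subsetD[rotated])
      thus ?thesis using S(2)[of "of_real t"] by simp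
    qed
    moreover have "\<forall>\<^sub>F t in at_left (1::real). t \<in> {0<..<1}" by (rule eventually_at_leftI[of 0]) auto
    ultimately have "\<forall>\<^sub>F t in at_left (1::real). ray_fun x0 1 1 (of_real t) = 0" by (auto elim!: eventually_mono)
    hence l0: "((\<lambda>t. ray_fun x0 1 1 (of_real t)) \<longlongrightarrow> 0) (at_left (1::real))" by (rule tendsto_eventually)
    have l1: "((\<lambda>t. ray_fun x0 1 1 (of_real t)) \<longlongrightarrow> Tc (of_real x0) (of_real 1) (of_real 1) (of_real (1/2)) (of_real (1 * (1 + 1/2)\<^sup>2))) (at_left 1)"
      by (rule ray_limit[OF x(2) x(1) r]) (use s7 in \<open>simp_all add: x0_def q power2_eq_square\<close>)
    have "Tc (of_real x0) (of_real 1) (of_real 1) (of_real (1/2)) (of_real (1 * (1 + 1/2)\<^sup>2)) = 0"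
      by (rule tendsto_unique[OF _ l1 l0]) simp
    moreover have "Tc (of_real x0) (of_real 1) (of_real 1) (of_real (1/2)) (of_real (1 * (1 + 1/2)\<^sup>2)) \<noteq> 0"
    proof -
      \<comment> \<open>For \<open>w = 1\<close> the radicand is a square, as in the proof of
        \<open>w2_poly_pos\<close>.\<close>
      have w2: "w2_poly (1/2) (9/4) 1 = (complex_of_real (333/32))\<^sup>2"
        by (simp add: w2_poly_def power2_eq_square power3_eq_cube)
      have "csqrt (w2_poly (1/2) (9/4) 1) = complex_of_real (333/32)"
        unfolding w2 by (rule csqrt_square) simp
      hence c: "csqrt (w2_poly (1/2) (9/4) 1) = 333/32" by simp
      have v: "complex_of_real (1 * (1 + 1/2)\<^sup>2) = 9/4" by (simp add: power2_eq_square)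
      have "Tc (8/169) 1 1 (1/2) (9/4) \<noteq> 0"
        unfolding Tc_def c w1_poly_def by (simp add: power2_eq_square power3_eq_cube)
      thus ?thesis unfolding v x0_def by simp
    qed
    ultimately show False by simp
  qed
  then obtain t where t: "0 < t" "t < \<delta>" "t < 1" "ray_fun x0 1 1 (of_real t) \<noteq> 0" by auto
  have s: "Tsummable (t * x0) (t * 1) (t * 1)"
    by (rule Tsummable_nonzero) (use \<delta>(2)[OF t(1,2)] t(4) in simp)
  have "Tsummable (t * x0) (t * x0) (t * x0)"
    by (rule Tsummable_mono[OF _ _ _ _ _ _ s]) (use t in \<open>auto simp: x0_def\<close>)
  thus ?thesis using that[of "t * x0"] t x by simp
qed

text \<open>Pringsheim's theorem covers the ray for \<open>s < 1\<close>. By nonnegativity the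
  partial sums at \<open>s = 1\<close> are bounded by the limit of the closed form, so the series
  converges at the end point too, even on the critical curve, and monotonicity in \<open>s\<close>
  identifies the sum.\<close>

theorem Tsummable_critical:
  assumes z: "z > 1/4" and x: "0 < x" "x \<le> r_fun z" and w: "0 < w" "w \<le> 1"
    and u: "0 \<le> u" "u \<le> u0_fun z" "x * z * (1 + z * (1 + u)\<^sup>2)\<^sup>2 = u"
  shows "Tsummable x z w"
    and "T_bullet (of_real x) (of_real z) (of_real w) = Tc (of_real x) (of_real z) (of_real w) (of_real u) (of_real (z * (1 + u)\<^sup>2))"
proof -
  have z0: "z > 0" using z by simp
  have nn: "0 \<le> x" "0 \<le> z" "0 \<le> w" using x z w by auto
  obtain \<xi> where \<xi>: "\<xi> > 0" "Tsummable \<xi> \<xi> \<xi>" by (rule Tsummable_small)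
  obtain D where D: "open D" "ray_fun x z w holomorphic_on D" "\<And>t. 0 \<le> t \<Longrightarrow> t < 1 \<Longrightarrow> of_real t \<in> D"
    using ray_holomorphic[OF z x w] by blast
  obtain \<delta>0 where \<delta>0: "\<delta>0 > 0" "\<And>t. 0 < t \<Longrightarrow> t < \<delta>0 \<Longrightarrow> T_bullet (of_real (t * x)) (of_real (t * z)) (of_real (t * w)) = ray_fun x z w (of_real t)"
    using ray_small[OF z x w] by blast
  define \<delta> where "\<delta> = min \<delta>0 (\<xi> / (x + z + w))"
  have \<delta>: "\<delta> > 0" using \<delta>0 \<xi> x z0 w by (simp add: \<delta>_def)
  have small: "(\<lambda>d. complex_of_real (lcoef x z w d * t ^ d)) sums ray_fun x z w (of_real t)" if t: "0 < t" "t < \<delta>" for t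
  proof -
    have "t * (x + z + w) < \<xi>" using t x z0 w by (simp add: \<delta>_def pos_less_divide_eq)
    moreover have "t * x \<ge> 0" "t * z \<ge> 0" "t * w \<ge> 0" using t nn by auto
    ultimately have b: "t * x \<le> \<xi>" "t * z \<le> \<xi>" "t * w \<le> \<xi>" by (auto simp: distrib_left)
    have s: "Tsummable (t * x) (t * z) (t * w)"
      by (rule Tsummable_mono[OF _ b(1) _ b(2) _ b(3) \<xi>(2)]) (use t nn in auto)
    have "(\<lambda>d. lcoef (t * x) (t * z) (t * w) d) sums (\<Sum>\<^sub>\<infinity>i. acoef i * mono3 (t * x) (t * z) (t * w) i)"
      by (rule Tsummable_imp_sums[OF _ _ _ s]) (use t nn in auto)
    hence "(\<lambda>d. complex_of_real (lcoef x z w d * t ^ d)) sums T_bullet (of_real (t * x)) (of_real (t * z)) (of_real (t * w))"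
      unfolding T_bullet_real lcoef_scale by (simp only: sums_of_real_iff)
    thus ?thesis using \<delta>0(2)[of t] t by (simp add: \<delta>_def)
  qed
  have all: "(\<lambda>d. complex_of_real (lcoef x z w d * t ^ d)) sums ray_fun x z w (of_real t)" if "0 < t" "t < 1" for t
    by (rule pringsheim_continuation[OF lcoef_nonneg[OF nn] D \<delta> small that])
  define L where "L = Tc (of_real x) (of_real z) (of_real w) (of_real u) (of_real (z * (1 + u)\<^sup>2))"
  have lim: "((\<lambda>t. ray_fun x z w (of_real t)) \<longlongrightarrow> L) (at_left 1)"
    unfolding L_def by (rule ray_limit[OF z x w u])
  hence limR: "((\<lambda>t. Re (ray_fun x z w (of_real t))) \<longlongrightarrow> Re L) (at_left 1)" by (rule tendsto_Re)
  have ev: "\<forall>\<^sub>F t in at_left (1::real). t \<in> {0<..<1}" by (rule eventually_at_leftI[of 0]) auto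
  have sR: "(\<lambda>d. lcoef x z w d * t ^ d) sums Re (ray_fun x z w (of_real t))" if "0 < t" "t < 1" for t
    using sums_Re[OF all[OF that]] by simp
  have part: "(\<Sum>d\<le>K. lcoef x z w d) \<le> Re L" for K
  proof (rule tendsto_le[OF _ limR])
    show "((\<lambda>t. \<Sum>d\<le>K. lcoef x z w d * t ^ d) \<longlongrightarrow> (\<Sum>d\<le>K. lcoef x z w d)) (at_left 1)"
    proof -
      have "((\<lambda>t. \<Sum>d\<le>K. lcoef x z w d * t ^ d) \<longlongrightarrow> (\<Sum>d\<le>K. lcoef x z w d * 1 ^ d)) (at_left (1::real))"
        by (intro tendsto_intros)
      thus ?thesis by simp
    qed
    show "\<forall>\<^sub>F t in at_left 1. (\<Sum>d\<le>K. lcoef x z w d * t ^ d) \<le> Re (ray_fun x z w (of_real t))"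
      using ev
    proof eventually_elim
      case (elim t)
      have s: "(\<lambda>d. lcoef x z w d * t ^ d) sums Re (ray_fun x z w (of_real t))" using sR elim by simp
      have "(\<Sum>d\<le>K. lcoef x z w d * t ^ d) \<le> (\<Sum>d. lcoef x z w d * t ^ d)"
        by (rule sum_le_suminf[OF sums_summable[OF s]]) (use elim lcoef_nonneg[OF nn] in auto)
      thus ?case using s by (simp add: sums_iff)
    qed
  qed simp
  have summ: "summable (lcoef x z w)"
    by (rule bounded_imp_summable[OF lcoef_nonneg[OF nn] part])
  thus Ts: "Tsummable x z w" by (rule summable_imp_Tsummable[OF nn])
  have T: "T_bullet (of_real x) (of_real z) (of_real w) = of_real (suminf (lcoef x z w))"
    unfolding T_bullet_real using Tsummable_imp_sums[OF nn Ts] by (simp add: sums_iff)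
  have le1: "suminf (lcoef x z w) \<le> Re L"
    by (rule suminf_le_const[OF summ]) (use part in \<open>metis lessThan_Suc_atMost lessThan_0 sum.empty not0_implies_Suc order_trans[OF sum_nonneg] lcoef_nonneg nn\<close>)
  have le2: "Re L \<le> suminf (lcoef x z w)"
  proof (rule tendsto_upperbound[OF limR])
    show "\<forall>\<^sub>F t in at_left 1. Re (ray_fun x z w (of_real t)) \<le> suminf (lcoef x z w)"
      using ev
    proof eventually_elim
      case (elim t)
      have s: "(\<lambda>d. lcoef x z w d * t ^ d) sums Re (ray_fun x z w (of_real t))" using sR elim by simp
      have "(\<Sum>d. lcoef x z w d * t ^ d) \<le> suminf (lcoef x z w)"
        by (rule suminf_le[OF _ sums_summable[OF s] summ])
           (use elim lcoef_nonneg[OF nn] in \<open>auto intro!: mult_left_le simp: power_le_one\<close>)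
      thus ?case using s by (simp add: sums_iff)
    qed
  qed simp
  have "Im L = 0"
  proof -
    have l1: "((\<lambda>t. Im (ray_fun x z w (of_real t))) \<longlongrightarrow> Im L) (at_left 1)" by (rule tendsto_Im[OF lim])
    have "\<forall>\<^sub>F t in at_left 1. Im (ray_fun x z w (of_real t)) = 0" using ev
    proof eventually_elim
      case (elim t)
      have "(\<lambda>d. 0::real) sums Im (ray_fun x z w (of_real t))" using sums_Im[OF all[of t]] elim by simp
      thus ?case by (simp add: sums_iff)
    qed
    hence l0: "((\<lambda>t. Im (ray_fun x z w (of_real t))) \<longlongrightarrow> 0) (at_left (1::real))" by (rule tendsto_eventually)
    show ?thesis by (rule tendsto_unique[OF _ l1 l0]) simp
  qed
  hence "L = of_real (suminf (lcoef x z w))" using le1 le2 by (simp add: complex_eq_iff)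
  thus "T_bullet (of_real x) (of_real z) (of_real w) = Tc (of_real x) (of_real z) (of_real w) (of_real u) (of_real (z * (1 + u)\<^sup>2))"
    unfolding T L_def by simp
qed

end

section \<open>Expansion at a fold point\<close>

lemma holomorphic_taylor_at:
  assumes "f holomorphic_on ball c \<delta>" "\<delta> > 0"
  obtains Q where "Q holomorphic_on ball 0 \<delta>"
    "\<And>e. e \<in> ball 0 \<delta> \<Longrightarrow> f (c + e) = (\<Sum>k\<le>m. (deriv ^^ k) f c / fact k * e ^ k) + e ^ Suc m * Q e"
proof -
  have sh: "(\<lambda>e. f (c + e)) holomorphic_on ball 0 \<delta>"
    by (rule holomorphic_on_compose_gen[OF _ assms(1), unfolded o_def, of "\<lambda>e. c + e"])
       (auto intro!: holomorphic_intros simp: dist_norm)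
  have d: "(deriv ^^ k) (\<lambda>e. f (c + e)) 0 = (deriv ^^ k) f c" for k
    by (subst (2) higher_deriv_shift_0) (simp add: o_def)
  show ?thesis
    using holomorphic_remainder[OF sh assms(2), of m] that unfolding d by blast
qed

lemma bounded_near_center:
  assumes "Q holomorphic_on ball (0::complex) \<delta>" "\<delta> > 0"
  obtains M where "M > 0" "\<And>e. norm e \<le> \<delta> / 2 \<Longrightarrow> norm (Q e) \<le> M"
proof -
  have "compact (Q ` cball 0 (\<delta>/2))"
    by (intro compact_continuous_image holomorphic_on_imp_continuous_on holomorphic_on_subset[OF assms(1)])
       (use assms in auto)
  then obtain M where "M > 0" "\<And>y. y \<in> Q ` cball 0 (\<delta>/2) \<Longrightarrow> norm y \<le> M"
    using compact_imp_bounded bounded_pos by metis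
  thus ?thesis using that by auto
qed

text \<open>As the derivative of \<open>N\<close> is that of \<open>z\<close> times
  \<open>K\<close>, the function \<open>N - K c * z\<close> has a derivative of order two in
  \<open>e\<close> at \<open>c\<close>. Integration gives an explicit cubic term and a remainder of
  order four.\<close>

lemma fold_remainder:
  fixes N K z :: "complex \<Rightarrow> complex" and k :: real
  assumes hol: "N holomorphic_on ball c \<delta>" "K holomorphic_on ball c \<delta>" "z holomorphic_on ball c \<delta>" and \<delta>: "\<delta> > 0"
    and dN: "\<And>t. t \<in> ball c \<delta> \<Longrightarrow> deriv N t = deriv z t * K t"
    and z: "deriv z c = 0" "deriv (deriv z) c = - 2 * of_real (k\<^sup>2)"
  obtains M where "M > 0" "\<And>e. norm e \<le> \<delta> / 2 \<Longrightarrow>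
    norm (N (c + e) - N c - K c * (z (c + e) - z c) + 2/3 * of_real (k\<^sup>2) * deriv K c * e ^ 3) \<le> M * norm e ^ 4"
proof -
  have hz: "deriv z holomorphic_on ball c \<delta>" by (intro holomorphic_deriv hol open_ball)
  obtain Q1 where Q1: "Q1 holomorphic_on ball 0 \<delta>" "\<And>e. e \<in> ball 0 \<delta> \<Longrightarrow> deriv z (c + e) = - 2 * of_real (k\<^sup>2) * e + e\<^sup>2 * Q1 e"
    using holomorphic_taylor_at[OF hz \<delta>, of 1] z by (auto simp: numeral_2_eq_2)
  obtain Q2 where Q2: "Q2 holomorphic_on ball 0 \<delta>" "\<And>e. e \<in> ball 0 \<delta> \<Longrightarrow> K (c + e) = K c + deriv K c * e + e\<^sup>2 * Q2 e"
    using holomorphic_taylor_at[OF hol(2) \<delta>, of 1] by (auto simp: numeral_2_eq_2)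
  define W where "W e = - 2 * of_real (k\<^sup>2) * Q2 e + Q1 e * deriv K c + e * Q1 e * Q2 e" for e
  have "W holomorphic_on ball 0 \<delta>" unfolding W_def by (intro holomorphic_intros Q1 Q2)
  then obtain M where M: "M > 0" "\<And>e. norm e \<le> \<delta> / 2 \<Longrightarrow> norm (W e) \<le> M"
    using bounded_near_center \<delta> by blast
  define R where "R e = N (c + e) - N c - K c * (z (c + e) - z c) + 2/3 * of_real (k\<^sup>2) * deriv K c * e ^ 3" for e
  have dR: "(R has_field_derivative e ^ 3 * W e) (at e)" if "e \<in> ball 0 \<delta>" for e
  proof -
    have ce: "c + e \<in> ball c \<delta>" using that by (simp add: dist_norm)
    have sh: "((\<lambda>e. f (c + e)) has_field_derivative deriv f (c + e)) (at e)" if "f holomorphic_on ball c \<delta>" for f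
    proof -
      have "((\<lambda>e. c + e) has_field_derivative 1) (at e)" by (rule derivative_eq_intros refl | simp)+
      from DERIV_chain2[OF holomorphic_derivI[OF that open_ball ce] this] show ?thesis by simp
    qed
    have "(R has_field_derivative deriv N (c + e) - K c * deriv z (c + e) + 2 * of_real (k\<^sup>2) * deriv K c * e\<^sup>2) (at e)"
      unfolding R_def by (rule derivative_eq_intros sh hol refl | simp)+
    also have "deriv N (c + e) - K c * deriv z (c + e) + 2 * of_real (k\<^sup>2) * deriv K c * e\<^sup>2
       = deriv z (c + e) * (K (c + e) - K c) + 2 * of_real (k\<^sup>2) * deriv K c * e\<^sup>2"
      by (simp add: dN[OF ce] algebra_simps)
    also have "\<dots> = e ^ 3 * W e"
      unfolding Q1(2)[OF that] Q2(2)[OF that] W_def by (simp add: algebra_simps power2_eq_square power3_eq_cube)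
    finally show ?thesis .
  qed
  show ?thesis
  proof
    show "M > 0" by (rule M)
    fix e :: complex assume e: "norm e \<le> \<delta> / 2"
    have "norm (R e - R 0) \<le> (norm e ^ 3 * M) * norm (e - 0)"
    proof (rule field_differentiable_bound[where S = "cball 0 (norm e)" and f' = "\<lambda>e. e ^ 3 * W e"])
      fix x :: complex assume x: "x \<in> cball 0 (norm e)"
      hence "x \<in> ball 0 \<delta>" using e \<delta> by simp
      thus "(R has_field_derivative x ^ 3 * W x) (at x within cball 0 (norm e))"
        using dR has_field_derivative_at_within by blast
      show "norm (x ^ 3 * W x) \<le> norm e ^ 3 * M"
        unfolding norm_mult norm_power using x e M by (intro mult_mono power_mono M(2)) auto
    qed auto
    moreover have "R 0 = 0" by (simp add: R_def)
    ultimately show "norm (N (c + e) - N c - K c * (z (c + e) - z c) + 2/3 * of_real (k\<^sup>2) * deriv K c * e ^ 3) \<le> M * norm e ^ 4"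
      unfolding R_def[symmetric] by (simp add: power4_eq_xxxx power3_eq_cube mult_ac)
  qed
qed

text \<open>A principal square root whose square lies in the right half-plane has argument below a
  quarter of pi in modulus.\<close>

lemma norm_le_2_Re_csqrt:
  assumes "Re z > 0" shows "norm (csqrt z) \<le> 2 * Re (csqrt z)"
proof -
  define Z where "Z = csqrt z"
  have "Re (Z\<^sup>2) > 0" using assms by (simp add: Z_def)
  hence i: "(Im Z)\<^sup>2 < (Re Z)\<^sup>2" by (simp add: Re_power2)
  have r: "Re Z \<ge> 0" unfolding Z_def using Re_csqrt by blast
  have "(norm Z)\<^sup>2 = (Re Z)\<^sup>2 + (Im Z)\<^sup>2" by (rule cmod_power2)
  also have "\<dots> \<le> 4 * (Re Z)\<^sup>2" using i zero_le_power2[of "Re Z"] by linarith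
  finally have "(norm Z)\<^sup>2 \<le> (2 * Re Z)\<^sup>2" by (simp add: power_mult_distrib)
  hence "norm Z \<le> 2 * Re Z" by (rule power2_le_imp_le) (use r in simp)
  thus ?thesis by (simp add: Z_def)
qed

text \<open>\<open>(Z - k * e) * (Z + k * e)\<close> is of order \<open>e ^ 3\<close>, so
  \<open>Z\<close> is close to \<open>k * e\<close> or to \<open>- k * e\<close>. As
  \<open>Re Z\<close> is comparable to \<open>norm Z\<close> while \<open>Re e\<close> is at most of
  second order on the positive side, the first case cannot occur.\<close>

lemma fold_branch:
  assumes k: "k > 0" and Z: "Z\<^sup>2 = (of_real k * e)\<^sup>2 - e ^ 3 * q" "norm Z \<le> 2 * Re Z" and q: "norm q \<le> M" and M: "M > 0"
    and e: "Re e \<le> C * norm e ^ 2" "e \<noteq> 0" "norm e * M \<le> k\<^sup>2 / 2" "norm e * (4 * (k * C + M / k)) < k" and C: "C \<ge> 0"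
  shows "norm (Z + of_real k * e) \<le> M / k * norm e ^ 2" and "k * norm e \<le> 2 * norm Z"
proof -
  have e0: "norm e > 0" using e by simp
  have n3: "norm (e ^ 3 * q) \<le> M * norm e ^ 3"
    unfolding norm_mult norm_power mult.commute[of "norm e ^ 3"] using q by (intro mult_right_mono) auto
  have "(k * norm e)\<^sup>2 = norm (Z\<^sup>2 + e ^ 3 * q)" using k by (simp add: Z(1) norm_mult norm_power power_mult_distrib)
  also have "\<dots> \<le> (norm Z)\<^sup>2 + M * norm e ^ 3"
    using norm_triangle_ineq[of "Z\<^sup>2" "e ^ 3 * q"] n3 by (simp add: norm_power)
  also have "M * norm e ^ 3 = (norm e * M) * norm e ^ 2" by (simp add: power3_eq_cube power2_eq_square)
  also have "\<dots> \<le> k\<^sup>2 / 2 * norm e ^ 2" using e(3) by (intro mult_right_mono) auto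
  finally have "(k * norm e)\<^sup>2 \<le> 2 * (norm Z)\<^sup>2" by (simp add: power_mult_distrib)
  also have "\<dots> \<le> (2 * norm Z)\<^sup>2" by (simp add: power_mult_distrib)
  finally show z: "k * norm e \<le> 2 * norm Z" by (rule power2_le_imp_le) simp
  define A where "A = norm (Z + of_real k * e)"
  define B where "B = norm (Z - of_real k * e)"
  have "(Z - of_real k * e) * (Z + of_real k * e) = - (e ^ 3 * q)" using Z(1) by (simp add: algebra_simps power2_eq_square)
  hence AB: "B * A \<le> M * norm e ^ 3" unfolding A_def B_def norm_mult[symmetric] using n3 by simp
  \<comment> \<open>If \<open>Z\<close> were close to \<open>k * e\<close>, its real part would be
    bounded by a second-order term, against \<open>norm Z \<le> 2 * Re Z\<close> and
    \<open>k * norm e \<le> 2 * norm Z\<close>.\<close>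
  have "B \<ge> k * norm e"
  proof (rule ccontr)
    assume nB: "\<not> ?thesis"
    have "norm (2 * of_real k * e) \<le> A + B"
      using norm_triangle_ineq4[of "Z + of_real k * e" "Z - of_real k * e"] by (simp add: A_def B_def algebra_simps)
    hence "A \<ge> k * norm e" using nB k by (simp add: norm_mult)
    hence "B * (k * norm e) \<le> B * A" by (intro mult_left_mono) (auto simp: B_def)
    also note AB
    finally have "B * k * norm e \<le> M * norm e ^ 2 * norm e" by (simp add: power3_eq_cube power2_eq_square mult_ac)
    hence "B * k \<le> M * norm e ^ 2" using e0 by simp
    hence B: "B \<le> M / k * norm e ^ 2" using k by (simp add: field_simps)
    have "Re Z = Re (Z - of_real k * e) + k * Re e" by simp
    also have "\<dots> \<le> B + k * (C * norm e ^ 2)"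
      unfolding B_def by (intro add_mono mult_left_mono complex_Re_le_cmod e(1)) (use k in auto)
    also have "\<dots> \<le> (k * C + M / k) * norm e ^ 2" using B by (simp add: algebra_simps)
    finally have "Re Z \<le> (k * C + M / k) * norm e ^ 2" .
    hence "k * norm e \<le> 4 * ((k * C + M / k) * norm e ^ 2)" using z Z(2) by linarith
    hence "k * norm e \<le> (norm e * (4 * (k * C + M / k))) * norm e" by (simp add: power2_eq_square algebra_simps)
    hence "k \<le> norm e * (4 * (k * C + M / k))" using e0 by (simp only: mult_le_cancel_right_pos)
    thus False using e(4) by simp
  qed
  hence "(k * norm e) * A \<le> B * A" by (intro mult_right_mono) (auto simp: A_def)
  also note AB
  finally have "A * k * norm e \<le> M * norm e ^ 2 * norm e" by (simp add: power3_eq_cube power2_eq_square mult_ac)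
  hence "A * k \<le> M * norm e ^ 2" using e0 by simp
  thus "norm (Z + of_real k * e) \<le> M / k * norm e ^ 2" using k by (simp add: A_def field_simps)
qed

text \<open>Near a fold point \<open>c\<close> of \<open>z\<close>, where \<open>1 - z = k\<^sup>2 (t - c)\<^sup>2 + \<dots>\<close>, a function \<open>N\<close> whose derivative is
  divisible by that of \<open>z\<close> has no term of order \<open>1 / 2\<close>; the branch with \<open>Re (t - c) \<lesssim> 0\<close> has
  \<open>csqrt (1 - z) \<sim> - k (t - c)\<close>.\<close>

theorem fold_expansion:
  fixes N K z t :: "complex \<Rightarrow> complex" and k :: real
  assumes hol: "N holomorphic_on ball c \<delta>" "K holomorphic_on ball c \<delta>" "z holomorphic_on ball c \<delta>" and \<delta>: "\<delta> > 0"
    and dN: "\<And>t. t \<in> ball c \<delta> \<Longrightarrow> deriv N t = deriv z t * K t"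
    and z: "z c = 1" "deriv z c = 0" "deriv (deriv z) c = - 2 * of_real (k\<^sup>2)" and k: "k > 0"
    and t: "(t \<longlongrightarrow> c) F" "\<forall>\<^sub>F s in F. z (t s) = s \<and> Re (t s - c) \<le> C * norm (t s - c) ^ 2 \<and> norm s < 1" and C: "C \<ge> 0"
  shows "(\<lambda>s. N (t s) - (N c + (- K c) * csqrt (1 - s) ^ 2 + (2/3 * deriv K c / of_real k) * csqrt (1 - s) ^ 3))
     \<in> O[F](\<lambda>s. csqrt (1 - s) ^ 4)"
proof -
  obtain M where M: "M > 0" "\<And>e. norm e \<le> \<delta> / 2 \<Longrightarrow>
    norm (N (c + e) - N c - K c * (z (c + e) - z c) + 2/3 * of_real (k\<^sup>2) * deriv K c * e ^ 3) \<le> M * norm e ^ 4"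
    using fold_remainder[OF hol \<delta> dN z(2,3)] by blast
  obtain Q where Q: "Q holomorphic_on ball 0 \<delta>" "\<And>e. e \<in> ball 0 \<delta> \<Longrightarrow> z (c + e) = 1 - of_real (k\<^sup>2) * e\<^sup>2 + e ^ 3 * Q e"
  proof -
    obtain Q where Q: "Q holomorphic_on ball 0 \<delta>" "\<And>e. e \<in> ball 0 \<delta> \<Longrightarrow> z (c + e) = (\<Sum>k\<le>2. (deriv ^^ k) z c / fact k * e ^ k) + e ^ Suc 2 * Q e"
      by (rule holomorphic_taylor_at[OF hol(3) \<delta>, of 2]) blast
    have "(\<Sum>j\<le>2. (deriv ^^ j) z c / fact j * e ^ j) = 1 - of_real (k\<^sup>2) * e\<^sup>2" for e
      using z by (simp add: numeral_2_eq_2)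
    with Q that show ?thesis by (simp add: numeral_3_eq_3)
  qed
  obtain P where P: "P > 0" "\<And>e. norm e \<le> \<delta> / 2 \<Longrightarrow> norm (Q e) \<le> P"
    using bounded_near_center[OF Q(1) \<delta>] by blast
  \<comment> \<open>The bounds are the range of the Taylor remainders and the two smallness
    conditions of \<open>fold_branch\<close>.\<close>
  define \<eta> where "\<eta> = min (\<delta> / 2) (min (k\<^sup>2 / (2 * P)) (k / (4 * (k * C + P / k) + 1)))"
  have kC: "k * C + P / k \<ge> 0" using k C P by simp
  have \<eta>: "\<eta> > 0" using \<delta> k P kC by (simp add: \<eta>_def add_nonneg_pos)
  define K1 where "K1 = norm (2/3 * deriv K c / of_real k)"
  define B where "B = M * (2 / k) ^ 4 + K1 * (P / k * (2 / k)\<^sup>2 * 7)"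
  have "\<forall>\<^sub>F s in F. dist (t s) c < \<eta>" using tendstoD[OF t(1) \<eta>] .
  hence "\<forall>\<^sub>F s in F. norm (N (t s) - (N c + (- K c) * csqrt (1 - s) ^ 2 + (2/3 * deriv K c / of_real k) * csqrt (1 - s) ^ 3))
     \<le> B * norm (csqrt (1 - s) ^ 4)"
    using t(2)
  proof eventually_elim
    case (elim s)
    define e where "e = t s - c"
    define Z where "Z = csqrt (1 - s)"
    have ts: "t s = c + e" by (simp add: e_def)
    have ne: "norm e < \<eta>" using elim by (simp add: e_def dist_norm)
    have n2: "norm e \<le> \<delta> / 2" "norm e < \<delta>" using ne \<delta> by (auto simp: \<eta>_def)
    have s: "z (c + e) = s" using elim ts by simp
    have s1: "norm s < 1" using elim by simp
    have "norm e * (2 * P) \<le> k\<^sup>2" using ne P by (simp add: \<eta>_def pos_less_divide_eq)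
    hence e3: "norm e * P \<le> k\<^sup>2 / 2" by simp
    have p1: "4 * (k * C + P / k) + 1 > 0" using kC by simp
    have "norm e * (4 * (k * C + P / k) + 1) < k" using ne p1 by (simp add: \<eta>_def pos_less_divide_eq)
    hence "norm e * (4 * (k * C + P / k)) + norm e * 1 < k" by (simp only: distrib_left[of "norm e" "4 * (k * C + P / k)" 1])
    hence e4: "norm e * (4 * (k * C + P / k)) < k" using norm_ge_zero[of e] by linarith
    have Z2: "Z\<^sup>2 = (of_real k * e)\<^sup>2 - e ^ 3 * Q e"
      using Q(2)[of e] n2 s by (simp add: Z_def power_mult_distrib)
    have "Re (1 - s) > 0" using s1 complex_Re_le_cmod[of s] by simp
    hence Zr: "norm Z \<le> 2 * Re Z" unfolding Z_def by (rule norm_le_2_Re_csqrt)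
    have e0: "e \<noteq> 0"
    proof
      assume "e = 0"
      hence "s = 1" using s z by simp
      thus False using s1 by simp
    qed
    have eC: "Re e \<le> C * norm e ^ 2" using elim by (simp add: e_def)
    note br = fold_branch[OF k Z2 Zr P(2)[OF n2(1)] P(1) eC e0 e3 e4 C]
    define n where "n = norm Z"
    have ez: "norm e \<le> 2 / k * n" using br(2) k by (simp add: n_def field_simps)
    have n0: "n \<ge> 0" by (simp add: n_def)
    have sum: "norm (Z + of_real k * e) \<le> P / k * (2 / k)\<^sup>2 * n\<^sup>2"
    proof -
      have "norm e ^ 2 \<le> (2 / k * n) ^ 2" using ez by (intro power_mono) auto
      hence "P / k * norm e ^ 2 \<le> P / k * (2 / k * n) ^ 2" using P k by (intro mult_left_mono) auto
      from order_trans[OF br(1) this] show ?thesis by (simp only: power_mult_distrib mult.assoc)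
    qed
    have q: "norm (Z\<^sup>2 - of_real k * e * Z + (of_real k * e)\<^sup>2) \<le> 7 * n\<^sup>2"
    proof -
      have ke: "norm (of_real k * e) \<le> 2 * n" using br(2) k by (simp add: norm_mult n_def)
      have "norm (Z\<^sup>2 - of_real k * e * Z + (of_real k * e)\<^sup>2) \<le> norm (Z\<^sup>2) + norm (of_real k * e * Z) + norm ((of_real k * e)\<^sup>2)"
        by (meson add_right_mono norm_triangle_ineq norm_triangle_ineq4 order_trans)
      also have "\<dots> \<le> n\<^sup>2 + (2 * n) * n + (2 * n)\<^sup>2"
        unfolding norm_mult[of "of_real k * e" Z] norm_power n_def[symmetric] using ke n0
        by (intro add_mono mult_right_mono power_mono order_refl) auto
      also have "\<dots> = 7 * n\<^sup>2" by (simp add: power2_eq_square)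
      finally show ?thesis .
    qed
    \<comment> \<open>\<open>Z ^ 3\<close> replaces minus the cube of \<open>k * e\<close>;
      factoring the sum of cubes shows that the error is of order four.\<close>
    have "Z ^ 3 + (of_real k * e) ^ 3 = (Z + of_real k * e) * (Z\<^sup>2 - of_real k * e * Z + (of_real k * e)\<^sup>2)"
      by (simp add: algebra_simps power2_eq_square power3_eq_cube)
    hence cube: "norm (Z ^ 3 + (of_real k * e) ^ 3) \<le> (P / k * (2 / k)\<^sup>2 * n\<^sup>2) * (7 * n\<^sup>2)"
      unfolding norm_mult[symmetric] using mult_mono[OF sum q] n0 P k by (simp add: norm_mult)
    define R where "R = N (c + e) - N c - K c * (z (c + e) - z c) + 2/3 * of_real (k\<^sup>2) * deriv K c * e ^ 3"
    have R: "norm R \<le> M * norm e ^ 4" unfolding R_def by (rule M(2)[OF n2(1)])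
    also have "\<dots> \<le> M * (2 / k * n) ^ 4" using ez M by (intro mult_left_mono power_mono) auto
    finally have R4: "norm R \<le> M * (2 / k) ^ 4 * n ^ 4" by (simp only: power_mult_distrib mult.assoc)
    have Zs: "z (c + e) - z c = - (Z\<^sup>2)" using s z by (simp add: Z_def)
    have "N (t s) - (N c + (- K c) * Z ^ 2 + (2/3 * deriv K c / of_real k) * Z ^ 3)
       = R - (2/3 * deriv K c / of_real k) * (Z ^ 3 + (of_real k * e) ^ 3)"
      unfolding R_def ts Zs using k by (simp add: field_simps power2_eq_square power3_eq_cube)
    hence "norm (N (t s) - (N c + (- K c) * Z ^ 2 + (2/3 * deriv K c / of_real k) * Z ^ 3))
      \<le> norm R + K1 * norm (Z ^ 3 + (of_real k * e) ^ 3)"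
      unfolding K1_def norm_mult[symmetric] by (simp only: norm_triangle_ineq4)
    also have "\<dots> \<le> M * (2 / k) ^ 4 * n ^ 4 + K1 * ((P / k * (2 / k)\<^sup>2 * n\<^sup>2) * (7 * n\<^sup>2))"
      using R4 cube by (intro add_mono mult_left_mono) (auto simp: K1_def)
    also have "\<dots> = B * n ^ 4" by (simp add: B_def algebra_simps power2_eq_square power4_eq_xxxx)
    finally show ?case by (simp add: Z_def n_def norm_power)
  qed
  thus ?thesis by (rule bigoI)
qed

section \<open>The curve for \<open>x = r\<close> and its fold\<close>

lemma u0_fun_1: "u0_fun 1 = ucrit"
proof -
  have "sqrt (4/9 + 1/3) = sqrt (7 / 9)" by simp
  also have "\<dots> = sqrt 7 / 3" by (simp add: real_sqrt_divide)
  finally show ?thesis by (simp add: u0_fun_def ucrit_def)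
qed

lemma r_fun_1: "r_fun 1 = ucrit / chi0\<^sup>2" "r_fun 1 = (7 * sqrt 7 - 17) / 32"
proof -
  have c: "1 + (1 + ucrit)\<^sup>2 = chi0" by (simp add: chi0_def power2_eq_square algebra_simps)
  show 1: "r_fun 1 = ucrit / chi0\<^sup>2" by (simp add: r_fun_def u0_fun_1 c)
  have "chi0 = (20 + 4 * sqrt 7) / 9"
    by (simp add: chi0_def ucrit_def power2_eq_square field_simps)
  moreover have "((20 + 4 * sqrt 7) / 9)\<^sup>2 * (7 * sqrt 7 - 17) = 32 * ((sqrt 7 - 1) / 3)"
    by (simp add: power2_eq_square field_simps)
  ultimately have "chi0\<^sup>2 * (7 * sqrt 7 - 17) = 32 * ucrit"
    by (simp only: ucrit_def)
  thus "r_fun 1 = (7 * sqrt 7 - 17) / 32" unfolding 1 using chi0_pos by (simp add: field_simps)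
qed

definition rcc :: complex where "rcc = (7 * s7 - 17) / 32"

lemma rcc: "of_real (r_fun 1) = rcc" by (simp add: r_fun_1(2) rcc_def s7_def)

text \<open>\<open>uf\<close>, \<open>vf\<close>, \<open>zf\<close> express \<open>u\<close>,
  \<open>v\<close>, \<open>z\<close> by the slope \<open>t\<close> of a line through the node, with
  \<open>dt\<close> and \<open>nt\<close> as building blocks. \<open>lf\<close> is the speed
  relative to the direction \<open>(dirU, dirV)\<close>, and \<open>tc\<close> is the slope at the
  critical point.\<close>

definition dt :: "complex \<Rightarrow> complex" where "dt t = 1 - rcc * t ^ 3"
definition nt :: "complex \<Rightarrow> complex" where "nt t = 1 - rcc * t\<^sup>2"
definition uf :: "complex \<Rightarrow> complex" where "uf t = rcc * t\<^sup>2 * (t - 1) / dt t"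
definition vf :: "complex \<Rightarrow> complex" where "vf t = (t - 1) / dt t"
definition zf :: "complex \<Rightarrow> complex" where "zf t = (t - 1) * dt t / (nt t)\<^sup>2"
definition lf :: "complex \<Rightarrow> complex" where "lf t = dt t / (t * (t - 1) * nt t)"
definition tc :: complex where "tc = (4 * s7 - 4) / 3"

text \<open>Rational parametrization of the nodal cubic \<open>u (1 + u)\<^sup>2 = r v (1 + v)\<^sup>2\<close> by the slope
  \<open>t = (1 + v) / (1 + u)\<close> through its node \<open>(-1, -1)\<close>.\<close>

lemma curve_param:
  assumes u: "u = rcc * z * (1 + v)\<^sup>2" and v: "v = z * (1 + u)\<^sup>2" and nz: "1 + u \<noteq> 0"
    and t: "t = (1 + v) / (1 + u)" and d: "dt t \<noteq> 0" "nt t \<noteq> 0"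
  shows "u = uf t" "v = vf t" "z = zf t"
proof -
  have t': "1 + v = t * (1 + u)" using t nz by simp
  have "u * (1 + u)\<^sup>2 = rcc * v * (1 + v)\<^sup>2" using u v by algebra
  \<comment> \<open>The node is a double point: \<open>(1 + u)\<^sup>2\<close> splits off, and an
    equation linear in \<open>u\<close> remains.\<close>
  hence "(1 + u)\<^sup>2 * ((1 + u) * dt t) = (1 + u)\<^sup>2 * nt t"
    unfolding dt_def nt_def using t' by algebra
  hence e: "(1 + u) * dt t = nt t" using nz by simp
  hence "u * dt t = nt t - dt t" by (simp add: algebra_simps)
  also have "\<dots> = rcc * t\<^sup>2 * (t - 1)" by (simp add: nt_def dt_def power2_eq_square power3_eq_cube algebra_simps)
  finally show u': "u = uf t" using d by (simp add: uf_def eq_divide_imp)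
  have vt: "v = t * (1 + u) - 1" using t' by (simp add: algebra_simps)
  have "v * dt t = t * ((1 + u) * dt t) - dt t" unfolding vt by (simp only: left_diff_distrib mult.assoc mult_1)
  also have "\<dots> = t - 1" unfolding e by (simp add: nt_def dt_def power2_eq_square power3_eq_cube algebra_simps)
  finally show v': "v = vf t" using d by (simp add: vf_def eq_divide_imp)
  have "1 + u = nt t / dt t" using e d by (simp add: eq_divide_imp)
  hence "z = v / (nt t / dt t)\<^sup>2" using v nz by (metis nonzero_mult_div_cancel_right power_not_zero)
  thus "z = zf t" unfolding v' using d by (simp add: vf_def zf_def power2_eq_square)
qed

lemma uf1: "dt t \<noteq> 0 \<Longrightarrow> 1 + uf t = nt t / dt t"
  by (simp add: uf_def field_simps) (simp add: nt_def dt_def power2_eq_square power3_eq_cube algebra_simps)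

lemma vf1: "dt t \<noteq> 0 \<Longrightarrow> 1 + vf t = t * nt t / dt t"
  by (simp add: vf_def field_simps) (simp add: nt_def dt_def power2_eq_square power3_eq_cube algebra_simps)

lemma zf_eq: "dt t \<noteq> 0 \<Longrightarrow> nt t \<noteq> 0 \<Longrightarrow> zf t = vf t / (1 + uf t)\<^sup>2"
  by (simp add: uf1 vf_def zf_def power2_eq_square)

lemma dt_deriv: "(dt has_field_derivative - 3 * rcc * t\<^sup>2) (at t)"
  unfolding dt_def[abs_def] by (rule derivative_eq_intros refl | simp)+

lemma nt_deriv: "(nt has_field_derivative - 2 * rcc * t) (at t)"
  unfolding nt_def[abs_def] by (rule derivative_eq_intros refl | simp)+

lemma uf_deriv:
  assumes "dt t \<noteq> 0" "nt t \<noteq> 0" "t \<noteq> 0" "t \<noteq> 1"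
  shows "(uf has_field_derivative lf t * dirU (uf t) (vf t)) (at t)"
proof -
  have 1: "((\<lambda>t. rcc * t\<^sup>2 * (t - 1)) has_field_derivative rcc * (3 * t\<^sup>2 - 2 * t)) (at t)"
    by (rule derivative_eq_intros refl | simp)+ (simp add: power2_eq_square algebra_simps)
  have d: "lf t * dirU (uf t) (vf t) = (rcc * (3 * t\<^sup>2 - 2 * t) * dt t - rcc * t\<^sup>2 * (t - 1) * (- 3 * rcc * t\<^sup>2)) / (dt t * dt t)"
  proof -
    have e: "1 + 3 * vf t = (dt t + 3 * (t - 1)) / dt t" using assms by (simp add: vf_def field_simps)
    have "lf t * dirU (uf t) (vf t) = rcc * t * (dt t + 3 * (t - 1)) / (dt t * dt t)"
      unfolding dirU_def e uf1[OF assms(1)] unfolding lf_def uf_def using assms by (simp add: field_simps power2_eq_square)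
    also have "rcc * t * (dt t + 3 * (t - 1)) = rcc * (3 * t\<^sup>2 - 2 * t) * dt t - rcc * t\<^sup>2 * (t - 1) * (- 3 * rcc * t\<^sup>2)"
      unfolding dt_def by algebra
    finally show ?thesis .
  qed
  have "uf = (\<lambda>t. rcc * t\<^sup>2 * (t - 1) / dt t)" by (simp add: uf_def fun_eq_iff)
  with DERIV_divide[OF 1 dt_deriv assms(1)] show ?thesis unfolding d by simp
qed

lemma vf_deriv:
  assumes "dt t \<noteq> 0" "nt t \<noteq> 0" "t \<noteq> 0" "t \<noteq> 1"
  shows "(vf has_field_derivative lf t * dirV (uf t) (vf t)) (at t)"
proof -
  have 1: "((\<lambda>t. t - 1) has_field_derivative 1) (at t)"
    by (rule derivative_eq_intros refl | simp)+
  have d: "lf t * dirV (uf t) (vf t) = (1 * dt t - (t - 1) * (- 3 * rcc * t\<^sup>2)) / (dt t * dt t)"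
  proof -
    have e: "1 + 3 * uf t = (dt t + 3 * (rcc * t\<^sup>2 * (t - 1))) / dt t" using assms by (simp add: uf_def field_simps)
    have "lf t * dirV (uf t) (vf t) = (dt t + 3 * (rcc * t\<^sup>2 * (t - 1))) / (dt t * dt t)"
      unfolding dirV_def e vf1[OF assms(1)] unfolding lf_def vf_def using assms by (simp add: field_simps power2_eq_square)
    thus ?thesis by (simp add: algebra_simps)
  qed
  have "vf = (\<lambda>t. (t - 1) / dt t)" by (simp add: vf_def fun_eq_iff)
  with DERIV_divide[OF 1 dt_deriv assms(1)] show ?thesis unfolding d by simp
qed

text \<open>Numerator of the derivative of \<open>zf\<close>; its zero \<open>tc\<close> is the
  fold.\<close>

definition pz :: "complex \<Rightarrow> complex" where
  "pz t = (dt t - 3 * rcc * t\<^sup>2 * (t - 1)) * nt t + 4 * rcc * t * (t - 1) * dt t"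

lemma zf_deriv:
  assumes "nt t \<noteq> 0"
  shows "(zf has_field_derivative pz t / nt t ^ 3) (at t)"
proof -
  have 1: "((\<lambda>t. (t - 1) * dt t) has_field_derivative dt t - 3 * rcc * t\<^sup>2 * (t - 1)) (at t)"
    by (rule derivative_eq_intros refl dt_deriv | simp)+
  have 2: "((\<lambda>t. (nt t)\<^sup>2) has_field_derivative 2 * nt t * (- 2 * rcc * t)) (at t)"
    by (rule derivative_eq_intros refl nt_deriv | simp)+
  show ?thesis unfolding zf_def[abs_def]
    by (rule DERIV_cong[OF DERIV_divide[OF 1 2]]) (use assms in \<open>simp_all add: pz_def field_simps power2_eq_square power3_eq_cube\<close>)
qed

text \<open>Brings the derivative into the logarithmic form with the factor \<open>Jac\<close>,
  parallel to \<open>Nuv_has_derivative\<close>.\<close>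

lemma zf_deriv_eq:
  assumes "dt t \<noteq> 0" "nt t \<noteq> 0" "t \<noteq> 0" "t \<noteq> 1"
  shows "pz t / nt t ^ 3 = lf t * zf t * Jac (uf t) (vf t)"
proof -
  have lz: "lf t * zf t = (dt t)\<^sup>2 / (t * nt t ^ 3)"
    using assms by (simp add: lf_def zf_def power2_eq_square power3_eq_cube)
  have "Jac (uf t) (vf t) = ((dt t)\<^sup>2 + rcc * t\<^sup>2 * (t - 1) * dt t + (t - 1) * dt t - 3 * (rcc * t\<^sup>2 * (t - 1)) * (t - 1)) / (dt t)\<^sup>2"
  proof -
    have J: "Jac (a / d) (n / d) = (d\<^sup>2 + a * d + n * d - 3 * a * n) / d\<^sup>2" if "d \<noteq> 0" for a n d
      using that by (simp add: Jac_def field_simps power2_eq_square)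
    show ?thesis unfolding uf_def vf_def using J[OF assms(1)] by simp
  qed
  moreover have "d\<^sup>2 / m * (p / d\<^sup>2) = p / m" if "d \<noteq> 0" for d m p :: complex using that by simp
  ultimately have "lf t * zf t * Jac (uf t) (vf t) = ((dt t)\<^sup>2 + rcc * t\<^sup>2 * (t - 1) * dt t + (t - 1) * dt t - 3 * (rcc * t\<^sup>2 * (t - 1)) * (t - 1)) / (t * nt t ^ 3)"
    using lz assms(1) by simp
  also have "(dt t)\<^sup>2 + rcc * t\<^sup>2 * (t - 1) * dt t + (t - 1) * dt t - 3 * (rcc * t\<^sup>2 * (t - 1)) * (t - 1) = t * pz t"
    unfolding pz_def dt_def nt_def by algebra
  also have "t * pz t / (t * nt t ^ 3) = pz t / nt t ^ 3" using assms by simp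
  finally show ?thesis by simp
qed

lemma tc_powers: "tc\<^sup>2 = (128 - 32 * s7) / 9" "tc ^ 3 = (640 * s7 - 1408) / 27"
proof -
  show 1: "tc\<^sup>2 = (128 - 32 * s7) / 9" by (simp add: tc_def power2_eq_square field_simps s7_rules)
  have "tc ^ 3 = tc\<^sup>2 * tc" by (simp add: power2_eq_square power3_eq_cube)
  thus "tc ^ 3 = (640 * s7 - 1408) / 27" unfolding 1 by (simp add: tc_def field_simps s7_rules)
qed

lemma tc_values:
  shows "dt tc = 24 * s7 - 63" "nt tc = 14 - 5 * s7" "dt tc \<noteq> 0" "nt tc \<noteq> 0" "tc \<noteq> 0" "tc \<noteq> 1"
    "uf tc = (s7 - 1) / 3" "vf tc = (11 + 4 * s7) / 9" "zf tc = 1" "pz tc = 0"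
proof -
  show d: "dt tc = 24 * s7 - 63" and n: "nt tc = 14 - 5 * s7"
    unfolding dt_def nt_def tc_powers rcc_def by (simp_all add: field_simps s7_rules)
  have "dt tc * (24 * s7 + 63) = 63" "nt tc * (14 + 5 * s7) = 21" "tc * (s7 + 1) = 8" "(tc - 1) * (4 * s7 + 7) = 21"
    unfolding d n by (simp_all add: tc_def field_simps s7_rules)
  thus nz: "dt tc \<noteq> 0" "nt tc \<noteq> 0" "tc \<noteq> 0" "tc \<noteq> 1" by auto
  have "rcc * tc\<^sup>2 * (tc - 1) = (s7 - 1) / 3 * dt tc" unfolding d tc_powers unfolding rcc_def tc_def by (simp add: field_simps s7_rules)
  thus "uf tc = (s7 - 1) / 3" using nz by (simp add: uf_def)
  have "tc - 1 = (11 + 4 * s7) / 9 * dt tc" unfolding d unfolding tc_def by (simp add: field_simps s7_rules)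
  thus "vf tc = (11 + 4 * s7) / 9" using nz by (simp add: vf_def)
  have "(tc - 1) * dt tc = (nt tc)\<^sup>2" unfolding d n unfolding power2_eq_square tc_def by (simp add: field_simps s7_rules)
  thus "zf tc = 1" using nz by (simp add: zf_def)
  show "pz tc = 0" unfolding pz_def d n tc_powers unfolding tc_def rcc_def by (simp add: field_simps s7_rules)
qed

text \<open>To second order \<open>1 - z\<close> is \<open>kfold\<^sup>2 * (t - tc)\<^sup>2\<close>
  at the fold, so the square is minus half the second derivative of \<open>zf\<close> there.\<close>

definition kfold :: real where "kfold = sqrt ((125 + 47 * sqrt 7) / 144)"

lemma kfold: "kfold > 0" "complex_of_real (kfold\<^sup>2) = (125 + 47 * s7) / 144"
proof -
  have p: "(125 + 47 * sqrt 7) / 144 > 0" by (simp add: add_pos_nonneg)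
  show "kfold > 0" unfolding kfold_def using p by (rule real_sqrt_gt_zero)
  have "kfold\<^sup>2 = (125 + 47 * sqrt 7) / 144" unfolding kfold_def using p by (intro real_sqrt_pow2) simp
  hence "complex_of_real (kfold\<^sup>2) = complex_of_real ((125 + 47 * sqrt 7) / 144)" by (rule arg_cong)
  thus "complex_of_real (kfold\<^sup>2) = (125 + 47 * s7) / 144" by (simp only: s7_def) simp
qed

lemma zf_deriv2: "((\<lambda>t. pz t / nt t ^ 3) has_field_derivative - 2 * of_real (kfold\<^sup>2)) (at tc)"
proof -
  define P' where "P' = (- 6 * rcc * tc\<^sup>2 - 6 * rcc * tc * (tc - 1)) * nt tc + (dt tc - 3 * rcc * tc\<^sup>2 * (tc - 1)) * (- 2 * rcc * tc)
     + 4 * rcc * (2 * tc - 1) * dt tc + 4 * rcc * tc * (tc - 1) * (- 3 * rcc * tc\<^sup>2)"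
  have p: "(pz has_field_derivative P') (at tc)"
    unfolding pz_def[abs_def] P'_def by (rule derivative_eq_intros refl dt_deriv nt_deriv | simp)+ (simp add: algebra_simps)
  have q: "((\<lambda>t. nt t ^ 3) has_field_derivative 3 * (nt tc)\<^sup>2 * (- 2 * rcc * tc)) (at tc)"
    by (rule derivative_eq_intros refl nt_deriv | simp)+
  have "P' = - 2 * ((125 + 47 * s7) / 144) * nt tc ^ 3"
  proof -
    have n3: "nt tc ^ 3 = 10094 - 3815 * s7"
      unfolding tc_values(2) by (simp add: power3_eq_cube algebra_simps s7_rules)
    show ?thesis unfolding P'_def n3 unfolding tc_values(1,2) tc_powers unfolding tc_def rcc_def
      by (simp add: field_simps s7_rules)
  qed
  hence P': "P' / nt tc ^ 3 = - 2 * of_real (kfold\<^sup>2)" unfolding kfold(2) by (simp only: nonzero_mult_div_cancel_right[OF power_not_zero[OF tc_values(4)]])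
  show ?thesis
  proof (rule DERIV_cong[OF DERIV_divide[OF p q]])
    show "nt tc ^ 3 \<noteq> 0" using tc_values(4) by simp
    have "pz tc = 0" by (rule tc_values)
    thus "(P' * nt tc ^ 3 - pz tc * (3 * (nt tc)\<^sup>2 * (- 2 * rcc * tc))) / (nt tc ^ 3 * nt tc ^ 3) = - 2 * of_real (kfold\<^sup>2)"
      unfolding P'[symmetric] using mult_divide_mult_cancel_right[of "nt tc ^ 3" P' "nt tc ^ 3"] tc_values(4)
      by (simp only: mult_zero_left diff_zero power_eq_0_iff) simp
  qed
qed

text \<open>The derivative of \<open>u\<close> with respect to \<open>t\<close> at the fold.\<close>

definition afold :: complex where "afold = (5 + 2 * s7) / 6"

lemma fold_speed: "lf tc * dirU (uf tc) (vf tc) = afold" "lf tc * dirV (uf tc) (vf tc) = 2 * ((2 + s7) / 3) * afold"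
proof -
  have l: "lf tc = (7 + 13 * s7) / 168"
  proof -
    have "dt tc * 168 = (7 + 13 * s7) * (tc * (tc - 1) * nt tc)"
      unfolding tc_values(1,2) unfolding tc_def by (simp add: field_simps s7_rules)
    moreover have "tc * (tc - 1) * nt tc \<noteq> 0" using tc_values by simp
    ultimately show ?thesis unfolding lf_def by (subst frac_eq_eq) auto
  qed
  show "lf tc * dirU (uf tc) (vf tc) = afold" "lf tc * dirV (uf tc) (vf tc) = 2 * ((2 + s7) / 3) * afold"
    unfolding l dirU_def dirV_def tc_values afold_def by (simp_all add: field_simps s7_rules)
qed

text \<open>The coefficient of the cube of the square root in the expansion of \<open>Nuv\<close>,
  without the factor that depends on \<open>w\<close>: two thirds of the constant part of the
  derivative of \<open>Kuv\<close>, divided by \<open>kfold\<close>.\<close>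

definition kap3 :: complex where "kap3 = 2/3 * (afold * ((19304 * s7 - 51016) / 243)) / of_real kfold"

lemma w2_crit: "w2_poly ((s7 - 1) / 3) ((11 + 4 * s7) / 9) w = (((2 + s7) / 3)\<^sup>2 * ((113 + 37 * s7) / 27))\<^sup>2 * qn w"
proof -
  have a: "(s7 - 1) / 3 = (2 + s7) / 3 - 1" by (simp add: field_simps)
  have b: "(11 + 4 * s7) / 9 = ((2 + s7) / 3)\<^sup>2" by (simp add: power2_eq_square field_simps s7_rules)
  show ?thesis unfolding a b w2_poly_diag q2_crit
    by (simp only: power_mult_distrib power_mult[symmetric]) simp
qed

text \<open>Each \<open>z\<close> near 1 has two parameters \<open>t\<close> near the fold. The
  bound \<open>norm (U s) \<le> ucrit\<close> singles out the one that belongs to the small solution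
  and thereby fixes the sign of the cubic term.\<close>

theorem N_fold_expansion:
  assumes w: "w2_poly ((s7 - 1) / 3) ((11 + 4 * s7) / 9) w \<notin> \<real>\<^sub>\<le>\<^sub>0"
    and UV: "\<forall>\<^sub>F s in F. U s = rcc * s * (1 + V s)\<^sup>2 \<and> V s = s * (1 + U s)\<^sup>2 \<and> norm (U s) \<le> ucrit \<and> norm s < 1"
    and U: "(U \<longlongrightarrow> of_real ucrit) F" and s1: "((\<lambda>s. s) \<longlongrightarrow> 1) F"
  obtains n0 n2 where "(\<lambda>s. Nuv (csqrt (w2_poly (U s) (V s) w)) (U s) (V s) w - (n0 + n2 * csqrt (1 - s) ^ 2 + (kap3 * ((1 + w) * hq w)) * csqrt (1 - s) ^ 3))
     \<in> O[F](\<lambda>s. csqrt (1 - s) ^ 4)"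
proof -
  have ucc: "complex_of_real ucrit = (s7 - 1) / 3" by (simp add: ucrit_def s7_def)
  define S where "S t = csqrt (w2_poly (uf t) (vf t) w)" for t
  define good where "good t \<longleftrightarrow> dt t \<noteq> 0 \<and> nt t \<noteq> 0 \<and> t \<noteq> 0 \<and> t \<noteq> 1 \<and> 1 + uf t + vf t \<noteq> 0 \<and> w2_poly (uf t) (vf t) w \<notin> \<real>\<^sub>\<le>\<^sub>0" for t
  have lims: "(dt \<longlongrightarrow> dt tc) (nhds tc)" "(nt \<longlongrightarrow> nt tc) (nhds tc)" "(uf \<longlongrightarrow> uf tc) (nhds tc)" "(vf \<longlongrightarrow> vf tc) (nhds tc)"
    using DERIV_isCont[OF dt_deriv] DERIV_isCont[OF nt_deriv] DERIV_isCont[OF uf_deriv] DERIV_isCont[OF vf_deriv] tc_values(3-6)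
    by (auto simp: isCont_def tendsto_at_iff_tendsto_nhds)
  have w2l: "((\<lambda>t. w2_poly (uf t) (vf t) w) \<longlongrightarrow> w2_poly (uf tc) (vf tc) w) (nhds tc)"
    unfolding w2_poly_def by (intro tendsto_intros lims)
  have "\<forall>\<^sub>F t in nhds tc. good t"
    unfolding good_def
  proof (intro eventually_conj)
    show "\<forall>\<^sub>F t in nhds tc. dt t \<noteq> 0" by (rule tendsto_imp_eventually_ne[OF lims(1) tc_values(3)])
    show "\<forall>\<^sub>F t in nhds tc. nt t \<noteq> 0" by (rule tendsto_imp_eventually_ne[OF lims(2) tc_values(4)])
    show "\<forall>\<^sub>F t in nhds tc. t \<noteq> 0" by (rule tendsto_imp_eventually_ne[OF filterlim_ident tc_values(5)])
    show "\<forall>\<^sub>F t in nhds tc. t \<noteq> 1" by (rule tendsto_imp_eventually_ne[OF filterlim_ident tc_values(6)])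
    have "1 + uf tc + vf tc \<noteq> 0"
    proof -
      have "(1 + uf tc + vf tc) * (17 - 7 * s7) = - 6" unfolding tc_values by (simp add: field_simps s7_rules)
      thus ?thesis by auto
    qed
    thus "\<forall>\<^sub>F t in nhds tc. 1 + uf t + vf t \<noteq> 0"
      by (intro tendsto_imp_eventually_ne[where c = "1 + uf tc + vf tc"] tendsto_intros lims)
    have "\<forall>\<^sub>F t in nhds tc. w2_poly (uf t) (vf t) w \<in> - \<real>\<^sub>\<le>\<^sub>0"
      by (rule topological_tendstoD[OF w2l]) (use w in \<open>simp_all add: open_Compl closed_nonpos_Reals_complex tc_values(7,8)\<close>)
    thus "\<forall>\<^sub>F t in nhds tc. w2_poly (uf t) (vf t) w \<notin> \<real>\<^sub>\<le>\<^sub>0" by simp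
  qed
  then obtain \<delta> where \<delta>: "\<delta> > 0" "\<And>t. t \<in> ball tc \<delta> \<Longrightarrow> good t"
    unfolding eventually_nhds_metric by (metis dist_commute mem_ball)
  define N where "N t = Nuv (S t) (uf t) (vf t) w" for t
  define K where "K t = Kuv (S t) (uf t) (vf t) w" for t
  have du: "(uf has_field_derivative lf t * dirU (uf t) (vf t)) (at t)"
    and dv: "(vf has_field_derivative lf t * dirV (uf t) (vf t)) (at t)"
    and dz: "(zf has_field_derivative lf t * zf t * Jac (uf t) (vf t)) (at t)"
    and vnz: "vf t \<noteq> 0" "1 + uf t \<noteq> 0" if "good t" for t
  proof -
    have g: "dt t \<noteq> 0" "nt t \<noteq> 0" "t \<noteq> 0" "t \<noteq> 1" using that unfolding good_def by blast+
    show "(uf has_field_derivative lf t * dirU (uf t) (vf t)) (at t)" by (rule uf_deriv[OF g])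
    show "(vf has_field_derivative lf t * dirV (uf t) (vf t)) (at t)" by (rule vf_deriv[OF g])
    show "(zf has_field_derivative lf t * zf t * Jac (uf t) (vf t)) (at t)"
      unfolding zf_deriv_eq[OF g, symmetric] by (rule zf_deriv[OF g(2)])
    show "vf t \<noteq> 0" using g by (simp add: vf_def)
    show "1 + uf t \<noteq> 0" using g by (simp only: uf1[OF g(1)]) simp
  qed
  have dS: "(S has_field_derivative (lf t * (w2u (uf t) (vf t) w * dirU (uf t) (vf t) + w2v (uf t) (vf t) w * dirV (uf t) (vf t)) / (2 * S t))) (at t)"
    if g: "good t" for t
  proof -
    have "((\<lambda>t. csqrt (w2_poly (uf t) (vf t) w)) has_field_derivative inverse (2 * csqrt (w2_poly (uf t) (vf t) w)) *
       (w2u (uf t) (vf t) w * (lf t * dirU (uf t) (vf t)) + w2v (uf t) (vf t) w * (lf t * dirV (uf t) (vf t)))) (at t)"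
      by (rule DERIV_chain2[OF has_field_derivative_csqrt w2_deriv[OF du[OF g] dv[OF g]]]) (use g in \<open>simp add: good_def\<close>)
    thus ?thesis unfolding S_def[symmetric]
      by (rule DERIV_cong) (simp only: divide_inverse distrib_left distrib_right mult_ac)
  qed
  have S2: "(S t)\<^sup>2 = w2_poly (uf t) (vf t) w" for t by (simp add: S_def)
  have S0: "S t \<noteq> 0" if "good t" for t using that S2[of t] by (auto simp: good_def)
  have dN: "(N has_field_derivative lf t * zf t * Jac (uf t) (vf t) * K t) (at t)" if g: "good t" for t
  proof -
    have "(N has_field_derivative lf t * Jac (uf t) (vf t) * ((za (uf t) (vf t) w + zb (uf t) (vf t) w / S t) / (1 + uf t + vf t) ^ 4)) (at t)"
      unfolding N_def by (rule Nuv_has_derivative[OF du[OF g] dv[OF g] dS[OF g] S2 S0[OF g]]) (use g in \<open>simp add: good_def\<close>)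
    thus ?thesis
    proof (rule DERIV_cong)
      define q where "q = za (uf t) (vf t) w + zb (uf t) (vf t) w / S t"
      have z: "zf t = vf t / (1 + uf t)\<^sup>2" using g zf_eq by (simp add: good_def)
      have "zf t * K t = q / (1 + uf t + vf t) ^ 4"
        unfolding K_def Kuv_def q_def[symmetric] z using vnz[OF g] g by (simp add: good_def)
      thus "lf t * Jac (uf t) (vf t) * (q / (1 + uf t + vf t) ^ 4) = lf t * zf t * Jac (uf t) (vf t) * K t"
        by (metis mult.assoc mult.commute)
    qed
  qed
  have hol: "uf holomorphic_on ball tc \<delta>" "vf holomorphic_on ball tc \<delta>" "zf holomorphic_on ball tc \<delta>" "S holomorphic_on ball tc \<delta>" "N holomorphic_on ball tc \<delta>"
    unfolding holomorphic_on_open[OF open_ball] using du dv dz dS dN \<delta>(2) by blast+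
  have Kh: "K holomorphic_on ball tc \<delta>"
    unfolding K_def Kuv_def za_def zb_def by (intro holomorphic_intros hol) (use \<delta>(2) vnz S0 in \<open>auto simp: good_def\<close>)
  have gtc: "good tc" using \<delta> by simp
  define gc where "gc = ((2 + sqrt 7) / 3)\<^sup>2 * ((113 + 37 * sqrt 7) / 27)"
  have gc: "gc > 0" unfolding gc_def by (intro mult_pos_pos divide_pos_pos zero_less_power add_pos_nonneg) auto
  have gcc: "((2 + s7) / 3)\<^sup>2 * ((113 + 37 * s7) / 27) = of_real gc" by (simp add: gc_def s7_def)
  have w2c: "w2_poly (uf tc) (vf tc) w = of_real gc ^ 2 * qn w" unfolding tc_values w2_crit gcc ..
  have Stc: "S tc = ((2 + s7) / 3)\<^sup>2 * ((113 + 37 * s7) / 27) * csqrt (qn w)"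
    unfolding gcc S_def
  proof (rule csqrt_unique)
    show "(of_real gc * csqrt (qn w))\<^sup>2 = w2_poly (uf tc) (vf tc) w" by (simp add: w2c power_mult_distrib)
    have "S tc \<noteq> 0" by (rule S0[OF gtc])
    hence q0: "csqrt (qn w) \<noteq> 0" using S2[of tc] w2c by auto
    show "0 < Re (of_real gc * csqrt (qn w)) \<or> Re (of_real gc * csqrt (qn w)) = 0 \<and> 0 \<le> Im (of_real gc * csqrt (qn w))"
      using csqrt_principal[of "qn w"] gc by auto
  qed
  have q0: "csqrt (qn w) \<noteq> 0" using Stc S0[OF gtc] by auto
  have dK: "deriv K tc = afold * ((19304 * s7 - 51016) / 243) * ((1 + w) * hq w)"
    unfolding hq_def K_def[abs_def]
  proof (rule DERIV_imp_deriv, rule Kuv_deriv_crit[where R = "csqrt (qn w)"])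
    show "(uf has_field_derivative afold) (at tc)" using du[OF gtc] by (simp only: fold_speed)
    show "(vf has_field_derivative 2 * ((2 + s7) / 3) * afold) (at tc)" using dv[OF gtc] by (simp only: fold_speed)
    show "(S has_field_derivative (w2u (uf tc) (vf tc) w * afold + w2v (uf tc) (vf tc) w * (2 * ((2 + s7) / 3) * afold)) / (2 * S tc)) (at tc)"
      by (rule DERIV_cong[OF dS[OF gtc]]) (simp only: distrib_left mult.left_commute[of "lf tc"] fold_speed)
  qed (use tc_values Stc q0 in auto)
  define t where "t s = (1 + V s) / (1 + U s)" for s
  have yc: "(2 + s7) / 3 \<noteq> 0"
  proof -
    have "(2 + s7) / 3 * (s7 - 2) = 1" by (simp add: field_simps s7_rules)
    thus ?thesis by auto
  qed
  have lV: "(V \<longlongrightarrow> (11 + 4 * s7) / 9) F"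
  proof -
    have "((\<lambda>s. s * (1 + U s)\<^sup>2) \<longlongrightarrow> 1 * (1 + of_real ucrit)\<^sup>2) F" by (intro tendsto_intros U s1)
    moreover have "1 * (1 + complex_of_real ucrit)\<^sup>2 = (11 + 4 * s7) / 9" unfolding ucc by (simp add: power2_eq_square field_simps s7_rules)
    ultimately have "((\<lambda>s. s * (1 + U s)\<^sup>2) \<longlongrightarrow> (11 + 4 * s7) / 9) F" by (simp only:)
    thus ?thesis by (rule Lim_transform_eventually) (use UV in \<open>auto elim!: eventually_mono\<close>)
  qed
  have 1: "1 + complex_of_real ucrit \<noteq> 0" using yc by (simp add: ucc field_simps)
  have lt: "(t \<longlongrightarrow> tc) F"
  proof -
    have "(t \<longlongrightarrow> (1 + (11 + 4 * s7) / 9) / (1 + of_real ucrit)) F" unfolding t_def by (intro tendsto_intros U lV 1)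
    moreover have "1 + (11 + 4 * s7) / 9 = tc * (1 + of_real ucrit)" unfolding ucc tc_def by (simp add: field_simps s7_rules)
    ultimately show ?thesis using 1 by simp
  qed
  have evg: "\<forall>\<^sub>F s in F. t s \<in> ball tc (\<delta>/2) \<and> 1 + U s \<noteq> 0"
  proof (rule eventually_conj)
    show "\<forall>\<^sub>F s in F. t s \<in> ball tc (\<delta>/2)"
      using tendstoD[OF lt, of "\<delta>/2"] \<delta> by (auto simp: dist_commute elim!: eventually_mono)
    show "\<forall>\<^sub>F s in F. 1 + U s \<noteq> 0"
      by (rule tendsto_imp_eventually_ne[OF tendsto_add[OF tendsto_const U] 1])
  qed
  obtain Q where Q: "Q holomorphic_on ball 0 \<delta>" "\<And>e. e \<in> ball 0 \<delta> \<Longrightarrow> uf (tc + e) = uf tc + deriv uf tc * e + e\<^sup>2 * Q e"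
    using holomorphic_taylor_at[OF hol(1) \<delta>(1), of 1] by (auto simp: numeral_2_eq_2)
  obtain P where P: "P > 0" "\<And>e. norm e \<le> \<delta> / 2 \<Longrightarrow> norm (Q e) \<le> P"
    using bounded_near_center[OF Q(1) \<delta>(1)] by blast
  define a where "a = (5 + 2 * sqrt 7) / 6"
  have a: "a > 0" "afold = of_real a" by (simp_all add: a_def afold_def s7_def add_pos_nonneg)
  have duc: "deriv uf tc = of_real a" using DERIV_imp_deriv[OF du[OF gtc]] by (simp only: fold_speed a(2))
  \<comment> \<open>At \<open>tc\<close> the function \<open>uf\<close> has a positive slope
    \<open>a\<close>. As \<open>Re (U s)\<close> never exceeds \<open>ucrit\<close>, the real part
    of \<open>t s - tc\<close> is bounded above by a term of second order, which is the branch
    condition of \<open>fold_expansion\<close>.\<close>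
  have ev: "\<forall>\<^sub>F s in F. U s = uf (t s) \<and> V s = vf (t s) \<and> zf (t s) = s \<and> Re (t s - tc) \<le> P / a * norm (t s - tc) ^ 2 \<and> norm s < 1"
    using evg UV
  proof eventually_elim
    case (elim s)
    have tb: "t s \<in> ball tc (\<delta>/2)" and Un: "norm (U s) \<le> ucrit" and sn: "norm s < 1" using elim by blast+
    have g: "good (t s)" using tb \<delta> by auto
    have p: "U s = uf (t s)" "V s = vf (t s)" "s = zf (t s)"
    proof -
      have 1: "U s = rcc * s * (1 + V s)\<^sup>2" "V s = s * (1 + U s)\<^sup>2" "1 + U s \<noteq> 0" using elim by blast+
      have 2: "dt (t s) \<noteq> 0" "nt (t s) \<noteq> 0" using g unfolding good_def by blast+
      note cp = curve_param[OF 1 t_def 2]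
      show "U s = uf (t s)" by (rule cp)
      show "V s = vf (t s)" by (rule cp)
      show "s = zf (t s)" by (rule cp)
    qed
    define e where "e = t s - tc"
    have e: "norm e < \<delta> / 2" using tb by (simp add: e_def dist_norm norm_minus_commute)
    have "uf (tc + e) = of_real ucrit + of_real a * e + e\<^sup>2 * Q e"
      using Q(2)[of e] e \<delta>(1) duc tc_values(7) by (simp add: ucc)
    hence "Re (U s) = ucrit + a * Re e + Re (e\<^sup>2 * Q e)" using p(1) by (simp add: e_def)
    moreover have "Re (U s) \<le> ucrit" using Un complex_Re_le_cmod[of "U s"] by linarith
    moreover have "- Re (e\<^sup>2 * Q e) \<le> norm e ^ 2 * P"
    proof -
      have "- Re (e\<^sup>2 * Q e) \<le> norm (e\<^sup>2 * Q e)" using abs_Re_le_cmod[of "e\<^sup>2 * Q e"] by linarith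
      also have "\<dots> \<le> norm e ^ 2 * P" unfolding norm_mult norm_power using P(2)[of e] e by (intro mult_left_mono) auto
      finally show ?thesis .
    qed
    ultimately have "a * Re e \<le> norm e ^ 2 * P" by linarith
    hence "Re e \<le> P / a * norm e ^ 2" using a by (simp add: field_simps)
    thus ?case using p(1,2) p(3)[symmetric] sn unfolding e_def by blast
  qed
  have "(\<lambda>s. N (t s) - (N tc + (- K tc) * csqrt (1 - s) ^ 2 + (2/3 * deriv K tc / of_real kfold) * csqrt (1 - s) ^ 3))
     \<in> O[F](\<lambda>s. csqrt (1 - s) ^ 4)"
  proof (rule fold_expansion[OF hol(5) Kh hol(3) \<delta>(1) _ _ _ _ kfold(1) lt])
    show "deriv N t = deriv zf t * K t" if "t \<in> ball tc \<delta>" for t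
      using DERIV_imp_deriv[OF dN] DERIV_imp_deriv[OF dz] \<delta>(2)[OF that] by simp
    show "zf tc = 1" by (rule tc_values)
    show "deriv zf tc = 0" using DERIV_imp_deriv[OF zf_deriv[OF tc_values(4)]] tc_values by simp
    show "deriv (deriv zf) tc = - 2 * of_real (kfold\<^sup>2)"
    proof -
      have "\<forall>\<^sub>F t in nhds tc. deriv zf t = pz t / nt t ^ 3"
        using tendsto_imp_eventually_ne[OF lims(2) tc_values(4)] by eventually_elim (rule DERIV_imp_deriv[OF zf_deriv])
      hence "deriv (deriv zf) tc = deriv (\<lambda>t. pz t / nt t ^ 3) tc" by (rule deriv_cong_ev) simp
      thus ?thesis using DERIV_imp_deriv[OF zf_deriv2] by simp
    qed
    show "\<forall>\<^sub>F s in F. zf (t s) = s \<and> Re (t s - tc) \<le> P / a * norm (t s - tc) ^ 2 \<and> norm s < 1"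
      using ev by (auto elim!: eventually_mono)
  qed (use P a in auto)
  moreover have "2/3 * deriv K tc / of_real kfold = kap3 * ((1 + w) * hq w)" by (simp add: dK kap3_def)
  ultimately have "(\<lambda>s. N (t s) - (N tc + (- K tc) * csqrt (1 - s) ^ 2 + (kap3 * ((1 + w) * hq w)) * csqrt (1 - s) ^ 3))
     \<in> O[F](\<lambda>s. csqrt (1 - s) ^ 4)" by (simp only:)
  also have "(\<lambda>s. N (t s) - (N tc + (- K tc) * csqrt (1 - s) ^ 2 + (kap3 * ((1 + w) * hq w)) * csqrt (1 - s) ^ 3)) \<in> O[F](\<lambda>s. csqrt (1 - s) ^ 4)
    \<longleftrightarrow> (\<lambda>s. Nuv (csqrt (w2_poly (U s) (V s) w)) (U s) (V s) w - (N tc + (- K tc) * csqrt (1 - s) ^ 2 + (kap3 * ((1 + w) * hq w)) * csqrt (1 - s) ^ 3)) \<in> O[F](\<lambda>s. csqrt (1 - s) ^ 4)"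
    by (rule landau_o.big.in_cong) (use ev in \<open>auto elim!: eventually_mono simp: N_def S_def\<close>)
  finally show ?thesis by (rule that)
qed

section \<open>The coefficient T3\<close>

text \<open>In terms of \<open>u0_fun z\<close> the variable \<open>z\<close> can be eliminated, and
  the last two factors increase with \<open>u0_fun z\<close>. This yields monotonicity and
  injectivity of \<open>r_fun\<close>, hence the values of \<open>tau\<close>.\<close>

lemma r_fun_eq:
  assumes z: "z > 0"
  shows "r_fun z = (3 * u0_fun z - 1)\<^sup>2 * (3 * u0_fun z + 2 - 1 / u0_fun z) / 16"
proof -
  define a where "a = u0_fun z"
  have a: "a > 1/3" "z * (1 + a) * (3 * a - 1) = 1" "r_fun z * z * (1 + z * (1 + a)\<^sup>2)\<^sup>2 = a"
    using u0_fun_props[OF z] by (simp_all add: a_def)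
  define p where "p = 3 * a - 1"
  have p: "p > 0" "1 + a > 0" "a > 0" using a by (simp_all add: p_def)
  have zz: "z = 1 / ((1 + a) * p)" using a(2) p unfolding p_def[symmetric] by (simp add: eq_divide_eq mult.assoc)
  have "1 + z * (1 + a)\<^sup>2 = 1 + (1 + a) / p" using p by (simp add: zz power2_eq_square)
  also have "\<dots> = 4 * a / p" using p by (simp add: field_simps p_def)
  finally have "r_fun z * (1 / ((1 + a) * p)) * (4 * a / p)\<^sup>2 = a" using a(3) zz by simp
  moreover have "r_fun z * (1 / ((1 + a) * p)) * (4 * a / p)\<^sup>2 * (p ^ 3 * (1 + a)) = a * (r_fun z * 16 * a)"
    using p by (simp add: power_divide power2_eq_square power3_eq_cube divide_simps)
  ultimately have "a * (p ^ 3 * (1 + a)) = a * (r_fun z * 16 * a)" by simp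
  hence "r_fun z * 16 * a = p ^ 3 * (1 + a)" using p by simp
  also have "\<dots> = p\<^sup>2 * (p * (1 + a))" by (simp add: power2_eq_square power3_eq_cube)
  also have "p * (1 + a) = (3 * a + 2 - 1 / a) * a" using p by (simp add: p_def field_simps)
  finally show ?thesis using p by (simp add: p_def a_def field_simps)
qed

lemma u0_fun_antimono: "0 < z \<Longrightarrow> z \<le> z' \<Longrightarrow> u0_fun z' \<le> u0_fun z"
  unfolding u0_fun_def by (intro add_left_mono real_sqrt_le_mono) (simp add: frac_le)

lemma u0_fun_inj: "0 < z \<Longrightarrow> 0 < z' \<Longrightarrow> u0_fun z = u0_fun z' \<Longrightarrow> z = z'"
  unfolding u0_fun_def by (simp add: field_simps)

lemma r_fun_shape_mono:
  fixes a b :: real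
  assumes "1/3 < a" "a < b"
  shows "(3 * a - 1)\<^sup>2 * (3 * a + 2 - 1 / a) / 16 < (3 * b - 1)\<^sup>2 * (3 * b + 2 - 1 / b) / 16"
proof -
  have p: "3 * a + 2 - 1 / a > 0"
  proof -
    have "1 / a < 3" using assms by (simp add: field_simps)
    thus ?thesis using assms by linarith
  qed
  have "(3 * a - 1)\<^sup>2 * (3 * a + 2 - 1 / a) < (3 * b - 1)\<^sup>2 * (3 * b + 2 - 1 / b)"
  proof (rule mult_strict_mono)
    show "(3 * a - 1)\<^sup>2 < (3 * b - 1)\<^sup>2" using assms by (intro power_strict_mono) auto
    have "1 / b < 1 / a" using assms by (intro divide_strict_left_mono) auto
    thus "3 * a + 2 - 1 / a < 3 * b + 2 - 1 / b" using assms by linarith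
  qed (use p assms in auto)
  thus ?thesis by simp
qed

lemma r_fun_antimono: "0 < z \<Longrightarrow> z \<le> z' \<Longrightarrow> r_fun z' \<le> r_fun z"
proof -
  assume z: "0 < z" "z \<le> z'"
  hence z': "0 < z'" by simp
  consider "u0_fun z' = u0_fun z" | "u0_fun z' < u0_fun z" using u0_fun_antimono[OF z] by linarith
  thus "r_fun z' \<le> r_fun z"
  proof cases
    case 2
    from r_fun_shape_mono[OF u0_fun_props(1)[OF z'] 2] show ?thesis unfolding r_fun_eq[OF z(1)] r_fun_eq[OF z'] by simp
  next
    case 1
    thus ?thesis unfolding r_fun_eq[OF z(1)] r_fun_eq[OF z'] by simp
  qed
qed

lemma r_fun_inj: "inj_on r_fun {0<..}"
proof (rule inj_onI)
  fix z z' :: real assume z: "z \<in> {0<..}" "z' \<in> {0<..}" "r_fun z = r_fun z'"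
  have "u0_fun z = u0_fun z'"
  proof (rule linorder_cases[of "u0_fun z" "u0_fun z'"])
    assume "u0_fun z < u0_fun z'"
    thus ?thesis using r_fun_shape_mono[OF u0_fun_props(1), of z "u0_fun z'"] z r_fun_eq[of z] r_fun_eq[of z'] by simp
  next
    assume "u0_fun z' < u0_fun z"
    thus ?thesis using r_fun_shape_mono[OF u0_fun_props(1), of z' "u0_fun z"] z r_fun_eq[of z] r_fun_eq[of z'] by simp
  qed
  thus "z = z'" using z u0_fun_inj by simp
qed

lemma tau_r_fun: "z > 0 \<Longrightarrow> tau (r_fun z) = z"
  unfolding tau_def by (rule the_inv_into_f_f[OF r_fun_inj]) simp

section \<open>Regularity of \<open>T_bullet\<close> in the variables \<open>z\<close> and
  \<open>w\<close>\<close>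

lemma has_sum_collect:
  fixes b :: "'i \<Rightarrow> 'a :: {banach, real_normed_field}" and e :: "'i \<Rightarrow> nat"
  assumes b: "(\<lambda>i. norm (b i)) summable_on UNIV" and s: "norm s \<le> 1"
  shows "(\<lambda>m. (\<Sum>\<^sub>\<infinity>i\<in>{i. e i = m}. b i) * s ^ m) sums (\<Sum>\<^sub>\<infinity>i. b i * s ^ e i)"
proof -
  define S where "S = (\<Sum>\<^sub>\<infinity>i. b i * s ^ e i)"
  have bij: "bij_betw snd (SIGMA m:UNIV. {i. e i = m}) UNIV"
    unfolding bij_betw_def by (auto simp: inj_on_def image_iff)
  have "(\<lambda>i. norm (b i * s ^ e i)) summable_on UNIV"
  proof (rule summable_on_comparison_test[OF b])
    show "norm (b i * s ^ e i) \<le> norm (b i)" for i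
      unfolding norm_mult norm_power by (intro mult_left_le power_le_one s norm_ge_zero)
  qed auto
  hence "((\<lambda>i. b i * s ^ e i) has_sum S) UNIV"
    unfolding S_def by (rule has_sum_infsum[OF abs_summable_summable])
  hence "((\<lambda>p. b (snd p) * s ^ e (snd p)) has_sum S) (SIGMA m:UNIV. {i. e i = m})"
    using has_sum_reindex_bij_betw[OF bij, of "\<lambda>i. b i * s ^ e i" S] by simp
  hence "((\<lambda>m. (\<Sum>\<^sub>\<infinity>i\<in>{i. e i = m}. b i) * s ^ m) has_sum S) UNIV"
  proof (rule has_sum_SigmaD)
    fix m :: nat
    have "b summable_on UNIV" by (rule abs_summable_summable[OF b])
    hence "(b has_sum (\<Sum>\<^sub>\<infinity>i\<in>{i. e i = m}. b i)) {i. e i = m}"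
      by (intro has_sum_infsum) (rule summable_on_subset_banach, auto)
    hence "((\<lambda>i. b i * s ^ m) has_sum (\<Sum>\<^sub>\<infinity>i\<in>{i. e i = m}. b i) * s ^ m) {i. e i = m}"
      by (rule has_sum_cmult_left)
    thus "((\<lambda>y. b (snd (m, y)) * s ^ e (snd (m, y))) has_sum (\<Sum>\<^sub>\<infinity>i\<in>{i. e i = m}. b i) * s ^ m) {i. e i = m}"
      by (subst has_sum_cong[of _ _ "\<lambda>i. b i * s ^ m"]) auto
  qed
  thus ?thesis unfolding S_def by (rule has_sum_imp_sums)
qed

lemma collect_abs_summable:
  fixes b :: "'i \<Rightarrow> 'a :: {banach, real_normed_field}" and e :: "'i \<Rightarrow> nat"
  assumes b: "(\<lambda>i. norm (b i)) summable_on UNIV"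
  shows "summable (\<lambda>m. norm (\<Sum>\<^sub>\<infinity>i\<in>{i. e i = m}. b i))"
proof (rule summable_comparison_test')
  have "(\<lambda>m. (\<Sum>\<^sub>\<infinity>i\<in>{i. e i = m}. norm (b i)) * 1 ^ m) sums (\<Sum>\<^sub>\<infinity>i. norm (b i) * 1 ^ e i)"
    by (rule has_sum_collect) (use b in auto)
  thus "summable (\<lambda>m. \<Sum>\<^sub>\<infinity>i\<in>{i. e i = m}. norm (b i))" by (simp add: sums_iff)
  show "norm (norm (\<Sum>\<^sub>\<infinity>i\<in>{i. e i = m}. b i)) \<le> (\<Sum>\<^sub>\<infinity>i\<in>{i. e i = m}. norm (b i))" if "0 \<le> m" for m
    using norm_infsum_bound[OF summable_on_subset_banach[OF b, of "{i. e i = m}"]] by simp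
qed

lemma power_series_disc:
  fixes c :: "nat \<Rightarrow> complex"
  assumes c: "summable (\<lambda>m. norm (c m))"
  shows "(\<lambda>s. \<Sum>m. c m * s ^ m) holomorphic_on ball 0 1" and "continuous_on (cball 0 1) (\<lambda>s. \<Sum>m. c m * s ^ m)"
proof -
  have cr: "conv_radius c \<ge> 1"
  proof -
    have "summable c" using c by (rule summable_norm_cancel)
    hence "summable (\<lambda>n. c n * 1 ^ n)" by simp
    from conv_radius_geI[OF this] show ?thesis by (simp add: one_ereal_def)
  qed
  show "(\<lambda>s. \<Sum>m. c m * s ^ m) holomorphic_on ball 0 1"
  proof (rule holomorphic_on_subset[OF power_series_holomorphic], rule subsetI)
    fix x :: complex assume "x \<in> ball 0 1"
    hence "ereal (norm x) < 1" by simp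
    also note cr
    finally show "x \<in> eball 0 (conv_radius c)" by (simp add: eball_def)
  qed
  have "uniform_limit (cball 0 1) (\<lambda>n s. \<Sum>m<n. c m * s ^ m) (\<lambda>s. \<Sum>m. c m * s ^ m) sequentially"
  proof (rule Weierstrass_m_test[OF _ c])
    show "norm (c m * s ^ m) \<le> norm (c m)" if "s \<in> cball 0 1" for m s
      unfolding norm_mult norm_power by (intro mult_left_le power_le_one norm_ge_zero) (use that in simp)
  qed
  thus "continuous_on (cball 0 1) (\<lambda>s. \<Sum>m. c m * s ^ m)"
    by (rule uniform_limit_theorem[rotated]) (auto intro!: always_eventually continuous_intros)
qed

lemma infsum_powers_disc:
  fixes b :: "'i \<Rightarrow> complex" and e :: "'i \<Rightarrow> nat"
  assumes b: "(\<lambda>i. norm (b i)) summable_on UNIV"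
  shows "(\<lambda>s. \<Sum>\<^sub>\<infinity>i. b i * s ^ e i) holomorphic_on ball 0 1" and "continuous_on (cball 0 1) (\<lambda>s. \<Sum>\<^sub>\<infinity>i. b i * s ^ e i)"
proof -
  define c where "c m = (\<Sum>\<^sub>\<infinity>i\<in>{i. e i = m}. b i)" for m
  have e: "(\<Sum>m. c m * s ^ m) = (\<Sum>\<^sub>\<infinity>i. b i * s ^ e i)" if "norm s \<le> 1" for s
    using has_sum_collect[OF b that, of e] by (simp add: sums_iff c_def)
  note P = power_series_disc[OF collect_abs_summable[OF b, of e]]
  show "(\<lambda>s. \<Sum>\<^sub>\<infinity>i. b i * s ^ e i) holomorphic_on ball 0 1"
    by (rule holomorphic_transform[OF P(1)]) (use e in \<open>auto simp: c_def\<close>)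
  show "continuous_on (cball 0 1) (\<lambda>s. \<Sum>\<^sub>\<infinity>i. b i * s ^ e i)"
    using P(2) by (rule continuous_on_cong[THEN iffD1, rotated -1]) (use e in \<open>auto simp: c_def\<close>)
qed

text \<open>Convergence at \<open>(x, 1, 1)\<close> dominates the series for all \<open>s\<close>
  and \<open>w\<close> in the closed unit disc; collecting the terms by the exponent of one variable
  makes it a power series in that variable.\<close>

lemma T_bullet_disc:
  assumes x: "x \<ge> 0" and Ts: "Tsummable x 1 1"
  shows "norm w \<le> 1 \<Longrightarrow> (\<lambda>s. T_bullet (of_real x) s w) holomorphic_on ball 0 1"
    and "norm s \<le> 1 \<Longrightarrow> (\<lambda>w. T_bullet (of_real x) s w) holomorphic_on ball 0 1"
    and "norm s \<le> 1 \<Longrightarrow> continuous_on (cball 0 1) (\<lambda>w. T_bullet (of_real x) s w)"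
proof -
  define p :: "nat \<times> nat \<times> nat \<Rightarrow> nat" where "p = (\<lambda>(n, m, k). m)"
  define q :: "nat \<times> nat \<times> nat \<Rightarrow> nat" where "q = (\<lambda>(n, m, k). k)"
  have T1: "T_bullet (of_real x) s w = (\<Sum>\<^sub>\<infinity>i. (of_real (acoef i * mono3 x 1 1 i) * w ^ q i) * s ^ p i)" for s w
    unfolding T_bullet_def by (rule infsum_cong) (auto simp: acoef_def mono3_def p_def q_def)
  have T2: "T_bullet (of_real x) s w = (\<Sum>\<^sub>\<infinity>i. (of_real (acoef i * mono3 x 1 1 i) * s ^ p i) * w ^ q i)" for s w
    unfolding T_bullet_def by (rule infsum_cong) (auto simp: acoef_def mono3_def p_def q_def)
  have sm: "(\<lambda>i. norm (of_real (acoef i * mono3 x 1 1 i) * y ^ e i :: complex)) summable_on UNIV" if "norm y \<le> 1" for y :: complex and e :: "_ \<Rightarrow> nat"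
  proof (rule summable_on_comparison_test[OF Ts])
    fix i
    have nn: "acoef i * mono3 x 1 1 i \<ge> 0" using x by (intro mult_nonneg_nonneg acoef_nonneg mono3_nonneg) auto
    have "norm (of_real (acoef i * mono3 x 1 1 i) * y ^ e i :: complex) = acoef i * mono3 x 1 1 i * norm y ^ e i"
      unfolding norm_mult norm_power norm_of_real using nn by simp
    also have "\<dots> \<le> acoef i * mono3 x 1 1 i" by (intro mult_left_le power_le_one nn that norm_ge_zero)
    finally show "norm (of_real (acoef i * mono3 x 1 1 i) * y ^ e i :: complex) \<le> acoef i * mono3 x 1 1 i" .
  qed auto
  show "norm w \<le> 1 \<Longrightarrow> (\<lambda>s. T_bullet (of_real x) s w) holomorphic_on ball 0 1"
    unfolding T1 by (rule infsum_powers_disc(1)[OF sm])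
  show "norm s \<le> 1 \<Longrightarrow> (\<lambda>w. T_bullet (of_real x) s w) holomorphic_on ball 0 1"
    unfolding T2 by (rule infsum_powers_disc(1)[OF sm])
  show "norm s \<le> 1 \<Longrightarrow> continuous_on (cball 0 1) (\<lambda>w. T_bullet (of_real x) s w)"
    unfolding T2 by (rule infsum_powers_disc(2)[OF sm])
qed

text \<open>A neighbourhood of the real segment from 0 to 1, written as a Minkowski sum because
  openness and convexity then come for free; convexity gives the connectedness for the identity
  theorem in \<open>w\<close>.\<close>

definition seg_nbhd :: "real \<Rightarrow> complex set" where
  "seg_nbhd \<delta> = (\<Union>x\<in>ball 0 \<delta>. \<Union>y\<in>closed_segment 0 1. {x + y})"

lemma seg_nbhd:
  "open (seg_nbhd \<delta>)" "convex (seg_nbhd \<delta>)" "w \<in> seg_nbhd \<delta> \<Longrightarrow> \<exists>t\<in>{0..1}. dist w (of_real t) < \<delta>"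
  "\<delta> > 0 \<Longrightarrow> of_real ` {0..1} \<subseteq> seg_nbhd \<delta>"
proof -
  show "open (seg_nbhd \<delta>)"
    unfolding seg_nbhd_def by (intro open_sums) simp
  show "convex (seg_nbhd \<delta>)" unfolding seg_nbhd_def by (intro convex_sums) auto
  show "\<exists>t\<in>{0..1}. dist w (of_real t) < \<delta>" if "w \<in> seg_nbhd \<delta>"
  proof -
    from that obtain x y where "x \<in> ball 0 \<delta>" "y \<in> closed_segment (0::complex) 1" "w = x + y" by (auto simp: seg_nbhd_def)
    moreover from this(2) obtain t where "0 \<le> t" "t \<le> 1" "y = of_real t"
      by (auto simp: closed_segment_def scaleR_conv_of_real)
    ultimately show ?thesis by (auto simp: dist_norm intro!: bexI[of _ t])
  qed
  show "of_real ` {0..1} \<subseteq> seg_nbhd \<delta>" if "\<delta> > 0"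
  proof safe
    fix t :: real assume "t \<in> {0..1}"
    hence "complex_of_real t \<in> closed_segment 0 1" by (auto simp: closed_segment_def scaleR_conv_of_real)
    thus "complex_of_real t \<in> seg_nbhd \<delta>" using that unfolding seg_nbhd_def
      by (intro UN_I[of 0] UN_I[of "complex_of_real t"]) auto
  qed
qed

text \<open>Compactness of the segment: one \<delta> serves all \<open>w\<close> near it.\<close>

lemma Tdom_uniform:
  fixes x a v :: real
  assumes "0 \<le> x" "0 \<le> a" "a \<le> 1" "0 \<le> v"
  obtains \<delta> where "\<delta> > 0" "\<And>s u v' w. dist s 1 < \<delta> \<Longrightarrow> dist u (of_real a) < \<delta> \<Longrightarrow> dist v' (of_real v) < \<delta> \<Longrightarrow> w \<in> seg_nbhd \<delta> \<Longrightarrow>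
     Tdom (of_real x) s w u v'"
proof -
  define K where "K = (\<lambda>t::real. (1::complex, complex_of_real a, complex_of_real v, complex_of_real t)) ` {0..1}"
  define f where "f = (\<lambda>(s, u, v, w). (1 + w * s) * (1 + of_real x * s) * (v * w + u\<^sup>2 + 2 * u + 1) * (1 + u + v :: complex))"
  define g where "g = (\<lambda>(s::complex, u, v, w). w2_poly u v w)"
  define Op where "Op = f -` (- {0}) \<inter> g -` (- \<real>\<^sub>\<le>\<^sub>0)"
  have Op: "open Op" unfolding Op_def
  proof (intro open_Int open_vimage)
    show "continuous_on UNIV f" unfolding f_def case_prod_unfold by (intro continuous_intros)
    show "continuous_on UNIV g" unfolding g_def case_prod_unfold w2_poly_def by (intro continuous_intros)
  qed (auto simp: open_Compl closed_nonpos_Reals_complex)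
  have mem: "(s, u, v', w) \<in> Op \<longleftrightarrow> Tdom (of_real x) s w u v'" for s u v' w
    by (auto simp: Op_def f_def g_def Tdom_def)
  have "compact K" unfolding K_def by (intro compact_continuous_image continuous_intros) auto
  moreover have "K \<subseteq> Op" unfolding K_def
  proof (rule image_subsetI)
    fix t :: real assume "t \<in> {0..1}"
    thus "(1, complex_of_real a, complex_of_real v, complex_of_real t) \<in> Op"
      unfolding mem using assms by (intro Tdom_real) auto
  qed
  ultimately obtain \<epsilon> where \<epsilon>: "\<epsilon> > 0" "(\<Union>p\<in>K. ball p \<epsilon>) \<subseteq> Op"
    using compact_subset_open_imp_ball_epsilon_subset[OF _ Op] by metis
  have dist_Pair: "dist (p, q) (p', q') \<le> dist p p' + dist q q'" for p p' :: "'p::metric_space" and q q' :: "'q::metric_space"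
    unfolding dist_prod_def by (simp add: sqrt_sum_squares_le_sum)
  show ?thesis
  proof
    show "\<epsilon> / 4 > 0" using \<epsilon> by simp
    fix s u v' w :: complex assume d: "dist s 1 < \<epsilon> / 4" "dist u (of_real a) < \<epsilon> / 4" "dist v' (of_real v) < \<epsilon> / 4" "w \<in> seg_nbhd (\<epsilon> / 4)"
    obtain t where t: "t \<in> {0..1}" "dist w (of_real t) < \<epsilon> / 4" using seg_nbhd(3)[OF d(4)] by blast
    have "dist (s, u, v', w) (1, of_real a, of_real v, of_real t) \<le> dist s 1 + (dist u (of_real a) + (dist v' (of_real v) + dist w (of_real t)))"
      by (intro order_trans[OF dist_Pair] add_left_mono order_refl)
    hence "dist (1, of_real a, of_real v, of_real t) (s, u, v', w) < \<epsilon>" using d t by (simp add: dist_commute)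
    moreover have "(1, of_real a, of_real v, of_real t) \<in> K" using t by (auto simp: K_def)
    ultimately have "(s, u, v', w) \<in> (\<Union>p\<in>K. ball p \<epsilon>)" by (auto simp: mem_ball intro!: bexI)
    thus "Tdom (of_real x) s w u v'" using \<epsilon>(2) mem by blast
  qed
qed

text \<open>The coefficients are read off in turn, by limits after division by powers of
  \<open>Z\<close>. This is the uniqueness behind the description operator in
  \<open>T3\<close>.\<close>

lemma bigo_const_zero:
  fixes F :: "'a filter" and Z :: "'a \<Rightarrow> complex"
  assumes F: "F \<noteq> bot" and Z: "(Z \<longlongrightarrow> 0) F" "\<forall>\<^sub>F s in F. Z s \<noteq> 0"
    and Op: "(\<lambda>s. d0 + d2 * Z s ^ 2 + d3 * Z s ^ 3) \<in> O[F](\<lambda>s. Z s ^ 4)"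
  shows "d3 = 0"
proof -
  obtain C where C: "\<forall>\<^sub>F s in F. norm (d0 + d2 * Z s ^ 2 + d3 * Z s ^ 3) \<le> C * norm (Z s ^ 4)"
    using Op by (auto elim: landau_o.bigE)
  have z: "((\<lambda>s. C * norm (Z s) ^ Suc n) \<longlongrightarrow> 0) F" for n
    by (rule tendsto_eq_intros Z refl | simp)+
  have "((\<lambda>s. d0 + d2 * Z s ^ 2 + d3 * Z s ^ 3) \<longlongrightarrow> 0) F"
    by (rule Lim_null_comparison[OF _ z[of 3]]) (use C in \<open>auto elim!: eventually_mono simp: norm_power\<close>)
  moreover have "((\<lambda>s. d0 + d2 * Z s ^ 2 + d3 * Z s ^ 3) \<longlongrightarrow> d0) F"
    by (rule tendsto_eq_intros Z refl | simp)+
  ultimately have d0: "d0 = 0" using tendsto_unique[OF F] by blast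
  have "((\<lambda>s. d2 + d3 * Z s) \<longlongrightarrow> 0) F"
  proof (rule Lim_null_comparison[OF _ z[of 1]])
    show "\<forall>\<^sub>F s in F. norm (d2 + d3 * Z s) \<le> C * norm (Z s) ^ Suc 1" using C Z(2)
    proof eventually_elim
      case (elim s)
      have "d0 + d2 * Z s ^ 2 + d3 * Z s ^ 3 = (d2 + d3 * Z s) * Z s ^ 2"
        unfolding d0 by (simp add: power2_eq_square power3_eq_cube algebra_simps)
      hence "norm (d2 + d3 * Z s) * norm (Z s) ^ 2 \<le> (C * norm (Z s) ^ 2) * norm (Z s) ^ 2"
        using elim(1) by (simp add: norm_mult norm_power power4_eq_xxxx power2_eq_square mult.assoc)
      thus ?case using elim(2) by (subst (asm) mult_le_cancel_right_pos) (auto simp: numeral_2_eq_2)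
    qed
  qed
  moreover have "((\<lambda>s. d2 + d3 * Z s) \<longlongrightarrow> d2) F"
    by (rule tendsto_eq_intros Z refl | simp)+
  ultimately have d2: "d2 = 0" using tendsto_unique[OF F] by blast
  have "((\<lambda>s. d3) \<longlongrightarrow> 0) F"
  proof (rule Lim_null_comparison[OF _ z[of 0]])
    show "\<forall>\<^sub>F s in F. norm d3 \<le> C * norm (Z s) ^ Suc 0" using C Z(2)
    proof eventually_elim
      case (elim s)
      have "norm d3 * norm (Z s) ^ 3 \<le> (C * norm (Z s)) * norm (Z s) ^ 3"
        using elim(1) unfolding d0 d2 by (simp add: norm_mult norm_power power4_eq_xxxx power3_eq_cube mult.assoc)
      thus ?case using elim(2) by (subst (asm) mult_le_cancel_right_pos) auto
    qed
  qed
  thus ?thesis using tendsto_unique[OF F _ tendsto_const] by metis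
qed

lemma tendsto_imp_bigo_1: "(f \<longlongrightarrow> (c :: complex)) F \<Longrightarrow> f \<in> O[F](\<lambda>_. 1)"
  by (rule bigoI_tendsto[where c = c]) simp_all

text \<open>The factors \<alpha> and \<beta> contribute only even powers of \<open>Z\<close> up to
  the error, so the cubic coefficient is just \<open>b0 * n3\<close>.\<close>

lemma bigo_product_expansion:
  fixes Z f g :: "'a \<Rightarrow> complex"
  assumes Z: "(Z \<longlongrightarrow> 0) F"
    and \<alpha>: "(\<lambda>s. \<alpha> s - (a0 + a2 * Z s ^ 2)) \<in> O[F](\<lambda>s. Z s ^ 4)"
    and \<beta>: "(\<lambda>s. \<beta> s - (b0 + b2 * Z s ^ 2)) \<in> O[F](\<lambda>s. Z s ^ 4)"
    and N: "(\<lambda>s. N s - (n0 + n2 * Z s ^ 2 + n3 * Z s ^ 3)) \<in> O[F](\<lambda>s. Z s ^ 4)"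
  shows "(\<lambda>s. \<alpha> s + \<beta> s * N s - ((a0 + b0 * n0) + (a2 + b0 * n2 + b2 * n0) * Z s ^ 2 + (b0 * n3) * Z s ^ 3)) \<in> O[F](\<lambda>s. Z s ^ 4)"
proof -
  have Z1: "Z \<in> O[F](\<lambda>_. 1)" by (rule tendsto_imp_bigo_1[OF Z])
  define P where "P s = n0 + n2 * Z s ^ 2 + n3 * Z s ^ 3" for s
  have P1: "P \<in> O[F](\<lambda>_. 1)"
  proof -
    have "(P \<longlongrightarrow> n0) F" unfolding P_def by (rule tendsto_eq_intros Z refl | simp)+
    thus ?thesis by (rule tendsto_imp_bigo_1)
  qed
  have Z41: "(\<lambda>s. Z s ^ 4) \<in> O[F](\<lambda>_. 1)" using landau_o.big_power[OF Z1, of 4] by simp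
  have b1: "\<beta> \<in> O[F](\<lambda>_. 1)"
  proof -
    have "(\<lambda>s. b0 + b2 * Z s ^ 2) \<in> O[F](\<lambda>_. 1)"
    proof -
      have "((\<lambda>s. b0 + b2 * Z s ^ 2) \<longlongrightarrow> b0) F" by (rule tendsto_eq_intros Z refl | simp)+
      thus ?thesis by (rule tendsto_imp_bigo_1)
    qed
    from sum_in_bigo(1)[OF landau_o.big_trans[OF \<beta> Z41] this] show ?thesis by simp
  qed
  have 1: "(\<lambda>s. \<beta> s * (N s - P s)) \<in> O[F](\<lambda>s. Z s ^ 4)"
    using landau_o.big.mult[OF b1 N] by (simp add: P_def)
  have 2: "(\<lambda>s. (\<beta> s - (b0 + b2 * Z s ^ 2)) * P s) \<in> O[F](\<lambda>s. Z s ^ 4)"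
    using landau_o.big.mult[OF \<beta> P1] by simp
  have 3: "(\<lambda>s. (b2 * n2 + b2 * n3 * Z s) * Z s ^ 4) \<in> O[F](\<lambda>s. Z s ^ 4)"
  proof -
    have "((\<lambda>s. b2 * n2 + b2 * n3 * Z s) \<longlongrightarrow> b2 * n2) F" by (rule tendsto_eq_intros Z refl | simp)+
    hence "(\<lambda>s. b2 * n2 + b2 * n3 * Z s) \<in> O[F](\<lambda>_. 1)" by (rule tendsto_imp_bigo_1)
    from landau_o.big.mult[OF this landau_o.big_refl[of "\<lambda>s. Z s ^ 4"]] show ?thesis by simp
  qed
  have eq: "(\<lambda>s. \<alpha> s + \<beta> s * N s - ((a0 + b0 * n0) + (a2 + b0 * n2 + b2 * n0) * Z s ^ 2 + (b0 * n3) * Z s ^ 3))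
     = (\<lambda>s. (\<alpha> s - (a0 + a2 * Z s ^ 2)) + (\<beta> s * (N s - P s) + ((\<beta> s - (b0 + b2 * Z s ^ 2)) * P s + (b2 * n2 + b2 * n3 * Z s) * Z s ^ 4)))"
    by (rule ext) (simp add: P_def power2_eq_square power3_eq_cube power4_eq_xxxx algebra_simps)
  show ?thesis unfolding eq by (intro sum_in_bigo \<alpha> 1 2 3)
qed

text \<open>\<open>s - 1\<close> is minus the square of \<open>csqrt (1 - s)\<close>, so a Taylor
  polynomial of degree one leaves an error of order four.\<close>

lemma analytic_expansion:
  assumes "f holomorphic_on ball 1 \<delta>" "\<delta> > 0" and s1: "((\<lambda>s. s) \<longlongrightarrow> 1) F"
  shows "(\<lambda>s. f s - (f 1 + (- deriv f 1) * csqrt (1 - s) ^ 2)) \<in> O[F](\<lambda>s. csqrt (1 - s) ^ 4)"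
proof -
  obtain Q where Q: "Q holomorphic_on ball 0 \<delta>" "\<And>e. e \<in> ball 0 \<delta> \<Longrightarrow> f (1 + e) = f 1 + deriv f 1 * e + e\<^sup>2 * Q e"
    using holomorphic_taylor_at[OF assms(1,2), of 1] by (auto simp: numeral_2_eq_2)
  obtain M where M: "M > 0" "\<And>e. norm e \<le> \<delta> / 2 \<Longrightarrow> norm (Q e) \<le> M" using bounded_near_center[OF Q(1) assms(2)] by blast
  have "\<forall>\<^sub>F s in F. dist s 1 < \<delta> / 2" using tendstoD[OF s1, of "\<delta> / 2"] assms by simp
  hence "\<forall>\<^sub>F s in F. norm (f s - (f 1 + (- deriv f 1) * csqrt (1 - s) ^ 2)) \<le> M * norm (csqrt (1 - s) ^ 4)"
  proof eventually_elim
    case (elim s)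
    define e where "e = s - 1"
    have e: "norm e < \<delta> / 2" using elim by (simp add: e_def dist_norm)
    have c4: "csqrt (1 - s) ^ 4 = e\<^sup>2"
    proof -
      have "csqrt (1 - s) ^ 4 = (csqrt (1 - s) ^ 2) ^ 2" by (simp only: power_mult[symmetric]) simp
      thus ?thesis by (simp add: e_def power2_commute)
    qed
    have "f s - (f 1 + (- deriv f 1) * csqrt (1 - s) ^ 2) = e\<^sup>2 * Q e"
      using Q(2)[of e] e assms(2) by (simp add: e_def algebra_simps)
    hence "norm (f s - (f 1 + (- deriv f 1) * csqrt (1 - s) ^ 2)) = norm (Q e) * norm (e\<^sup>2)" by (simp add: norm_mult)
    also have "\<dots> \<le> M * norm (e\<^sup>2)" using M(2)[of e] e by (intro mult_right_mono) auto
    finally show ?case unfolding c4 .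
  qed
  thus ?thesis by (rule bigoI)
qed

section \<open>The closed form near \<open>x = r\<close>, \<open>z = 1\<close>\<close>

definition rc :: real where "rc = r_fun 1"

lemma rc_pos: "rc > 0" unfolding rc_def by (rule u0_fun_props) simp

lemma tau_rc: "tau rc = 1" unfolding rc_def by (rule tau_r_fun) simp

definition uc :: "complex \<Rightarrow> complex" where "uc s = usol (of_real rc) s"
definition vc :: "complex \<Rightarrow> complex" where "vc s = vsol (of_real rc) s"

lemma uc_bound: "norm (s::complex) < 1 \<Longrightarrow> norm (of_real rc * s) < r_fun 1 * 1 \<and> norm s \<le> 1"
  using rc_pos by (simp add: norm_mult flip: rc_def)

lemma uc_fixpoint:
  assumes "norm s < 1"
  shows "of_real rc * s * (1 + vc s)\<^sup>2 = uc s" "vc s = s * (1 + uc s)\<^sup>2" "norm (uc s) \<le> ucrit"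
proof -
  define \<sigma> where "\<sigma> = norm s"
  have "norm (of_real rc * s) \<le> \<sigma> * (r_fun 1 * 1)" using rc_pos by (simp add: \<sigma>_def norm_mult rc_def)
  note P = usol_props[of 1, OF _ this]
  show v: "vc s = s * (1 + uc s)\<^sup>2" by (simp add: vc_def vsol_def uc_def)
  have "Phi (of_real rc) s (uc s) = uc s" unfolding uc_def by (rule P(1)) (use assms in \<open>auto simp: \<sigma>_def\<close>)
  thus "of_real rc * s * (1 + vc s)\<^sup>2 = uc s" unfolding v by (simp add: Phi_def)
  have "norm (uc s) \<le> \<sigma> * u0_fun 1" unfolding uc_def by (rule P(2)) (use assms in \<open>auto simp: \<sigma>_def\<close>)
  also have "\<dots> \<le> 1 * u0_fun 1" using assms u0_fun_props[of 1] by (intro mult_right_mono) (auto simp: \<sigma>_def)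
  finally show "norm (uc s) \<le> ucrit" by (simp add: u0_fun_1)
qed

lemma uc_holomorphic: "uc holomorphic_on ball 0 1"
  unfolding uc_def[abs_def]
  by (rule usol_holomorphic[OF _ open_ball, of 1]) (use uc_bound in \<open>auto intro!: holomorphic_intros\<close>)

lemma vc_holomorphic: "vc holomorphic_on ball 0 1"
  using uc_holomorphic unfolding vc_def[abs_def] vsol_def uc_def[abs_def] by (intro holomorphic_intros)

lemma crit_fixpoint: "rc * 1 * (1 + 1 * (1 + ucrit)\<^sup>2)\<^sup>2 = ucrit"
  using u0_fun_props(4)[of 1] by (simp add: u0_fun_1 rc_def)

lemma uc_tendsto: "(uc \<longlongrightarrow> of_real ucrit) (at 1 within ball 0 1)"
  unfolding uc_def[abs_def]
proof (rule usol_tendsto[of 1, OF _ _ tendsto_const tendsto_ident_at])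
  show "\<forall>\<^sub>F s in at 1 within ball 0 1. norm (complex_of_real rc * s) < r_fun 1 * 1 \<and> norm s \<le> 1"
    unfolding eventually_at_filter using uc_bound by (intro always_eventually) auto
  show "Phi (of_real rc) 1 (of_real ucrit) = of_real ucrit"
    using arg_cong[OF crit_fixpoint, of complex_of_real] by (simp add: Phi_def)
qed (use rc_pos u0_fun_1 u0_fun_props[of 1] in \<open>auto simp: rc_def\<close>)

lemma vc_tendsto: "(vc \<longlongrightarrow> of_real ((1 + ucrit)\<^sup>2)) (at 1 within ball 0 1)"
proof -
  have "((\<lambda>s. s * (1 + uc s)\<^sup>2) \<longlongrightarrow> 1 * (1 + of_real ucrit)\<^sup>2) (at 1 within ball 0 1)"
    by (intro tendsto_intros uc_tendsto)
  thus ?thesis by (simp add: vc_def[abs_def] vsol_def uc_def)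
qed

text \<open>With \<open>v = s * (1 + u)\<^sup>2\<close> the quadratic factor of the denominator is
  \<open>(1 + u)\<^sup>2 * (1 + w * s)\<close>. The surviving \<open>1 / (1 + w * s)\<close> later
  cancels the factor \<open>1 + w\<close> of the singular coefficient.\<close>

lemma Tc_Nuv:
  assumes d: "Tdom x s w u v" and v: "v = s * (1 + u)\<^sup>2"
  shows "Tc x s w u v = x\<^sup>2 * s\<^sup>2 * w\<^sup>2 / 2 * (1 / (1 + w * s) + 1 / (1 + x * s) - 1)
    + (x\<^sup>2 * s\<^sup>2 * w / (4 * (1 + w * s))) * Nuv (csqrt (w2_poly u v w)) u v w"
proof -
  define N where "N = - w1_poly u v w + (u - w + 1) * csqrt (w2_poly u v w)"
  define A where "A = 1 / (1 + w * s) + 1 / (1 + x * s) - 1"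
  have P: "v * w + u\<^sup>2 + 2 * u + 1 = (u + 1)\<^sup>2 * (1 + w * s)"
    unfolding v by (simp add: power2_eq_square algebra_simps)
  hence nz: "(u + 1)\<^sup>2 \<noteq> 0" using d unfolding Tdom_def by auto
  have "Tc x s w u v = x\<^sup>2 * s\<^sup>2 * w / 2 * (w * A + (u + 1)\<^sup>2 * N / (2 * ((u + 1)\<^sup>2 * (1 + w * s)) * (1 + u + v) ^ 3))"
    unfolding Tc_def P N_def A_def ..
  also have "(u + 1)\<^sup>2 * N / (2 * ((u + 1)\<^sup>2 * (1 + w * s)) * (1 + u + v) ^ 3) = (1 / (2 * (1 + w * s))) * (N / (1 + u + v) ^ 3)"
    using nz by simp
  also have "x\<^sup>2 * s\<^sup>2 * w / 2 * (w * A + (1 / (2 * (1 + w * s))) * (N / (1 + u + v) ^ 3))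
     = x\<^sup>2 * s\<^sup>2 * w\<^sup>2 / 2 * A + (x\<^sup>2 * s\<^sup>2 * w / (4 * (1 + w * s))) * (N / (1 + u + v) ^ 3)"
  proof -
    have "a * w / 2 * (w * A + (1 / (2 * p)) * M) = a * w\<^sup>2 / 2 * A + a * w / (4 * p) * M" for a p M :: complex
      by (simp add: distrib_left power2_eq_square mult_ac)
    thus ?thesis .
  qed
  finally show ?thesis by (simp only: Nuv_def N_def A_def)
qed

context closed_form
begin

lemma Tsummable_rc: "Tsummable rc 1 1"
  by (rule Tsummable_critical(1)[of 1 rc 1 ucrit])
     (use rc_pos crit_fixpoint ucrit_bounds u0_fun_1 in \<open>auto simp: rc_def\<close>)

text \<open>Since \<open>r_fun\<close> decreases, \<open>(rc, s)\<close> with \<open>s < 1\<close>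
  does not lie beyond the critical curve.\<close>

lemma T_bullet_real_critical:
  fixes s w :: real
  assumes s: "1/4 < s" "s < 1" and w: "0 < w" "w \<le> 1"
  shows "T_bullet (of_real rc) (of_real s) (of_real w) = Tc (of_real rc) (of_real s) (of_real w) (uc (of_real s)) (vc (of_real s))"
proof -
  have n: "norm (complex_of_real s) < 1" using s by simp
  have "usol (of_real rc) (of_real s) \<in> \<real>\<^sub>\<ge>\<^sub>0"
    by (rule usol_nonneg(1)[of 1]) (use uc_bound[OF n] rc_pos s in auto)
  then obtain u where u: "u \<ge> 0" "uc (of_real s) = of_real u" unfolding uc_def by (auto elim: nonneg_Reals_cases)
  note F = uc_fixpoint[OF n]
  have v: "vc (of_real s) = of_real (s * (1 + u)\<^sup>2)" using F(2) u by simp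
  have "complex_of_real (rc * s * (1 + s * (1 + u)\<^sup>2)\<^sup>2) = of_real u" using F(1) unfolding v u(2) by simp
  hence fp: "rc * s * (1 + s * (1 + u)\<^sup>2)\<^sup>2 = u" using of_real_eq_iff by blast
  have "u \<le> ucrit" using F(3) u by simp
  also have "\<dots> \<le> u0_fun s" using u0_fun_antimono[of s 1] s u0_fun_1 by simp
  finally have ub: "u \<le> u0_fun s" .
  have "rc \<le> r_fun s" unfolding rc_def using r_fun_antimono[of s 1] s by simp
  from Tsummable_critical(2)[OF s(1) rc_pos this w u(1) ub fp] show ?thesis unfolding u(2) v .
qed

text \<open>The identity theorem is used twice: for complex \<open>s\<close> with \<open>w\<close>
  real and fixed, and then for complex \<open>w\<close>. The boundary \<open>norm w = 1\<close> is
  reached radially by continuity.\<close>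

lemma T_bullet_near_one:
  obtains \<delta> \<eta> where "\<delta> > 0" "\<eta> > 0"
    "\<And>s w. s \<in> ball 1 \<eta> \<inter> ball 0 1 \<Longrightarrow> w \<in> seg_nbhd \<delta> \<Longrightarrow> norm w \<le> 1 \<Longrightarrow>
       Tdom (of_real rc) s w (uc s) (vc s) \<and> T_bullet (of_real rc) s w = Tc (of_real rc) s w (uc s) (vc s)"
    "\<And>w. w \<in> seg_nbhd \<delta> \<Longrightarrow> Tdom (of_real rc) 1 w (of_real ucrit) (of_real ((1 + ucrit)\<^sup>2))"
proof -
  obtain \<delta> where \<delta>: "\<delta> > 0" "\<And>s u v' w. dist s 1 < \<delta> \<Longrightarrow> dist u (of_real ucrit) < \<delta> \<Longrightarrow> dist v' (of_real ((1 + ucrit)\<^sup>2)) < \<delta> \<Longrightarrow> w \<in> seg_nbhd \<delta> \<Longrightarrow>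
     Tdom (of_real rc) s w u v'"
    by (rule Tdom_uniform[of rc ucrit "(1 + ucrit)\<^sup>2"]) (use rc_pos ucrit_bounds in auto)
  have "\<forall>\<^sub>F s in at 1 within ball 0 1. dist (uc s) (of_real ucrit) < \<delta> \<and> dist (vc s) (of_real ((1 + ucrit)\<^sup>2)) < \<delta>"
    by (intro eventually_conj tendstoD[OF uc_tendsto] tendstoD[OF vc_tendsto] \<delta>(1))
  then obtain \<eta>0 where \<eta>0: "\<eta>0 > 0" "\<And>s. s \<in> ball 0 1 \<Longrightarrow> s \<noteq> 1 \<Longrightarrow> dist s 1 < \<eta>0 \<Longrightarrow> dist (uc s) (of_real ucrit) < \<delta> \<and> dist (vc s) (of_real ((1 + ucrit)\<^sup>2)) < \<delta>"
    unfolding eventually_at by blast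
  define \<eta> where "\<eta> = min \<delta> (min \<eta>0 (1/2))"
  define B where "B = ball (1::complex) \<eta> \<inter> ball 0 1"
  have \<eta>: "\<eta> > 0" using \<delta> \<eta>0 by (simp add: \<eta>_def)
  have dom: "Tdom (of_real rc) s w (uc s) (vc s)" if "s \<in> B" "w \<in> seg_nbhd \<delta>" for s w
  proof -
    have s: "s \<in> ball 0 1" "s \<noteq> 1" "dist s 1 < \<eta>0" "dist s 1 < \<delta>" using that by (auto simp: B_def \<eta>_def dist_commute)
    show ?thesis using \<eta>0(2)[OF s(1-3)] s(4) that(2) by (intro \<delta>(2)) auto
  qed
  have Bp: "open B" "Topological_Spaces.connected B"
    unfolding B_def by (auto intro!: convex_connected convex_Int)
  define s0 where "s0 = 1 - \<eta> / 2"
  have rB: "of_real t \<in> B \<and> 1/4 < t \<and> t < 1" if "1 - \<eta> < t" "t < 1" for t :: real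
  proof -
    have "dist (1::complex) (of_real t) = dist 1 t" by (metis dist_of_real of_real_1)
    thus ?thesis using that by (auto simp: B_def \<eta>_def dist_real_def)
  qed
  have stepB: "T_bullet (of_real rc) s (of_real w) = Tc (of_real rc) s (of_real w) (uc s) (vc s)"
    if s: "s \<in> B" and w: "0 < w" "w \<le> 1" for s and w :: real
  proof -
    define f where "f s = T_bullet (of_real rc) s (of_real w) - Tc (of_real rc) s (of_real w) (uc s) (vc s)" for s
    have wU: "complex_of_real w \<in> seg_nbhd \<delta>" using seg_nbhd(4)[OF \<delta>(1)] w by auto
    have sub: "B \<subseteq> ball 0 1" by (auto simp: B_def)
    have "f s = 0"
    proof (rule analytic_continuation[where f = f and U = "of_real ` {1 - \<eta><..<1}" and \<xi> = "of_real s0", OF _ Bp _ _ _ _ s])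
      have "(\<lambda>s. T_bullet (of_real rc) s (of_real w)) holomorphic_on B"
        by (rule holomorphic_on_subset[OF T_bullet_disc(1) sub]) (use rc_pos Tsummable_rc w in auto)
      moreover have "(\<lambda>s. Tc (of_real rc) s (of_real w) (uc s) (vc s)) holomorphic_on {s \<in> B. Tdom (of_real rc) s (of_real w) (uc s) (vc s)}"
        by (rule Tc_holomorphic[OF Bp(1)]) (intro holomorphic_intros holomorphic_on_subset[OF uc_holomorphic sub] holomorphic_on_subset[OF vc_holomorphic sub])+
      moreover have "{s \<in> B. Tdom (of_real rc) s (of_real w) (uc s) (vc s)} = B" using dom wU by auto
      ultimately show "f holomorphic_on B" unfolding f_def by (intro holomorphic_intros) auto
      show "of_real ` {1 - \<eta><..<1} \<subseteq> B" using rB by auto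
      show "complex_of_real s0 \<in> B" using rB[of s0] \<eta> by (simp add: s0_def)
      show "complex_of_real s0 islimpt of_real ` {1 - \<eta><..<1}" by (rule of_real_islimpt) (use \<eta> in \<open>auto simp: s0_def\<close>)
      show "f z = 0" if "z \<in> of_real ` {1 - \<eta><..<1}" for z
        using that T_bullet_real_critical[OF _ _ w] rB by (auto simp: f_def)
    qed
    thus ?thesis by (simp add: f_def)
  qed
  have stepC: "T_bullet (of_real rc) s w = Tc (of_real rc) s w (uc s) (vc s)"
    if s: "s \<in> B" and w: "w \<in> seg_nbhd \<delta>" "norm w \<le> 1" for s w
  proof -
    define f where "f w = T_bullet (of_real rc) s w - Tc (of_real rc) s w (uc s) (vc s)" for w
    define W where "W = seg_nbhd \<delta> \<inter> ball 0 1"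
    have s1: "norm s \<le> 1" using s by (auto simp: B_def)
    have Wp: "open W" "convex W" unfolding W_def by (auto intro!: convex_Int seg_nbhd)
    have g: "(\<lambda>w. Tc (of_real rc) s w (uc s) (vc s)) holomorphic_on seg_nbhd \<delta>"
    proof -
      have "(\<lambda>w. Tc (of_real rc) s w (uc s) (vc s)) holomorphic_on {w \<in> seg_nbhd \<delta>. Tdom (of_real rc) s w (uc s) (vc s)}"
        by (rule Tc_holomorphic[OF seg_nbhd(1)]) (intro holomorphic_intros)+
      moreover have "{w \<in> seg_nbhd \<delta>. Tdom (of_real rc) s w (uc s) (vc s)} = seg_nbhd \<delta>" using dom s by auto
      ultimately show ?thesis by simp
    qed
    have t: "(\<lambda>w. T_bullet (of_real rc) s w) holomorphic_on ball 0 1" "continuous_on (cball 0 1) (\<lambda>w. T_bullet (of_real rc) s w)"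
      using T_bullet_disc(2,3)[OF _ Tsummable_rc s1] rc_pos by auto
    have real: "of_real r \<in> W" if "0 < r" "r < 1" for r :: real
      using seg_nbhd(4)[OF \<delta>(1)] that by (auto simp: W_def)
    have inner: "f w' = 0" if w': "w' \<in> W" for w'
    proof (rule analytic_continuation[where f = f and U = "of_real ` {0<..<1}" and \<xi> = "of_real (1/2)", OF _ Wp(1) convex_connected[OF Wp(2)] _ _ _ _ w'])
      show "f holomorphic_on W" unfolding f_def
        by (intro holomorphic_intros holomorphic_on_subset[OF g] holomorphic_on_subset[OF t(1)]) (auto simp: W_def)
      show "of_real ` {0<..<1} \<subseteq> W" "complex_of_real (1/2) \<in> W" using real real[of "1/2"] by auto
      show "complex_of_real (1/2) islimpt of_real ` {0<..<1}" by (rule of_real_islimpt) auto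
      show "f z = 0" if "z \<in> of_real ` {0<..<1}" for z using that stepB[OF s] by (auto simp: f_def)
    qed
    have z0: "0 \<in> seg_nbhd \<delta>" using seg_nbhd(4)[OF \<delta>(1)] by force
    \<comment> \<open>Shrinking towards 0 stays in the neighbourhood, which is convex and contains
      0, and moves \<open>w\<close> into the open unit disc.\<close>
    have tw: "of_real t * w \<in> W" if "0 < t" "t < 1" for t :: real
    proof -
      have "t *\<^sub>R w + (1 - t) *\<^sub>R 0 \<in> seg_nbhd \<delta>" by (rule convexD[OF seg_nbhd(2) w(1) z0]) (use that in auto)
      moreover have "t * norm w < 1" using that w(2) mult_left_le[of "norm w" t] by linarith
      ultimately show ?thesis using that by (simp add: W_def norm_mult scaleR_conv_of_real)
    qed
    have cf: "continuous_on (seg_nbhd \<delta> \<inter> cball 0 1) f" unfolding f_def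
      by (intro continuous_intros continuous_on_subset[OF t(2)] continuous_on_subset[OF holomorphic_on_imp_continuous_on[OF g]]) auto
    have lim: "((\<lambda>t. complex_of_real t * w) \<longlongrightarrow> w) (at_left 1)"
    proof -
      have "((\<lambda>t. complex_of_real t * w) \<longlongrightarrow> of_real 1 * w) (at_left 1)" by (intro tendsto_intros)
      thus ?thesis by simp
    qed
    have ev: "\<forall>\<^sub>F t in at_left (1::real). t \<in> {0<..<1}" by (rule eventually_at_leftI[of 0]) auto
    have "((\<lambda>t. f (of_real t * w)) \<longlongrightarrow> f w) (at_left 1)"
      by (rule continuous_on_tendsto_compose[OF cf lim])
         (use w ev tw in \<open>auto elim!: eventually_mono simp: W_def intro!: less_imp_le\<close>)
    moreover have "((\<lambda>t. f (of_real t * w)) \<longlongrightarrow> 0) (at_left (1::real))"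
      by (rule Lim_transform_eventually[OF tendsto_const]) (use ev inner tw in \<open>auto elim!: eventually_mono\<close>)
    ultimately have "f w = 0" using tendsto_unique[of "at_left (1::real)"] by auto
    thus ?thesis by (simp add: f_def)
  qed
  show ?thesis
  proof (rule that[OF \<delta>(1) \<eta>])
    show "Tdom (of_real rc) s w (uc s) (vc s) \<and> T_bullet (of_real rc) s w = Tc (of_real rc) s w (uc s) (vc s)"
      if "s \<in> ball 1 \<eta> \<inter> ball 0 1" "w \<in> seg_nbhd \<delta>" "norm w \<le> 1" for s w
      using dom stepC that unfolding B_def by blast
    show "Tdom (of_real rc) 1 w (of_real ucrit) (of_real ((1 + ucrit)\<^sup>2))" if "w \<in> seg_nbhd \<delta>" for w
      by (rule \<delta>(2)) (use that \<delta>(1) in auto)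
  qed
qed

lemma at_one_within_ball_nontrivial: "at (1::complex) within ball 0 1 \<noteq> bot"
proof -
  have "(1::complex) islimpt ball 0 1" by (subst islimpt_ball) auto
  thus ?thesis by (simp add: trivial_limit_within)
qed

text \<open>As \<open>tau rc = 1\<close>, the variable of the expansion is
  \<open>csqrt (1 - s)\<close>. The fold expansion gives existence, \<open>bigo_const_zero\<close>
  uniqueness, and the factors \<open>1 + w\<close> cancel.\<close>

lemma T3_eq:
  obtains U where "open U" "of_real ` {0..1} \<subseteq> U" "\<And>w. w \<in> U \<Longrightarrow> norm w \<le> 1 \<Longrightarrow> T3 rc w = of_real rc ^ 2 / 4 * kap3 * (w * hq w)"
proof -
  obtain \<delta> \<eta> where \<delta>: "\<delta> > 0" "\<eta> > 0" and T:
    "\<And>s w. s \<in> ball 1 \<eta> \<inter> ball 0 1 \<Longrightarrow> w \<in> seg_nbhd \<delta> \<Longrightarrow> norm w \<le> 1 \<Longrightarrow>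
       Tdom (of_real rc) s w (uc s) (vc s) \<and> T_bullet (of_real rc) s w = Tc (of_real rc) s w (uc s) (vc s)"
    and D: "\<And>w. w \<in> seg_nbhd \<delta> \<Longrightarrow> Tdom (of_real rc) 1 w (of_real ucrit) (of_real ((1 + ucrit)\<^sup>2))"
    by (rule T_bullet_near_one) blast
  define F where "F = at (1::complex) within ball 0 1"
  have Fnb: "F \<noteq> bot" unfolding F_def by (rule at_one_within_ball_nontrivial)
  have s1: "((\<lambda>s. s) \<longlongrightarrow> 1) F" unfolding F_def by (rule tendsto_ident_at)
  have Zl: "((\<lambda>s. csqrt (1 - s)) \<longlongrightarrow> 0) F"
  proof -
    have "((\<lambda>s. norm (1 - s)) \<longlongrightarrow> norm (1 - (1::complex))) F" by (intro tendsto_intros s1)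
    hence "((\<lambda>s. sqrt (norm (1 - s))) \<longlongrightarrow> sqrt 0) F" by (intro tendsto_real_sqrt) simp
    thus ?thesis by (intro tendsto_norm_zero_cancel[where f = "\<lambda>s. csqrt (1 - s)", THEN asm_rl]) (simp add: norm_csqrt)
  qed
  have Znz: "\<forall>\<^sub>F s in F. csqrt (1 - s) \<noteq> 0" unfolding F_def eventually_at_filter by (intro always_eventually) auto
  have ball: "\<forall>\<^sub>F s in F. s \<in> ball 0 1" unfolding F_def eventually_at_filter by (intro always_eventually) auto
  have near: "\<forall>\<^sub>F s in F. s \<in> ball 1 \<eta> \<inter> ball 0 1"
    using ball tendstoD[OF s1 \<delta>(2)] by eventually_elim (auto simp: dist_commute)
  have ucc: "complex_of_real ucrit = (s7 - 1) / 3" by (simp add: ucrit_def s7_def)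
  have vcc: "complex_of_real ((1 + ucrit)\<^sup>2) = (11 + 4 * s7) / 9"
  proof -
    have "complex_of_real ((1 + ucrit)\<^sup>2) = (1 + complex_of_real ucrit)\<^sup>2" by simp
    also have "\<dots> = (11 + 4 * s7) / 9" unfolding ucc by (simp add: power2_eq_square field_simps s7_rules)
    finally show ?thesis .
  qed
  have Zdef: "singular_expansion rc w t0 t2 t3 \<longleftrightarrow>
     (\<lambda>s. T_bullet (of_real rc) s w - (t0 + t2 * csqrt (1 - s) ^ 2 + t3 * csqrt (1 - s) ^ 3)) \<in> O[F](\<lambda>s. csqrt (1 - s) ^ 4)" for w t0 t2 t3
    by (simp add: singular_expansion_def tau_rc F_def Let_def)
  have ex: "\<exists>t0 t2. singular_expansion rc w t0 t2 (of_real rc ^ 2 / 4 * kap3 * (w * hq w))"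
    if w: "w \<in> seg_nbhd \<delta>" "norm w \<le> 1" for w
  proof -
    note d = D[OF w(1)]
    have w2: "w2_poly ((s7 - 1) / 3) ((11 + 4 * s7) / 9) w \<notin> \<real>\<^sub>\<le>\<^sub>0" using d unfolding Tdom_def ucc vcc by blast
    have nz: "1 + w * 1 \<noteq> 0" "1 + of_real rc * 1 \<noteq> (0::complex)" using d unfolding Tdom_def by auto
    have UV: "\<forall>\<^sub>F s in F. uc s = rcc * s * (1 + vc s)\<^sup>2 \<and> vc s = s * (1 + uc s)\<^sup>2 \<and> norm (uc s) \<le> ucrit \<and> norm s < 1"
      using ball
    proof eventually_elim
      case (elim s)
      hence n: "norm s < 1" by simp
      show ?case using uc_fixpoint[OF n] n unfolding rcc[symmetric] rc_def[symmetric] by metis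
    qed
    obtain n0 n2 where N: "(\<lambda>s. Nuv (csqrt (w2_poly (uc s) (vc s) w)) (uc s) (vc s) w - (n0 + n2 * csqrt (1 - s) ^ 2 + (kap3 * ((1 + w) * hq w)) * csqrt (1 - s) ^ 3))
     \<in> O[F](\<lambda>s. csqrt (1 - s) ^ 4)"
      by (rule N_fold_expansion[OF w2 UV uc_tendsto[folded F_def] s1])
    define \<alpha> where "\<alpha> s = of_real rc ^ 2 * s\<^sup>2 * w\<^sup>2 / 2 * (1 / (1 + w * s) + 1 / (1 + of_real rc * s) - 1)" for s
    define \<beta> where "\<beta> s = of_real rc ^ 2 * s\<^sup>2 * w / (4 * (1 + w * s))" for s
    have nl: "((\<lambda>s. 1 + c * s) \<longlongrightarrow> 1 + c * 1) (nhds (1::complex))" for c by (intro tendsto_intros filterlim_ident)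
    have "\<forall>\<^sub>F s in nhds 1. 1 + w * s \<noteq> 0 \<and> 1 + of_real rc * s \<noteq> (0::complex)"
      by (intro eventually_conj tendsto_imp_eventually_ne[OF nl nz(1)] tendsto_imp_eventually_ne[OF nl nz(2)])
    then obtain \<rho> where \<rho>: "\<rho> > 0" "\<And>s. s \<in> ball 1 \<rho> \<Longrightarrow> 1 + w * s \<noteq> 0 \<and> 1 + of_real rc * s \<noteq> (0::complex)"
      unfolding eventually_nhds_metric by (metis dist_commute mem_ball)
    have \<alpha>: "\<alpha> holomorphic_on ball 1 \<rho>" and \<beta>: "\<beta> holomorphic_on ball 1 \<rho>"
      unfolding \<alpha>_def[abs_def] \<beta>_def[abs_def] using \<rho>(2) by (intro holomorphic_intros; simp del: distrib_left_numeral)+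
    note E = bigo_product_expansion[OF Zl analytic_expansion[OF \<alpha> \<rho>(1) s1] analytic_expansion[OF \<beta> \<rho>(1) s1] N]
    have eqb: "\<beta> 1 * (kap3 * ((1 + w) * hq w)) = of_real rc ^ 2 / 4 * kap3 * (w * hq w)"
    proof -
      have "R * w / (4 * p) * (kap3 * (p * h)) = R / 4 * kap3 * (w * h)" if "p \<noteq> 0" for R p h using that by simp
      from this[OF nz(1)] show ?thesis by (simp add: \<beta>_def)
    qed
    have eqT: "\<forall>\<^sub>F s in F. T_bullet (of_real rc) s w = \<alpha> s + \<beta> s * Nuv (csqrt (w2_poly (uc s) (vc s) w)) (uc s) (vc s) w"
      using near
    proof eventually_elim
      case (elim s)
      have n: "norm s < 1" using elim by simp
      from T[OF elim w] show ?case using Tc_Nuv[OF _ uc_fixpoint(2)[OF n]] unfolding \<alpha>_def \<beta>_def by metis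
    qed
    show ?thesis unfolding Zdef
    proof (intro exI)
      show "(\<lambda>s. T_bullet (of_real rc) s w - ((\<alpha> 1 + \<beta> 1 * n0) + (- deriv \<alpha> 1 + \<beta> 1 * n2 + (- deriv \<beta> 1) * n0) * csqrt (1 - s) ^ 2
         + of_real rc ^ 2 / 4 * kap3 * (w * hq w) * csqrt (1 - s) ^ 3)) \<in> O[F](\<lambda>s. csqrt (1 - s) ^ 4)"
        using E unfolding eqb
        by (rule landau_o.big.in_cong[THEN iffD1, rotated]) (use eqT in \<open>auto elim!: eventually_mono\<close>)
    qed
  qed
  have uniq: "t3 = t3'" if "singular_expansion rc w t0 t2 t3" "singular_expansion rc w t0' t2' t3'" for w t0 t2 t3 t0' t2' t3'
  proof -
    have "(\<lambda>s. (t0 - t0') + (t2 - t2') * csqrt (1 - s) ^ 2 + (t3 - t3') * csqrt (1 - s) ^ 3) \<in> O[F](\<lambda>s. csqrt (1 - s) ^ 4)"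
    proof -
      have "(T - (t0' + t2' * z ^ 2 + t3' * z ^ 3)) - (T - (t0 + t2 * z ^ 2 + t3 * z ^ 3)) = (t0 - t0') + (t2 - t2') * z ^ 2 + (t3 - t3') * z ^ 3"
        for T z by (simp add: algebra_simps)
      thus ?thesis using sum_in_bigo(2)[OF that(2,1)[unfolded Zdef]] by (simp only:)
    qed
    from bigo_const_zero[OF Fnb Zl Znz this] show ?thesis by simp
  qed
  show ?thesis
  proof (rule that[OF seg_nbhd(1) seg_nbhd(4)[OF \<delta>(1)]])
    show "T3 rc w = of_real rc ^ 2 / 4 * kap3 * (w * hq w)" if "w \<in> seg_nbhd \<delta>" "norm w \<le> 1" for w
      unfolding T3_def by (rule the_equality) (use ex[OF that] uniq in blast)+
  qed
qed

end

section \<open>The generating function of the root degree\<close>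

text \<open>A continuity theorem from convergence on a short interval only. Once the coefficients
  before \<open>k\<close> converge, \<open>p k n\<close> agrees up to an error \<open>w\<close> with
  a quantity that converges in \<open>n\<close> for fixed \<open>w\<close>; letting \<open>w\<close>
  shrink shows that it is Cauchy.\<close>

lemma pgf_continuity:
  fixes p :: "nat \<Rightarrow> nat \<Rightarrow> real" and P :: "nat \<Rightarrow> real \<Rightarrow> real"
  assumes \<delta>: "\<delta> > 0" "\<delta> \<le> 1"
    and tail: "\<forall>\<^sub>F n in sequentially. \<forall>w K. 0 < w \<longrightarrow> w < \<delta> \<longrightarrow> 0 \<le> P n w - (\<Sum>j<K. p j n * w ^ j) \<and> P n w - (\<Sum>j<K. p j n * w ^ j) \<le> w ^ K"
    and lim: "\<And>w. 0 < w \<Longrightarrow> w < \<delta> \<Longrightarrow> (\<lambda>n. P n w) \<longlonglongrightarrow> Q w"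
  obtains e where "\<And>k. p k \<longlonglongrightarrow> e k" "\<And>w. 0 < w \<Longrightarrow> w < \<delta> \<Longrightarrow> (\<lambda>k. e k * w ^ k) sums Q w"
proof -
  have "\<exists>e. p k \<longlonglongrightarrow> e" for k
  proof (induction k rule: less_induct)
    case (less k)
    have "\<exists>e. \<forall>j<k. p j \<longlonglongrightarrow> e j" using less by metis
    then obtain e where e: "\<And>j. j < k \<Longrightarrow> p j \<longlonglongrightarrow> e j" by blast
    have "Cauchy (p k)"
    proof (rule metric_CauchyI)
      fix \<epsilon> :: real assume \<epsilon>: "\<epsilon> > 0"
      \<comment> \<open>Replacing \<open>p k\<close> by \<open>q\<close> costs at most
        \<open>w\<close> at each of two indices, that is \<open>\<epsilon> / 2\<close> in
        total.\<close>
      define w where "w = min (\<delta> / 2) (\<epsilon> / 4)"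
      have w: "0 < w" "w < \<delta>" "w \<le> \<epsilon> / 4" using \<delta> \<epsilon> by (auto simp: w_def)
      define q where "q n = (P n w - (\<Sum>j<k. p j n * w ^ j)) / w ^ k" for n
      have "q \<longlonglongrightarrow> (Q w - (\<Sum>j<k. e j * w ^ j)) / w ^ k"
        unfolding q_def by (intro tendsto_intros lim w e) (use w in auto)
      hence "Cauchy q" by (rule LIMSEQ_imp_Cauchy)
      then obtain N1 where N1: "\<And>m n. m \<ge> N1 \<Longrightarrow> n \<ge> N1 \<Longrightarrow> dist (q m) (q n) < \<epsilon> / 2"
        using \<epsilon> unfolding Cauchy_def by (meson half_gt_zero)
      obtain N2 where N2: "\<And>n w K. n \<ge> N2 \<Longrightarrow> 0 < w \<Longrightarrow> w < \<delta> \<Longrightarrow> 0 \<le> P n w - (\<Sum>j<K. p j n * w ^ j) \<and> P n w - (\<Sum>j<K. p j n * w ^ j) \<le> w ^ K"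
        using tail unfolding eventually_sequentially by blast
      have near: "0 \<le> q n - p k n \<and> q n - p k n \<le> w" if "n \<ge> N2" for n
      proof -
        have "q n - p k n = (P n w - (\<Sum>j<Suc k. p j n * w ^ j)) / w ^ k"
          using w by (simp add: q_def field_simps)
        moreover have "w ^ Suc k / w ^ k = w" using w by simp
        ultimately show ?thesis using N2[OF that w(1,2), of "Suc k"] w
          by (metis divide_nonneg_pos divide_right_mono less_imp_le zero_less_power)
      qed
      show "\<exists>M. \<forall>m\<ge>M. \<forall>n\<ge>M. dist (p k m) (p k n) < \<epsilon>"
      proof (intro exI allI impI)
        fix m n assume "max N1 N2 \<le> m" "max N1 N2 \<le> n"
        hence "dist (q m) (q n) < \<epsilon> / 2" "0 \<le> q n - p k n \<and> q n - p k n \<le> w" "0 \<le> q m - p k m \<and> q m - p k m \<le> w"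
          using N1 near by auto
        thus "dist (p k m) (p k n) < \<epsilon>" using w(3) unfolding dist_real_def by linarith
      qed
    qed
    thus ?case by (simp add: Cauchy_convergent_iff convergent_def)
  qed
  then obtain e where e: "\<And>k. p k \<longlonglongrightarrow> e k" by metis
  show ?thesis
  proof (rule that[OF e])
    fix w assume w: "0 < w" "w < \<delta>"
    have b: "0 \<le> Q w - (\<Sum>j<K. e j * w ^ j) \<and> Q w - (\<Sum>j<K. e j * w ^ j) \<le> w ^ K" for K
    proof -
      have l: "(\<lambda>n. P n w - (\<Sum>j<K. p j n * w ^ j)) \<longlonglongrightarrow> Q w - (\<Sum>j<K. e j * w ^ j)"
        by (intro tendsto_intros lim w e)
      have "\<forall>\<^sub>F n in sequentially. 0 \<le> P n w - (\<Sum>j<K. p j n * w ^ j)" using tail by eventually_elim (use w in blast)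
      moreover have "\<forall>\<^sub>F n in sequentially. P n w - (\<Sum>j<K. p j n * w ^ j) \<le> w ^ K" using tail by eventually_elim (use w in blast)
      ultimately show ?thesis using tendsto_lowerbound[OF l _ sequentially_bot] tendsto_upperbound[OF l _ sequentially_bot] by blast
    qed
    have "(\<lambda>K. (\<Sum>j<K. e j * w ^ j) - Q w) \<longlonglongrightarrow> 0"
    proof (rule Lim_null_comparison)
      show "(\<lambda>K. w ^ K) \<longlonglongrightarrow> 0" by (rule LIMSEQ_realpow_zero) (use w \<delta> in auto)
      have "norm ((\<Sum>j<K. e j * w ^ j) - Q w) \<le> w ^ K" for K using b[of K] by (simp only: real_norm_def) linarith
      thus "\<forall>\<^sub>F K in sequentially. norm ((\<Sum>j<K. e j * w ^ j) - Q w) \<le> w ^ K" by simp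
    qed
    thus "(\<lambda>k. e k * w ^ k) sums Q w" unfolding sums_def by (simp add: LIM_zero_iff)
  qed
qed

text \<open>Coefficient of \<open>x ^ n\<close> in \<open>T_bullet\<close>, a polynomial in
  \<open>z\<close> and \<open>w\<close>. For \<open>z = 1\<close>, divided by
  \<open>rn n 1 1\<close>, it is the generating function of the root degree.\<close>

definition rn :: "nat \<Rightarrow> real \<Rightarrow> real \<Rightarrow> real" where
  "rn n z w = (\<Sum>(G, e)\<in>rooted_tc_graphs n. z ^ num_edges G * w ^ deg G (fst e)) / fact n"

lemma rn_has_sum: "((\<lambda>i. acoef i * mono3 x z w i) has_sum (rn n z w * x ^ n)) {i. fst i = n}"
proof -
  define R where "R = rooted_tc_graphs n"
  define f where "f = (\<lambda>(G, e :: nat \<times> nat). (num_edges G, deg G (fst e)))"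
  define I where "I = f ` R"
  have fin: "finite R" unfolding R_def by (rule finite_rooted)
  have t: "t_count n (fst q) (snd q) = card {p \<in> R. f p = q}" for q
    unfolding t_count_def R_def f_def by (rule arg_cong[of _ _ card]) (cases q, auto)
  have "rn n z w * fact n = (\<Sum>p\<in>R. z ^ fst (f p) * w ^ snd (f p))"
    by (simp add: rn_def f_def R_def case_prod_unfold)
  also have "\<dots> = (\<Sum>q\<in>I. \<Sum>p\<in>{p \<in> R. f p = q}. z ^ fst (f p) * w ^ snd (f p))"
    unfolding I_def by (rule sum.image_gen[OF fin])
  also have "\<dots> = (\<Sum>q\<in>I. real (t_count n (fst q) (snd q)) * (z ^ fst q * w ^ snd q))"
    by (intro sum.cong refl) (simp add: t)
  finally have "rn n z w * x ^ n = (\<Sum>q\<in>I. real (t_count n (fst q) (snd q)) * (z ^ fst q * w ^ snd q)) * x ^ n / fact n"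
    by (simp add: field_simps)
  also have "\<dots> = (\<Sum>q\<in>I. acoef (n, q) * mono3 x z w (n, q))"
    unfolding sum_distrib_right sum_divide_distrib
    by (intro sum.cong refl) (simp add: acoef_def mono3_def case_prod_unfold mult_ac)
  also have "\<dots> = (\<Sum>i\<in>Pair n ` I. acoef i * mono3 x z w i)"
    by (subst sum.reindex) (auto intro: inj_onI)
  finally have "((\<lambda>i. acoef i * mono3 x z w i) has_sum (rn n z w * x ^ n)) (Pair n ` I)"
    using fin by (simp only:) (rule has_sum_finite, simp add: I_def)
  moreover have "acoef i = 0" if i: "fst i = n" "i \<notin> Pair n ` I" for i
  proof -
    obtain q where q: "i = (n, q)" using i by (cases i) auto
    hence "q \<notin> I" using i by auto
    hence "{p \<in> R. f p = q} = {}" by (auto simp: I_def)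
    hence "t_count n (fst q) (snd q) = 0" unfolding t by (simp only: card.empty)
    thus ?thesis by (simp add: q acoef_def case_prod_unfold)
  qed
  ultimately show ?thesis by (subst has_sum_cong_neutral[of "Pair n ` I" _ _ "\<lambda>i. acoef i * mono3 x z w i"]) auto
qed

lemma rn_sums_real:
  assumes "0 \<le> x" "0 \<le> z" "0 \<le> w" "Tsummable x z w"
  shows "(\<lambda>n. rn n z w * x ^ n) sums (\<Sum>\<^sub>\<infinity>i. acoef i * mono3 x z w i)"
proof -
  have "(\<lambda>i. norm (acoef i * mono3 x z w i)) summable_on UNIV"
    using assms by (simp add: abs_mult acoef_nonneg mono3_nonneg)
  from has_sum_collect[OF this, of 1 fst] show ?thesis by (simp add: infsumI[OF rn_has_sum])
qed

lemma rn_sums: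
  assumes "0 \<le> x" "0 \<le> z" "0 \<le> w" "Tsummable x z w"
  shows "(\<lambda>n. complex_of_real (rn n z w * x ^ n)) sums T_bullet (of_real x) (of_real z) (of_real w)"
  unfolding T_bullet_real using rn_sums_real[OF assms] by (simp only: sums_of_real_iff)

lemma tc_graphs_small: "n < 4 \<Longrightarrow> tc_graphs n = {}"
  by (auto simp: tc_graphs_def k_connected_def)

lemma rn_small: "n < 4 \<Longrightarrow> rn n z w = 0"
  by (simp add: rn_def rooted_tc_graphs_def tc_graphs_small)

lemma rn_1: "rn n 1 1 = card (rooted_tc_graphs n) / fact n"
  by (simp add: rn_def case_prod_unfold)

lemma rn_nonneg: "0 \<le> z \<Longrightarrow> 0 \<le> w \<Longrightarrow> rn n z w \<ge> 0"
  unfolding rn_def by (intro divide_nonneg_nonneg sum_nonneg) (auto simp: case_prod_unfold)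

text \<open>The partial sum misses exactly the roots of degree at least \<open>K\<close>, each of
  weight at most \<open>w ^ K\<close>.\<close>

lemma root_degree_tail:
  assumes ne: "tc_graphs n \<noteq> {}" and w: "0 < w" "w \<le> 1"
  shows "0 \<le> rn n 1 w / rn n 1 1 - (\<Sum>j<K. root_degree_prob j n * w ^ j)"
    and "rn n 1 w / rn n 1 1 - (\<Sum>j<K. root_degree_prob j n * w ^ j) \<le> w ^ K"
proof -
  define R where "R = rooted_tc_graphs n"
  define d where "d = (\<lambda>(G, e :: nat \<times> nat). deg G (fst e))"
  have fin: "finite R" unfolding R_def by (rule finite_rooted)
  have n1: "1 \<in> {1..n}" using ne tc_graphs_small[of n] by (cases "n = 0") auto
  have cR: "card R > 0" using vertex_degree_prob_eq(4)[OF ne n1] fin by (simp add: R_def card_gt_0_iff)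
  have rd: "root_degree_prob j n = card {p \<in> R. d p = j} / card R" for j
  proof -
    have "{(G, e) \<in> rooted_tc_graphs n. deg G (fst e) = j} = {p \<in> R. d p = j}" by (auto simp: R_def d_def)
    thus ?thesis using vertex_degree_prob_eq(2)[OF ne n1, of j] by (simp add: R_def)
  qed
  have 1: "rn n 1 w / rn n 1 1 = (\<Sum>p\<in>R. w ^ d p) / card R"
    by (simp add: rn_def R_def d_def case_prod_unfold)
  have "(\<Sum>j<K. root_degree_prob j n * w ^ j) = (\<Sum>j<K. \<Sum>p\<in>{p \<in> {p \<in> R. d p < K}. d p = j}. w ^ d p) / card R"
  proof (subst sum_divide_distrib, intro sum.cong refl)
    fix j assume j: "j \<in> {..<K}"
    have "{p \<in> {p \<in> R. d p < K}. d p = j} = {p \<in> R. d p = j}" using j by auto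
    thus "root_degree_prob j n * w ^ j = (\<Sum>p\<in>{p \<in> {p \<in> R. d p < K}. d p = j}. w ^ d p) / card R"
      by (simp add: rd)
  qed
  also have "(\<Sum>j<K. \<Sum>p\<in>{p \<in> {p \<in> R. d p < K}. d p = j}. w ^ d p) = (\<Sum>p\<in>{p \<in> R. d p < K}. w ^ d p)"
    by (rule sum.group) (use fin in auto)
  finally have 2: "(\<Sum>j<K. root_degree_prob j n * w ^ j) = (\<Sum>p\<in>{p \<in> R. d p < K}. w ^ d p) / card R" .
  have "(\<Sum>p\<in>R. w ^ d p) - (\<Sum>p\<in>{p \<in> R. d p < K}. w ^ d p) = (\<Sum>p\<in>R - {p \<in> R. d p < K}. w ^ d p)"
    by (rule sum_diff[symmetric]) (use fin in auto)
  hence 3: "rn n 1 w / rn n 1 1 - (\<Sum>j<K. root_degree_prob j n * w ^ j) = (\<Sum>p\<in>R - {p \<in> R. d p < K}. w ^ d p) / card R"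
    unfolding 1 2 by (simp flip: diff_divide_distrib)
  show "0 \<le> rn n 1 w / rn n 1 1 - (\<Sum>j<K. root_degree_prob j n * w ^ j)"
    unfolding 3 using w by (intro divide_nonneg_nonneg sum_nonneg) auto
  have "(\<Sum>p\<in>R - {p \<in> R. d p < K}. w ^ d p) \<le> (\<Sum>p\<in>R - {p \<in> R. d p < K}. w ^ K)"
    using w by (intro sum_mono power_decreasing) auto
  also have "\<dots> = card (R - {p \<in> R. d p < K}) * w ^ K" by simp
  also have "\<dots> \<le> card R * w ^ K" using w fin by (intro mult_right_mono) (auto intro!: card_mono)
  finally show "rn n 1 w / rn n 1 1 - (\<Sum>j<K. root_degree_prob j n * w ^ j) \<le> w ^ K"
    unfolding 3 using cR by (simp add: field_simps)
qed

text \<open>As \<open>q2\<close> is a square for \<open>w = 1\<close>, so is \<open>qn 1\<close>,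
  and the value is computed within the field generated by \<open>s7\<close>.\<close>

lemma hq_1: "hq 1 = 1"
proof -
  define \<rho> where "\<rho> = (117 - 31 * sqrt 7) / 59"
  have "sqrt 7 < sqrt ((117 / 31)\<^sup>2)" by (intro real_sqrt_less_mono) (simp add: power2_eq_square)
  hence p: "\<rho> > 0" by (simp add: \<rho>_def)
  have rc: "complex_of_real \<rho> = (117 - 31 * s7) / 59" by (simp add: \<rho>_def s7_def)
  have "qn 1 = (of_real \<rho>)\<^sup>2" unfolding rc qn_def by (simp add: power2_eq_square field_simps s7_rules)
  hence q: "csqrt (qn 1) = of_real \<rho>" using p by (intro csqrt_unique) auto
  have r3: "(of_real \<rho>) ^ 3 = (3962790 - 1481614 * s7) / 205379"
    unfolding rc power3_eq_cube by (simp add: field_simps s7_rules)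
  have k1: "kn 1 = (3962790 - 1481614 * s7) / 205379 / 2"
    unfolding kn_def by (simp add: field_simps s7_rules)
  have "(of_real \<rho>) ^ 3 \<noteq> (0::complex)" using p by simp
  hence "kn 1 / (of_real \<rho>) ^ 3 = 1 / 2" unfolding k1 r3[symmetric] by simp
  thus ?thesis unfolding hq_def q by (simp add: field_simps)
qed

lemma rc_eq: "rc = ucrit / chi0\<^sup>2" by (simp add: rc_def r_fun_1)

lemma rc_lt: "rc < 1 / 2"
proof -
  have "sqrt 7 < sqrt (3\<^sup>2)" by (intro real_sqrt_less_mono) simp
  thus ?thesis by (simp add: rc_def r_fun_1(2))
qed

text \<open>The constant from \<open>diag_asymptotics\<close> apart from its dependence on
  \<open>w\<close>; it cancels in the ratios.\<close>

definition amp :: complex where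
  "amp = of_real (ucrit / (2 * pi) * sqrt (pi / ksigma)) * ((42496 - 15872 * s7) / 243)"

lemma amp_nonzero: "amp \<noteq> 0"
proof -
  have k: "ksigma > 0" using ucrit_bounds chi0_pos by (simp add: ksigma_def add_pos_nonneg)
  have "sqrt 7 < sqrt ((42496/15872)\<^sup>2)" by (intro real_sqrt_less_mono) (simp add: power2_eq_square)
  hence "42496 - 15872 * sqrt 7 > 0" by simp
  hence "complex_of_real (42496 - 15872 * sqrt 7) \<noteq> 0" by (subst of_real_eq_0_iff) auto
  hence "42496 - 15872 * s7 \<noteq> 0" by (simp add: s7_def)
  moreover have "ucrit / (2 * pi) * sqrt (pi / ksigma) \<noteq> 0" using k ucrit_bounds pi_gt_zero by simp
  ultimately show ?thesis unfolding amp_def by simp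
qed

context closed_form
begin

text \<open>The points are parametrized by the value \<open>t\<close> of \<open>u\<close>, of which
  \<open>x\<close> is an explicit function when \<open>z = 1\<close>; being a small fixed point,
  \<open>t\<close> satisfies the premises of \<open>Tsummable_critical\<close>.\<close>

lemma diag_T_bullet:
  fixes t w :: real
  assumes br: "sqbranch (of_real w) \<sigma>" and w: "0 < w" "w \<le> 1" and t: "0 < t" "t < min (1/10) rc"
  defines "x \<equiv> t / (2 + 2 * t + t\<^sup>2)\<^sup>2"
  shows "0 < x" "x < 1" "Tsummable x 1 w"
    "T_bullet (of_real x) 1 (of_real w) = of_real x ^ 2 * of_real w ^ 2 / 2 * (1 / (1 + of_real w) + 1 / (1 + of_real x) - 1)
       + of_real x ^ 2 * of_real w / (4 * (1 + of_real w)) * Ndiag (\<sigma> (of_real t)) (1 + of_real t) (of_real w)"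
proof -
  define c where "c = 2 + 2 * t + t\<^sup>2"
  have c: "c > 2" using t by (simp add: c_def add_pos_nonneg)
  have c1: "c\<^sup>2 > 1" using c by (simp add: one_less_power)
  have xc: "x = t / c\<^sup>2" by (simp add: x_def c_def)
  show x0: "0 < x" using t c by (simp add: xc)
  have xt: "x \<le> t" using t c1 by (simp add: xc divide_le_eq)
  thus "x < 1" using t by simp
  have fp: "x * 1 * (1 + 1 * (1 + t)\<^sup>2)\<^sup>2 = t"
  proof -
    have "1 + 1 * (1 + t)\<^sup>2 = c" by (simp add: c_def power2_eq_square algebra_simps)
    thus ?thesis using c by (simp add: xc)
  qed
  have xr: "x \<le> r_fun 1" using xt t by (simp add: rc_def)
  have tu: "t \<le> u0_fun 1" using t ucrit_bounds by (simp add: u0_fun_1)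
  have crit: "Tsummable x 1 w" "T_bullet (of_real x) (of_real 1) (of_real w) = Tc (of_real x) (of_real 1) (of_real w) (of_real t) (of_real (1 * (1 + t)\<^sup>2))"
    using Tsummable_critical[OF _ x0 xr w _ tu fp] t by auto
  show "Tsummable x 1 w" by (rule crit)
  define u where "u = complex_of_real t"
  define W where "W = complex_of_real w"
  have d: "Tdom (of_real x) 1 W u ((1 + u)\<^sup>2)"
  proof -
    have "Tdom (of_real x) (of_real 1) (of_real w) (of_real t) (of_real ((1 + t)\<^sup>2))"
      by (rule Tdom_real) (use x0 w t in \<open>simp_all only: nonneg_Reals_of_real_iff norm_of_real, auto\<close>)
    thus ?thesis by (simp add: u_def W_def)
  qed
  have "T_bullet (of_real x) 1 W = Tc (of_real x) 1 W u ((1 + u)\<^sup>2)" using crit(2) by (simp add: u_def W_def)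
  also have "\<dots> = of_real x ^ 2 * W ^ 2 / 2 * (1 / (1 + W) + 1 / (1 + of_real x) - 1)
       + of_real x ^ 2 * W / (4 * (1 + W)) * Nuv (csqrt (w2_poly u ((1 + u)\<^sup>2) W)) u ((1 + u)\<^sup>2) W"
    using Tc_Nuv[OF d] by simp
  also have "Nuv (csqrt (w2_poly u ((1 + u)\<^sup>2) W)) u ((1 + u)\<^sup>2) W = Ndiag (\<sigma> u) (1 + u) W"
  proof -
    define y where "y = 1 + u"
    have uy: "u = y - 1" by (simp add: y_def)
    have ub: "u \<in> ball 0 (11/20)" using t by (simp add: u_def)
    have s2: "(\<sigma> u)\<^sup>2 = q2 y W" and sp: "Re (\<sigma> u) > 0"
      using br ub t unfolding sqbranch_def y_def u_def W_def by auto
    have yr: "y = of_real (1 + t)" by (simp add: y_def u_def)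
    have y2: "y\<^sup>2 = of_real ((1 + t)\<^sup>2)" by (simp add: yr)
    have ynz: "y \<noteq> 0" "1 + y \<noteq> 0"
    proof -
      have "complex_of_real (1 + t) \<noteq> 0" using t by (subst of_real_eq_0_iff) auto
      thus "y \<noteq> 0" unfolding yr .
      have "complex_of_real (2 + t) \<noteq> 0" using t by (subst of_real_eq_0_iff) auto
      thus "1 + y \<noteq> 0" unfolding yr by (simp flip: add.assoc)
    qed
    \<comment> \<open>The positive real part of \<sigma> identifies the principal square
      root.\<close>
    have "csqrt (w2_poly (y - 1) (y\<^sup>2) W) = y\<^sup>2 * \<sigma> u"
    proof (rule csqrt_unique)
      show "(y\<^sup>2 * \<sigma> u)\<^sup>2 = w2_poly (y - 1) (y\<^sup>2) W"
        unfolding w2_poly_diag power_mult_distrib s2 by (simp flip: power_mult)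
      have "Re (y\<^sup>2 * \<sigma> u) = (1 + t)\<^sup>2 * Re (\<sigma> u)" unfolding y2 by simp
      thus "0 < Re (y\<^sup>2 * \<sigma> u) \<or> Re (y\<^sup>2 * \<sigma> u) = 0 \<and> 0 \<le> Im (y\<^sup>2 * \<sigma> u)" using sp t by simp
    qed
    hence "Nuv (csqrt (w2_poly (y - 1) (y\<^sup>2) W)) (y - 1) (y\<^sup>2) W = (- (y\<^sup>2 * w1r y W) + (y - W) * (y\<^sup>2 * \<sigma> u)) / (y + y\<^sup>2) ^ 3"
      by (simp add: Nuv_def w1_poly_diag)
    also have "\<dots> = (y\<^sup>2 * (- w1r y W + (y - W) * \<sigma> u)) / (y\<^sup>2 * (y * (1 + y) ^ 3))"
    proof -
      have "(y + y\<^sup>2) ^ 3 = y\<^sup>2 * (y * (1 + y) ^ 3)" by (simp add: power2_eq_square power3_eq_cube algebra_simps)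
      moreover have "- (y\<^sup>2 * w1r y W) + (y - W) * (y\<^sup>2 * \<sigma> u) = y\<^sup>2 * (- w1r y W + (y - W) * \<sigma> u)" by (simp add: algebra_simps)
      ultimately show ?thesis by (simp only:)
    qed
    also have "\<dots> = Ndiag (\<sigma> u) y W" using ynz by (simp add: Ndiag_def)
    finally show ?thesis unfolding uy[symmetric] by (simp add: y_def)
  qed
  finally show "T_bullet (of_real x) 1 (of_real w) = of_real x ^ 2 * of_real w ^ 2 / 2 * (1 / (1 + of_real w) + 1 / (1 + of_real x) - 1)
       + of_real x ^ 2 * of_real w / (4 * (1 + of_real w)) * Ndiag (\<sigma> (of_real t)) (1 + of_real t) (of_real w)"
    by (simp only: u_def W_def)
qed

text \<open>Coefficients of \<open>Ndiag\<close> as a series in \<open>x\<close>, found by solving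
  the formula of \<open>diag_T_bullet\<close> for it: the shift by 2 comes from
  \<open>x\<^sup>2\<close>, the powers of -1 from \<open>1 / (1 + x)\<close>, and the constant terms
  sit at \<open>n = 0\<close>.\<close>

definition nu_coef :: "real \<Rightarrow> nat \<Rightarrow> real" where
  "nu_coef w n = 4 * (1 + w) / w * (rn (n + 2) 1 w - w\<^sup>2 / 2 * ((- 1) ^ n + (if n = 0 then 1 / (1 + w) - 1 else 0)))"

lemma nu_coef_sums:
  fixes t w :: real
  assumes br: "sqbranch (of_real w) \<sigma>" and w: "0 < w" "w \<le> 1" and t: "0 < t" "t < min (1/10) rc"
  shows "(\<lambda>n. of_real (nu_coef w n) * of_real (t / (2 + 2 * t + t\<^sup>2)\<^sup>2) ^ n) sums Ndiag (\<sigma> (of_real t)) (1 + of_real t) (of_real w)"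
proof -
  define x where "x = t / (2 + 2 * t + t\<^sup>2)\<^sup>2"
  note D = diag_T_bullet[of w \<sigma> t, OF br w t, folded x_def]
  define N where "N = Ndiag (\<sigma> (of_real t)) (1 + of_real t) (of_real w)"
  define B where "B = 1 / (1 + complex_of_real w) + 1 / (1 + of_real x) - 1"
  have xnz: "complex_of_real x \<noteq> 0" using D(1) by simp
  have w1: "1 + complex_of_real w \<noteq> 0"
  proof -
    have "complex_of_real (1 + w) \<noteq> 0" using w by (subst of_real_eq_0_iff) auto
    thus ?thesis by simp
  qed
  have "(\<lambda>n. complex_of_real (rn n 1 w * x ^ n)) sums T_bullet (of_real x) (of_real 1) (of_real w)"
    by (rule rn_sums) (use D w in auto)
  hence "(\<lambda>n. complex_of_real (rn n 1 w * x ^ n)) sums (of_real x ^ 2 * of_real w ^ 2 / 2 * B + of_real x ^ 2 * of_real w / (4 * (1 + of_real w)) * N)"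
    using D(4) by (simp add: N_def B_def)
  hence "(\<lambda>n. complex_of_real (rn (n + 2) 1 w * x ^ (n + 2))) sums (of_real x ^ 2 * of_real w ^ 2 / 2 * B + of_real x ^ 2 * of_real w / (4 * (1 + of_real w)) * N)"
    by (subst sums_iff_shift) (simp add: rn_small numeral_2_eq_2)
  hence "(\<lambda>n. complex_of_real (rn (n + 2) 1 w * x ^ (n + 2)) / of_real x ^ 2) sums
     ((of_real x ^ 2 * of_real w ^ 2 / 2 * B + of_real x ^ 2 * of_real w / (4 * (1 + of_real w)) * N) / of_real x ^ 2)"
    by (rule sums_divide)
  moreover have "(of_real x ^ 2 * of_real w ^ 2 / 2 * B + of_real x ^ 2 * of_real w / (4 * (1 + of_real w)) * N) / of_real x ^ 2
      = of_real w ^ 2 / 2 * B + of_real w / (4 * (1 + of_real w)) * N"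
    using xnz by (simp add: add_divide_distrib)
  moreover have "complex_of_real (rn (n + 2) 1 w * x ^ (n + 2)) / of_real x ^ 2 = of_real (rn (n + 2) 1 w) * of_real x ^ n" for n
    using xnz by (simp add: power_add power2_eq_square)
  ultimately have 1: "(\<lambda>n. of_real (rn (n + 2) 1 w) * complex_of_real x ^ n) sums (of_real w ^ 2 / 2 * B + of_real w / (4 * (1 + of_real w)) * N)"
    by simp
  have "(\<lambda>n. (- complex_of_real x) ^ n) sums (1 / (1 - (- of_real x)))" by (rule geometric_sums) (use D in simp)
  hence g: "(\<lambda>n. (- 1) ^ n * complex_of_real x ^ n) sums (1 / (1 + of_real x))"
    by (simp add: power_minus[of "complex_of_real x"])
  have h: "(\<lambda>n. (if n = 0 then 1 / (1 + complex_of_real w) - 1 else 0) * complex_of_real x ^ n) sums (1 / (1 + of_real w) - 1)"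
    using sums_single[of 0 "\<lambda>n. (1 / (1 + complex_of_real w) - 1) * complex_of_real x ^ n"]
    by (simp add: if_distrib[of "\<lambda>a. a * _"] cong: if_cong)
  have "(\<lambda>n. ((- 1) ^ n + (if n = 0 then 1 / (1 + complex_of_real w) - 1 else 0)) * complex_of_real x ^ n) sums B"
  proof -
    have "1 / (1 + complex_of_real x) + (1 / (1 + complex_of_real w) - 1) = B" by (simp add: B_def)
    with sums_add[OF g h] show ?thesis by (simp only: distrib_right)
  qed
  from sums_diff[OF 1 sums_mult[OF this, of "of_real w ^ 2 / 2"]]
  have "(\<lambda>n. of_real (rn (n + 2) 1 w) * complex_of_real x ^ n - of_real w ^ 2 / 2 * (((- 1) ^ n + (if n = 0 then 1 / (1 + complex_of_real w) - 1 else 0)) * complex_of_real x ^ n))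
     sums (of_real w / (4 * (1 + of_real w)) * N)" by simp
  from sums_mult[OF this, of "4 * (1 + of_real w) / of_real w"]
  have "(\<lambda>n. 4 * (1 + of_real w) / of_real w * (of_real (rn (n + 2) 1 w) * complex_of_real x ^ n - of_real w ^ 2 / 2 * (((- 1) ^ n + (if n = 0 then 1 / (1 + complex_of_real w) - 1 else 0)) * complex_of_real x ^ n)))
     sums (4 * (1 + of_real w) / of_real w * (of_real w / (4 * (1 + of_real w)) * N))" .
  moreover have "4 * (1 + complex_of_real w) / of_real w * (of_real w / (4 * (1 + of_real w)) * N) = N"
    using w1 w by (simp del: distrib_left_numeral)
  moreover have "4 * (1 + of_real w) / of_real w * (of_real (rn (n + 2) 1 w) * complex_of_real x ^ n - of_real w ^ 2 / 2 * (((- 1) ^ n + (if n = 0 then 1 / (1 + complex_of_real w) - 1 else 0)) * complex_of_real x ^ n))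
     = of_real (nu_coef w n) * of_real x ^ n" for n
    by (cases "n = 0") (simp_all add: nu_coef_def left_diff_distrib mult.assoc)
  ultimately show ?thesis unfolding x_def[symmetric] N_def[symmetric] by (simp only:)
qed

text \<open>The normalization from \<open>diag_asymptotics\<close>, of order \<open>rc ^ m\<close>
  times the power 5/2 of \<open>m\<close>.\<close>

definition scale :: "nat \<Rightarrow> real" where
  "scale m = sqrt (real (Suc m)) * rc ^ Suc m * (real (m + 2) * real (m + 1))"

lemma scale_pos: "scale m > 0" using rc_pos by (simp add: scale_def)

text \<open>Disposes of the bounded terms \<open>(- 1) ^ n\<close> in
  \<open>nu_coef\<close>.\<close>

lemma scale_null: "scale \<longlonglongrightarrow> 0"
proof (rule tendsto_sandwich)
  show "\<forall>\<^sub>F m in sequentially. 0 \<le> scale m" using scale_pos by (simp add: less_imp_le)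
  have "scale m \<le> sqrt (real m + 1) * (1/2) ^ Suc m * ((real m + 2) * (real m + 1))" for m
    unfolding scale_def using rc_pos rc_lt by (intro mult_mono power_mono) (auto simp: add.commute)
  thus "\<forall>\<^sub>F m in sequentially. scale m \<le> sqrt (real m + 1) * (1/2) ^ Suc m * ((real m + 2) * (real m + 1))" by simp
  show "(\<lambda>m. sqrt (real m + 1) * (1/2) ^ Suc m * ((real m + 2) * (real m + 1))) \<longlonglongrightarrow> 0" by real_asymp
qed simp

text \<open>The index is \<open>m + 4\<close>: two steps from the second derivative and two from the
  factor \<open>x\<^sup>2\<close>.\<close>

lemma rn_asymp:
  fixes w :: real
  assumes br: "sqbranch (of_real w) \<sigma>" and w: "0 < w" "w \<le> 1"
  shows "(\<lambda>m. complex_of_real (scale m * rn (m + 4) 1 w)) \<longlonglongrightarrow> amp / 4 * (of_real w * hq (of_real w))"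
proof -
  have L: "(\<lambda>m. of_real (sqrt (real (Suc m)) * (ucrit / chi0\<^sup>2) ^ Suc m) * (of_nat (Suc (Suc m)) * of_nat (Suc m) * complex_of_real (nu_coef w (Suc (Suc m)))))
    \<longlonglongrightarrow> of_real (ucrit / (2 * pi) * sqrt (pi / ksigma)) * ((42496 - 15872 * s7) / 243 * ((1 + of_real w) * hq (of_real w)))"
    by (rule diag_asymptotics[OF br w, of "min (1/10) rc"]) (use rc_pos nu_coef_sums[OF br w] in auto)
  have e: "of_real (sqrt (real (Suc m)) * (ucrit / chi0\<^sup>2) ^ Suc m) * (of_nat (Suc (Suc m)) * of_nat (Suc m) * complex_of_real (nu_coef w (Suc (Suc m))))
     = complex_of_real (scale m * nu_coef w (Suc (Suc m)))" for m
    unfolding scale_def rc_eq by simp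
  have L': "(\<lambda>m. complex_of_real (scale m * nu_coef w (Suc (Suc m)))) \<longlonglongrightarrow> amp * ((1 + of_real w) * hq (of_real w))"
    using L unfolding e by (simp only: amp_def mult.assoc)
  have n0: "(\<lambda>m. complex_of_real (scale m * (w\<^sup>2 / 2 * (- 1) ^ m))) \<longlonglongrightarrow> of_real 0"
  proof (rule tendsto_of_real, rule Lim_null_comparison)
    show "(\<lambda>m. scale m * (w\<^sup>2 / 2)) \<longlonglongrightarrow> 0" using tendsto_mult_right[OF scale_null, of "w\<^sup>2 / 2"] by simp
    show "\<forall>\<^sub>F m in sequentially. norm (scale m * (w\<^sup>2 / 2 * (- 1) ^ m)) \<le> scale m * (w\<^sup>2 / 2)"
      using scale_pos by (simp add: abs_mult power_abs less_imp_le)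
  qed
  have w1: "1 + complex_of_real w \<noteq> 0"
  proof -
    have "complex_of_real (1 + w) \<noteq> 0" using w by (subst of_real_eq_0_iff) auto
    thus ?thesis by simp
  qed
  have eq: "complex_of_real (scale m * rn (m + 4) 1 w) = of_real (w / (4 * (1 + w))) * complex_of_real (scale m * nu_coef w (Suc (Suc m))) + complex_of_real (scale m * (w\<^sup>2 / 2 * (- 1) ^ m))" for m
  proof -
    have "nu_coef w (Suc (Suc m)) = 4 * (1 + w) / w * (rn (m + 4) 1 w - w\<^sup>2 / 2 * (- 1) ^ m)" by (simp add: nu_coef_def eval_nat_numeral)
    moreover have "w / (4 * (1 + w)) * (s * (4 * (1 + w) / w * b)) = s * b" for s b
    proof -
      have "w \<noteq> 0" "1 + w \<noteq> 0" using w by auto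
      thus ?thesis by (simp del: distrib_left_numeral)
    qed
    ultimately have "w / (4 * (1 + w)) * (scale m * nu_coef w (Suc (Suc m))) = scale m * (rn (m + 4) 1 w - w\<^sup>2 / 2 * (- 1) ^ m)" by simp
    hence "scale m * rn (m + 4) 1 w = w / (4 * (1 + w)) * (scale m * nu_coef w (Suc (Suc m))) + scale m * (w\<^sup>2 / 2 * (- 1) ^ m)"
      by (simp add: right_diff_distrib)
    thus ?thesis by (simp only: of_real_add of_real_mult)
  qed
  have "(\<lambda>m. complex_of_real (scale m * rn (m + 4) 1 w)) \<longlonglongrightarrow> of_real (w / (4 * (1 + w))) * (amp * ((1 + of_real w) * hq (of_real w))) + of_real 0"
    unfolding eq by (intro tendsto_add tendsto_mult tendsto_const L' n0)
  moreover have "of_real (w / (4 * (1 + w))) * (amp * ((1 + of_real w) * hq (of_real w))) + of_real 0 = amp / 4 * (of_real w * hq (of_real w))"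
  proof -
    have "a / (4 * p) * (b * (p * c)) = b / 4 * (a * c)" if "p \<noteq> 0" for a b c p :: complex using that by simp
    from this[OF w1] show ?thesis by simp
  qed
  ultimately show ?thesis by (simp only:)
qed

text \<open>A lower bound for the number of rooted graphs; it shows that graphs exist and serves as
  the denominator in the Chernoff bounds.\<close>

lemma rn_1_lower: obtains c where "c > 0" "\<forall>\<^sub>F m in sequentially. scale m * rn (m + 4) 1 1 \<ge> c"
proof -
  obtain \<sigma> where "sqbranch 1 \<sigma>" using sqbranch_one by blast
  hence "(\<lambda>m. complex_of_real (scale m * rn (m + 4) 1 1)) \<longlonglongrightarrow> amp / 4 * (of_real 1 * hq (of_real 1))" by (intro rn_asymp) auto
  hence "(\<lambda>m. norm (complex_of_real (scale m * rn (m + 4) 1 1))) \<longlonglongrightarrow> norm (amp / 4)"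
    using tendsto_norm hq_1 by fastforce
  moreover have "norm (complex_of_real (scale m * rn (m + 4) 1 1)) = scale m * rn (m + 4) 1 1" for m
    unfolding norm_of_real using scale_pos[of m] rn_nonneg[of 1 1 "m + 4"] by (simp add: abs_mult)
  ultimately have "(\<lambda>m. scale m * rn (m + 4) 1 1) \<longlonglongrightarrow> norm (amp / 4)" by simp
  moreover have "norm (amp / 4) / 2 < norm (amp / 4)" using amp_nonzero by simp
  ultimately have "\<forall>\<^sub>F m in sequentially. norm (amp / 4) / 2 < scale m * rn (m + 4) 1 1" by (rule order_tendstoD)
  hence "\<forall>\<^sub>F m in sequentially. norm (amp / 4) / 2 \<le> scale m * rn (m + 4) 1 1" by eventually_elim (rule less_imp_le)
  moreover have "norm (amp / 4) / 2 > 0" using amp_nonzero by simp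
  ultimately show ?thesis using that by blast
qed

lemma rn_ratio:
  fixes w :: real
  assumes br: "sqbranch (of_real w) \<sigma>" and w: "0 < w" "w \<le> 1"
  shows "(\<lambda>n. complex_of_real (rn n 1 w / rn n 1 1)) \<longlonglongrightarrow> of_real w * hq (of_real w)"
proof -
  obtain \<sigma>1 where "sqbranch 1 \<sigma>1" using sqbranch_one by blast
  hence 1: "(\<lambda>m. complex_of_real (scale m * rn (m + 4) 1 1)) \<longlonglongrightarrow> amp / 4 * (of_real 1 * hq (of_real 1))" by (intro rn_asymp) auto
  have "(\<lambda>m. complex_of_real (scale m * rn (m + 4) 1 w) / complex_of_real (scale m * rn (m + 4) 1 1))
     \<longlonglongrightarrow> (amp / 4 * (of_real w * hq (of_real w))) / (amp / 4 * (of_real 1 * hq (of_real 1)))"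
    by (rule tendsto_divide[OF rn_asymp[OF assms] 1]) (use amp_nonzero hq_1 in simp)
  moreover have "complex_of_real (scale m * rn (m + 4) 1 w) / complex_of_real (scale m * rn (m + 4) 1 1) = of_real (rn (m + 4) 1 w / rn (m + 4) 1 1)" for m
    using scale_pos[of m] by simp
  moreover have "(amp / 4 * (of_real w * hq (of_real w))) / (amp / 4 * (of_real 1 * hq (of_real 1))) = of_real w * hq (of_real w)"
    using amp_nonzero hq_1 by simp
  ultimately have "(\<lambda>m. complex_of_real (rn (m + 4) 1 w / rn (m + 4) 1 1)) \<longlonglongrightarrow> of_real w * hq (of_real w)" by simp
  thus ?thesis by (rule LIMSEQ_offset)
qed

text \<open>Existence of graphs of every large size is read off the asymptotics of their
  number.\<close>

lemma tc_graphs_nonempty: "\<forall>\<^sub>F n in sequentially. tc_graphs n \<noteq> {}"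
proof -
  obtain c where c: "c > 0" "\<forall>\<^sub>F m in sequentially. scale m * rn (m + 4) 1 1 \<ge> c" by (rule rn_1_lower)
  have "\<forall>\<^sub>F m in sequentially. tc_graphs (m + 4) \<noteq> {}"
    using c(2)
  proof eventually_elim
    case (elim m)
    hence "rn (m + 4) 1 1 \<noteq> 0" using c(1) by auto
    thus ?case by (auto simp: rn_def rooted_tc_graphs_def)
  qed
  thus ?thesis using eventually_sequentially_seg[of "\<lambda>n. tc_graphs n \<noteq> {}" 4] by blast
qed

end

section \<open>The limit distribution\<close>

text \<open>\<open>aq\<close> and \<open>bq\<close> are the reciprocals of the zeros of
  \<open>qn\<close>; the larger one, \<open>aq\<close>, is the \<open>q\<close> of the
  theorem.\<close>

definition aq :: real where "aq = sqrt 7 - 2"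
definition bq :: real where "bq = (673 * sqrt 7 - 1754) / 3481"
definition kq :: "nat \<Rightarrow> real" where
  "kq i = [(- 15 - 7 * sqrt 7) / 64, (424 + 223 * sqrt 7) / 1888, (13004466 - 4684953 * sqrt 7) / 6572128,
     (31778872 - 12015797 * sqrt 7) / 6572128, (37371401 - 14125021 * sqrt 7) / 13144256] ! i"

lemma sqrt7_bounds: "2.6457513 < sqrt 7" "sqrt 7 < 2.6457514"
  by (rule real_less_rsqrt, simp add: power2_eq_square) (rule real_less_lsqrt, auto simp: power2_eq_square)

lemma aq_bounds: "0.6457 < aq" "aq < 0.6458" and bq_bounds: "0 < bq" "bq < aq"
  using sqrt7_bounds by (simp_all add: aq_def bq_def)

lemma aq_mult_lt:
  assumes "t \<le> 1" shows "aq * t < 1"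
proof -
  have a: "0 < aq" "aq < 1" using aq_bounds by simp_all
  hence "aq * t \<le> aq * 1" using assms by (intro mult_left_mono) auto
  thus ?thesis using a by linarith
qed

text \<open>\<open>w * hq w\<close> for real \<open>w\<close>, with the cube of the square root
  split into two real powers.\<close>

definition pgf_val :: "real \<Rightarrow> real" where
  "pgf_val w = (15 + 7 * sqrt 7) / 64 * w + (17 - 7 * sqrt 7) / 64 * w\<^sup>2
     + (\<Sum>i<5. kq i * w ^ Suc i) * ((1 - bq * w) powr (- 3/2) * (1 - aq * w) powr (- 3/2))"

lemma powr_neg_three_halves: "Q > 0 \<Longrightarrow> Q powr (- 3/2) = 1 / sqrt Q ^ 3" for Q :: real
proof -
  assume Q: "Q > 0"
  have "Q powr (3/2) = (Q powr (1/2)) powr 3" by (simp add: powr_powr)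
  also have "\<dots> = sqrt Q ^ 3" using Q by (simp add: powr_half_sqrt powr_numeral)
  finally show ?thesis using powr_minus_divide[of Q "3/2"] by simp
qed

lemma hq_real:
  assumes w: "0 \<le> w" "aq * w < 1"
  shows "of_real w * hq (of_real w) = of_real (pgf_val w)"
proof -
  define Q where "Q = (1 - aq * w) * (1 - bq * w)"
  have bw: "bq * w < 1" using w bq_bounds mult_right_mono[of bq aq w] by linarith
  have Q: "Q > 0" unfolding Q_def using w bw by simp
  have q: "qn (of_real w) = of_real Q" by (simp add: qn_def Q_def aq_def bq_def s7_def)
  have c: "csqrt (of_real Q) ^ 3 = of_real (sqrt Q ^ 3)" using Q by (simp add: csqrt_of_real_nonneg)
  have k: "of_real w * kn (of_real w) = of_real (\<Sum>i<5. kq i * w ^ Suc i)"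
    by (simp add: kn_def kq_def s7_def eval_nat_numeral lessThan_Suc algebra_simps)
  have p: "(1 - bq * w) powr (- 3/2) * (1 - aq * w) powr (- 3/2) = 1 / sqrt Q ^ 3"
  proof -
    have "Q powr (- 3/2) = (1 - bq * w) powr (- 3/2) * (1 - aq * w) powr (- 3/2)"
      unfolding Q_def using w bw by (subst powr_mult) auto
    thus ?thesis using powr_neg_three_halves[OF Q] by simp
  qed
  have "of_real w * hq (of_real w) = (15 + 7 * s7) / 64 * of_real w + (17 - 7 * s7) / 64 * (of_real w)\<^sup>2
     + (of_real w * kn (of_real w)) / of_real (sqrt Q ^ 3)"
    unfolding hq_def q c by (simp add: distrib_left power2_eq_square mult_ac)
  also have "\<dots> = of_real (pgf_val w)"
    unfolding k pgf_val_def p by (simp add: s7_def)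
  finally show ?thesis .
qed

text \<open>The coefficients of \<open>w hq(w)\<close>.\<close>

definition edist :: "nat \<Rightarrow> real" where
  "edist k = (if k = 1 then (15 + 7 * sqrt 7) / 64 else 0) + (if k = 2 then (17 - 7 * sqrt 7) / 64 else 0)
     + (\<Sum>i<5. kq i * (if k \<ge> Suc i then conv_c aq bq (k - Suc i) else 0))"

lemma sums_shift_coeff:
  fixes c :: "nat \<Rightarrow> real"
  assumes "(\<lambda>k. c k * w ^ k) sums s"
  shows "(\<lambda>k. (if k \<ge> j then c (k - j) else 0) * w ^ k) sums (w ^ j * s)"
proof -
  have "(\<lambda>i. w ^ j * (c i * w ^ i)) sums (w ^ j * s)" by (intro sums_mult assms)
  hence "(\<lambda>i. (if i + j \<ge> j then c (i + j - j) else 0) * w ^ (i + j)) sums (w ^ j * s)" by (simp add: power_add mult_ac)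
  thus ?thesis by (subst (asm) sums_zero_iff_shift) auto
qed

lemma edist_sums:
  assumes w: "0 \<le> w" "aq * w < 1"
  shows "(\<lambda>k. edist k * w ^ k) sums pgf_val w"
proof -
  define V where "V = (1 - bq * w) powr (- 3/2) * (1 - aq * w) powr (- 3/2)"
  have 0: "(\<lambda>k. conv_c aq bq k * w ^ k) sums V"
    unfolding V_def by (rule conv_c_sums) (use bq_bounds w in auto)
  have s: "(\<lambda>k. (if k = j then a else 0) * w ^ k) sums (a * w ^ j)" for j and a :: real
    using sums_single[of j "\<lambda>k. a * w ^ k"] by (simp add: if_distrib[of "\<lambda>a. a * _"] cong: if_cong)
  have "(\<lambda>k. (if k = 1 then (15 + 7 * sqrt 7) / 64 else 0) * w ^ k + (if k = 2 then (17 - 7 * sqrt 7) / 64 else 0) * w ^ k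
     + (\<Sum>i<5. kq i * ((if k \<ge> Suc i then conv_c aq bq (k - Suc i) else 0) * w ^ k))) sums
     ((15 + 7 * sqrt 7) / 64 * w ^ 1 + (17 - 7 * sqrt 7) / 64 * w ^ 2 + (\<Sum>i<5. kq i * (w ^ Suc i * V)))"
    by (intro sums_add sums_sum sums_mult s sums_shift_coeff 0)
  moreover have "(if k = 1 then (15 + 7 * sqrt 7) / 64 else 0) * w ^ k + (if k = 2 then (17 - 7 * sqrt 7) / 64 else 0) * w ^ k
     + (\<Sum>i<5. kq i * ((if k \<ge> Suc i then conv_c aq bq (k - Suc i) else 0) * w ^ k)) = edist k * w ^ k" for k
    unfolding edist_def distrib_right sum_distrib_right mult.assoc ..
  moreover have "(15 + 7 * sqrt 7) / 64 * w ^ 1 + (17 - 7 * sqrt 7) / 64 * w ^ 2 + (\<Sum>i<5. kq i * (w ^ Suc i * V)) = pgf_val w"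
    unfolding pgf_val_def V_def[symmetric] sum_distrib_right by (simp add: mult.assoc)
  ultimately show ?thesis by (simp only:)
qed

definition cconst :: real where "cconst = sqrt ((1379 + 517 * sqrt 7) / (1008 * pi))"

text \<open>Contributions at the singularity \<open>1 / aq\<close>: the polynomial numerator, the
  factor with \<open>bq\<close>, and \<open>1 / Gamma (3/2)\<close>. Squaring moves the comparison
  into the field generated by \<open>sqrt 7\<close>, apart from a factor pi.\<close>

lemma cconst_eq: "(\<Sum>i<5. kq i / aq ^ Suc i) * (2 / sqrt pi * (1 - bq / aq) powr (- 3/2)) = cconst"
proof -
  define S where "S = (238588 + 98636 * sqrt 7) / 616137"
  define t where "t = (3080 + 136 * sqrt 7) / 3481"
  have t0: "t > 0" and S0: "S > 0" by (simp_all add: t_def S_def add_pos_nonneg)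
  have ia: "1 / aq = (sqrt 7 + 2) / 3" using aq_bounds by (simp add: aq_def field_simps)
  have bt: "1 - bq / aq = t"
  proof -
    have "1 - bq / aq = 1 - bq * ((sqrt 7 + 2) / 3)" unfolding ia[symmetric] by simp
    also have "\<dots> = t" unfolding bq_def t_def by (simp add: field_simps)
    finally show ?thesis .
  qed
  have p2: "((sqrt 7 + 2) / 3)\<^sup>2 = (11 + 4 * sqrt 7) / 9" by (simp add: power2_eq_square field_simps)
  have p3: "((sqrt 7 + 2) / 3) ^ 3 = (50 + 19 * sqrt 7) / 27"
    unfolding power_Suc[of _ 2, simplified] p2 by (simp add: field_simps)
  have p4: "((sqrt 7 + 2) / 3) ^ 4 = (233 + 88 * sqrt 7) / 81"
    unfolding power_Suc[of _ 3, simplified] p3 by (simp add: field_simps)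
  have p5: "((sqrt 7 + 2) / 3) ^ 5 = (1082 + 409 * sqrt 7) / 243"
    unfolding power_Suc[of _ 4, simplified] p4 by (simp add: field_simps)
  have "(\<Sum>i<5. kq i / aq ^ Suc i) = (\<Sum>i<5. kq i * (1 / aq) ^ Suc i)" by (simp add: divide_inverse power_inverse)
  also have "\<dots> = kq 0 * (1 / aq) + kq 1 * (1 / aq)\<^sup>2 + kq 2 * (1 / aq) ^ 3 + kq 3 * (1 / aq) ^ 4 + kq 4 * (1 / aq) ^ 5"
    by (simp add: eval_nat_numeral)
  also have "\<dots> = S" unfolding ia p2 p3 p4 p5 S_def kq_def by (simp add: eval_nat_numeral) (simp add: field_simps)
  finally have S: "(\<Sum>i<5. kq i / aq ^ Suc i) = S" .
  have "S * (2 / sqrt pi * (1 / sqrt t ^ 3)) = cconst"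
    unfolding cconst_def
  proof (rule real_sqrt_unique[symmetric])
    have st: "(sqrt t ^ 3)\<^sup>2 = t ^ 3"
    proof -
      have "(sqrt t ^ 3)\<^sup>2 = ((sqrt t)\<^sup>2) ^ 3" by (simp only: power_mult[symmetric] mult.commute)
      thus ?thesis using t0 by simp
    qed
    have "(S * (2 / sqrt pi * (1 / X)))\<^sup>2 = 4 * S\<^sup>2 / (pi * X\<^sup>2)" for X
      by (simp add: power_mult_distrib power_divide)
    from this[of "sqrt t ^ 3"] have "(S * (2 / sqrt pi * (1 / sqrt t ^ 3)))\<^sup>2 = 4 * S\<^sup>2 / (pi * t ^ 3)"
      unfolding st .
    also have "\<dots> = (1379 + 517 * sqrt 7) / (1008 * pi)"
    proof -
      have S2: "S\<^sup>2 = (125027657216 + 47066731936 * sqrt 7) / 379624802769" by (simp add: S_def power2_eq_square field_simps)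
      have t2: "t\<^sup>2 = (9615872 + 837760 * sqrt 7) / 12117361" by (simp add: t_def power2_eq_square field_simps)
      have t3: "t ^ 3 = t\<^sup>2 * t" by (simp add: power2_eq_square power3_eq_cube)
      have "4 * S\<^sup>2 * 1008 = (1379 + 517 * sqrt 7) * t ^ 3"
        unfolding S2 t3 unfolding t2 unfolding t_def by (simp add: field_simps)
      thus ?thesis using t0 by (simp add: frac_eq_eq)
    qed
    finally show "(S * (2 / sqrt pi * (1 / sqrt t ^ 3)))\<^sup>2 = (1379 + 517 * sqrt 7) / (1008 * pi)" .
    show "0 \<le> S * (2 / sqrt pi * (1 / sqrt t ^ 3))" using S0 t0 by simp
  qed
  thus ?thesis unfolding S bt powr_neg_three_halves[OF t0] .
qed

lemma cconst_numeric: "\<bar>cconst - 0.9313492\<bar> < 5 / 10 ^ 8"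
proof -
  have "(1379 + 517 * sqrt 7) / (1008 * pi) < (0.93134925)\<^sup>2"
  proof -
    have "1379 + 517 * sqrt 7 < (0.93134925)\<^sup>2 * (1008 * 3.141592653588)"
      using sqrt7_bounds by (simp add: power2_eq_square)
    also have "\<dots> \<le> (0.93134925)\<^sup>2 * (1008 * pi)" using pi_approx by simp
    finally show ?thesis using pi_gt_zero by (simp add: divide_less_eq)
  qed
  hence 1: "cconst < 0.93134925" unfolding cconst_def by (intro real_less_lsqrt) (auto intro: add_nonneg_nonneg)
  have "(0.93134915)\<^sup>2 < (1379 + 517 * sqrt 7) / (1008 * pi)"
  proof -
    have "(0.93134915)\<^sup>2 * (1008 * pi) \<le> (0.93134915)\<^sup>2 * (1008 * 3.1415926535899)" using pi_approx by simp
    also have "\<dots> < 1379 + 517 * sqrt 7" using sqrt7_bounds by (simp add: power2_eq_square)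
    finally show ?thesis using pi_gt_zero by (simp add: less_divide_eq)
  qed
  hence 2: "0.93134915 < cconst" unfolding cconst_def by (rule real_less_rsqrt)
  show ?thesis unfolding abs_less_iff using 1 2 by (intro conjI) simp_all
qed

lemma cconst_pos: "cconst > 0" using cconst_numeric unfolding abs_less_iff by simp

text \<open>A shift of the index by \<open>j\<close> changes the normalized limit by the factor
  \<open>1 / aq ^ j\<close>; the separate terms at 1 and 2 disappear for large
  \<open>k\<close>.\<close>

lemma edist_asymp: "(\<lambda>k. edist k / (real k powr (1/2) * aq ^ k)) \<longlonglongrightarrow> cconst"
proof -
  define L where "L = 2 / sqrt pi * (1 - bq / aq) powr (- 3/2)"
  have a: "aq > 0" using aq_bounds by simp
  have C: "(\<lambda>k. conv_c aq bq k / (aq ^ k * sqrt (real k))) \<longlonglongrightarrow> L" unfolding L_def by (rule conv_c_asymp[OF bq_bounds])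
  have sh: "(\<lambda>k. (if k \<ge> j then conv_c aq bq (k - j) else 0) / (sqrt (real k) * aq ^ k)) \<longlonglongrightarrow> L / aq ^ j" for j
  proof (rule LIMSEQ_offset[of _ j])
    have "(\<lambda>n. sqrt (real n / real (n + j))) \<longlonglongrightarrow> sqrt 1"
    proof (intro tendsto_real_sqrt)
      show "(\<lambda>n. real n / real (n + j)) \<longlonglongrightarrow> 1" by real_asymp
    qed
    from tendsto_mult[OF tendsto_mult[OF C this] tendsto_const[of "1 / aq ^ j"]]
    have "(\<lambda>n. conv_c aq bq n / (aq ^ n * sqrt (real n)) * sqrt (real n / real (n + j)) * (1 / aq ^ j)) \<longlonglongrightarrow> L / aq ^ j" by simp
    thus "(\<lambda>n. (if n + j \<ge> j then conv_c aq bq (n + j - j) else 0) / (sqrt (real (n + j)) * aq ^ (n + j))) \<longlonglongrightarrow> L / aq ^ j"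
    proof (rule Lim_transform_eventually)
      show "\<forall>\<^sub>F n in sequentially. conv_c aq bq n / (aq ^ n * sqrt (real n)) * sqrt (real n / real (n + j)) * (1 / aq ^ j)
         = (if n + j \<ge> j then conv_c aq bq (n + j - j) else 0) / (sqrt (real (n + j)) * aq ^ (n + j))"
        using eventually_gt_at_top[of 0]
        by eventually_elim (use a in \<open>simp add: real_sqrt_divide power_add del: of_nat_add\<close>)
    qed
  qed
  have z: "(\<lambda>k. (if k = j then c else 0) / (sqrt (real k) * aq ^ k)) \<longlonglongrightarrow> 0" for j and c :: real
  proof (rule tendsto_eventually)
    show "\<forall>\<^sub>F k in sequentially. (if k = j then c else 0) / (sqrt (real k) * aq ^ k) = 0"
      using eventually_gt_at_top[of j] by eventually_elim simp
  qed
  have "(\<lambda>k. (if k = 1 then (15 + 7 * sqrt 7) / 64 else 0) / (sqrt (real k) * aq ^ k) + (if k = 2 then (17 - 7 * sqrt 7) / 64 else 0) / (sqrt (real k) * aq ^ k)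
     + (\<Sum>i<5. kq i * ((if k \<ge> Suc i then conv_c aq bq (k - Suc i) else 0) / (sqrt (real k) * aq ^ k)))) \<longlonglongrightarrow> 0 + 0 + (\<Sum>i<5. kq i * (L / aq ^ Suc i))"
    by (intro tendsto_add z tendsto_sum tendsto_mult tendsto_const sh)
  moreover have "(if k = 1 then (15 + 7 * sqrt 7) / 64 else 0) / (sqrt (real k) * aq ^ k) + (if k = 2 then (17 - 7 * sqrt 7) / 64 else 0) / (sqrt (real k) * aq ^ k)
     + (\<Sum>i<5. kq i * ((if k \<ge> Suc i then conv_c aq bq (k - Suc i) else 0) / (sqrt (real k) * aq ^ k))) = edist k / (real k powr (1/2) * aq ^ k)" for k
    unfolding edist_def add_divide_distrib sum_divide_distrib times_divide_eq_right by (simp only: powr_half_sqrt of_nat_0_le_iff)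
  moreover have "0 + 0 + (\<Sum>i<5. kq i * (L / aq ^ Suc i)) = cconst"
    unfolding cconst_eq[symmetric] L_def[symmetric] sum_distrib_right by simp
  ultimately show ?thesis by (simp only:)
qed

text \<open>The series converges for \<open>norm w < 3/2\<close>, since
  \<open>aq * (3/2) < 1\<close>. Near the segment \<open>qn\<close> avoids the cut, so both sides
  are holomorphic on a convex neighbourhood and agree on the reals.\<close>

lemma hq_disc:
  obtains U where "open U" "of_real ` {0..1} \<subseteq> U" "\<And>w. w \<in> U \<Longrightarrow> (\<lambda>k. of_real (edist k) * w ^ k) sums (w * hq w)"
proof -
  have qo: "open {w. qn w \<in> - \<real>\<^sub>\<le>\<^sub>0}"
  proof -
    have "open (qn -` (- \<real>\<^sub>\<le>\<^sub>0))"
      by (rule open_vimage) (auto simp: open_Compl closed_nonpos_Reals_complex qn_def[abs_def] intro!: continuous_intros)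
    thus ?thesis by (simp add: vimage_def)
  qed
  have "complex_of_real ` {0..1} \<subseteq> {w. qn w \<in> - \<real>\<^sub>\<le>\<^sub>0}"
  proof safe
    fix t :: real assume t: "t \<in> {0..1}" and n: "qn (of_real t) \<in> \<real>\<^sub>\<le>\<^sub>0"
    have "aq * t < 1" using t by (intro aq_mult_lt) simp
    moreover have "bq * t \<le> aq * t" using t bq_bounds by (intro mult_right_mono) auto
    ultimately have "1 - aq * t > 0" "1 - bq * t > 0" by linarith+
    hence "(1 - aq * t) * (1 - bq * t) > 0" by simp
    moreover have "qn (of_real t) = of_real ((1 - aq * t) * (1 - bq * t))" by (simp add: qn_def aq_def bq_def s7_def)
    ultimately show False using n by (simp only: nonpos_Reals_of_real_iff)
  qed
  moreover have "compact (complex_of_real ` {0..1})" by (intro compact_continuous_image continuous_intros) auto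
  ultimately obtain \<epsilon> where \<epsilon>: "\<epsilon> > 0" "(\<Union>x\<in>complex_of_real ` {0..1}. ball x \<epsilon>) \<subseteq> {w. qn w \<in> - \<real>\<^sub>\<le>\<^sub>0}"
    using compact_subset_open_imp_ball_epsilon_subset[OF _ qo] by metis
  define \<delta> where "\<delta> = min \<epsilon> (1/2)"
  have \<delta>: "\<delta> > 0" using \<epsilon> by (simp add: \<delta>_def)
  have sub: "qn w \<notin> \<real>\<^sub>\<le>\<^sub>0 \<and> norm w < 3/2" if sw: "w \<in> seg_nbhd \<delta>" for w
  proof -
    obtain t where t: "t \<in> {0..1}" "dist w (of_real t) < \<delta>" using seg_nbhd(3)[OF sw] by blast
    have "w \<in> ball (of_real t) \<epsilon>" using t by (simp add: \<delta>_def dist_commute)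
    hence "w \<in> {w. qn w \<in> - \<real>\<^sub>\<le>\<^sub>0}" using \<epsilon>(2) t(1) by blast
    moreover have "norm w \<le> norm (w - of_real t) + norm (complex_of_real t)" using norm_triangle_ineq[of "w - of_real t" "of_real t"] by simp
    ultimately show ?thesis using t by (auto simp: \<delta>_def dist_norm)
  qed
  define c where "c k = complex_of_real (edist k)" for k
  have cr: "conv_radius c \<ge> ereal (3/2)"
  proof -
    have "summable (\<lambda>k. edist k * (3/2) ^ k)" using edist_sums[of "3/2"] aq_bounds by (simp add: sums_iff)
    hence "summable (\<lambda>k. complex_of_real (edist k * (3/2) ^ k))" by (simp only: summable_complex_of_real)
    hence "summable (\<lambda>k. c k * (3/2) ^ k)" by (simp add: c_def)
    from conv_radius_geI[OF this] show ?thesis by simp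
  qed
  have conv: "(\<lambda>k. c k * w ^ k) sums (\<Sum>k. c k * w ^ k)" if "norm w < 3/2" for w
  proof -
    have "ereal (norm w) < ereal (3/2)" using that by simp
    also note cr
    finally show ?thesis by (intro summable_sums summable_in_conv_radius)
  qed
  have ps: "(\<lambda>w. \<Sum>k. c k * w ^ k) holomorphic_on seg_nbhd \<delta>"
  proof (rule holomorphic_on_subset[OF power_series_holomorphic], rule subsetI)
    fix w assume "w \<in> seg_nbhd \<delta>"
    hence "ereal (norm w) < ereal (3/2)" using sub by simp
    also note cr
    finally show "w \<in> eball 0 (conv_radius c)" by (simp add: eball_def)
  qed
  have hh: "(\<lambda>w. w * hq w) holomorphic_on seg_nbhd \<delta>"
  proof -
    have qh: "qn holomorphic_on seg_nbhd \<delta>" unfolding qn_def[abs_def] by (intro holomorphic_intros)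
    have kh: "kn holomorphic_on seg_nbhd \<delta>" unfolding kn_def[abs_def] by (intro holomorphic_intros) auto
    have nz: "qn w \<noteq> 0" if "w \<in> seg_nbhd \<delta>" for w using sub[OF that] by auto
    show ?thesis unfolding hq_def by (intro holomorphic_intros qh kh holomorphic_on_csqrt') (use sub nz in auto)
  qed
  have eq: "(\<Sum>k. c k * w ^ k) = w * hq w" if w: "w \<in> seg_nbhd \<delta>" for w
  proof -
    have "(\<Sum>k. c k * w ^ k) - w * hq w = 0"
    proof (rule analytic_continuation[where f = "\<lambda>w. (\<Sum>k. c k * w ^ k) - w * hq w" and U = "of_real ` {0<..<1}" and \<xi> = "of_real (1/2)",
        OF _ seg_nbhd(1) convex_connected[OF seg_nbhd(2)] _ _ _ _ w])
      show "(\<lambda>w. (\<Sum>k. c k * w ^ k) - w * hq w) holomorphic_on seg_nbhd \<delta>" by (intro holomorphic_intros ps hh)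
      have "of_real t \<in> seg_nbhd \<delta>" if "0 < t" "t < 1" for t :: real using seg_nbhd(4)[OF \<delta>] that by auto
      from this this[of "1/2"] show "complex_of_real ` {0<..<1} \<subseteq> seg_nbhd \<delta>" "complex_of_real (1/2) \<in> seg_nbhd \<delta>" by auto
      show "complex_of_real (1/2) islimpt of_real ` {0<..<1}" by (rule of_real_islimpt) auto
      show "(\<Sum>k. c k * z ^ k) - z * hq z = 0" if z: "z \<in> of_real ` {0<..<1}" for z
      proof -
        obtain t :: real where t: "z = of_real t" "0 < t" "t < 1" using z by auto
        have at: "aq * t < 1" using t aq_mult_lt[of t] by simp
        have "(\<lambda>k. complex_of_real (edist k * t ^ k)) sums of_real (pgf_val t)"
          using edist_sums[OF _ at] t by (simp only: sums_of_real_iff)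
        hence "(\<Sum>k. c k * z ^ k) = of_real (pgf_val t)" by (simp add: sums_iff c_def t)
        thus ?thesis using hq_real[OF _ at] t by simp
      qed
    qed
    thus ?thesis by simp
  qed
  show ?thesis
  proof (rule that[OF seg_nbhd(1) seg_nbhd(4)[OF \<delta>]])
    show "(\<lambda>k. of_real (edist k) * w ^ k) sums (w * hq w)" if "w \<in> seg_nbhd \<delta>" for w
      using conv[of w] sub[OF that] eq[OF that] by (simp add: c_def)
  qed
qed

lemma kap3_nonzero: "kap3 \<noteq> 0"
proof -
  have "complex_of_real (19304 * sqrt 7 - 51016) \<noteq> 0" using sqrt7_bounds by (subst of_real_eq_0_iff) auto
  hence "19304 * s7 - 51016 \<noteq> 0" by (simp add: s7_def)
  moreover have "complex_of_real (5 + 2 * sqrt 7) \<noteq> 0" using sqrt7_bounds by (subst of_real_eq_0_iff) auto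
  hence "afold \<noteq> 0" by (simp add: afold_def s7_def)
  moreover have "complex_of_real kfold \<noteq> 0" using kfold(1) by simp
  ultimately show ?thesis unfolding kap3_def by simp
qed

context closed_form
begin

text \<open>The ratio of the \<open>rn\<close> converges for small \<open>w\<close>; the continuity
  theorem turns this into limits of probabilities, and uniqueness of power series names
  them.\<close>

lemma root_degree_limit: "(\<lambda>n. root_degree_prob k n) \<longlonglongrightarrow> edist k"
proof -
  have lim: "(\<lambda>n. rn n 1 w / rn n 1 1) \<longlonglongrightarrow> pgf_val w" if w: "0 < w" "w < 1/200000" for w
  proof -
    obtain \<sigma> where "sqbranch (of_real w) \<sigma>" using sqbranch_small[OF w] by blast
    hence "(\<lambda>n. complex_of_real (rn n 1 w / rn n 1 1)) \<longlonglongrightarrow> of_real w * hq (of_real w)" by (rule rn_ratio) (use w in auto)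
    moreover have "aq * w < 1" using w aq_mult_lt[of w] by simp
    ultimately have "(\<lambda>n. complex_of_real (rn n 1 w / rn n 1 1)) \<longlonglongrightarrow> of_real (pgf_val w)" using hq_real[of w] w by simp
    thus ?thesis by (simp only: tendsto_of_real_iff)
  qed
  have tail: "\<forall>\<^sub>F n in sequentially. \<forall>w K. 0 < w \<longrightarrow> w < 1/200000 \<longrightarrow> 0 \<le> rn n 1 w / rn n 1 1 - (\<Sum>j<K. root_degree_prob j n * w ^ j)
      \<and> rn n 1 w / rn n 1 1 - (\<Sum>j<K. root_degree_prob j n * w ^ j) \<le> w ^ K"
    using tc_graphs_nonempty
  proof eventually_elim
    case (elim n)
    show ?case using root_degree_tail[OF elim] by simp
  qed
  obtain e where e: "\<And>k. (\<lambda>n. root_degree_prob k n) \<longlonglongrightarrow> e k" "\<And>w. 0 < w \<Longrightarrow> w < 1/200000 \<Longrightarrow> (\<lambda>k. e k * w ^ k) sums pgf_val w"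
    using pgf_continuity[OF _ _ tail lim] by auto
  have "(\<lambda>k. complex_of_real (e k)) = (\<lambda>k. complex_of_real (edist k))"
  proof (rule power_series_eqI[of "1/200000" _ "\<lambda>w. of_real (pgf_val w)"])
    fix w :: real assume w: "0 < w" "w < 1/200000"
    have "aq * w < 1" using w aq_mult_lt[of w] by simp
    hence "(\<lambda>k. complex_of_real (e k * w ^ k)) sums of_real (pgf_val w)" "(\<lambda>k. complex_of_real (edist k * w ^ k)) sums of_real (pgf_val w)"
      using e(2)[OF w] edist_sums[of w] w by (simp_all only: sums_of_real_iff less_imp_le)
    thus "(\<lambda>k. complex_of_real (e k) * of_real w ^ k) sums of_real (pgf_val w)" "(\<lambda>k. complex_of_real (edist k) * of_real w ^ k) sums of_real (pgf_val w)"
      by simp_all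
  qed auto
  hence "e k = edist k" by (metis of_real_eq_iff)
  thus ?thesis using e(1)[of k] by simp
qed

text \<open>The explicit coefficients do not show a sign; it is inherited from the
  probabilities.\<close>

lemma edist_nonneg: "edist k \<ge> 0"
  by (rule tendsto_lowerbound[OF root_degree_limit]) (auto simp: root_degree_prob_def)

lemma edist_T3:
  "\<exists>U. open U \<and> complex_of_real ` {0..1} \<subseteq> U \<and>
     (\<forall>w\<in>U. norm w \<le> 1 \<longrightarrow> (\<lambda>k. complex_of_real (edist k) * w ^ k) sums (T3 rc w / T3 rc 1))"
proof -
  obtain U1 where U1: "open U1" "of_real ` {0..1} \<subseteq> U1" "\<And>w. w \<in> U1 \<Longrightarrow> norm w \<le> 1 \<Longrightarrow> T3 rc w = of_real rc ^ 2 / 4 * kap3 * (w * hq w)"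
    by (rule T3_eq) blast
  obtain U2 where U2: "open U2" "of_real ` {0..1} \<subseteq> U2" "\<And>w. w \<in> U2 \<Longrightarrow> (\<lambda>k. of_real (edist k) * w ^ k) sums (w * hq w)"
    by (rule hq_disc) blast
  have "of_real 1 \<in> U1" using U1(2) by force
  hence "T3 rc 1 = of_real rc ^ 2 / 4 * kap3" using U1(3)[of 1] hq_1 by simp
  moreover have "of_real rc ^ 2 / 4 * kap3 \<noteq> 0" using kap3_nonzero rc_pos by simp
  ultimately have "T3 rc w / T3 rc 1 = w * hq w" if "w \<in> U1" "norm w \<le> 1" for w
    using U1(3)[OF that] by (metis nonzero_mult_div_cancel_left)
  thus ?thesis using U1(1,2) U2 by (intro exI[of _ "U1 \<inter> U2"]) auto
qed

text \<open>Because of \<open>hq 1 = 1\<close> no mass escapes to infinity.\<close>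

lemma edist_sums_1: "edist sums 1"
proof -
  obtain U2 where U2: "open U2" "of_real ` {0..1} \<subseteq> U2" "\<And>w. w \<in> U2 \<Longrightarrow> (\<lambda>k. of_real (edist k) * w ^ k) sums (w * hq w)"
    by (rule hq_disc) blast
  have "of_real 1 \<in> U2" using U2(2) by force
  hence "(\<lambda>k. complex_of_real (edist k)) sums of_real 1" using U2(3)[of 1] hq_1 by simp
  thus ?thesis by (simp only: sums_of_real_iff)
qed

end

section \<open>The average degree\<close>

text \<open>The limiting number of edges per vertex, half of \<alpha>.\<close>

definition mu :: real where "mu = (7 + sqrt 7) / 4"

text \<open>Differentiates the form \<open>r_fun_eq\<close>, in which \<open>z\<close> occurs only
  through \<open>u0_fun z\<close>.\<close>

lemma r_fun_deriv_1: "(r_fun has_field_derivative - mu * rc) (at 1)"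
proof -
  define h where "h a = (3 * a - 1)\<^sup>2 * (3 * a + 2 - 1 / a) / 16" for a :: real
  have u: "ucrit \<noteq> 0" using ucrit_bounds by simp
  have iu: "1 / ucrit = (sqrt 7 + 1) / 2" using u by (simp add: ucrit_def field_simps)
  have dh: "(h has_field_derivative (6 * (3 * ucrit - 1) * (3 * ucrit + 2 - 1 / ucrit) + (3 * ucrit - 1)\<^sup>2 * (3 + (1 / ucrit)\<^sup>2)) / 16) (at ucrit)"
    unfolding h_def by (rule derivative_eq_intros refl u | simp)+ (simp add: u power2_eq_square field_simps)
  have "(u0_fun has_field_derivative - 1 / (2 * sqrt 7)) (at 1)"
  proof -
    have d: "((\<lambda>z. 4/9 + 1 / (3 * z)) has_field_derivative - 1/3) (at (1::real))"
      by (rule derivative_eq_intros refl | simp)+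
    have s: "4/9 + 1 / (3 * 1) = (7/9 :: real)" by simp
    have q: "sqrt (7/9) = sqrt 7 / 3" by (simp add: real_sqrt_divide)
    have "((\<lambda>z. sqrt (4/9 + 1 / (3 * z))) has_field_derivative (inverse (sqrt (4/9 + 1 / (3 * 1))) / 2) * (- 1/3)) (at (1::real))"
      by (rule DERIV_chain2[OF DERIV_real_sqrt d]) simp
    hence "((\<lambda>z. sqrt (4/9 + 1 / (3 * z))) has_field_derivative - 1 / (2 * sqrt 7)) (at (1::real))"
      unfolding s q by (simp add: field_simps)
    hence "((\<lambda>z. - 1/3 + sqrt (4/9 + 1 / (3 * z))) has_field_derivative 0 + - 1 / (2 * sqrt 7)) (at (1::real))"
      by (intro DERIV_add DERIV_const)
    thus ?thesis by (simp add: u0_fun_def[abs_def])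
  qed
  from DERIV_chain2[OF _ this, of h] dh
  have D: "((\<lambda>z. h (u0_fun z)) has_field_derivative ((6 * (3 * ucrit - 1) * (3 * ucrit + 2 - 1 / ucrit) + (3 * ucrit - 1)\<^sup>2 * (3 + (1 / ucrit)\<^sup>2)) / 16) * (- 1 / (2 * sqrt 7))) (at 1)"
    by (simp only: u0_fun_1)
  have v: "((6 * (3 * ucrit - 1) * (3 * ucrit + 2 - 1 / ucrit) + (3 * ucrit - 1)\<^sup>2 * (3 + (1 / ucrit)\<^sup>2)) / 16) * (- 1 / (2 * sqrt 7)) = - mu * rc"
  proof -
    have 1: "(6 * (3 * ucrit - 1) * (3 * ucrit + 2 - 1 / ucrit) + (3 * ucrit - 1)\<^sup>2 * (3 + (1 / ucrit)\<^sup>2)) / 16 = 7/2 - 35/32 * sqrt 7"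
      unfolding iu unfolding ucrit_def by (simp add: power2_eq_square field_simps)
    have "(7/2 - 35/32 * sqrt 7) * (- 1 / (2 * sqrt 7)) = - ((7 + sqrt 7) / 4) * ((7 * sqrt 7 - 17) / 32)"
      by (simp add: field_simps)
    thus ?thesis unfolding 1 by (simp only: mu_def rc_def r_fun_1(2))
  qed
  show ?thesis
  proof (rule has_field_derivative_transform_within[OF D[unfolded v]])
    show "h (u0_fun z) = r_fun z" if "dist z 1 < 1" for z :: real
    proof -
      have "z > 0" using that by (simp add: dist_real_def)
      thus ?thesis by (simp add: r_fun_eq h_def)
    qed
  qed auto
qed

text \<open>The sign of \<open>a - mu\<close> decides on which side of \<open>z = 1\<close> the
  weighted radius of convergence exceeds \<open>rc\<close>.\<close>

lemma r_fun_powr_deriv: "((\<lambda>z. r_fun z * z powr a) has_field_derivative (a - mu) * rc) (at 1)"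
proof -
  have "((\<lambda>z. z powr a) has_field_derivative a * 1 powr (a - 1)) (at (1::real))"
    by (rule has_real_derivative_powr) simp
  hence "((\<lambda>z. z powr a) has_field_derivative a) (at (1::real))" by simp
  from DERIV_mult'[OF r_fun_deriv_1 this] show ?thesis by (rule DERIV_cong) (simp add: rc_def algebra_simps)
qed

lemma card_parcs:
  assumes G: "G \<in> tc_graphs n"
  shows "card (parcs G) = 2 * num_edges G" and "n \<le> card (parcs G)"
proof -
  note F = tc_graphs_facts[OF G]
  define A where "A = {(a, b) \<in> parcs G. a < b}"
  have fA: "finite A" unfolding A_def using F(3) by (rule finite_subset[rotated]) auto
  have "parcs G = A \<union> prod.swap ` A"
  proof (rule set_eqI)
    fix e show "e \<in> parcs G \<longleftrightarrow> e \<in> A \<union> prod.swap ` A"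
    proof (cases e)
      case (Pair a b)
      show ?thesis
      proof
        assume e: "e \<in> parcs G"
        hence "(b, a) \<in> parcs G \<and> a \<noteq> b" using F(4) Pair by blast
        thus "e \<in> A \<union> prod.swap ` A" using e Pair by (cases "a < b") (auto simp: A_def image_iff)
      next
        assume "e \<in> A \<union> prod.swap ` A"
        thus "e \<in> parcs G" using F(4) by (auto simp: A_def)
      qed
    qed
  qed
  moreover have "A \<inter> prod.swap ` A = {}" by (auto simp: A_def)
  moreover have "card (prod.swap ` A) = card A" by (intro card_image) (auto simp: inj_on_def)
  ultimately have "card (parcs G) = 2 * card A" using fA by (simp add: card_Un_disjoint)
  thus "card (parcs G) = 2 * num_edges G" by (simp add: num_edges_def)
  have "{1..n} \<subseteq> fst ` parcs G"
  proof
    fix v assume "v \<in> {1..n}"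
    from deg_pos[OF G this] have "{e \<in> parcs G. fst e = v} \<noteq> {}" unfolding deg_eq_card by (metis card.empty less_irrefl)
    thus "v \<in> fst ` parcs G" by force
  qed
  hence "card {1..n} \<le> card (parcs G)" using F(3) by (meson card_image_le card_mono finite_imageI le_trans)
  thus "n \<le> card (parcs G)" by simp
qed

context closed_form
begin

text \<open>The series still converges at its critical point \<open>x = r_fun z\<close>, so its
  terms are bounded.\<close>

lemma rn_upper:
  assumes z: "z > 1/4"
  obtains K where "K > 0" "\<And>n. rn n z 1 * r_fun z ^ n \<le> K"
proof -
  have z0: "z > 0" using z by simp
  note P = u0_fun_props[OF z0]
  have "Tsummable (r_fun z) z 1"
    by (rule Tsummable_critical(1)[OF z P(3) order_refl _ _ _ order_refl]) (use P in auto)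
  from rn_sums_real[OF _ _ _ this] have s: "summable (\<lambda>n. rn n z 1 * r_fun z ^ n)" using P(3) z0 by (simp add: sums_iff)
  have nn: "0 \<le> rn n z 1 * r_fun z ^ n" for n using P(3) z0 rn_nonneg[of z 1 n] by simp
  have "rn n z 1 * r_fun z ^ n \<le> suminf (\<lambda>n. rn n z 1 * r_fun z ^ n) + 1" for n
    using sum_le_suminf[OF s, of "{n}"] nn by simp
  moreover have "suminf (\<lambda>n. rn n z 1 * r_fun z ^ n) + 1 > 0" using suminf_nonneg[OF s nn] by simp
  ultimately show ?thesis using that by blast
qed

text \<open>The numerator is at most of order \<open>1 / r_fun z ^ n\<close>, the denominator at
  least of order \<open>1 / rc ^ n\<close> up to a power of \<open>n\<close>; the strict inequality
  in \<open>a\<close> makes the quotient decay exponentially.\<close>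

lemma rn_ratio_decay:
  assumes z: "z > 1/4" and a: "rc < r_fun z * z powr a"
  shows "(\<lambda>n. rn n z 1 / (rn n 1 1 * z powr (a * real n))) \<longlonglongrightarrow> 0"
proof -
  have z0: "z > 0" using z by simp
  have r0: "r_fun z > 0" by (rule u0_fun_props(3)[OF z0])
  obtain K where K: "K > 0" "\<And>n. rn n z 1 * r_fun z ^ n \<le> K" by (rule rn_upper[OF z]) blast
  obtain c where c: "c > 0" "\<forall>\<^sub>F m in sequentially. scale m * rn (m + 4) 1 1 \<ge> c" by (rule rn_1_lower)
  define \<rho> where "\<rho> = rc / (r_fun z * z powr a)"
  have \<rho>: "0 < \<rho>" "\<rho> < 1" using a rc_pos r0 z0 by (auto simp: \<rho>_def)
  have "(\<lambda>m. K / c / rc ^ 3 * (sqrt (real m + 1) * ((real m + 2) * (real m + 1)) * \<rho> ^ (m + 4))) \<longlonglongrightarrow> K / c / rc ^ 3 * 0"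
  proof (intro tendsto_mult tendsto_const)
    have "(\<lambda>m. sqrt (real m + 1) * ((real m + 2) * (real m + 1)) * exp (ln \<rho> * (real m + 4))) \<longlonglongrightarrow> 0"
    proof -
      have l: "ln \<rho> < 0" using \<rho> by simp
      define b where "b = - ln \<rho>"
      have b: "b > 0" using l by (simp add: b_def)
      have "(\<lambda>m. sqrt (real m + 1) * ((real m + 2) * (real m + 1)) * exp (- b * (real m + 4))) \<longlonglongrightarrow> 0"
        using b by real_asymp
      thus ?thesis by (simp add: b_def)
    qed
    moreover have "exp (ln \<rho> * (real m + 4)) = \<rho> ^ (m + 4)" for m
    proof -
      have "\<rho> ^ (m + 4) = \<rho> powr real (m + 4)" using \<rho> by (simp only: powr_realpow)
      thus ?thesis using \<rho> by (simp add: powr_def mult.commute)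
    qed
    ultimately show "(\<lambda>m. sqrt (real m + 1) * ((real m + 2) * (real m + 1)) * \<rho> ^ (m + 4)) \<longlonglongrightarrow> 0" by simp
  qed
  hence lim: "(\<lambda>m. K / c / rc ^ 3 * (sqrt (real m + 1) * ((real m + 2) * (real m + 1)) * \<rho> ^ (m + 4))) \<longlonglongrightarrow> 0" by simp
  have "(\<lambda>m. rn (m + 4) z 1 / (rn (m + 4) 1 1 * z powr (a * real (m + 4)))) \<longlonglongrightarrow> 0"
  proof (rule Lim_null_comparison[OF _ lim])
    show "\<forall>\<^sub>F m in sequentially. norm (rn (m + 4) z 1 / (rn (m + 4) 1 1 * z powr (a * real (m + 4))))
       \<le> K / c / rc ^ 3 * (sqrt (real m + 1) * ((real m + 2) * (real m + 1)) * \<rho> ^ (m + 4))"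
      using c(2)
    proof eventually_elim
      case (elim m)
      define n where "n = m + 4"
      have sp: "scale m > 0" by (rule scale_pos)
      have rp: "rn n 1 1 > 0" using elim c(1) sp unfolding n_def by (metis less_le_trans zero_less_mult_pos)
      have zp: "z powr (a * real n) = (z powr a) ^ n" using z0 by (simp add: powr_powr[symmetric] powr_realpow)
      have "norm (rn n z 1 / (rn n 1 1 * z powr (a * real n))) = rn n z 1 / (rn n 1 1 * (z powr a) ^ n)"
        using rn_nonneg[of z 1 n] rp z0 by (simp add: zp)
      also have "\<dots> \<le> (K / r_fun z ^ n) / ((c / scale m) * (z powr a) ^ n)"
      proof (rule frac_le)
        show "rn n z 1 \<le> K / r_fun z ^ n" using K(2)[of n] r0 by (simp add: le_divide_eq)
        have "c / scale m \<le> rn n 1 1" using elim sp by (simp add: divide_le_eq n_def mult.commute)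
        thus "c / scale m * (z powr a) ^ n \<le> rn n 1 1 * (z powr a) ^ n" by (intro mult_right_mono) auto
      qed (use K c sp z0 r0 in auto)
      also have "\<dots> = K / c * (scale m / (r_fun z * z powr a) ^ n)"
        using sp c by (simp add: power_mult_distrib field_simps)
      also have "scale m = rc ^ n / rc ^ 3 * (sqrt (real m + 1) * ((real m + 2) * (real m + 1)))"
      proof -
        have "rc ^ n = rc ^ Suc m * rc ^ 3" by (simp add: n_def power_add[symmetric] eval_nat_numeral)
        thus ?thesis using rc_pos by (simp add: scale_def add.commute)
      qed
      also have "K / c * (rc ^ n / rc ^ 3 * (sqrt (real m + 1) * ((real m + 2) * (real m + 1))) / (r_fun z * z powr a) ^ n)
        = K / c / rc ^ 3 * (sqrt (real m + 1) * ((real m + 2) * (real m + 1)) * \<rho> ^ n)"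
        by (simp add: \<rho>_def power_divide mult_ac)
      finally show ?case by (simp add: n_def)
    qed
  qed
  thus ?thesis by (rule LIMSEQ_offset)
qed

text \<open>Chernoff bounds: \<open>- mu\<close> is the logarithmic derivative at 1 of the radius of convergence \<open>r_fun z\<close>.\<close>

lemma edge_concentration:
  assumes \<zeta>: "\<zeta> > 0"
  shows "(\<lambda>n. card {p \<in> rooted_tc_graphs n. \<bar>real (num_edges (fst p)) - mu * real n\<bar> \<ge> \<zeta> * real n} / card (rooted_tc_graphs n)) \<longlonglongrightarrow> 0"
proof -
  have g1: "r_fun 1 * 1 powr a = rc" for a by (simp add: rc_def)
  \<comment> \<open>A weight base above 1 penalizes an excess of edges, one below 1 a deficit; both
    are supplied by the sign of the derivative at 1.\<close>
  obtain z1 where z1: "z1 > 1" "rc < r_fun z1 * z1 powr (mu + \<zeta>)"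
  proof -
    have "(mu + \<zeta> - mu) * rc > 0" using \<zeta> rc_pos by simp
    from DERIV_pos_inc_right[OF r_fun_powr_deriv this] obtain d where "d > 0" "\<forall>h>0. h < d \<longrightarrow> r_fun 1 * 1 powr (mu + \<zeta>) < r_fun (1 + h) * (1 + h) powr (mu + \<zeta>)" by blast
    thus ?thesis using that[of "1 + d/2"] g1 by auto
  qed
  obtain z2 where z2: "z2 < 1" "z2 > 1/4" "rc < r_fun z2 * z2 powr (mu - \<zeta>)"
  proof -
    have "(mu - \<zeta> - mu) * rc < 0" using \<zeta> rc_pos by simp
    from DERIV_neg_dec_left[OF r_fun_powr_deriv this] obtain d where d: "d > 0" "\<forall>h>0. h < d \<longrightarrow> r_fun 1 * 1 powr (mu - \<zeta>) < r_fun (1 - h) * (1 - h) powr (mu - \<zeta>)" by blast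
    \<comment> \<open>The bound 1/2 keeps \<open>z2\<close> above 1/4, where the convergence results
      apply.\<close>
    define h where "h = min (d/2) (1/2)"
    have "h > 0" "h < d" "h \<le> 1/2" using d by (auto simp: h_def)
    thus ?thesis using that[of "1 - h"] d g1 by auto
  qed
  define X1 where "X1 n = rn n z1 1 / (rn n 1 1 * z1 powr ((mu + \<zeta>) * real n))" for n
  define X2 where "X2 n = rn n z2 1 / (rn n 1 1 * z2 powr ((mu - \<zeta>) * real n))" for n
  have L: "(\<lambda>n. X1 n + X2 n) \<longlonglongrightarrow> 0"
  proof -
    have "X1 \<longlonglongrightarrow> 0" "X2 \<longlonglongrightarrow> 0" unfolding X1_def X2_def using z1 z2 by (auto intro!: rn_ratio_decay)
    from tendsto_add[OF this] show ?thesis by simp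
  qed
  show ?thesis
  proof (rule Lim_null_comparison[OF always_eventually L], rule allI)
    fix n
    define R where "R = rooted_tc_graphs n"
    define m where "m = (\<lambda>p :: nat pair_pre_digraph \<times> (nat \<times> nat). real (num_edges (fst p)))"
    have fin: "finite R" unfolding R_def by (rule finite_rooted)
    define B where "B = {p \<in> R. \<bar>m p - mu * real n\<bar> \<ge> \<zeta> * real n}"
    have rn: "rn n z 1 = (\<Sum>p\<in>R. z powr m p) / fact n" if "z > 0" for z
      using that by (simp add: rn_def R_def m_def case_prod_unfold powr_realpow)
    have X: "rn n z 1 / (rn n 1 1 * z powr (a * real n)) = (\<Sum>p\<in>R. z powr (m p - a * real n)) / card R" if "z > 0" for z a
    proof -
      have "(\<Sum>p\<in>R. z powr (m p - a * real n)) = (\<Sum>p\<in>R. z powr m p) / z powr (a * real n)"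
        by (simp add: powr_diff sum_divide_distrib)
      moreover have "(S / f) / ((C / f) * P) = (S / P) / C" if "f \<noteq> 0" for S f C P :: real using that by simp
      ultimately show ?thesis unfolding rn[OF that] rn_1 R_def[symmetric] by simp
    qed
    have pt: "(if p \<in> B then 1 else 0) \<le> z1 powr (m p - (mu + \<zeta>) * real n) + z2 powr (m p - (mu - \<zeta>) * real n)" if p: "p \<in> R" for p
    proof (cases "p \<in> B")
      case True
      have nn: "0 \<le> z1 powr y" "0 \<le> z2 powr y" for y by simp_all
      from True have "\<bar>m p - mu * real n\<bar> \<ge> \<zeta> * real n" by (simp add: B_def)
      hence "m p - (mu + \<zeta>) * real n \<ge> 0 \<or> m p - (mu - \<zeta>) * real n \<le> 0"
        unfolding distrib_right left_diff_distrib by linarith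
      hence "z1 powr (m p - (mu + \<zeta>) * real n) \<ge> 1 \<or> z2 powr (m p - (mu - \<zeta>) * real n) \<ge> 1"
      proof
        assume "m p - (mu + \<zeta>) * real n \<ge> 0"
        thus ?thesis using z1 by (simp add: ge_one_powr_ge_zero)
      next
        assume "m p - (mu - \<zeta>) * real n \<le> 0"
        hence "z2 powr 0 \<le> z2 powr (m p - (mu - \<zeta>) * real n)" using z2 by (intro powr_mono') auto
        thus ?thesis using z2 by simp
      qed
      thus ?thesis using True nn[of "m p - (mu + \<zeta>) * real n"] nn[of "m p - (mu - \<zeta>) * real n"] by (simp only: if_True) linarith
    qed simp
    have "real (card B) = (\<Sum>p\<in>R. if p \<in> B then 1 else 0)"
    proof -
      have "R \<inter> B = B" by (auto simp: B_def)
      thus ?thesis using fin by (simp add: sum.If_cases)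
    qed
    also have "\<dots> \<le> (\<Sum>p\<in>R. z1 powr (m p - (mu + \<zeta>) * real n) + z2 powr (m p - (mu - \<zeta>) * real n))"
      by (rule sum_mono) (rule pt)
    finally have "real (card B) / card R \<le> (\<Sum>p\<in>R. z1 powr (m p - (mu + \<zeta>) * real n) + z2 powr (m p - (mu - \<zeta>) * real n)) / card R"
      by (rule divide_right_mono) simp
    also have "\<dots> = X1 n + X2 n"
      using X[of z1 "mu + \<zeta>"] X[of z2 "mu - \<zeta>"] z1 z2 by (simp add: X1_def X2_def sum.distrib add_divide_distrib)
    finally show "norm (card {p \<in> rooted_tc_graphs n. \<bar>real (num_edges (fst p)) - mu * real n\<bar> \<ge> \<zeta> * real n} / card (rooted_tc_graphs n)) \<le> X1 n + X2 n"
      by (simp add: B_def R_def m_def)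
  qed
qed

text \<open>Rooting weights a graph by its number of arcs, and dividing by that number undoes the
  bias. The summands are at most 1 because no vertex is isolated, so convergence in probability
  passes to the mean.\<close>

lemma expected_avg_deg_inverse:
  assumes "tc_graphs n \<noteq> {}"
  shows "1 / expected_avg_deg n = (\<Sum>p\<in>rooted_tc_graphs n. real n / card (parcs (fst p))) / card (rooted_tc_graphs n)"
proof -
  have n1: "1 \<in> {1..n}" using assms tc_graphs_small[of n] by (cases "n = 0") auto
  have "(\<Sum>p\<in>rooted_tc_graphs n. real n / card (parcs (fst p))) = (\<Sum>G\<in>tc_graphs n. \<Sum>e\<in>parcs G. real n / card (parcs G))"
    unfolding rooted_tc_graphs_def using finite_tc_graphs tc_graphs_facts(3)
    by (subst sum.Sigma) (auto simp: case_prod_unfold)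
  also have "\<dots> = (\<Sum>G\<in>tc_graphs n. real n)"
  proof (intro sum.cong refl)
    fix G assume "G \<in> tc_graphs n"
    from card_parcs(2)[OF this] have "card (parcs G) > 0" using n1 by auto
    thus "(\<Sum>e\<in>parcs G. real n / card (parcs G)) = real n" by simp
  qed
  finally have "(\<Sum>p\<in>rooted_tc_graphs n. real n / card (parcs (fst p))) = real (card (tc_graphs n)) * real n" by simp
  thus ?thesis using vertex_degree_prob_eq(3)[OF assms n1] by (simp add: mult.commute)
qed

lemma expected_avg_deg_limit: "expected_avg_deg \<longlonglongrightarrow> 2 * mu"
proof -
  have mu: "mu > 1" using sqrt7_bounds by (simp add: mu_def)
  have "(\<lambda>n. 1 / expected_avg_deg n) \<longlonglongrightarrow> 1 / (2 * mu)"
  proof (rule LIMSEQ_I)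
    fix \<eta> :: real assume \<eta>: "\<eta> > 0"
    define \<epsilon> where "\<epsilon> = min (1/2) (\<eta> / 4)"
    have \<epsilon>: "\<epsilon> > 0" "\<epsilon> \<le> 1/2" "\<epsilon> \<le> \<eta> / 4" using \<eta> by (auto simp: \<epsilon>_def)
    define D where "D n = card {p \<in> rooted_tc_graphs n. \<bar>real (num_edges (fst p)) - mu * real n\<bar> \<ge> \<epsilon> * real n} / card (rooted_tc_graphs n)" for n
    have "D \<longlonglongrightarrow> 0" unfolding D_def by (rule edge_concentration[OF \<epsilon>(1)])
    hence "\<forall>\<^sub>F n in sequentially. D n < \<eta> / 2" using \<eta> by (intro order_tendstoD(2)) auto
    hence "\<forall>\<^sub>F n in sequentially. norm (1 / expected_avg_deg n - 1 / (2 * mu)) < \<eta>"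
      using tc_graphs_nonempty
    proof eventually_elim
      case (elim n)
      define R where "R = rooted_tc_graphs n"
      define m where "m = (\<lambda>p :: nat pair_pre_digraph \<times> (nat \<times> nat). real (num_edges (fst p)))"
      define B where "B = {p \<in> R. \<bar>m p - mu * real n\<bar> \<ge> \<epsilon> * real n}"
      have n1: "1 \<in> {1..n}" using elim(2) tc_graphs_small[of n] by (cases "n = 0") auto
      have n0: "real n > 0" using n1 by simp
      have fin: "finite R" unfolding R_def by (rule finite_rooted)
      have cR: "real (card R) > 0" using vertex_degree_prob_eq(4)[OF elim(2) n1] fin by (simp add: R_def card_gt_0_iff)
      \<comment> \<open>On the exceptional set both numbers lie between 0 and 1; elsewhere the
        number of edges is close to \<open>mu * n\<close>.\<close>
      have dev: "\<bar>real n / card (parcs (fst p)) - 1 / (2 * mu)\<bar> \<le> \<epsilon> + (if p \<in> B then 1 else 0)" if p: "p \<in> R" for p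
      proof -
        have G: "fst p \<in> tc_graphs n" using p by (auto simp: R_def rooted_tc_graphs_def)
        note C = card_parcs[OF G]
        have cp: "real (card (parcs (fst p))) = 2 * m p" using C(1) by (simp add: m_def)
        have mn: "2 * m p \<ge> real n" using C(2) unfolding cp[symmetric] by simp
        show ?thesis
        proof (cases "p \<in> B")
          case True
          have "0 \<le> real n / (2 * m p)" "real n / (2 * m p) \<le> 1" using mn n0 by (simp_all add: divide_le_eq)
          moreover have "0 < 1 / (2 * mu)" "1 / (2 * mu) < 1" using mu by (simp_all add: divide_less_eq)
          ultimately show ?thesis using True \<epsilon>(1) unfolding cp by (simp only: if_True)
        next
          case False
          hence d: "\<bar>m p - mu * real n\<bar> < \<epsilon> * real n" using p by (simp add: B_def)
          have mp: "m p > 0" using mn n0 by simp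
          have "real n / (2 * m p) - 1 / (2 * mu) = (mu * real n - m p) / (2 * mu * m p)"
            using mp mu by (simp add: field_simps)
          hence "\<bar>real n / (2 * m p) - 1 / (2 * mu)\<bar> = \<bar>m p - mu * real n\<bar> / (2 * mu * m p)"
            using mp mu by (simp add: abs_minus_commute)
          also have "\<dots> \<le> (\<epsilon> * real n) / (2 * mu * m p)" using d mp mu by (intro divide_right_mono) auto
          also have "\<dots> \<le> \<epsilon>"
          proof -
            have "real n \<le> mu * (2 * m p)" using mult_mono[of 1 mu "real n" "2 * m p"] mu mn n0 by simp
            hence "\<epsilon> * real n \<le> \<epsilon> * (2 * mu * m p)" using \<epsilon>(1) by (intro mult_left_mono) (auto simp: mult_ac)
            thus ?thesis using mp mu by (simp add: divide_le_eq)
          qed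
          finally show ?thesis using False unfolding cp by simp
        qed
      qed
      have "1 / expected_avg_deg n - 1 / (2 * mu) = (\<Sum>p\<in>R. real n / card (parcs (fst p)) - 1 / (2 * mu)) / card R"
        using expected_avg_deg_inverse[OF elim(2)] cR by (simp add: R_def sum_subtractf diff_divide_distrib)
      hence "norm (1 / expected_avg_deg n - 1 / (2 * mu)) \<le> (\<Sum>p\<in>R. \<epsilon> + (if p \<in> B then 1 else 0)) / card R"
        using cR by (simp add: divide_right_mono order_trans[OF sum_abs sum_mono[OF dev]])
      also have "(\<Sum>p\<in>R. \<epsilon> + (if p \<in> B then 1 else 0)) = card R * \<epsilon> + card B"
      proof -
        have "R \<inter> B = B" by (auto simp: B_def)
        thus ?thesis using fin by (simp add: sum.distrib sum.If_cases)
      qed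
      also have "(card R * \<epsilon> + card B) / card R = \<epsilon> + D n"
        using cR by (simp add: add_divide_distrib D_def B_def R_def m_def)
      also have "\<dots> < \<eta>" using elim(1) \<epsilon>(3) \<eta> by linarith
      finally show ?case .
    qed
    thus "\<exists>no. \<forall>n\<ge>no. norm (1 / expected_avg_deg n - 1 / (2 * mu)) < \<eta>" unfolding eventually_sequentially .
  qed
  from tendsto_divide[OF tendsto_const[of 1] this] show ?thesis using mu by simp
qed

end

theorem theorem6p10:
  assumes T_explicit:
    "\<exists>\<epsilon>>0. \<forall>x z w u v :: complex.
       norm x < \<epsilon> \<and> norm z < \<epsilon> \<and> norm w < \<epsilon> \<and> norm u < \<epsilon> \<and> norm v < \<epsilon> \<and> w \<noteq> 0 \<and>
       u = x * z * (1 + v)\<^sup>2 \<and> v = z * (1 + u)\<^sup>2 \<longrightarrow>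
       T_bullet x z w = T_closed_form x z w u v"
  shows "\<exists>(d :: nat \<Rightarrow> real) (e :: nat \<Rightarrow> real) (c :: real).
    let r = r_fun 1;
        u0 = (sqrt 7 - 1) / 3;
        q = 1 / (u0 + 1);
        \<alpha> = (3 * u0 - 1) * (3 * u0 + 1) * (u0 + 1) / u0
    in
      (\<forall>v k. v \<ge> 1 \<longrightarrow> (\<lambda>n. vertex_degree_prob v k n) \<longlonglongrightarrow> d k) \<and>
      (\<forall>k. (\<lambda>n. root_degree_prob k n) \<longlonglongrightarrow> e k) \<and>
      r = (7 * sqrt 7 - 17) / 32 \<and>
      (\<exists>U. open U \<and> complex_of_real ` {0..1} \<subseteq> U \<and>
         (\<forall>w\<in>U. norm w \<le> 1 \<longrightarrow>
            (\<lambda>k. complex_of_real (e k) * w ^ k) sums (T3 r w / T3 r 1))) \<and>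
      (\<forall>k. e k \<ge> 0) \<and> e sums 1 \<and>
      c = sqrt ((1379 + 517 * sqrt 7) / (1008 * pi)) \<and>
      \<bar>c - 0.9313492\<bar> < 5 / 10 ^ 8 \<and>
      q = sqrt 7 - 2 \<and>
      e \<sim>[at_top] (\<lambda>k. c * real k powr (1/2) * q ^ k) \<and>
      (\<forall>k\<ge>1. d k = \<alpha> * e k / real k) \<and>
      d \<sim>[at_top] (\<lambda>k. c * \<alpha> * real k powr (- 1/2) * q ^ k) \<and>
      \<alpha> = (sqrt 7 + 7) / 2 \<and>
      expected_avg_deg \<longlonglongrightarrow> \<alpha>"
proof -
  from T_explicit obtain \<epsilon> where "closed_form \<epsilon>" unfolding closed_form_def by blast
  then interpret closed_form \<epsilon> .
  define \<alpha> where "\<alpha> = (sqrt 7 + 7) / 2"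
  define d where "d k = \<alpha> * edist k / real k" for k
  have \<alpha>mu: "2 * mu = \<alpha>" by (simp add: mu_def \<alpha>_def)
  have \<alpha>0: "\<alpha> > 0" by (simp add: \<alpha>_def add_nonneg_pos)
  have u0: "(sqrt 7 - 1) / 3 \<noteq> (0::real)" using sqrt7_bounds by simp
  have q: "1 / ((sqrt 7 - 1) / 3 + 1) = sqrt 7 - 2"
  proof -
    have "(sqrt 7 - 2) * ((sqrt 7 - 1) / 3 + 1) = 1" by (simp add: field_simps)
    thus ?thesis using nonzero_divide_eq_eq by (metis mult_zero_right zero_neq_one)
  qed
  have \<alpha>: "(3 * ((sqrt 7 - 1) / 3) - 1) * (3 * ((sqrt 7 - 1) / 3) + 1) * ((sqrt 7 - 1) / 3 + 1) / ((sqrt 7 - 1) / 3) = \<alpha>"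
    using u0 by (subst divide_eq_eq) (simp add: \<alpha>_def field_simps)
  have avg: "expected_avg_deg \<longlonglongrightarrow> \<alpha>" using expected_avg_deg_limit unfolding \<alpha>mu .
  have vdeg: "(\<lambda>n. vertex_degree_prob v k n) \<longlonglongrightarrow> d k" if v: "v \<ge> 1" for v k
  proof -
    have "(\<lambda>n. expected_avg_deg n * root_degree_prob k n / real k) \<longlonglongrightarrow> d k"
    \<comment> \<open>For \<open>k = 0\<close> the sequence and \<open>d 0\<close> are both 0 by the
      convention for division.\<close>
    proof (cases "k = 0")
      case False
      thus ?thesis unfolding d_def by (intro tendsto_divide tendsto_mult avg root_degree_limit tendsto_const) auto
    qed (simp add: d_def)
    \<comment> \<open>Once \<open>n \<ge> v\<close>, the label \<open>v\<close> is a vertex of every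
      graph in \<open>tc_graphs n\<close>.\<close>
    moreover have "\<forall>\<^sub>F n in sequentially. expected_avg_deg n * root_degree_prob k n / real k = vertex_degree_prob v k n"
      using tc_graphs_nonempty eventually_ge_at_top[of v]
      by eventually_elim (rule vertex_degree_prob_eq(1)[symmetric], use v in auto)
    ultimately show ?thesis by (rule Lim_transform_eventually)
  qed
  have easymp: "edist \<sim>[at_top] (\<lambda>k. cconst * real k powr (1/2) * aq ^ k)"
    using asymp_equivI'_const[OF edist_asymp] cconst_pos by (simp add: mult.assoc)
  have dasymp: "d \<sim>[at_top] (\<lambda>k. cconst * \<alpha> * real k powr (- 1/2) * aq ^ k)"
  proof -
    have "(\<lambda>k. edist k * (\<alpha> / real k)) \<sim>[at_top] (\<lambda>k. (cconst * real k powr (1/2) * aq ^ k) * (\<alpha> / real k))"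
      by (intro asymp_equiv_intros easymp)
    moreover have "(cconst * real k powr (1/2) * aq ^ k) * (\<alpha> / real k) = cconst * \<alpha> * real k powr (- 1/2) * aq ^ k" for k
    proof (cases "k = 0")
      case False
      have e: "real k powr (1/2) / real k = real k powr (- 1/2)" using powr_diff[of "real k" "1/2" 1] False by simp
      have "(cconst * P * aq ^ k) * (\<alpha> / real k) = cconst * \<alpha> * (P / real k) * aq ^ k" for P by simp
      from this[of "real k powr (1/2)"] show ?thesis unfolding e .
    qed simp
    moreover have "(\<lambda>k. edist k * (\<alpha> / real k)) = d" by (simp add: d_def fun_eq_iff)
    ultimately show ?thesis by simp
  qed
  show ?thesis
    unfolding Let_def q \<alpha>
    by (rule exI[of _ d], rule exI[of _ edist], rule exI[of _ cconst])
      (use vdeg root_degree_limit r_fun_1(2) edist_T3[unfolded rc_def] edist_nonneg edist_sums_1 cconst_def cconst_numeric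
        easymp[unfolded aq_def] dasymp[unfolded aq_def] avg in \<open>auto simp: d_def \<alpha>_def\<close>)
qed

end
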